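(* Let $(X,\hat g)$ be a generalized pseudo-Riemannian manifold with generalized Levi-Civita connection $\hat D$ and generalized Christoffel symbols $\hat\Gamma^i_{jk}$. (i) If $\hat g_{ab}=\Sigma(g_{ab})$, where $g_{ab}$ is a classical smooth pseudo-Riemannian metric with Levi-Civita connection $D$ and Christoffel symbols $\Gamma^i_{jk}$, then in any chart $\hat\Gamma^i_{jk}=\sigma(\Gamma^i_{jk})$. Hence $\hat D_\xi\eta=D_\xi\eta$ for all $\xi,\eta\in\mathcal G^1_0(X)$. (ii) If $\hat g_{ab}\approx_\infty g_{ab}$ with $g_{ab}$ a classical smooth metric with Levi-Civita connection $D$, and $\xi,\eta\in\mathcal G^1_0(X)$ with $\xi\approx_\infty\zeta\in\mathcal T^1_0(X)$ and $\eta\approx\nu\in\mathcal D'^1_0(X)$ (or vice versa, i.e. $\xi\approx\zeta\in\mathcal D'^1_0(X)$ and $\eta\approx_\infty\nu\in\mathcal T^1_0(X)$), then $\hat D_\xi\eta\approx D_\zeta\nu$. (iii) Let $k\ge1$ and $\hat g_{ab}\approx_k g_{ab}$ with $g_{ab}$ a classical $C^k$-metric with Levi-Civita connection $D$ and Christoffel symbols $\Gamma^i_{jk}$. Then, in any chart, $\hat\Gamma^i_{jk}\approx_{k-1}\Gamma^i_{jk}$. If in addition $\xi,\eta\in\mathcal G^1_0(X)$, $\xi\approx_{k-1}\zeta\in\Gamma^{k-1}(X,TX)$ and $\eta\approx_k\nu\in\Gamma^k(X,TX)$, then $\hat D_\xi\eta\approx_{k-1}D_\zeta\nu$.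
   Context: $X$ is a paracompact smooth Hausdorff manifold; all functions and tensor fields are real. $\mathcal G(X):=\mathcal E_M(X)/\mathcal N(X)$, where $\mathcal E_M(X)$ is the set of nets $(u_\varepsilon)_{\varepsilon\in(0,1]}$ in $C^\infty(X)$ such that for every compact $K\subset X$ and every linear differential operator $P$ there is $N\in\mathbb N$ with $\sup_K|Pu_\varepsilon|=O(\varepsilon^{-N})$ as $\varepsilon\to0$; $\mathcal N(X)$ consists of those with $\sup_K|u_\varepsilon|=O(\varepsilon^m)$ for all compact $K$ and all $m\in\mathbb N_0$. $\mathcal R$ denotes the ring of generalized real numbers (real nets with $|r_\varepsilon|=O(\varepsilon^{-N})$ for some $N$, modulo nets with $|r_\varepsilon|=O(\varepsilon^m)$ for all $m$). The $\mathcal G(X)$-module $\mathcal G^r_s(X)$ (generalized $(r,s)$-tensor fields) is defined analogously to $\mathcal G(X)$: nets $(s_\varepsilon)_\varepsilon$ of smooth $(r,s)$-tensor fields with $\sup_K\|Ps_\varepsilon\|=O(\varepsilon^{-N})$ for each compact $K$ and linear differential operator $P$ on $(r,s)$-tensor fields (some $N$), modulo those with $\sup_K\|s_\varepsilon\|=O(\varepsilon^m)$ for all $K$, $m$. Operations (contraction, action of vector fields on functions, Lie bracket) are $\varepsilon$-wise on representatives. $\sigma(f)=[(f)_\varepsilon]$ and $\Sigma(s)=[(s)_\varepsilon]$ are the embeddings of smooth functions and smooth tensor fields as constant nets. $\mathcal T^1_0(X)$ is the space of smooth vector fields, $\Gamma^k(X,TX)$ that of $C^k$ vector fields, $\mathcal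 D'^1_0(X)$ that of distributional vector fields (locally: vector fields with distributional components). $\hat g\in\mathcal G^0_2(X)$ is a generalized pseudo-Riemannian metric, and $(X,\hat g)$ a generalized pseudo-Riemannian manifold, if (1) in every chart the determinant of the matrix of components of $\hat g$ is invertible in the Colombeau algebra over the chart domain, (2) for each relatively compact open $V\subseteq X$ there are a representative $(\hat g_\varepsilon)_\varepsilon$ of $\hat g$ and $\varepsilon_0>0$ such that $\hat g_\varepsilon|_V$ is a smooth pseudo-Riemannian metric for all $\varepsilon<\varepsilon_0$, and (3) $\hat g$ possesses an index $j$, different from $0$: the representatives in (2) can be chosen so that $\hat g_\varepsilon|_V$ has index $j$, with the same $j$ for all $V$. A generalized connection is a map $\hat D:\mathcal G^1_0(X)\times\mathcal G^1_0(X)\to\mathcal G^1_0(X)$ with $\hat D_\xi\eta$ $\mathcal R$-linear in $\eta$, $\mathcal G(X)$-linear in $\xi$, and $\hat D_\xi(u\eta)=u\hat D_\xi\eta+\xi(u)\eta$ for $u\in\mathcal G(X)$. The generalized Levi-Civita connection of $(X,\hat g)$ is the unique generalized connection with $[\xi,\eta]=\hat D_\xi\eta-\hat D_\eta\xi$ and $\xi\,\hat g(\eta,\zeta)=\hat g(\hat D_\xi\eta,\zeta)+\hat g(\eta,\hat D_\xi\zeta)$ for all $\xi,\eta,\zeta\in\mathcal G^1_0(X)$. It is local, and in a chart with domain $V$ its generalized Christoffel symbols $\hat\Gamma^k_{ij}\in\mathcal G(V)$ are defined by $\hat D_{\partial_i}\partial_j=\sum_k\hat\Gamma^k_{ij}\partial_k$.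 A classical smooth connection $D$ acts on generalized vector fields by $D_\xi\eta:=[(D_{\xi_\varepsilon}\eta_\varepsilon)_\varepsilon]$. For one smooth and one distributional argument, $D_\zeta\nu$ is defined by the usual coordinate formula $(\zeta^i\partial_i\nu^k+\Gamma^k_{ij}\zeta^i\nu^j)\partial_k$ in the sense of distributions. Association: $u\in\mathcal G(X)$ is associated with $w\in\mathcal D'(X)$, $u\approx w$, if $\int_X u_\varepsilon\mu\to\langle w,\mu\rangle$ as $\varepsilon\to0$ for all compactly supported smooth one-densities $\mu$ and one (hence every) representative; a generalized tensor field $s$ satisfies $s\approx w$ for a distributional tensor field $w$ if all its components in every chart are associated with those of $w$. For $0\le k\le\infty$ and a $C^k$ object $t$, $s\approx_k t$ means that for one (hence every) representative, in every chart all components of $s_\varepsilon$ converge to those of $t$ uniformly on compact sets in all derivatives of order $\le k$ (all finite orders if $k=\infty$). *)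

theory Defs
  imports "HOL-Analysis.Analysis" "HOL-Library.Landau_Symbols"
begin

section \<open>Calculus on open subsets of \<open>real ^ 'n\<close>\<close>

text \<open>Iterated partial derivatives are indexed by lists of coordinate directions, and the order
  is the length of the list. By Schwarz's theorem the lists of a fixed length give the same derivatives
  (with repetitions) as the multi-indices of that order.\<close>

fun pd :: "'n list \<Rightarrow> (real ^ 'n \<Rightarrow> real) \<Rightarrow> real ^ 'n \<Rightarrow> real" where
  "pd [] f = f"
| "pd (i # \<alpha>) f = (\<lambda>x. frechet_derivative (pd \<alpha> f) (at x) (axis i 1))"

definition Ck_on :: "enat \<Rightarrow> (real ^ 'n::finite) set \<Rightarrow> (real ^ 'n \<Rightarrow> real) \<Rightarrow> bool" where
  "Ck_on k S f \<longleftrightarrow>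
     (\<forall>\<alpha>. enat (length \<alpha>) \<le> k \<longrightarrow> continuous_on S (pd \<alpha> f)) \<and>
     (\<forall>\<alpha>. enat (length \<alpha>) < k \<longrightarrow> (\<forall>x\<in>S. pd \<alpha> f differentiable at x))"

section \<open>Manifolds\<close>

text \<open>A chart is a pair of a domain and a coordinate map. The values of the coordinate map off the
  domain carry no meaning.\<close>

type_synonym ('a, 'n) chart = "'a set \<times> ('a \<Rightarrow> real ^ 'n)"

abbreviation cdom :: "('a, 'n::finite) chart \<Rightarrow> 'a set" where "cdom c \<equiv> fst c"
abbreviation cmap :: "('a, 'n::finite) chart \<Rightarrow> 'a \<Rightarrow> real ^ 'n" where "cmap c \<equiv> snd c"

definition cran :: "('a, 'n::finite) chart \<Rightarrow> (real ^ 'n) set" where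
  "cran c = cmap c ` cdom c"

definition cinv :: "('a, 'n::finite) chart \<Rightarrow> real ^ 'n \<Rightarrow> 'a" where
  "cinv c = inv_into (cdom c) (cmap c)"

definition is_chart :: "('a::topological_space, 'n::finite) chart \<Rightarrow> bool" where
  "is_chart c \<longleftrightarrow> open (cdom c) \<and> open (cran c) \<and> homeomorphism (cdom c) (cran c) (cmap c) (cinv c)"

definition transition_smooth :: "('a, 'n::finite) chart \<Rightarrow> ('a, 'n) chart \<Rightarrow> bool" where
  "transition_smooth c c' \<longleftrightarrow>
     (\<forall>k. Ck_on \<infinity> (cmap c ` (cdom c \<inter> cdom c')) (\<lambda>x. cmap c' (cinv c x) $ k))"

definition compatible :: "('a, 'n::finite) chart \<Rightarrow> ('a, 'n) chart \<Rightarrow> bool" where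
  "compatible c c' \<longleftrightarrow> transition_smooth c c' \<and> transition_smooth c' c"

definition smooth_structure :: "('a::topological_space, 'n::finite) chart set \<Rightarrow> bool" where
  "smooth_structure A \<longleftrightarrow>
     (\<forall>c\<in>A. is_chart c) \<and> \<Union> (cdom ` A) = UNIV \<and>
     (\<forall>c\<in>A. \<forall>c'\<in>A. compatible c c') \<and>
     (\<forall>c. is_chart c \<and> (\<forall>c'\<in>A. compatible c c') \<longrightarrow> c \<in> A)"

definition paracompact :: "'a::topological_space itself \<Rightarrow> bool" where
  "paracompact _ \<longleftrightarrow>
     (\<forall>\<U> :: 'a set set. (\<forall>U\<in>\<U>. open U) \<and> \<Union> \<U> = UNIV \<longrightarrow>
        (\<exists>\<V>. (\<forall>V\<in>\<V>. open V) \<and> \<Union> \<V> = UNIV \<and> (\<forall>V\<in>\<V>. \<exists>U\<in>\<U>. V \<subseteq> U) \<and>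
             locally_finite_in euclidean \<V>))"

text \<open>The manifold is the whole type, so the Hausdorff property is the type class.\<close>

definition smooth_manifold :: "('a::t2_space, 'n::finite) chart set \<Rightarrow> bool" where
  "smooth_manifold A \<longleftrightarrow> smooth_structure A \<and> paracompact TYPE('a)"

text \<open>All notions below are relative to a set of charts. For an open set \<open>V\<close>, the open submanifold
  \<open>V\<close> is given by the charts whose domain lies in \<open>V\<close>, which form its maximal atlas.\<close>

definition restr :: "('a, 'n::finite) chart set \<Rightarrow> 'a set \<Rightarrow> ('a, 'n) chart set" where
  "restr A V = {c \<in> A. cdom c \<subseteq> V}"

definition carrier_of :: "('a, 'n::finite) chart set \<Rightarrow> 'a set" where
  "carrier_of A = \<Union> (cdom ` A)"

text \<open>Row \<open>k\<close>, column \<open>i\<close>: the derivative of the \<open>k\<close>-th coordinate of \<open>c'\<close> with respect to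
  the \<open>i\<close>-th coordinate of \<open>c\<close>.\<close>

definition jac :: "('a, 'n::finite) chart \<Rightarrow> ('a, 'n) chart \<Rightarrow> 'a \<Rightarrow> real ^ 'n ^ 'n" where
  "jac c c' p = (\<chi> k i. pd [i] (\<lambda>x. cmap c' (cinv c x) $ k) (cmap c p))"

section \<open>Tensor fields\<close>

text \<open>An \<open>(r,s)\<close>-tensor field is given by its components in all charts: \<open>t c p I J\<close> is the component
  at \<open>p\<close> in the chart \<open>c\<close> with the list \<open>I\<close> of \<open>r\<close> upper and the list \<open>J\<close> of \<open>s\<close> lower indices. Outside
  the meaningful arguments it is \<open>0\<close>, so that equality of tensor fields is equality in the logic.
  Functions are the \<open>(0,0)\<close>-tensor fields: their value at \<open>p\<close> is the same in all charts.\<close>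

type_synonym ('a, 'n) tensor = "('a, 'n) chart \<Rightarrow> 'a \<Rightarrow> 'n list \<Rightarrow> 'n list \<Rightarrow> real"

definition idx :: "nat \<Rightarrow> 'n list set" where
  "idx r = {I. length I = r}"

definition tens :: "('a, 'n::finite) chart set \<Rightarrow> nat \<Rightarrow> nat \<Rightarrow> ('a, 'n) tensor \<Rightarrow> ('a, 'n) tensor" where
  "tens A r s F = (\<lambda>c p I J. if c \<in> A \<and> p \<in> cdom c \<and> I \<in> idx r \<and> J \<in> idx s then F c p I J else 0)"

definition coord :: "('a, 'n::finite) chart \<Rightarrow> ('a, 'n) tensor \<Rightarrow> 'n list \<Rightarrow> 'n list \<Rightarrow> real ^ 'n \<Rightarrow> real" where
  "coord c t I J = (\<lambda>x. t c (cinv c x) I J)"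

definition Ck_tensor :: "enat \<Rightarrow> ('a, 'n::finite) chart set \<Rightarrow> nat \<Rightarrow> nat \<Rightarrow> ('a, 'n) tensor set" where
  "Ck_tensor k A r s = {t. t = tens A r s t \<and>
     (\<forall>c\<in>A. \<forall>c'\<in>A. \<forall>p \<in> cdom c \<inter> cdom c'. \<forall>I\<in>idx r. \<forall>J\<in>idx s.
        t c' p I J = (\<Sum>I'\<in>idx r. \<Sum>J'\<in>idx s.
          (\<Prod>a<r. jac c c' p $ (I ! a) $ (I' ! a)) *
          (\<Prod>b<s. jac c' c p $ (J' ! b) $ (J ! b)) * t c p I' J')) \<and>
     (\<forall>c\<in>A. \<forall>I\<in>idx r. \<forall>J\<in>idx s. Ck_on k (cran c) (coord c t I J))}"

abbreviation smooth_tensor where "smooth_tensor \<equiv> Ck_tensor \<infinity>"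

definition tadd :: "('a, 'n::finite) tensor \<Rightarrow> ('a, 'n) tensor \<Rightarrow> ('a, 'n) tensor" where
  "tadd t u = (\<lambda>c p I J. t c p I J + u c p I J)"

definition tsub :: "('a, 'n::finite) tensor \<Rightarrow> ('a, 'n) tensor \<Rightarrow> ('a, 'n) tensor" where
  "tsub t u = (\<lambda>c p I J. t c p I J - u c p I J)"

definition rscale :: "real \<Rightarrow> ('a, 'n::finite) tensor \<Rightarrow> ('a, 'n) tensor" where
  "rscale a t = (\<lambda>c p I J. a * t c p I J)"

definition fscale :: "('a, 'n::finite) tensor \<Rightarrow> ('a, 'n) tensor \<Rightarrow> ('a, 'n) tensor" where
  "fscale u t = (\<lambda>c p I J. u c p [] [] * t c p I J)"

definition one_fun :: "('a, 'n::finite) chart set \<Rightarrow> ('a, 'n) tensor" where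
  "one_fun A = tens A 0 0 (\<lambda>c p I J. 1)"

text \<open>The action \<open>\<xi>(u)\<close> of a vector field on a function, the Lie bracket, and the contraction
  \<open>g(\<eta>,\<zeta>)\<close>, in coordinates.\<close>

definition act :: "('a, 'n::finite) chart set \<Rightarrow> ('a, 'n) tensor \<Rightarrow> ('a, 'n) tensor \<Rightarrow> ('a, 'n) tensor" where
  "act A \<xi> u = tens A 0 0 (\<lambda>c p I J.
     \<Sum>i\<in>UNIV. \<xi> c p [i] [] * pd [i] (coord c u [] []) (cmap c p))"

definition bracket :: "('a, 'n::finite) chart set \<Rightarrow> ('a, 'n) tensor \<Rightarrow> ('a, 'n) tensor \<Rightarrow> ('a, 'n) tensor" where
  "bracket A \<xi> \<eta> = tens A 1 0 (\<lambda>c p I J.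
     \<Sum>i\<in>UNIV. \<xi> c p [i] [] * pd [i] (coord c \<eta> I []) (cmap c p)
             - \<eta> c p [i] [] * pd [i] (coord c \<xi> I []) (cmap c p))"

definition contr2 :: "('a, 'n::finite) chart set \<Rightarrow> ('a, 'n) tensor \<Rightarrow> ('a, 'n) tensor \<Rightarrow> ('a, 'n) tensor \<Rightarrow> ('a, 'n) tensor" where
  "contr2 A g \<eta> \<zeta> = tens A 0 0 (\<lambda>c p I J.
     \<Sum>i\<in>UNIV. \<Sum>j\<in>UNIV. g c p [] [i, j] * \<eta> c p [i] [] * \<zeta> c p [j] [])"

section \<open>Metrics\<close>

definition gmat :: "('a, 'n::finite) tensor \<Rightarrow> ('a, 'n) chart \<Rightarrow> 'a \<Rightarrow> real ^ 'n ^ 'n" where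
  "gmat g c p = (\<chi> i j. g c p [] [i, j])"

definition form_index :: "real ^ 'n::finite ^ 'n \<Rightarrow> nat" where
  "form_index M = Max {dim S | S. subspace S \<and> (\<forall>v\<in>S. v \<noteq> 0 \<longrightarrow> v \<bullet> (M *v v) < 0)}"

definition has_index :: "('a, 'n::finite) chart set \<Rightarrow> ('a, 'n) tensor \<Rightarrow> nat \<Rightarrow> bool" where
  "has_index A g j \<longleftrightarrow> (\<forall>c\<in>A. \<forall>p\<in>cdom c. form_index (gmat g c p) = j)"

definition pr_metric :: "enat \<Rightarrow> ('a, 'n::finite) chart set \<Rightarrow> ('a, 'n) tensor \<Rightarrow> bool" where
  "pr_metric k A g \<longleftrightarrow> g \<in> Ck_tensor k A 0 2 \<and>
     (\<forall>c\<in>A. \<forall>p\<in>cdom c. transpose (gmat g c p) = gmat g c p \<and>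
        (\<forall>v. (\<forall>w. w \<bullet> (gmat g c p *v v) = 0) \<longrightarrow> v = 0)) \<and>
     (\<exists>j. has_index A g j)"

definition riem_metric :: "('a, 'n::finite) chart set \<Rightarrow> ('a, 'n) tensor \<Rightarrow> bool" where
  "riem_metric A h \<longleftrightarrow> h \<in> smooth_tensor A 0 2 \<and>
     (\<forall>c\<in>A. \<forall>p\<in>cdom c. transpose (gmat h c p) = gmat h c p \<and>
        (\<forall>v. v \<noteq> 0 \<longrightarrow> v \<bullet> (gmat h c p *v v) > 0))"

text \<open>The norm that the Riemannian metric \<open>h\<close> induces on \<open>(r,s)\<close>-tensors at \<open>p\<close>, computed in the
  chart \<open>c\<close>; \<open>T\<close> are the components there. The value does not depend on the chart.\<close>

definition fibre_norm ::
  "('a, 'n::finite) tensor \<Rightarrow> nat \<Rightarrow> nat \<Rightarrow> ('a, 'n) chart \<Rightarrow> 'a \<Rightarrow> ('n list \<Rightarrow> 'n list \<Rightarrow> real) \<Rightarrow> real" where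
  "fibre_norm h r s c p T = sqrt (\<Sum>I\<in>idx r. \<Sum>I'\<in>idx r. \<Sum>J\<in>idx s. \<Sum>J'\<in>idx s.
     (\<Prod>a<r. gmat h c p $ (I ! a) $ (I' ! a)) *
     (\<Prod>b<s. matrix_inv (gmat h c p) $ (J ! b) $ (J' ! b)) * T I J * T I' J')"

section \<open>Generalized tensor fields\<close>

definition lin_diff_op ::
  "('a, 'n::finite) chart set \<Rightarrow> nat \<Rightarrow> nat \<Rightarrow> (('a, 'n) tensor \<Rightarrow> ('a, 'n) tensor) \<Rightarrow> bool" where
  "lin_diff_op A r s P \<longleftrightarrow>
     (\<forall>t\<in>smooth_tensor A r s. P t \<in> smooth_tensor A r s) \<and>
     (\<exists>m. \<forall>c\<in>A. \<exists>a.
        (\<forall>\<alpha> I J I' J'. Ck_on \<infinity> (cran c) (a \<alpha> I J I' J')) \<and>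
        (\<forall>t\<in>smooth_tensor A r s. \<forall>p\<in>cdom c. \<forall>I\<in>idx r. \<forall>J\<in>idx s.
           P t c p I J = (\<Sum>\<alpha> | length \<alpha> \<le> m. \<Sum>I'\<in>idx r. \<Sum>J'\<in>idx s.
             a \<alpha> I J I' J' (cmap c p) * pd \<alpha> (coord c t I' J') (cmap c p))))"

text \<open>\<open>net_bigo A r s K q b\<close> says that the supremum over \<open>K\<close> of the norm of \<open>q \<epsilon>\<close> is \<open>O(b \<epsilon>)\<close> as
  \<open>\<epsilon> \<rightarrow> 0\<close>. The norm comes from a Riemannian metric on a neighbourhood of the compact set \<open>K\<close>;
  any two such norms are equivalent over \<open>K\<close>.\<close>

definition net_bigo ::
  "('a::topological_space, 'n::finite) chart set \<Rightarrow> nat \<Rightarrow> nat \<Rightarrow> 'a set \<Rightarrow> (real \<Rightarrow> ('a, 'n) tensor) \<Rightarrow> (real \<Rightarrow> real) \<Rightarrow> bool" where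
  "net_bigo A r s K q b \<longleftrightarrow>
     (\<forall>V h. open V \<and> K \<subseteq> V \<and> riem_metric (restr A V) h \<longrightarrow>
        (\<exists>C. \<forall>\<^sub>F \<epsilon> in at_right 0. \<forall>c\<in>restr A V. \<forall>p \<in> K \<inter> cdom c.
            fibre_norm h r s c p (q \<epsilon> c p) \<le> C * b \<epsilon>))"

text \<open>Only the values of a net at \<open>\<epsilon> \<in> (0,1]\<close> matter.\<close>

definition moderate ::
  "('a::topological_space, 'n::finite) chart set \<Rightarrow> nat \<Rightarrow> nat \<Rightarrow> (real \<Rightarrow> ('a, 'n) tensor) set" where
  "moderate A r s = {t. (\<forall>\<epsilon>\<in>{0<..1}. t \<epsilon> \<in> smooth_tensor A r s) \<and>
     (\<forall>K P. compact K \<and> K \<subseteq> carrier_of A \<and> lin_diff_op A r s P \<longrightarrow>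
        (\<exists>N::nat. net_bigo A r s K (\<lambda>\<epsilon>. P (t \<epsilon>)) (\<lambda>\<epsilon>. 1 / \<epsilon> ^ N)))}"

definition negligible_nets ::
  "('a::topological_space, 'n::finite) chart set \<Rightarrow> nat \<Rightarrow> nat \<Rightarrow> (real \<Rightarrow> ('a, 'n) tensor) set" where
  "negligible_nets A r s = {t \<in> moderate A r s.
     \<forall>K. compact K \<and> K \<subseteq> carrier_of A \<longrightarrow> (\<forall>m::nat. net_bigo A r s K t (\<lambda>\<epsilon>. \<epsilon> ^ m))}"

type_synonym ('a, 'n) gtensor = "(real \<Rightarrow> ('a, 'n) tensor) set"

definition net_rel ::
  "('a::topological_space, 'n::finite) chart set \<Rightarrow> nat \<Rightarrow> nat \<Rightarrow> ((real \<Rightarrow> ('a, 'n) tensor) \<times> (real \<Rightarrow> ('a, 'n) tensor)) set" where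
  "net_rel A r s = {(t, u). t \<in> moderate A r s \<and> u \<in> moderate A r s \<and>
     (\<lambda>\<epsilon>. tsub (t \<epsilon>) (u \<epsilon>)) \<in> negligible_nets A r s}"

definition Gen :: "('a::topological_space, 'n::finite) chart set \<Rightarrow> nat \<Rightarrow> nat \<Rightarrow> ('a, 'n) gtensor set" where
  "Gen A r s = moderate A r s // net_rel A r s"

definition gcls ::
  "('a::topological_space, 'n::finite) chart set \<Rightarrow> nat \<Rightarrow> nat \<Rightarrow> (real \<Rightarrow> ('a, 'n) tensor) \<Rightarrow> ('a, 'n) gtensor" where
  "gcls A r s t = net_rel A r s `` {t}"

text \<open>The embeddings \<open>\<sigma>\<close> (for \<open>r = s = 0\<close>) and \<open>\<Sigma>\<close>.\<close>

definition const_emb :: "('a::topological_space, 'n::finite) chart set \<Rightarrow> nat \<Rightarrow> nat \<Rightarrow> ('a, 'n) tensor \<Rightarrow> ('a, 'n) gtensor" where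
  "const_emb A r s t = gcls A r s (\<lambda>\<epsilon>. t)"

text \<open>Operations on classes, \<open>\<epsilon>\<close>-wise on representatives. The result is an \<open>(r,s)\<close>-tensor field over
  \<open>A\<close>; for an operation that respects the equivalence relation, the union is a single class.\<close>

definition lift1 ::
  "('a::topological_space, 'n::finite) chart set \<Rightarrow> nat \<Rightarrow> nat \<Rightarrow> ('x \<Rightarrow> ('a, 'n) tensor) \<Rightarrow> (real \<Rightarrow> 'x) set \<Rightarrow> ('a, 'n) gtensor" where
  "lift1 A r s F T = (\<Union>t\<in>T. gcls A r s (\<lambda>\<epsilon>. F (t \<epsilon>)))"

definition lift2 ::
  "('a::topological_space, 'n::finite) chart set \<Rightarrow> nat \<Rightarrow> nat \<Rightarrow> ('x \<Rightarrow> 'y \<Rightarrow> ('a, 'n) tensor) \<Rightarrow> (real \<Rightarrow> 'x) set \<Rightarrow> (real \<Rightarrow> 'y) set \<Rightarrow> ('a, 'n) gtensor" where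
  "lift2 A r s F T U = (\<Union>t\<in>T. \<Union>u\<in>U. gcls A r s (\<lambda>\<epsilon>. F (t \<epsilon>) (u \<epsilon>)))"

definition gcontr2 ::
  "('a::topological_space, 'n::finite) chart set \<Rightarrow> ('a, 'n) gtensor \<Rightarrow> ('a, 'n) gtensor \<Rightarrow> ('a, 'n) gtensor \<Rightarrow> ('a, 'n) gtensor" where
  "gcontr2 A G Y Z = (\<Union>g\<in>G. \<Union>\<eta>\<in>Y. \<Union>\<zeta>\<in>Z. gcls A 0 0 (\<lambda>\<epsilon>. contr2 A (g \<epsilon>) (\<eta> \<epsilon>) (\<zeta> \<epsilon>)))"

definition grestr ::
  "('a::topological_space, 'n::finite) chart set \<Rightarrow> 'a set \<Rightarrow> nat \<Rightarrow> nat \<Rightarrow> ('a, 'n) gtensor \<Rightarrow> ('a, 'n) gtensor" where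
  "grestr A V r s = lift1 (restr A V) r s (tens (restr A V) r s)"

text \<open>The ring of generalized real numbers.\<close>

definition moderate_real :: "(real \<Rightarrow> real) set" where
  "moderate_real = {r. \<exists>N::nat. r \<in> O[at_right 0](\<lambda>\<epsilon>. 1 / \<epsilon> ^ N)}"

definition Gen_real :: "(real \<Rightarrow> real) set set" where
  "Gen_real = moderate_real // {(r, r'). r \<in> moderate_real \<and> r' \<in> moderate_real \<and>
     (\<forall>m::nat. (\<lambda>\<epsilon>. r \<epsilon> - r' \<epsilon>) \<in> O[at_right 0](\<lambda>\<epsilon>. \<epsilon> ^ m))}"

text \<open>In the last conjunct of the following definition the requirement that \<open>g \<epsilon>\<close> restricted to \<open>V\<close> be
  a metric and the requirement on the index are imposed on the same representative.\<close>

definition gen_metric :: "('a::topological_space, 'n::finite) chart set \<Rightarrow> ('a, 'n) gtensor \<Rightarrow> bool" where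
  "gen_metric A G \<longleftrightarrow> G \<in> Gen A 0 2 \<and>
     (\<forall>c\<in>A. let B = restr A (cdom c);
                 d = lift1 B 0 0 (\<lambda>g. tens B 0 0 (\<lambda>c' p I J. det (gmat g c p))) G
             in \<exists>h\<in>Gen B 0 0. lift2 B 0 0 fscale d h = const_emb B 0 0 (one_fun B)) \<and>
     (\<exists>j. j \<noteq> 0 \<and>
        (\<forall>V. open V \<and> compact (closure V) \<longrightarrow>
           (\<exists>g\<in>G. \<exists>\<epsilon>0>0. \<forall>\<epsilon>\<in>{0<..1}. \<epsilon> < \<epsilon>0 \<longrightarrow>
              pr_metric \<infinity> (restr A V) (tens (restr A V) 0 2 (g \<epsilon>)) \<and>
              has_index (restr A V) (tens (restr A V) 0 2 (g \<epsilon>)) j)))"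

section \<open>Connections\<close>

definition gen_connection ::
  "('a::topological_space, 'n::finite) chart set \<Rightarrow> (('a, 'n) gtensor \<Rightarrow> ('a, 'n) gtensor \<Rightarrow> ('a, 'n) gtensor) \<Rightarrow> bool" where
  "gen_connection A D \<longleftrightarrow>
     (\<forall>\<xi>\<in>Gen A 1 0. \<forall>\<eta>\<in>Gen A 1 0. D \<xi> \<eta> \<in> Gen A 1 0) \<and>
     (\<forall>\<xi>\<in>Gen A 1 0. \<forall>\<eta>\<in>Gen A 1 0. \<forall>\<eta>'\<in>Gen A 1 0.
        D \<xi> (lift2 A 1 0 tadd \<eta> \<eta>') = lift2 A 1 0 tadd (D \<xi> \<eta>) (D \<xi> \<eta>')) \<and>
     (\<forall>\<xi>\<in>Gen A 1 0. \<forall>\<eta>\<in>Gen A 1 0. \<forall>r\<in>Gen_real.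
        D \<xi> (lift2 A 1 0 rscale r \<eta>) = lift2 A 1 0 rscale r (D \<xi> \<eta>)) \<and>
     (\<forall>\<xi>\<in>Gen A 1 0. \<forall>\<xi>'\<in>Gen A 1 0. \<forall>\<eta>\<in>Gen A 1 0.
        D (lift2 A 1 0 tadd \<xi> \<xi>') \<eta> = lift2 A 1 0 tadd (D \<xi> \<eta>) (D \<xi>' \<eta>)) \<and>
     (\<forall>\<xi>\<in>Gen A 1 0. \<forall>\<eta>\<in>Gen A 1 0. \<forall>u\<in>Gen A 0 0.
        D (lift2 A 1 0 fscale u \<xi>) \<eta> = lift2 A 1 0 fscale u (D \<xi> \<eta>)) \<and>
     (\<forall>\<xi>\<in>Gen A 1 0. \<forall>\<eta>\<in>Gen A 1 0. \<forall>u\<in>Gen A 0 0.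
        D \<xi> (lift2 A 1 0 fscale u \<eta>) =
          lift2 A 1 0 tadd (lift2 A 1 0 fscale u (D \<xi> \<eta>))
                           (lift2 A 1 0 fscale (lift2 A 0 0 (act A) \<xi> u) \<eta>))"

definition gen_levi_civita ::
  "('a::topological_space, 'n::finite) chart set \<Rightarrow> ('a, 'n) gtensor \<Rightarrow> (('a, 'n) gtensor \<Rightarrow> ('a, 'n) gtensor \<Rightarrow> ('a, 'n) gtensor) \<Rightarrow> bool" where
  "gen_levi_civita A G D \<longleftrightarrow> gen_connection A D \<and>
     (\<forall>\<xi>\<in>Gen A 1 0. \<forall>\<eta>\<in>Gen A 1 0.
        lift2 A 1 0 (bracket A) \<xi> \<eta> = lift2 A 1 0 tsub (D \<xi> \<eta>) (D \<eta> \<xi>)) \<and>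
     (\<forall>\<xi>\<in>Gen A 1 0. \<forall>\<eta>\<in>Gen A 1 0. \<forall>\<zeta>\<in>Gen A 1 0.
        lift2 A 0 0 (act A) \<xi> (gcontr2 A G \<eta> \<zeta>) =
          lift2 A 0 0 tadd (gcontr2 A G (D \<xi> \<eta>) \<zeta>) (gcontr2 A G \<eta> (D \<xi> \<zeta>)))"

text \<open>The connections of \<open>C\<^sup>k\<close>-metrics: \<open>D \<xi> \<eta>\<close> is defined for \<open>\<xi>\<close> of class \<open>C\<^bsup>k-1\<^esup>\<close> and \<open>\<eta>\<close>
  of class \<open>C\<^sup>k\<close>, and is of class \<open>C\<^bsup>k-1\<^esup>\<close>. For \<open>k = \<infinity>\<close> this is a smooth connection.\<close>

definition connection ::
  "enat \<Rightarrow> ('a, 'n::finite) chart set \<Rightarrow> (('a, 'n) tensor \<Rightarrow> ('a, 'n) tensor \<Rightarrow> ('a, 'n) tensor) \<Rightarrow> bool" where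
  "connection k A D \<longleftrightarrow>
     (\<forall>\<xi>\<in>Ck_tensor (k - 1) A 1 0. \<forall>\<eta>\<in>Ck_tensor k A 1 0. D \<xi> \<eta> \<in> Ck_tensor (k - 1) A 1 0) \<and>
     (\<forall>\<xi>\<in>Ck_tensor (k - 1) A 1 0. \<forall>\<eta>\<in>Ck_tensor k A 1 0. \<forall>\<eta>'\<in>Ck_tensor k A 1 0.
        D \<xi> (tadd \<eta> \<eta>') = tadd (D \<xi> \<eta>) (D \<xi> \<eta>')) \<and>
     (\<forall>\<xi>\<in>Ck_tensor (k - 1) A 1 0. \<forall>\<eta>\<in>Ck_tensor k A 1 0. \<forall>a.
        D \<xi> (rscale a \<eta>) = rscale a (D \<xi> \<eta>)) \<and>
     (\<forall>\<xi>\<in>Ck_tensor (k - 1) A 1 0. \<forall>\<xi>'\<in>Ck_tensor (k - 1) A 1 0. \<forall>\<eta>\<in>Ck_tensor k A 1 0.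
        D (tadd \<xi> \<xi>') \<eta> = tadd (D \<xi> \<eta>) (D \<xi>' \<eta>)) \<and>
     (\<forall>\<xi>\<in>Ck_tensor (k - 1) A 1 0. \<forall>\<eta>\<in>Ck_tensor k A 1 0. \<forall>u\<in>Ck_tensor (k - 1) A 0 0.
        D (fscale u \<xi>) \<eta> = fscale u (D \<xi> \<eta>)) \<and>
     (\<forall>\<xi>\<in>Ck_tensor (k - 1) A 1 0. \<forall>\<eta>\<in>Ck_tensor k A 1 0. \<forall>u\<in>Ck_tensor k A 0 0.
        D \<xi> (fscale u \<eta>) = tadd (fscale u (D \<xi> \<eta>)) (fscale (act A \<xi> u) \<eta>))"

definition levi_civita ::
  "enat \<Rightarrow> ('a, 'n::finite) chart set \<Rightarrow> ('a, 'n) tensor \<Rightarrow> (('a, 'n) tensor \<Rightarrow> ('a, 'n) tensor \<Rightarrow> ('a, 'n) tensor) \<Rightarrow> bool" where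
  "levi_civita k A g D \<longleftrightarrow> connection k A D \<and>
     (\<forall>\<xi>\<in>Ck_tensor k A 1 0. \<forall>\<eta>\<in>Ck_tensor k A 1 0. bracket A \<xi> \<eta> = tsub (D \<xi> \<eta>) (D \<eta> \<xi>)) \<and>
     (\<forall>\<xi>\<in>Ck_tensor (k - 1) A 1 0. \<forall>\<eta>\<in>Ck_tensor k A 1 0. \<forall>\<zeta>\<in>Ck_tensor k A 1 0.
        act A \<xi> (contr2 A g \<eta> \<zeta>) = tadd (contr2 A g (D \<xi> \<eta>) \<zeta>) (contr2 A g \<eta> (D \<xi> \<zeta>)))"

text \<open>The coordinate vector field \<open>\<partial>\<^sub>i\<close> of the chart \<open>c\<close> on an open subset \<open>W\<close> of its domain, and the
  linear combination \<open>\<Sum>\<^sub>k u\<^sub>k \<partial>\<^sub>k\<close> there.\<close>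

definition frame :: "('a, 'n::finite) chart set \<Rightarrow> 'a set \<Rightarrow> ('a, 'n) chart \<Rightarrow> 'n \<Rightarrow> ('a, 'n) tensor" where
  "frame A W c i = tens (restr A W) 1 0 (\<lambda>c' p I J. jac c c' p $ (I ! 0) $ i)"

definition frame_comb ::
  "('a, 'n::finite) chart set \<Rightarrow> 'a set \<Rightarrow> ('a, 'n) chart \<Rightarrow> ('n \<Rightarrow> ('a, 'n) tensor) \<Rightarrow> ('a, 'n) tensor" where
  "frame_comb A W c u = tens (restr A W) 1 0 (\<lambda>c' p I J.
     \<Sum>k\<in>UNIV. u k c' p [] [] * frame A W c k c' p I J)"

text \<open>Christoffel symbols: the functions \<open>\<Gamma> k i j\<close> (upper index first) on the chart domain with
  \<open>D\<^bsub>\<partial>i\<^esub> \<partial>\<^sub>j = \<Sum>\<^sub>k \<Gamma>\<^sup>k\<^sub>i\<^sub>j \<partial>\<^sub>k\<close>. The coordinate fields need not extend to the manifold, so the left-hand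
  side is the restriction of the local operator \<open>D\<close>: on any open \<open>W\<close> inside the chart domain it is
  computed from global fields that agree with \<open>\<partial>\<^sub>i\<close> and \<open>\<partial>\<^sub>j\<close> on \<open>W\<close>.\<close>

definition christoffel ::
  "enat \<Rightarrow> ('a::topological_space, 'n::finite) chart set \<Rightarrow> (('a, 'n) tensor \<Rightarrow> ('a, 'n) tensor \<Rightarrow> ('a, 'n) tensor) \<Rightarrow>
     ('a, 'n) chart \<Rightarrow> 'n \<Rightarrow> 'n \<Rightarrow> 'n \<Rightarrow> ('a, 'n) tensor" where
  "christoffel k A D c = (THE \<Gamma>.
     (\<forall>l i j. \<Gamma> l i j \<in> Ck_tensor (k - 1) (restr A (cdom c)) 0 0) \<and>
     (\<forall>i j W. \<forall>\<xi>\<in>Ck_tensor (k - 1) A 1 0. \<forall>\<eta>\<in>Ck_tensor k A 1 0.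
        open W \<and> W \<subseteq> cdom c \<and>
        tens (restr A W) 1 0 \<xi> = frame A W c i \<and> tens (restr A W) 1 0 \<eta> = frame A W c j \<longrightarrow>
        tens (restr A W) 1 0 (D \<xi> \<eta>) = frame_comb A W c (\<lambda>l. \<Gamma> l i j)))"

definition gen_christoffel ::
  "('a::topological_space, 'n::finite) chart set \<Rightarrow> (('a, 'n) gtensor \<Rightarrow> ('a, 'n) gtensor \<Rightarrow> ('a, 'n) gtensor) \<Rightarrow>
     ('a, 'n) chart \<Rightarrow> 'n \<Rightarrow> 'n \<Rightarrow> 'n \<Rightarrow> ('a, 'n) gtensor" where
  "gen_christoffel A D c = (THE \<Gamma>.
     (\<forall>l i j. \<Gamma> l i j \<in> Gen (restr A (cdom c)) 0 0) \<and>
     (\<forall>i j W. \<forall>\<xi>\<in>Gen A 1 0. \<forall>\<eta>\<in>Gen A 1 0.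
        open W \<and> W \<subseteq> cdom c \<and>
        grestr A W 1 0 \<xi> = const_emb (restr A W) 1 0 (frame A W c i) \<and>
        grestr A W 1 0 \<eta> = const_emb (restr A W) 1 0 (frame A W c j) \<longrightarrow>
        (\<forall>u. (\<forall>l. u l \<in> \<Gamma> l i j) \<longrightarrow>
           grestr A W 1 0 (D \<xi> \<eta>) = gcls (restr A W) 1 0 (\<lambda>\<epsilon>. frame_comb A W c (\<lambda>l. u l \<epsilon>)))))"

section \<open>Distributional vector fields\<close>

definition tsupp :: "(real ^ 'n::finite \<Rightarrow> real) \<Rightarrow> (real ^ 'n) set" where
  "tsupp f = closure {x. f x \<noteq> 0}"

definition test_fun :: "(real ^ 'n::finite) set \<Rightarrow> (real ^ 'n \<Rightarrow> real) set" where
  "test_fun S = {f. Ck_on \<infinity> UNIV f \<and> compact (tsupp f) \<and> tsupp f \<subseteq> S}"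

definition distribution :: "(real ^ 'n::finite) set \<Rightarrow> ((real ^ 'n \<Rightarrow> real) \<Rightarrow> real) \<Rightarrow> bool" where
  "distribution S w \<longleftrightarrow>
     (\<forall>f\<in>test_fun S. \<forall>g\<in>test_fun S. \<forall>a b. w (\<lambda>x. a * f x + b * g x) = a * w f + b * w g) \<and>
     (\<forall>K. compact K \<and> K \<subseteq> S \<longrightarrow> (\<exists>C m. \<forall>f\<in>test_fun S. tsupp f \<subseteq> K \<longrightarrow>
        \<bar>w f\<bar> \<le> C * (\<Sum>\<alpha> | length \<alpha> \<le> m. SUP x. \<bar>pd \<alpha> f x\<bar>)))"

text \<open>On a chart domain a compactly supported one-density is \<open>f |dx|\<close> for a test function \<open>f\<close> on the
  range of the chart. If it lives on the overlap with another chart \<open>c\<close>, this is its coefficient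
  with respect to \<open>c\<close>.\<close>

definition density_change :: "('a, 'n::finite) chart \<Rightarrow> ('a, 'n) chart \<Rightarrow> (real ^ 'n \<Rightarrow> real) \<Rightarrow> real ^ 'n \<Rightarrow> real" where
  "density_change c c' f = (\<lambda>x. if x \<in> cmap c ` (cdom c \<inter> cdom c')
     then f (cmap c' (cinv c x)) * \<bar>det (jac c c' (cinv c x))\<bar> else 0)"

text \<open>\<open>w c i\<close> is the \<open>i\<close>-th component in the chart \<open>c\<close>.\<close>

type_synonym ('a, 'n) dist_vf = "('a, 'n) chart \<Rightarrow> 'n \<Rightarrow> (real ^ 'n \<Rightarrow> real) \<Rightarrow> real"

definition is_dist_vf :: "('a, 'n::finite) chart set \<Rightarrow> ('a, 'n) dist_vf \<Rightarrow> bool" where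
  "is_dist_vf A w \<longleftrightarrow>
     (\<forall>c\<in>A. \<forall>i. distribution (cran c) (w c i)) \<and>
     (\<forall>c\<in>A. \<forall>c'\<in>A. \<forall>l. \<forall>f\<in>test_fun (cmap c' ` (cdom c \<inter> cdom c')).
        w c' l f = (\<Sum>i\<in>UNIV. w c i (\<lambda>x. jac c c' (cinv c x) $ l $ i * density_change c c' f x)))"

definition dist_mult :: "(real ^ 'n::finite \<Rightarrow> real) \<Rightarrow> ((real ^ 'n \<Rightarrow> real) \<Rightarrow> real) \<Rightarrow> (real ^ 'n \<Rightarrow> real) \<Rightarrow> real" where
  "dist_mult a w = (\<lambda>f. w (\<lambda>x. a x * f x))"

definition dist_pd :: "'n::finite \<Rightarrow> ((real ^ 'n \<Rightarrow> real) \<Rightarrow> real) \<Rightarrow> (real ^ 'n \<Rightarrow> real) \<Rightarrow> real" where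
  "dist_pd i w = (\<lambda>f. - w (pd [i] f))"

text \<open>The coordinate formula
  \<open>D\<^sub>\<zeta> \<nu> = (\<zeta>\<^sup>i \<partial>\<^sub>i \<nu>\<^sup>l + \<Gamma>\<^sup>l\<^sub>i\<^sub>j \<zeta>\<^sup>i \<nu>\<^sup>j) \<partial>\<^sub>l\<close> with \<open>\<zeta>\<close> smooth and \<open>\<nu>\<close> distributional,
  then with \<open>\<zeta>\<close> distributional and \<open>\<nu>\<close> smooth.\<close>

definition nabla_smooth_dist ::
  "('a::topological_space, 'n::finite) chart set \<Rightarrow> (('a, 'n) tensor \<Rightarrow> ('a, 'n) tensor \<Rightarrow> ('a, 'n) tensor) \<Rightarrow>
     ('a, 'n) tensor \<Rightarrow> ('a, 'n) dist_vf \<Rightarrow> ('a, 'n) dist_vf" where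
  "nabla_smooth_dist A D \<zeta> \<nu> = (\<lambda>c l f.
     (\<Sum>i\<in>UNIV. dist_mult (coord c \<zeta> [i] []) (dist_pd i (\<nu> c l)) f) +
     (\<Sum>i\<in>UNIV. \<Sum>j\<in>UNIV.
        dist_mult (\<lambda>x. coord c (christoffel \<infinity> A D c l i j) [] [] x * coord c \<zeta> [i] [] x) (\<nu> c j) f))"

definition nabla_dist_smooth ::
  "('a::topological_space, 'n::finite) chart set \<Rightarrow> (('a, 'n) tensor \<Rightarrow> ('a, 'n) tensor \<Rightarrow> ('a, 'n) tensor) \<Rightarrow>
     ('a, 'n) dist_vf \<Rightarrow> ('a, 'n) tensor \<Rightarrow> ('a, 'n) dist_vf" where
  "nabla_dist_smooth A D \<zeta> \<nu> = (\<lambda>c l f.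
     (\<Sum>i\<in>UNIV. dist_mult (pd [i] (coord c \<nu> [l] [])) (\<zeta> c i) f) +
     (\<Sum>i\<in>UNIV. \<Sum>j\<in>UNIV.
        dist_mult (\<lambda>x. coord c (christoffel \<infinity> A D c l i j) [] [] x * coord c \<nu> [j] [] x) (\<zeta> c i) f))"

section \<open>Association\<close>

definition assoc_k ::
  "enat \<Rightarrow> ('a, 'n::finite) chart set \<Rightarrow> nat \<Rightarrow> nat \<Rightarrow> ('a, 'n) gtensor \<Rightarrow> ('a, 'n) tensor \<Rightarrow> bool" where
  "assoc_k k A r s S t \<longleftrightarrow> (\<exists>u\<in>S. \<forall>c\<in>A. \<forall>I\<in>idx r. \<forall>J\<in>idx s.
     \<forall>\<alpha>. enat (length \<alpha>) \<le> k \<longrightarrow> (\<forall>K. compact K \<and> K \<subseteq> cran c \<longrightarrow>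
       uniform_limit K (\<lambda>\<epsilon>. pd \<alpha> (coord c (u \<epsilon>) I J)) (pd \<alpha> (coord c t I J)) (at_right 0)))"

definition assoc_dist_vf ::
  "('a, 'n::finite) chart set \<Rightarrow> ('a, 'n) gtensor \<Rightarrow> ('a, 'n) dist_vf \<Rightarrow> bool" where
  "assoc_dist_vf A S w \<longleftrightarrow> (\<exists>u\<in>S. \<forall>c\<in>A. \<forall>i. \<forall>f\<in>test_fun (cran c).
     ((\<lambda>\<epsilon>. LINT x:cran c|lborel. coord c (u \<epsilon>) [i] [] x * f x) \<longlongrightarrow> w c i f) (at_right 0))"

end

theory Submission
  imports Defs
begin

text \<open>Everything is local, and in a chart a tensor field is a family of functions on an open subset of
\<open>real ^ 'n\<close>. So the three claims become claims about nets of such functions. The parameter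
\<open>\<epsilon>\<close> of a net is written \<open>e\<close> below.

The heart of the proof is one coordinate formula. Let \<open>\<gamma>\<close> be a representative of the generalized metric,
and let \<open>gchr\<close> be the classical expression for the Christoffel symbols in \<open>\<gamma>\<close> and its first derivatives,
where the inverse matrix is the adjugate of \<open>\<gamma>\<close> times a generalized inverse of \<open>det \<gamma>\<close>. If \<open>\<xi>\<close>, \<open>\<eta>\<close>
represent two generalized vector fields and \<open>w\<close> represents the covariant derivative of the second along the first,
then \<open>w\<close> has the components
\<open>\<Sum>\<^sub>i \<xi>\<^sup>i (\<partial>\<^sub>i \<eta>\<^sup>l + \<Sum>\<^sub>j gchr l i j \<eta>\<^sup>j)\<close>
up to negligible nets (\<open>gen_formula\<close>). The proof is the classical one. The fields are cut off and expanded in a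
smooth local frame, linearity and the Leibniz rule reduce the claim to the frame fields, and for these torsion
freeness and compatibility with the metric give the Koszul identity. This argument uses few properties of
``equality'', so it is carried out once, in the locale \<open>conn\<close>, for an abstract class of null nets. Taking
zero nets as null gives the formula for the Levi-Civita connection of a \<open>C\<^sup>k\<close>-metric
(\<open>levi_civita_formula\<close>), and taking negligible nets as null gives \<open>gen_formula\<close>. As the coordinate fields are the
frame, the formulas also identify both kinds of Christoffel symbols (\<open>christoffel_eq\<close>, \<open>gen_christoffel_eq\<close>).

Given these formulas, each part of the proposition compares two explicit expressions in \<open>\<gamma>\<close>, \<open>\<xi>\<close> and \<open>\<eta>\<close>.
If the generalized metric is the class of a smooth metric \<open>g\<close>, then \<open>\<gamma> - g\<close> is negligible, and sums, products,
derivatives and the inverse of the determinant preserve this (\<open>gchr_Neq_cchr\<close>). If \<open>\<gamma>\<close> converges to a metric \<open>g\<close> in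
\<open>C\<^sup>k\<close>, then the inverse matrix converges in \<open>C\<^sup>k\<close>, and \<open>gchr\<close>, which contains one derivative, converges
in \<open>C\<^bsup>k-1\<^esup>\<close> (\<open>Conv_inverse\<close>, \<open>gchr_Conv\<close>). For distributional limits each term is a derivative or a
product of a weakly convergent net and a net that converges in \<open>C\<^bsup>\<infinity>\<^esup>\<close>. Derivatives are moved to the test
function by integration by parts. For the product the varying factor is absorbed into the test function, and
one needs that a weakly convergent sequence of functionals converges along a convergent sequence
of test functions. This is the Banach--Steinhaus theorem for test functions, proved by a gliding hump.

Generalized tensor fields are defined by means of linear differential operators and Riemannian norms. The passage to components
(\<open>moderate_Mod\<close>, \<open>moderateI\<close> and their counterparts for negligible nets) rests on two facts: a partial derivative
in a chart becomes a differential operator on the whole manifold after multiplication by a cut-off function, and a moderate net whose values are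
negligible has negligible derivatives (\<open>NegI\<close>).\<close>

section \<open>Partial derivatives\<close>

lemma pd_append: "pd (\<alpha> @ \<beta>) f = pd \<alpha> (pd \<beta> f)"
  by (induction \<alpha>) auto

lemma pd_one: "(f has_derivative f') (at x) \<Longrightarrow> pd [i] f x = f' (axis i 1)"
  by (simp add: frechet_derivative_at[symmetric])

lemma pd_frechet: "pd [i] f x = frechet_derivative f (at x) (axis i 1)"
  by simp

lemma pd_const [simp]: "pd [i] (\<lambda>x. c) = (\<lambda>x. 0)" by simp

lemma pd_Cons: "pd (i # \<alpha>) f = pd [i] (pd \<alpha> f)" by simp

declare pd.simps(2) [simp del]

lemma pd_const_list: "pd \<alpha> (\<lambda>x. c) = (\<lambda>x. if \<alpha> = [] then c else 0)"
  by (induction \<alpha>) (auto simp: pd.simps(2))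

text \<open>Iterated frechet derivatives are total functions, with an unspecified value where the derivative does not exist. So the locality
of \<open>pd\<close> is proved without any differentiability: the sets of possible derivatives of \<open>f\<close> and \<open>g\<close> agree.\<close>

lemma pd_cong_open:
  assumes "open S" "x \<in> S" "\<And>y. y \<in> S \<Longrightarrow> f y = g y"
  shows "pd \<alpha> f x = pd \<alpha> g x"
  using assms(2)
proof (induction \<alpha> arbitrary: x)
  case Nil then show ?case using assms(3) by simp
next
  case (Cons i \<alpha>)
  have "(pd \<alpha> f has_derivative D) (at x) \<longleftrightarrow> (pd \<alpha> g has_derivative D) (at x)" for D
  proof
    show "(pd \<alpha> g has_derivative D) (at x)" if "(pd \<alpha> f has_derivative D) (at x)"
      by (rule has_derivative_transform_within_open[OF that assms(1) Cons.prems]) (rule Cons.IH)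
    show "(pd \<alpha> f has_derivative D) (at x)" if "(pd \<alpha> g has_derivative D) (at x)"
      by (rule has_derivative_transform_within_open[OF that assms(1) Cons.prems]) (rule Cons.IH[symmetric])
  qed
  then show ?case by (simp add: pd.simps(2) frechet_derivative_def)
qed

lemma differentiable_cong_open:
  assumes "f differentiable at x" "open S" "x \<in> S" "\<And>y. y \<in> S \<Longrightarrow> f y = g y"
  shows "g differentiable at x"
  using assms has_derivative_transform_within_open unfolding differentiable_def by metis

lemma has_derivative_pd:
  fixes f :: "real^'n::finite \<Rightarrow> real"
  assumes "f differentiable at x"
  shows "(f has_derivative (\<lambda>v. \<Sum>i\<in>UNIV. v $ i * pd [i] f x)) (at x)"
proof -
  let ?D = "frechet_derivative f (at x)"
  have D: "(f has_derivative ?D) (at x)" using assms frechet_derivative_works by blast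
  have "?D v = (\<Sum>i\<in>UNIV. v $ i * pd [i] f x)" for v
  proof -
    have "?D v = ?D (\<Sum>i\<in>UNIV. v $ i *\<^sub>R axis i 1)" by (simp add: basis_expansion scalar_mult_eq_scaleR[symmetric])
    also have "\<dots> = (\<Sum>i\<in>UNIV. v $ i * ?D (axis i 1))"
      using linear_frechet_derivative[OF assms] by (simp add: linear_sum linear_cmul)
    finally show ?thesis by (simp add: pd_frechet)
  qed
  then show ?thesis using D by (metis (no_types, lifting) ext)
qed

lemma pd_add: assumes "f differentiable at x" "g differentiable at x"
  shows "pd [i] (\<lambda>y. f y + g y) x = pd [i] f x + pd [i] g x"
  by (subst pd_one[OF has_derivative_add[OF assms[unfolded frechet_derivative_works]]]) (simp add: pd_frechet)

lemma pd_mult: assumes "f differentiable at x" "g differentiable at x"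
  shows "pd [i] (\<lambda>y. f y * g y :: real) x = pd [i] f x * g x + f x * pd [i] g x"
proof -
  show ?thesis
    by (subst pd_one[OF has_derivative_mult[OF assms[unfolded frechet_derivative_works]]]) (simp add: pd_frechet)
qed

lemma differentiable_vec:
  fixes \<tau> :: "real^'n::finite \<Rightarrow> real^'n"
  assumes "\<And>j. (\<lambda>y. \<tau> y $ j) differentiable at x"
  shows "\<tau> differentiable at x"
proof -
  have *: "\<tau> = (\<lambda>y. \<Sum>j\<in>UNIV. (\<tau> y $ j) *\<^sub>R axis j 1)"
    by (rule ext) (simp add: basis_expansion scalar_mult_eq_scaleR[symmetric])
  show ?thesis by (subst *) (use assms in \<open>intro differentiable_sum differentiable_scaleR; simp\<close>)
qed

lemma pd_comp:
  fixes \<tau> :: "real^'n::finite \<Rightarrow> real^'n"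
  assumes f: "f differentiable at (\<tau> x)" and t: "\<And>j. (\<lambda>y. \<tau> y $ j) differentiable at x"
  shows "pd [i] (\<lambda>y. f (\<tau> y)) x = (\<Sum>j\<in>UNIV. pd [i] (\<lambda>y. \<tau> y $ j) x * pd [j] f (\<tau> x))"
    and "(\<lambda>y. f (\<tau> y)) differentiable at x"
proof -
  let ?D = "frechet_derivative \<tau> (at x)"
  have D: "(\<tau> has_derivative ?D) (at x)" using differentiable_vec[OF t] frechet_derivative_works by blast
  from has_derivative_compose[OF D has_derivative_pd[OF f]]
  have c: "((\<lambda>y. f (\<tau> y)) has_derivative (\<lambda>v. \<Sum>j\<in>UNIV. ?D v $ j * pd [j] f (\<tau> x))) (at x)" .
  have "pd [i] (\<lambda>y. \<tau> y $ j) x = ?D (axis i 1) $ j" for j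
    by (rule pd_one) (rule bounded_linear.has_derivative[OF bounded_linear_vec_nth D])
  then show "pd [i] (\<lambda>y. f (\<tau> y)) x = (\<Sum>j\<in>UNIV. pd [i] (\<lambda>y. \<tau> y $ j) x * pd [j] f (\<tau> x))"
    using pd_one[OF c] by simp
  show "(\<lambda>y. f (\<tau> y)) differentiable at x" using c unfolding differentiable_def by blast
qed

section \<open>Graded classes of nets\<close>

text \<open>A class of nets is given by a condition \<open>Q x f\<close> on the behaviour of a net \<open>f\<close> near a point \<open>x\<close>, and \<open>grade I Q k\<close> imposes it
on all derivatives of order at most \<open>k\<close>. The recursion takes the innermost derivative first, since the proofs of closure
under products and composition apply the induction hypothesis to the first derivatives of a net. The description by
lists of directions is \<open>grade_iff\<close>.
The indices in \<open>I\<close> are those at which differentiability is required; with the limit as the member at \<open>0\<close> this also covers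
convergent nets.\<close>

primrec grade :: "real set \<Rightarrow> (real^'n::finite \<Rightarrow> (real \<Rightarrow> real^'n \<Rightarrow> real) \<Rightarrow> bool) \<Rightarrow> nat \<Rightarrow>
   (real^'n) set \<Rightarrow> (real \<Rightarrow> real^'n \<Rightarrow> real) \<Rightarrow> bool" where
  "grade I Q 0 S f = (\<forall>x\<in>S. Q x f)"
| "grade I Q (Suc k) S f = ((\<forall>x\<in>S. Q x f) \<and> (\<forall>e\<in>I. \<forall>x\<in>S. f e differentiable at x) \<and>
     (\<forall>i. grade I Q k S (\<lambda>e. pd [i] (f e))))"

lemma grade_iff:
  "grade I Q k S f \<longleftrightarrow> (\<forall>\<alpha>. length \<alpha> \<le> k \<longrightarrow> (\<forall>x\<in>S. Q x (\<lambda>e. pd \<alpha> (f e)))) \<and>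
    (\<forall>\<alpha>. length \<alpha> < k \<longrightarrow> (\<forall>e\<in>I. \<forall>x\<in>S. pd \<alpha> (f e) differentiable at x))"
proof (induction k arbitrary: f)
  case 0 then show ?case by auto
next
  case (Suc k)
  have all: "(\<forall>\<alpha>::'a list. P \<alpha>) \<longleftrightarrow> P [] \<and> (\<forall>i \<alpha>. P (\<alpha> @ [i]))" for P by (metis rev_exhaust)
  have 1: "(\<forall>\<alpha>. length \<alpha> \<le> Suc k \<longrightarrow> (\<forall>x\<in>S. Q x (\<lambda>e. pd \<alpha> (f e)))) \<longleftrightarrow>
    (\<forall>x\<in>S. Q x f) \<and> (\<forall>i \<alpha>. length \<alpha> \<le> k \<longrightarrow> (\<forall>x\<in>S. Q x (\<lambda>e. pd \<alpha> (pd [i] (f e)))))"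
    by (subst all) (simp add: pd_append)
  have 2: "(\<forall>\<alpha>. length \<alpha> < Suc k \<longrightarrow> (\<forall>e\<in>I. \<forall>x\<in>S. pd \<alpha> (f e) differentiable at x)) \<longleftrightarrow>
    (\<forall>e\<in>I. \<forall>x\<in>S. f e differentiable at x) \<and>
    (\<forall>i \<alpha>. length \<alpha> < k \<longrightarrow> (\<forall>e\<in>I. \<forall>x\<in>S. pd \<alpha> (pd [i] (f e)) differentiable at x))"
    by (subst all) (simp add: pd_append)
  show ?case unfolding grade.simps Suc.IH 1 2 by blast
qed

lemma grade_mono: "grade I Q k S f \<Longrightarrow> k' \<le> k \<Longrightarrow> T \<subseteq> S \<Longrightarrow> grade I Q k' T f"
  unfolding grade_iff by (meson less_le_trans order_trans subsetD)

lemma grade_Suc: "grade I Q (Suc k) S f \<Longrightarrow> grade I Q k S f"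
  by (erule grade_mono) auto

lemma grade_local: "(\<And>x. x \<in> S \<Longrightarrow> \<exists>U. x \<in> U \<and> grade I Q k U f) \<Longrightarrow> grade I Q k S f"
  unfolding grade_iff by meson

lemma grade_pd: "grade I Q (k + length \<alpha>) S f \<Longrightarrow> grade I Q k S (\<lambda>e. pd \<alpha> (f e))"
  unfolding grade_iff pd_append[symmetric] by simp

locale net_class =
  fixes I :: "real set" and Q :: "real^'n::finite \<Rightarrow> (real \<Rightarrow> real^'n \<Rightarrow> real) \<Rightarrow> bool"
  assumes e_cong: "open S \<Longrightarrow> x \<in> S \<Longrightarrow> (\<And>e y. e \<in> I \<Longrightarrow> y \<in> S \<Longrightarrow> f e y = g e y) \<Longrightarrow> Q x f \<Longrightarrow> Q x g"
    and e_add: "Q x f \<Longrightarrow> Q x g \<Longrightarrow> Q x (\<lambda>e y. f e y + g e y)"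
    and e_zero: "Q x (\<lambda>e y. 0)"
begin

abbreviation G where "G \<equiv> grade I Q"

lemma G_cong:
  assumes "open S" "\<And>e y. e \<in> I \<Longrightarrow> y \<in> S \<Longrightarrow> f e y = g e y" "G k S f"
  shows "G k S g"
  using assms(2,3)
proof (induction k arbitrary: f g)
  case 0
  have "Q x g" if "x \<in> S" for x
    by (rule e_cong[OF assms(1) that, of f]) (use 0 that in auto)
  then show ?case by simp
next
  case (Suc k)
  have "G k S (\<lambda>e. pd [i] (g e))" for i
    by (rule Suc.IH[of "\<lambda>e. pd [i] (f e)"]) (use Suc.prems(2) pd_cong_open[OF assms(1) _ Suc.prems(1)] in simp_all)
  moreover have "Q x g" if "x \<in> S" for x
    by (rule e_cong[OF assms(1) that, of f]) (use Suc.prems that in auto)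
  moreover have "\<forall>e\<in>I. \<forall>x\<in>S. g e differentiable at x"
    using Suc.prems(2) by (auto intro: differentiable_cong_open[OF _ assms(1) _ Suc.prems(1)])
  ultimately show ?case by simp
qed

lemma G_zero: "G k S (\<lambda>e y. 0)"
  by (induction k) (auto simp: e_zero)

lemma G_add:
  assumes "open S" "G k S f" "G k S g"
  shows "G k S (\<lambda>e y. f e y + g e y)"
  using assms(2,3)
proof (induction k arbitrary: f g)
  case 0 then show ?case by (simp add: e_add)
next
  case (Suc k)
  have "G k S (\<lambda>e. pd [i] (\<lambda>y. f e y + g e y))" for i
    by (rule G_cong[OF assms(1) _ Suc.IH[of "\<lambda>e. pd [i] (f e)" "\<lambda>e. pd [i] (g e)"]])
      (use Suc.prems in \<open>auto simp: pd_add\<close>)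
  then show ?case using Suc.prems by (auto simp: e_add)
qed

lemma G_sum:
  assumes "open S" "\<And>j. j \<in> J \<Longrightarrow> G k S (\<lambda>e. f j e)"
  shows "G k S (\<lambda>e y. \<Sum>j\<in>J. f j e y)"
  using assms(2) by (induction J rule: infinite_finite_induct) (auto simp: G_zero G_add[OF assms(1)])

end

lemma C_diff: "Ck_on (enat (Suc k)) S f \<Longrightarrow> x \<in> S \<Longrightarrow> f differentiable at x"
  unfolding Ck_on_def by (metis enat_ord_simps(2) list.size(3) pd.simps(1) zero_less_Suc)

text \<open>The nets in \<open>e1\<close> act on those in \<open>e2\<close> by multiplication, like the moderate nets on the negligible ones. The lemmas below lift the
properties of the pointwise conditions to all derivatives. They serve four times: for continuity, which yields the classical
facts on \<open>C\<^sup>k\<close>-functions, and for moderate, negligible and convergent nets.\<close>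

locale net_module = R: net_class I e1 + M: net_class I e2
  for I :: "real set" and e1 e2 :: "real^'n::finite \<Rightarrow> (real \<Rightarrow> real^'n \<Rightarrow> real) \<Rightarrow> bool" +
  assumes e_mult: "e1 x f \<Longrightarrow> e2 x g \<Longrightarrow> e2 x (\<lambda>e y. f e y * g e y)"
    and e_const: "isCont \<phi> x \<Longrightarrow> e1 x (\<lambda>e. \<phi>)"
    and e_comp: "e2 (\<tau> x) f \<Longrightarrow> isCont \<tau> x \<Longrightarrow> e2 x (\<lambda>e y. f e (\<tau> y))"
begin

lemma G_mult:
  assumes "open S" "grade I e1 k S f" "grade I e2 k S g"
  shows "grade I e2 k S (\<lambda>e y. f e y * g e y)"
  using assms(2,3)
proof (induction k arbitrary: f g)
  case 0 then show ?case by (simp add: e_mult)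
next
  case (Suc k)
  have "grade I e2 k S (\<lambda>e y. pd [i] (f e) y * g e y + f e y * pd [i] (g e) y)" for i
    by (rule M.G_add[OF assms(1)]; rule Suc.IH)
      (use Suc.prems grade_Suc[OF Suc.prems(1)] grade_Suc[OF Suc.prems(2)] in simp_all)
  then have "grade I e2 k S (\<lambda>e. pd [i] (\<lambda>y. f e y * g e y))" for i
    by (rule M.G_cong[OF assms(1), rotated]) (use Suc.prems in \<open>simp add: pd_mult\<close>)
  then show ?case using Suc.prems by (auto simp: e_mult)
qed

lemma G_const:
  assumes "open S" "Ck_on (enat k) S \<phi>"
  shows "grade I e1 k S (\<lambda>e. \<phi>)"
proof -
  have "isCont (pd \<alpha> \<phi>) x" if "length \<alpha> \<le> k" "x \<in> S" for \<alpha> x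
    using assms that unfolding Ck_on_def by (simp add: continuous_on_eq_continuous_at)
  moreover have "pd \<alpha> \<phi> differentiable at x" if "length \<alpha> < k" "x \<in> S" for \<alpha> x
    using assms that unfolding Ck_on_def by simp
  ultimately show ?thesis unfolding grade_iff using e_const by blast
qed

lemma G_uminus: "open S \<Longrightarrow> grade I e2 k S g \<Longrightarrow> grade I e2 k S (\<lambda>e y. - g e y)"
proof -
  assume "open S" "grade I e2 k S g"
  moreover have "grade I e1 k S (\<lambda>e x. -1)"
  proof -
    have "Ck_on (enat k) S (\<lambda>x. - 1)"
      unfolding Ck_on_def pd_const_list by auto
    then show ?thesis using G_const \<open>open S\<close> by blast
  qed
  ultimately have "grade I e2 k S (\<lambda>e y. - 1 * g e y)" using G_mult by blast
  then show ?thesis by simp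
qed

lemma G_diff: "open S \<Longrightarrow> grade I e2 k S f \<Longrightarrow> grade I e2 k S g \<Longrightarrow> grade I e2 k S (\<lambda>e y. f e y - g e y)"
  using M.G_add[OF _ _ G_uminus, of S k f g] by simp

lemma G_comp:
  assumes "open S" "open T" "grade I e2 k T f" "\<And>x. x \<in> S \<Longrightarrow> \<tau> x \<in> T"
    and t: "\<And>j. Ck_on (enat k) S (\<lambda>x. \<tau> x $ j)"
  shows "grade I e2 k S (\<lambda>e y. f e (\<tau> y))"
proof -
  have c: "isCont \<tau> x" if "x \<in> S" for x
  proof -
    have "isCont (\<lambda>y. \<tau> y $ j) x" for j
      using t[of j] assms(1) that unfolding Ck_on_def
      by (metis continuous_on_eq_continuous_at pd.simps(1) list.size(3) zero_enat_def zero_le)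
    then show ?thesis using vec_tendstoI[of \<tau> "\<tau> x" "at x"] by (simp add: isCont_def)
  qed
  show ?thesis using assms(3) t
  proof (induction k arbitrary: f)
    case 0 then show ?case using c assms(4) e_comp by simp
  next
    case (Suc k)
    have tj: "Ck_on (enat k) S (\<lambda>x. \<tau> x $ j)" "Ck_on (enat k) S (pd [i] (\<lambda>x. \<tau> x $ j))" for i j
      using Suc.prems(2)[of j] unfolding Ck_on_def pd_append[symmetric] by auto
    \<comment> \<open>the chain rule, with the first derivatives of the outer net covered by the induction hypothesis\<close>
    have H: "grade I e2 k S (\<lambda>e y. \<Sum>j\<in>UNIV. pd [i] (\<lambda>y. \<tau> y $ j) y * pd [j] (f e) (\<tau> y))" for i
      by (intro M.G_sum G_mult G_const assms(1) tj Suc.IH) (use Suc.prems in auto)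
    have "grade I e2 k S (\<lambda>e. pd [i] (\<lambda>y. f e (\<tau> y)))" for i
    proof (rule M.G_cong[OF assms(1) _ H[of i]])
      fix e y assume ey: "e \<in> I" "y \<in> S"
      then have "f e differentiable at (\<tau> y)" using Suc.prems(1) assms(4) by simp
      from pd_comp(1)[OF this C_diff[OF Suc.prems(2) ey(2)]] show "(\<Sum>j\<in>UNIV. pd [i] (\<lambda>y. \<tau> y $ j) y * pd [j] (f e) (\<tau> y)) = pd [i] (\<lambda>y. f e (\<tau> y)) y"
        by simp
    qed
    moreover have "(\<lambda>y. f e (\<tau> y)) differentiable at x" if "e \<in> I" "x \<in> S" for e x
    proof -
      have "f e differentiable at (\<tau> x)" using that Suc.prems(1) assms(4) by simp
      from pd_comp(2)[OF this C_diff[OF Suc.prems(2) that(2)]] show ?thesis .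
    qed
    moreover have "e2 x (\<lambda>e y. f e (\<tau> y))" if "x \<in> S" for x
      using c[OF that] Suc.prems(1) e_comp assms(4)[OF that] by simp
    ultimately show ?case by simp
  qed
qed

end

section \<open>Functions of class \<open>C\<^sup>k\<close>\<close>

interpretation cont: net_module UNIV "\<lambda>x f. \<forall>e. isCont (f e) x" "\<lambda>x f. \<forall>e. isCont (f e) x"
proof unfold_locales
  fix S and x :: "real^'n" and f g :: "real \<Rightarrow> real^'n \<Rightarrow> real"
  assume *: "open S" "x \<in> S" "\<And>e y. e \<in> UNIV \<Longrightarrow> y \<in> S \<Longrightarrow> f e y = g e y" "\<forall>e. isCont (f e) x"
  have "isCont (f e) x \<longleftrightarrow> isCont (g e) x" for e
    by (rule isCont_cong, rule eventually_mono[OF eventually_nhds_in_open[OF *(1,2)]]) (rule *(3); simp)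
  then show "\<forall>e. isCont (g e) x" using *(4) by blast
next
  fix \<tau> :: "real^'n \<Rightarrow> real^'n" and x and f :: "real \<Rightarrow> real^'n \<Rightarrow> real" assume "\<forall>e. isCont (f e) (\<tau> x)" "isCont \<tau> x"
  then show "\<forall>e. isCont (\<lambda>y. f e (\<tau> y)) x" using isCont_o2 by blast
qed auto

lemma Ck_grade: "open S \<Longrightarrow> Ck_on (enat k) S f \<longleftrightarrow> grade UNIV (\<lambda>x f. \<forall>e. isCont (f e) x) k S (\<lambda>_. f)"
  unfolding grade_iff Ck_on_def by (auto simp: continuous_on_eq_continuous_at)

text \<open>Reduces closure properties for \<open>k = \<infinity>\<close> to finite orders, where induction is available.\<close>

lemma Ck_enat: "Ck_on k S f \<longleftrightarrow> (\<forall>n. enat n \<le> k \<longrightarrow> Ck_on (enat n) S f)"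
proof (cases k)
  case (enat m) then show ?thesis unfolding Ck_on_def by (auto intro: order_trans less_le_trans)
next
  case infinity
  have "\<forall>n. Ck_on (enat n) S f \<Longrightarrow> Ck_on \<infinity> S f"
    unfolding Ck_on_def by (metis enat_ord_simps(2) lessI order_refl)
  moreover have "Ck_on \<infinity> S f \<Longrightarrow> Ck_on (enat n) S f" for n unfolding Ck_on_def by auto
  ultimately show ?thesis using infinity by auto
qed

lemma Ck_mono: "Ck_on k S f \<Longrightarrow> k' \<le> k \<Longrightarrow> T \<subseteq> S \<Longrightarrow> Ck_on k' T f"
  unfolding Ck_on_def by (meson continuous_on_subset less_le_trans order_trans subsetD)

lemma Ck_cong: "open S \<Longrightarrow> (\<And>y. y \<in> S \<Longrightarrow> f y = g y) \<Longrightarrow> Ck_on k S f \<Longrightarrow> Ck_on k S g"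
  by (subst (asm) Ck_enat, subst Ck_enat) (auto simp: Ck_grade intro: cont.R.G_cong[of S "\<lambda>_. f" "\<lambda>_. g"])

lemma Ck_local:
  assumes "\<And>x. x \<in> S \<Longrightarrow> \<exists>U. open U \<and> x \<in> U \<and> Ck_on k U f" "open S"
  shows "Ck_on k S f"
  using assms(1) by (auto simp: Ck_on_def continuous_on_eq_continuous_at[OF assms(2)])
    (metis continuous_on_eq_continuous_at)+

lemma Ck_const: "Ck_on k S (\<lambda>x. c)"
  unfolding Ck_on_def pd_const_list by auto

lemma Ck_add: "open S \<Longrightarrow> Ck_on k S f \<Longrightarrow> Ck_on k S g \<Longrightarrow> Ck_on k S (\<lambda>y. f y + g y)"
  by (subst (asm) Ck_enat, subst (asm) (2) Ck_enat, subst Ck_enat) (auto simp: Ck_grade intro: cont.R.G_add)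

lemma Ck_diff: "open S \<Longrightarrow> Ck_on k S f \<Longrightarrow> Ck_on k S g \<Longrightarrow> Ck_on k S (\<lambda>y. f y - g y)"
  by (subst (asm) Ck_enat, subst (asm) (2) Ck_enat, subst Ck_enat) (auto simp: Ck_grade intro: cont.G_diff)

lemma Ck_mult: "open S \<Longrightarrow> Ck_on k S f \<Longrightarrow> Ck_on k S g \<Longrightarrow> Ck_on k S (\<lambda>y. f y * g y)"
  by (subst (asm) Ck_enat, subst (asm) (2) Ck_enat, subst Ck_enat) (auto simp: Ck_grade intro: cont.G_mult)

lemma Ck_sum: "open S \<Longrightarrow> (\<And>j. j \<in> J \<Longrightarrow> Ck_on k S (f j)) \<Longrightarrow> Ck_on k S (\<lambda>y. \<Sum>j\<in>J. f j y)"
  by (induction J rule: infinite_finite_induct) (auto intro: Ck_const Ck_add)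

lemma Ck_prod: "open S \<Longrightarrow> (\<And>j. j \<in> J \<Longrightarrow> Ck_on k S (f j)) \<Longrightarrow> Ck_on k S (\<lambda>y. \<Prod>j\<in>J. f j y)"
  by (induction J rule: infinite_finite_induct) (auto intro: Ck_const Ck_mult)

lemma Ck_comp:
  fixes \<tau> :: "real^'n::finite \<Rightarrow> real^'n"
  assumes "open S" "open T" "Ck_on k T f" "\<And>x. x \<in> S \<Longrightarrow> \<tau> x \<in> T" "\<And>j. Ck_on k S (\<lambda>x. \<tau> x $ j)"
  shows "Ck_on k S (\<lambda>y. f (\<tau> y))"
proof -
  have "Ck_on (enat n) S (\<lambda>y. f (\<tau> y))" if "enat n \<le> k" for n
    using cont.G_comp[OF assms(1,2) _ assms(4), of n "\<lambda>_. f"] Ck_mono[OF assms(3) that order_refl]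
      Ck_mono[OF assms(5) that order_refl] assms(1,2) by (simp add: Ck_grade)
  then show ?thesis using Ck_enat by blast
qed

lemma Ck_SucI:
  assumes "open S" "\<And>x. x \<in> S \<Longrightarrow> f differentiable at x" "\<And>i. Ck_on (enat k) S (pd [i] f)"
  shows "Ck_on (enat (Suc k)) S f"
  using assms by (auto simp: Ck_grade differentiable_imp_continuous_within)

lemma Ck_SucD:
  assumes "open S" "Ck_on (enat (Suc k)) S f" shows "Ck_on (enat k) S (pd [i] f)"
  using assms by (auto simp: Ck_grade)

lemma Ck_pd: "Ck_on (k + enat (length \<alpha>)) S f \<Longrightarrow> Ck_on k S (pd \<alpha> f)"
  unfolding Ck_on_def pd_append[symmetric]
  by (cases k) auto

lemma Ck_pd_inf: "Ck_on \<infinity> S f \<Longrightarrow> Ck_on \<infinity> S (pd \<alpha> f)"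
  by (rule Ck_pd) simp

lemma Ck_inverse:
  assumes "open S" "Ck_on k S f" "\<And>x. x \<in> S \<Longrightarrow> f x \<noteq> 0"
  shows "Ck_on k S (\<lambda>x. 1 / f x)"
proof -
  have "Ck_on (enat n) S (\<lambda>x. 1 / f x)" if "Ck_on (enat n) S f" for n
    using that
  proof (induction n)
    case 0
    then show ?case using assms(1,3) by (auto simp: Ck_grade intro!: continuous_intros)
  next
    case (Suc n)
    \<comment> \<open>the derivative is a polynomial in the derivative of f and in 1 / f, which is already of class C^n\<close>
    have d: "(\<lambda>x. 1 / f x) differentiable at x" 
      and p: "pd [i] (\<lambda>x. 1 / f x) x = (-1) * (pd [i] f x * ((1 / f x) * (1 / f x)))" if "x \<in> S" for x i
    proof -
      have D: "(f has_derivative frechet_derivative f (at x)) (at x)"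
        using C_diff[OF Suc.prems that] frechet_derivative_works by blast
      note D' = has_derivative_divide'[OF has_derivative_const[of "1::real"] D assms(3)[OF that]]
      show "(\<lambda>x. 1 / f x) differentiable at x" using D' unfolding differentiable_def by blast
      show "pd [i] (\<lambda>x. 1 / f x) x = (-1) * (pd [i] f x * ((1 / f x) * (1 / f x)))"
        by (subst pd_one[OF D']) (simp add: divide_simps pd_frechet)
    qed
    have IH: "Ck_on (enat n) S (\<lambda>x. 1 / f x)"
      using Suc.IH Ck_mono[OF Suc.prems] by simp
    have H: "Ck_on (enat n) S (\<lambda>x. (-1) * (pd [i] f x * ((1 / f x) * (1 / f x))))" for i
      by (intro Ck_mult assms(1) IH Ck_SucD[OF assms(1) Suc.prems] Ck_const)
    have "Ck_on (enat n) S (pd [i] (\<lambda>x. 1 / f x))" for i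
      by (rule Ck_cong[OF assms(1) _ H[of i]]) (simp add: p)
    then show ?case using Ck_SucI[OF assms(1) d] by blast
  qed
  then show ?thesis using assms(2) Ck_enat by metis
qed

lemma Ck_coord: "Ck_on k S (\<lambda>x::real^'n::finite. x $ i)"
proof -
  have p: "pd [j] (\<lambda>x::real^'n. x $ i) = (\<lambda>x. axis j 1 $ i)" for j
    by (rule ext, rule pd_one, rule bounded_linear_imp_has_derivative, rule bounded_linear_vec_nth)
  have "Ck_on (enat n) UNIV (\<lambda>x::real^'n. x $ i)" for n
  proof (cases n)
    case 0 then show ?thesis by (auto simp: Ck_on_def zero_enat_def intro!: continuous_intros)
  next
    case (Suc m) 
    have "(\<lambda>x::real^'n. x $ i) differentiable at x" for x
      using bounded_linear_imp_has_derivative[OF bounded_linear_vec_nth] differentiable_def by blast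
    then show ?thesis using Suc Ck_SucI[of UNIV "\<lambda>x::real^'n. x $ i" m] p by (simp add: Ck_const)
  qed
  then show ?thesis using Ck_enat Ck_mono by (metis order_refl subset_UNIV)
qed

lemma pd_coord: "pd [j] (\<lambda>x::real^'n::finite. x $ i) x = (if i = j then 1 else 0)"
  by (subst pd_one[OF bounded_linear_imp_has_derivative[OF bounded_linear_vec_nth]]) (simp add: axis_def)

section \<open>Moderate, negligible and convergent nets of functions\<close>

text \<open>The condition holds for all small parameters, uniformly in a neighbourhood of \<open>x\<close>. On locally compact spaces this pointwise
notion is the same as uniformity on compact sets (\<open>ev_compact\<close>, \<open>ev_cball\<close>), and it is easier to combine.\<close>

definition ev :: "'b::metric_space \<Rightarrow> (real \<Rightarrow> 'b \<Rightarrow> bool) \<Rightarrow> bool" where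
  "ev x P \<longleftrightarrow> (\<exists>d>0. \<forall>e y. 0 < e \<longrightarrow> e < d \<longrightarrow> dist y x < d \<longrightarrow> P e y)"

lemma ev_filter: "ev x P \<longleftrightarrow> eventually (\<lambda>p. P (fst p) (snd p)) (at_right 0 \<times>\<^sub>F nhds x)"
proof
  assume "ev x P"
  then obtain d where d: "d > 0" "\<And>e y. 0 < e \<Longrightarrow> e < d \<Longrightarrow> dist y x < d \<Longrightarrow> P e y"
    unfolding ev_def by blast
  have "eventually (\<lambda>e. 0 < e \<and> e < d) (at_right (0::real))"
    using d(1) eventually_at_right_field by blast
  moreover have "eventually (\<lambda>y. dist y x < d) (nhds x)"
    using d(1) eventually_nhds_metric by blast
  ultimately show "eventually (\<lambda>p. P (fst p) (snd p)) (at_right 0 \<times>\<^sub>F nhds x)"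
    unfolding eventually_prod_filter using d(2)
    by (intro exI[of _ "\<lambda>e. 0 < e \<and> e < d"] exI[of _ "\<lambda>y. dist y x < d"] conjI) simp_all
next
  assume "eventually (\<lambda>p. P (fst p) (snd p)) (at_right 0 \<times>\<^sub>F nhds x)"
  then obtain A B where A: "eventually A (at_right (0::real))" and B: "eventually B (nhds x)"
    and P: "\<And>e y. A e \<Longrightarrow> B y \<Longrightarrow> P e y"
    unfolding eventually_prod_filter by auto
  obtain a where a: "a > 0" "\<And>e. 0 < e \<Longrightarrow> e < a \<Longrightarrow> A e" using A unfolding eventually_at_right_field by blast
  obtain b where b: "b > 0" "\<And>y. dist y x < b \<Longrightarrow> B y" using B unfolding eventually_nhds_metric by blast
  show "ev x P" unfolding ev_def using a b P by (intro exI[of _ "min a b"]) auto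
qed

lemma ev_mono: "ev x P \<Longrightarrow> (\<And>e y. P e y \<Longrightarrow> Q e y) \<Longrightarrow> ev x Q"
  unfolding ev_def by meson

lemma ev_conj: "ev x P \<Longrightarrow> ev x Q \<Longrightarrow> ev x (\<lambda>e y. P e y \<and> Q e y)"
  unfolding ev_filter by (rule eventually_conj)

lemma ev_small: "c > 0 \<Longrightarrow> ev x (\<lambda>e y. 0 < e \<and> e < c)"
  unfolding ev_def by blast

lemma ev_one: "ev x (\<lambda>e y. 0 < e \<and> e < 1)" by (rule ev_small) simp

lemma ev_half: "ev x (\<lambda>e y. 0 < e \<and> e < 1/2)" by (rule ev_small) simp

lemma ev_open: "open S \<Longrightarrow> x \<in> S \<Longrightarrow> ev x (\<lambda>e y. y \<in> S)"
  unfolding ev_def using open_dist by metis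

lemma isCont_near: "isCont \<phi> x \<Longrightarrow> r > 0 \<Longrightarrow> \<exists>d>0. \<forall>y. dist y x < d \<longrightarrow> dist (\<phi> y) (\<phi> x) < r"
  unfolding continuous_at_eps_delta by blast

lemma ev_comp: "ev (\<tau> x) P \<Longrightarrow> isCont \<tau> x \<Longrightarrow> ev x (\<lambda>e y. P e (\<tau> y))"
proof -
  assume "ev (\<tau> x) P" and c: "isCont \<tau> x"
  then obtain d where d: "d > 0" "\<And>e y. 0 < e \<Longrightarrow> e < d \<Longrightarrow> dist y (\<tau> x) < d \<Longrightarrow> P e y"
    unfolding ev_def by blast
  obtain r where "r > 0" "\<And>y. dist y x < r \<Longrightarrow> dist (\<tau> y) (\<tau> x) < d"
    using isCont_near[OF c d(1)] by blast
  then show ?thesis unfolding ev_def using d by (intro exI[of _ "min d r"]) auto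
qed

lemma ev_compact:
  assumes "compact K" "\<And>x. x \<in> K \<Longrightarrow> ev x P"
  shows "eventually (\<lambda>e. \<forall>y\<in>K. P e y) (at_right 0)"
proof -
  obtain d where d: "\<And>x. x \<in> K \<Longrightarrow> d x > 0 \<and> (\<forall>e y. 0 < e \<longrightarrow> e < d x \<longrightarrow> dist y x < d x \<longrightarrow> P e y)"
    using assms(2) unfolding ev_def by metis
  have "K \<subseteq> (\<Union>x\<in>K. ball x (d x))" using d by auto
  then obtain F where F: "F \<subseteq> K" "finite F" "K \<subseteq> (\<Union>x\<in>F. ball x (d x))"
    using compactE_image[OF assms(1), of K "\<lambda>x. ball x (d x)"] by auto
  have "eventually (\<lambda>e. 0 < e \<and> e < d x) (at_right (0::real))" if "x \<in> F" for x
    using d[of x] that F(1) eventually_at_right_field[of "\<lambda>e. 0 < e \<and> e < d x" 0] by blast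
  then have "eventually (\<lambda>e. \<forall>x\<in>F. 0 < e \<and> e < d x) (at_right (0::real))"
    using F(2) by (intro eventually_ball_finite ballI) auto
  then show ?thesis
  proof eventually_elim
    case (elim e)
    show ?case
    proof
      fix y assume "y \<in> K"
      then obtain x where "x \<in> F" "dist y x < d x" using F(3) by (auto simp: dist_commute)
      then show "P e y" using d F(1) elim by blast
    qed
  qed
qed

lemma ev_cball:
  assumes "r > 0" "eventually (\<lambda>e. \<forall>y\<in>cball x r. P e y) (at_right 0)"
  shows "ev x P"
proof -
  obtain a where "a > 0" "\<And>e. 0 < e \<Longrightarrow> e < a \<Longrightarrow> \<forall>y\<in>cball x r. P e y"
    using assms(2) unfolding eventually_at_right_field by blast
  then show ?thesis unfolding ev_def using assms(1) by (intro exI[of _ "min a r"]) (auto simp: dist_commute)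
qed

definition emod :: "real^'n::finite \<Rightarrow> (real \<Rightarrow> real^'n \<Rightarrow> real) \<Rightarrow> bool" where
  "emod x f \<longleftrightarrow> (\<exists>N::nat. ev x (\<lambda>e y. \<bar>f e y\<bar> \<le> 1 / e ^ N))"

definition eneg :: "real^'n::finite \<Rightarrow> (real \<Rightarrow> real^'n \<Rightarrow> real) \<Rightarrow> bool" where
  "eneg x f \<longleftrightarrow> (\<forall>m::nat. ev x (\<lambda>e y. \<bar>f e y\<bar> \<le> e ^ m))"

text \<open>The net carries its limit as the member at \<open>0\<close>, so that convergence is a property of one object and fits the scheme of \<open>net_module\<close>.
The condition says that \<open>(e, y) \<mapsto> f e y\<close> tends to \<open>f 0 x\<close> at \<open>(0, x)\<close>.\<close>

definition econv :: "real^'n::finite \<Rightarrow> (real \<Rightarrow> real^'n \<Rightarrow> real) \<Rightarrow> bool" where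
  "econv x f \<longleftrightarrow> isCont (f 0) x \<and>
     ((\<lambda>p. f (fst p) (snd p)) \<longlongrightarrow> f 0 x) (at_right 0 \<times>\<^sub>F nhds x)"

lemma econv_ev: "econv x f \<longleftrightarrow> isCont (f 0) x \<and> (\<forall>r>0. ev x (\<lambda>e y. \<bar>f e y - f 0 x\<bar> < r))"
  unfolding econv_def tendsto_iff ev_filter dist_real_def ..

lemma power_neg_le: "0 < e \<Longrightarrow> e < 1 \<Longrightarrow> N \<le> M \<Longrightarrow> 1 / e ^ N \<le> 1 / (e::real) ^ M"
  by (intro divide_left_mono) (auto intro: power_decreasing)

lemma emod_mono: "ev x (\<lambda>e y. \<bar>f e y\<bar> \<le> 1 / e ^ N) \<Longrightarrow> N \<le> M \<Longrightarrow> ev x (\<lambda>e y. \<bar>f e y\<bar> \<le> 1 / e ^ M)"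
  by (drule ev_conj[OF ev_one], erule ev_mono) (meson order_trans power_neg_le)

text \<open>A factor \<open>1/2\<close> is absorbed by one more power of the parameter; this replaces the constants of the \<open>O\<close>-notation.\<close>

lemma half_power: "0 < e \<Longrightarrow> e < 1/2 \<Longrightarrow> 2 * (1 / e ^ N) \<le> 1 / (e::real) ^ (Suc N)"
  by (simp add: field_simps)

lemma half_power': "0 < e \<Longrightarrow> e < 1/2 \<Longrightarrow> 2 * (e::real) ^ Suc m \<le> e ^ m"
  using mult_right_mono[of "2 * e" 1 "e ^ m"] by (simp add: mult.assoc)

lemma net_class_emod: "net_class {0<..1} emod"
proof
  fix S and x :: "real^'n" and f g :: "real \<Rightarrow> real^'n \<Rightarrow> real"
  assume *: "open S" "x \<in> S" "\<And>e y. e \<in> {0<..1} \<Longrightarrow> y \<in> S \<Longrightarrow> f e y = g e y" "emod x f"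
  then obtain N where "ev x (\<lambda>e y. \<bar>f e y\<bar> \<le> 1 / e ^ N)" unfolding emod_def by blast
  from ev_conj[OF this ev_conj[OF ev_open[OF *(1,2)] ev_one]]
  have "ev x (\<lambda>e y. \<bar>g e y\<bar> \<le> 1 / e ^ N)" by (rule ev_mono) (use *(3) in auto)
  then show "emod x g" unfolding emod_def by blast
next
  fix x :: "real^'n" and f g :: "real \<Rightarrow> real^'n \<Rightarrow> real"
  assume "emod x f" "emod x g"
  then obtain N M where 1: "ev x (\<lambda>e y. \<bar>f e y\<bar> \<le> 1 / e ^ N)" "ev x (\<lambda>e y. \<bar>g e y\<bar> \<le> 1 / e ^ M)"
    unfolding emod_def by blast
  have "ev x (\<lambda>e y. \<bar>f e y\<bar> \<le> 1 / e ^ max N M)" "ev x (\<lambda>e y. \<bar>g e y\<bar> \<le> 1 / e ^ max N M)"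
    using 1 emod_mono max.cobounded1 max.cobounded2 by blast+
  from ev_conj[OF this(1) ev_conj[OF this(2) ev_half]]
  have "ev x (\<lambda>e y. \<bar>f e y + g e y\<bar> \<le> 1 / e ^ Suc (max N M))"
  proof (rule ev_mono)
    fix e y assume "\<bar>f e y\<bar> \<le> 1 / e ^ max N M \<and> \<bar>g e y\<bar> \<le> 1 / e ^ max N M \<and> 0 < e \<and> e < 1 / 2"
    then show "\<bar>f e y + g e y\<bar> \<le> 1 / e ^ Suc (max N M)"
      using half_power[of e "max N M"] by linarith
  qed
  then show "emod x (\<lambda>e y. f e y + g e y)" unfolding emod_def by blast
next
  fix x :: "real^'n"
  show "emod x (\<lambda>e y. 0)" unfolding emod_def ev_def by (intro exI[of _ 0] exI[of _ 1]) auto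
qed

lemma net_class_eneg: "net_class {0<..1} eneg"
proof
  fix S and x :: "real^'n" and f g :: "real \<Rightarrow> real^'n \<Rightarrow> real"
  assume *: "open S" "x \<in> S" "\<And>e y. e \<in> {0<..1} \<Longrightarrow> y \<in> S \<Longrightarrow> f e y = g e y" "eneg x f"
  show "eneg x g" unfolding eneg_def
  proof
    fix m
    have "ev x (\<lambda>e y. \<bar>f e y\<bar> \<le> e ^ m)" using *(4) unfolding eneg_def by blast
    from ev_conj[OF this ev_conj[OF ev_open[OF *(1,2)] ev_one]]
    show "ev x (\<lambda>e y. \<bar>g e y\<bar> \<le> e ^ m)" by (rule ev_mono) (use *(3) in auto)
  qed
next
  fix x :: "real^'n" and f g :: "real \<Rightarrow> real^'n \<Rightarrow> real"
  assume *: "eneg x f" "eneg x g"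
  show "eneg x (\<lambda>e y. f e y + g e y)" unfolding eneg_def
  proof
    fix m
    have 1: "ev x (\<lambda>e y. \<bar>f e y\<bar> \<le> e ^ Suc m)" "ev x (\<lambda>e y. \<bar>g e y\<bar> \<le> e ^ Suc m)"
      using * unfolding eneg_def by blast+
    from ev_conj[OF this(1) ev_conj[OF this(2) ev_half]]
    show "ev x (\<lambda>e y. \<bar>f e y + g e y\<bar> \<le> e ^ m)"
    proof (rule ev_mono)
      fix e y assume "\<bar>f e y\<bar> \<le> e ^ Suc m \<and> \<bar>g e y\<bar> \<le> e ^ Suc m \<and> 0 < e \<and> e < 1 / 2"
      then show "\<bar>f e y + g e y\<bar> \<le> e ^ m" using half_power'[of e m] by linarith
    qed
  qed
next
  fix x :: "real^'n"
  show "eneg x (\<lambda>e y. 0)" unfolding eneg_def ev_def by (auto intro!: exI[of _ 1])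
qed

lemma isCont_bounded: "isCont (\<phi> :: 'b::metric_space \<Rightarrow> real) x \<Longrightarrow> ev x (\<lambda>e y. \<bar>\<phi> y\<bar> < \<bar>\<phi> x\<bar> + (1::real))"
proof -
  assume "isCont \<phi> x"
  then obtain d where "d > 0" "\<And>y. dist y x < d \<Longrightarrow> dist (\<phi> y) (\<phi> x) < 1"
    using isCont_near[of x \<phi> 1] by auto
  then show ?thesis unfolding ev_def dist_real_def by (intro exI[of _ d]) fastforce
qed

lemma emod_bounded: "isCont \<phi> x \<Longrightarrow> emod x (\<lambda>e. \<phi>)"
proof -
  assume "isCont \<phi> x"
  moreover have "ev x (\<lambda>e y. 0 < e \<and> e < 1 / (\<bar>\<phi> x\<bar> + 1))" by (rule ev_small) simp
  ultimately have "ev x (\<lambda>e y. \<bar>\<phi> y\<bar> < \<bar>\<phi> x\<bar> + 1 \<and> 0 < e \<and> e < 1 / (\<bar>\<phi> x\<bar> + 1))"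
    using ev_conj isCont_bounded by blast
  then
  have "ev x (\<lambda>e y. \<bar>\<phi> y\<bar> \<le> 1 / e ^ 1)"
  proof (rule ev_mono)
    fix e y assume "\<bar>\<phi> y\<bar> < \<bar>\<phi> x\<bar> + 1 \<and> 0 < e \<and> e < 1 / (\<bar>\<phi> x\<bar> + 1)"
    moreover then have "\<bar>\<phi> x\<bar> + 1 < 1 / e" by (simp add: field_simps)
    ultimately show "\<bar>\<phi> y\<bar> \<le> 1 / e ^ 1" by simp
  qed
  then show ?thesis unfolding emod_def by blast
qed

interpretation neg: net_module "{0<..1}" emod eneg
proof (intro net_module.intro net_class_emod net_class_eneg net_module_axioms.intro)
  fix x :: "real^'n" and f g :: "real \<Rightarrow> real^'n \<Rightarrow> real"
  assume "emod x f" and g: "eneg x g"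
  then obtain N where N: "ev x (\<lambda>e y. \<bar>f e y\<bar> \<le> 1 / e ^ N)" unfolding emod_def by blast
  show "eneg x (\<lambda>e y. f e y * g e y)" unfolding eneg_def
  proof
    fix m
    have "ev x (\<lambda>e y. \<bar>g e y\<bar> \<le> e ^ (N + m))" using g unfolding eneg_def by blast
    from ev_conj[OF N ev_conj[OF this ev_one]]
    show "ev x (\<lambda>e y. \<bar>f e y * g e y\<bar> \<le> e ^ m)"
    proof (rule ev_mono)
      fix e y assume a: "\<bar>f e y\<bar> \<le> 1 / e ^ N \<and> \<bar>g e y\<bar> \<le> e ^ (N + m) \<and> 0 < e \<and> e < 1"
      then have "\<bar>f e y\<bar> * \<bar>g e y\<bar> \<le> 1 / e ^ N * e ^ (N + m)" by (intro mult_mono) auto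
      then show "\<bar>f e y * g e y\<bar> \<le> e ^ m" using a by (simp add: abs_mult power_add)
    qed
  qed
next
  fix x :: "real^'n" and \<tau> :: "real^'n \<Rightarrow> real^'n" and f
  assume "eneg (\<tau> x) f" "isCont \<tau> x"
  then show "eneg x (\<lambda>e y. f e (\<tau> y))" unfolding eneg_def
    using ev_comp[of \<tau> x "\<lambda>e y. \<bar>f e y\<bar> \<le> e ^ _"] by auto
qed (rule emod_bounded)

interpretation mod: net_module "{0<..1}" emod emod
proof (intro net_module.intro net_class_emod net_module_axioms.intro)
  fix x :: "real^'n" and f g :: "real \<Rightarrow> real^'n \<Rightarrow> real"
  assume "emod x f" and g: "emod x g"
  then obtain N M where N: "ev x (\<lambda>e y. \<bar>f e y\<bar> \<le> 1 / e ^ N)" "ev x (\<lambda>e y. \<bar>g e y\<bar> \<le> 1 / e ^ M)"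
    unfolding emod_def by blast
  from ev_conj[OF N(1) ev_conj[OF N(2) ev_one]]
  have "ev x (\<lambda>e y. \<bar>f e y * g e y\<bar> \<le> 1 / e ^ (N + M))"
  proof (rule ev_mono)
    fix e y assume a: "\<bar>f e y\<bar> \<le> 1 / e ^ N \<and> \<bar>g e y\<bar> \<le> 1 / e ^ M \<and> 0 < e \<and> e < 1"
    then have "\<bar>f e y\<bar> * \<bar>g e y\<bar> \<le> 1 / e ^ N * (1 / e ^ M)" by (intro mult_mono) auto
    then show "\<bar>f e y * g e y\<bar> \<le> 1 / e ^ (N + M)" using a by (simp add: abs_mult power_add)
  qed
  then show "emod x (\<lambda>e y. f e y * g e y)" unfolding emod_def by blast
next
  fix x :: "real^'n" and \<tau> :: "real^'n \<Rightarrow> real^'n" and f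
  assume "emod (\<tau> x) f" "isCont \<tau> x"
  then show "emod x (\<lambda>e y. f e (\<tau> y))" unfolding emod_def
    using ev_comp[of \<tau> x "\<lambda>e y. \<bar>f e y\<bar> \<le> 1 / e ^ _"] by blast
qed (rule emod_bounded)

interpretation conv: net_module "{0..1}" econv econv
proof
  fix S and x :: "real^'n" and f g :: "real \<Rightarrow> real^'n \<Rightarrow> real"
  assume *: "open S" "x \<in> S" "\<And>e y. e \<in> {0..1} \<Longrightarrow> y \<in> S \<Longrightarrow> f e y = g e y" "econv x f"
  have "isCont (f 0) x \<longleftrightarrow> isCont (g 0) x"
    by (rule isCont_cong, rule eventually_mono[OF eventually_nhds_in_open[OF *(1,2)]]) (rule *(3); simp)
  moreover have "ev x (\<lambda>e y. \<bar>g e y - g 0 x\<bar> < r)" if "ev x (\<lambda>e y. \<bar>f e y - f 0 x\<bar> < r)" for r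
    using ev_conj[OF that ev_conj[OF ev_open[OF *(1,2)] ev_one]]
    by (rule ev_mono) (use *(2,3) in auto)
  ultimately show "econv x g" using *(4) unfolding econv_ev by blast
next
  fix x :: "real^'n" and f g :: "real \<Rightarrow> real^'n \<Rightarrow> real"
  assume "econv x f" "econv x g"
  then show "econv x (\<lambda>e y. f e y + g e y)" "econv x (\<lambda>e y. f e y * g e y)"
    unfolding econv_def by (auto intro: tendsto_add tendsto_mult continuous_intros)
next
  fix x :: "real^'n" and \<phi> :: "real^'n \<Rightarrow> real" assume c: "isCont \<phi> x"
  have "ev x (\<lambda>e y. \<bar>\<phi> y - \<phi> x\<bar> < r)" if "r > 0" for r
  proof -
    obtain d where "d > 0" "\<And>y. dist y x < d \<Longrightarrow> dist (\<phi> y) (\<phi> x) < r"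
      using isCont_near[OF c \<open>r > 0\<close>] by blast
    then show ?thesis unfolding ev_def dist_real_def by (intro exI[of _ d]) auto
  qed
  then show "econv x (\<lambda>e. \<phi>)" using c unfolding econv_ev by blast
next
  fix x :: "real^'n" and \<tau> :: "real^'n \<Rightarrow> real^'n" and f
  assume "econv (\<tau> x) f" "isCont \<tau> x"
  then show "econv x (\<lambda>e y. f e (\<tau> y))" unfolding econv_ev
    by (auto intro: ev_comp[of \<tau> x "\<lambda>e y. \<bar>f e y - f 0 (\<tau> x)\<bar> < _"] isCont_o2[of x \<tau> "f 0"])
qed (auto simp: econv_def)

definition Mod :: "(real^'n::finite) set \<Rightarrow> (real \<Rightarrow> real^'n \<Rightarrow> real) \<Rightarrow> bool" where
  "Mod S f \<longleftrightarrow> (\<forall>k. grade {0<..1} emod k S f)"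

definition Neg :: "(real^'n::finite) set \<Rightarrow> (real \<Rightarrow> real^'n \<Rightarrow> real) \<Rightarrow> bool" where
  "Neg S f \<longleftrightarrow> (\<forall>k. grade {0<..1} eneg k S f)"

text \<open>Convergence to \<open>f0\<close> in all derivatives of order at most \<open>k\<close>, locally uniformly. The value of \<open>f\<close> at the parameter \<open>0\<close> is overwritten.\<close>

definition Conv :: "enat \<Rightarrow> (real^'n::finite) set \<Rightarrow> (real \<Rightarrow> real^'n \<Rightarrow> real) \<Rightarrow> (real^'n \<Rightarrow> real) \<Rightarrow> bool" where
  "Conv k S f f0 \<longleftrightarrow> (\<forall>n. enat n \<le> k \<longrightarrow> grade {0..1} econv n S (f(0 := f0)))"

lemma eneg_emod: "eneg x f \<Longrightarrow> emod x f"
proof -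
  assume "eneg x f"
  then have "ev x (\<lambda>e y. \<bar>f e y\<bar> \<le> e ^ 0)" unfolding eneg_def by blast
  then have "ev x (\<lambda>e y. \<bar>f e y\<bar> \<le> 1 / e ^ 0)" by simp
  then show ?thesis unfolding emod_def by blast
qed

lemma Neg_Mod: "Neg S f \<Longrightarrow> Mod S f"
  unfolding Neg_def Mod_def grade_iff using eneg_emod by blast

lemma Mod_iff: "Mod S f \<longleftrightarrow> (\<forall>\<alpha>. \<forall>x\<in>S. emod x (\<lambda>e. pd \<alpha> (f e)) \<and> (\<forall>e\<in>{0<..1}. pd \<alpha> (f e) differentiable at x))"
  unfolding Mod_def grade_iff by (meson lessI less_imp_le)

lemma Neg_iff: "Neg S f \<longleftrightarrow> (\<forall>\<alpha>. \<forall>x\<in>S. eneg x (\<lambda>e. pd \<alpha> (f e)) \<and> (\<forall>e\<in>{0<..1}. pd \<alpha> (f e) differentiable at x))"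
  unfolding Neg_def grade_iff by (meson lessI less_imp_le)

lemma Ck_inf_iff: "open S \<Longrightarrow> Ck_on \<infinity> S f \<longleftrightarrow> (\<forall>\<alpha>. \<forall>x\<in>S. pd \<alpha> f differentiable at x)"
  unfolding Ck_on_def
  by (auto simp: continuous_on_eq_continuous_at intro: differentiable_imp_continuous_within)

lemma Mod_smooth: "open S \<Longrightarrow> Mod S f \<Longrightarrow> e \<in> {0<..1} \<Longrightarrow> Ck_on \<infinity> S (f e)"
  unfolding Mod_iff Ck_inf_iff by blast

lemma ModI:
  assumes "open S" "\<And>e. e \<in> {0<..1} \<Longrightarrow> Ck_on \<infinity> S (f e)" "\<And>\<alpha> x. x \<in> S \<Longrightarrow> emod x (\<lambda>e. pd \<alpha> (f e))"
  shows "Mod S f"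
  using assms Ck_inf_iff unfolding Mod_iff by blast

lemma Ck_nat: "Ck_on \<infinity> S f \<Longrightarrow> Ck_on (enat k) S f"
  by (rule Ck_mono) auto

lemma Mod_cong: "open S \<Longrightarrow> (\<And>e y. e \<in> {0<..1} \<Longrightarrow> y \<in> S \<Longrightarrow> f e y = g e y) \<Longrightarrow> Mod S f \<Longrightarrow> Mod S g"
  unfolding Mod_def using neg.R.G_cong[of S f g] by blast

lemma Mod_add: "open S \<Longrightarrow> Mod S f \<Longrightarrow> Mod S g \<Longrightarrow> Mod S (\<lambda>e y. f e y + g e y)"
  unfolding Mod_def by (blast intro: neg.R.G_add)

lemma Mod_diff: "open S \<Longrightarrow> Mod S f \<Longrightarrow> Mod S g \<Longrightarrow> Mod S (\<lambda>e y. f e y - g e y)"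
  unfolding Mod_def by (blast intro: mod.G_diff)

lemma Mod_mult: "open S \<Longrightarrow> Mod S f \<Longrightarrow> Mod S g \<Longrightarrow> Mod S (\<lambda>e y. f e y * g e y)"
  unfolding Mod_def by (blast intro: mod.G_mult)

lemma Mod_sum: "open S \<Longrightarrow> (\<And>j. j \<in> J \<Longrightarrow> Mod S (f j)) \<Longrightarrow> Mod S (\<lambda>e y. \<Sum>j\<in>J. f j e y)"
  unfolding Mod_def by (blast intro: neg.R.G_sum)

lemma Mod_const: "open S \<Longrightarrow> Ck_on \<infinity> S \<phi> \<Longrightarrow> Mod S (\<lambda>e. \<phi>)"
  unfolding Mod_def using mod.G_const Ck_nat by blast

lemma Mod_prod: "open S \<Longrightarrow> (\<And>j. j \<in> J \<Longrightarrow> Mod S (f j)) \<Longrightarrow> Mod S (\<lambda>e y. \<Prod>j\<in>J. f j e y)"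
  by (induction J rule: infinite_finite_induct) (auto intro: Mod_const Ck_const Mod_mult)

lemma Mod_pd: "Mod S f \<Longrightarrow> Mod S (\<lambda>e. pd \<alpha> (f e))"
  unfolding Mod_def using grade_pd by blast

lemma Mod_mono: "Mod S f \<Longrightarrow> T \<subseteq> S \<Longrightarrow> Mod T f"
  unfolding Mod_def using grade_mono by blast

lemma Neg_cong: "open S \<Longrightarrow> (\<And>e y. e \<in> {0<..1} \<Longrightarrow> y \<in> S \<Longrightarrow> f e y = g e y) \<Longrightarrow> Neg S f \<Longrightarrow> Neg S g"
  unfolding Neg_def using neg.M.G_cong[of S f g] by blast

lemma Neg_zero: "Neg S (\<lambda>e y. 0)"
  unfolding Neg_def by (blast intro: neg.M.G_zero)

lemma Neg_add: "open S \<Longrightarrow> Neg S f \<Longrightarrow> Neg S g \<Longrightarrow> Neg S (\<lambda>e y. f e y + g e y)"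
  unfolding Neg_def by (blast intro: neg.M.G_add)

lemma Neg_diff: "open S \<Longrightarrow> Neg S f \<Longrightarrow> Neg S g \<Longrightarrow> Neg S (\<lambda>e y. f e y - g e y)"
  unfolding Neg_def by (blast intro: neg.G_diff)

lemma Neg_mult: "open S \<Longrightarrow> Mod S f \<Longrightarrow> Neg S g \<Longrightarrow> Neg S (\<lambda>e y. f e y * g e y)"
  unfolding Mod_def Neg_def by (blast intro: neg.G_mult)

lemma Neg_sum: "open S \<Longrightarrow> (\<And>j. j \<in> J \<Longrightarrow> Neg S (f j)) \<Longrightarrow> Neg S (\<lambda>e y. \<Sum>j\<in>J. f j e y)"
  unfolding Neg_def by (blast intro: neg.M.G_sum)

lemma Neg_pd: "Neg S f \<Longrightarrow> Neg S (\<lambda>e. pd \<alpha> (f e))"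
  unfolding Neg_def using grade_pd by blast

lemma Neg_mono: "Neg S f \<Longrightarrow> T \<subseteq> S \<Longrightarrow> Neg T f"
  unfolding Neg_def using grade_mono by blast

lemma Neg_local: "(\<And>x. x \<in> S \<Longrightarrow> \<exists>U. x \<in> U \<and> Neg U f) \<Longrightarrow> Neg S f"
  unfolding Neg_def by (intro allI grade_local) blast

text \<open>The Landau--Kolmogorov argument. If \<open>f\<close> is bounded by a high power of \<open>e\<close> and its second derivative by \<open>1 / e ^ N\<close>, the mean value theorem
on a segment of length \<open>h = e ^ a\<close> gives a point where the first derivative is at most \<open>2 e ^ (a + m + 1) / h\<close>,
and moving from there to the end of the segment changes it by at most \<open>h / e ^ N\<close>. The exponent \<open>a = m + N + 1\<close> makes both errors of order \<open>e ^ (m + 1)\<close>.\<close>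

lemma eneg_pd:
  assumes S: "open S" and f: "Mod S f" and n: "\<And>x. x \<in> S \<Longrightarrow> eneg x f" and x: "x \<in> S"
  shows "eneg x (\<lambda>e. pd [i] (f e))"
  unfolding eneg_def
proof
  fix m :: nat
  obtain N where N: "ev x (\<lambda>e y. \<bar>pd [i, i] (f e) y\<bar> \<le> 1 / e ^ N)"
    using f x unfolding Mod_iff emod_def by blast
  define a where "a = m + N + 1"
  have "ev x (\<lambda>e y. \<bar>f e y\<bar> \<le> e ^ (a + m + 1))" using n[OF x] unfolding eneg_def by blast
  from ev_conj[OF N ev_conj[OF this ev_open[OF S x]]]
  obtain d where d: "d > 0" "\<And>e y. 0 < e \<Longrightarrow> e < d \<Longrightarrow> dist y x < d \<Longrightarrow>
     \<bar>pd [i, i] (f e) y\<bar> \<le> 1 / e ^ N \<and> \<bar>f e y\<bar> \<le> e ^ (a + m + 1) \<and> y \<in> S" unfolding ev_def by blast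
  show "ev x (\<lambda>e y. \<bar>pd [i] (f e) y\<bar> \<le> e ^ m)"
    unfolding ev_def
  proof (intro exI[of _ "min (d/2) (1/3)"] conjI allI impI)
    show "min (d/2) (1/3) > 0" using d(1) by simp
    fix e y assume e: "0 < e" "e < min (d/2) (1/3)" and y: "dist y x < min (d/2) (1/3)"
    define h where "h = e ^ a"
    have h: "0 < h" "h \<le> e" using e power_decreasing[of 1 a e] unfolding h_def a_def by auto
    have near: "dist (y + t *\<^sub>R axis i 1) x < d" if "0 \<le> t" "t \<le> h" for t
    proof -
      have "dist (y + t *\<^sub>R axis i 1) x \<le> dist (y + t *\<^sub>R axis i 1) y + dist y x" by (rule dist_triangle)
      also have "dist (y + t *\<^sub>R axis i 1) y = t" using that by (simp add: dist_norm norm_axis_1)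
      finally show ?thesis using that h e y by linarith
    qed
    have eI: "e \<in> {0<..1}" using e by auto
    have dv: "((\<lambda>t. F (y + t *\<^sub>R axis i 1)) has_real_derivative pd [i] F (y + t *\<^sub>R axis i 1)) (at t)"
      if "F differentiable at (y + t *\<^sub>R axis i 1)" for F t
    proof -
      have "((\<lambda>t. y + t *\<^sub>R axis i (1::real)) has_derivative (\<lambda>u. u *\<^sub>R axis i 1)) (at t)"
        by (auto intro!: derivative_eq_intros)
      from has_derivative_compose[OF this has_derivative_pd[OF that]] show ?thesis
        unfolding has_field_derivative_def
        by (rule has_derivative_eq_rhs) (auto simp: axis_def fun_eq_iff if_distrib[where f="\<lambda>x. _ * x * _"] mult.commute cong: if_cong)
    qed
    have D: "pd \<alpha> (f e) differentiable at (y + t *\<^sub>R axis i 1)" if "0 \<le> t" "t \<le> h" for t \<alpha>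
      using f eI d(2)[OF e(1) _ near[OF that]] e(2) unfolding Mod_iff by auto
    let ?g = "\<lambda>t. f e (y + t *\<^sub>R axis i 1)" and ?g' = "\<lambda>t. pd [i] (f e) (y + t *\<^sub>R axis i 1)"
      and ?g'' = "\<lambda>t. pd [i, i] (f e) (y + t *\<^sub>R axis i 1)"
    have g: "(?g has_real_derivative ?g' t) (at t)" if "0 \<le> t" "t \<le> h" for t
      using dv[of "f e"] D[OF that, of "[]"] by simp
    have g': "(?g' has_real_derivative ?g'' t) (at t)" if "0 \<le> t" "t \<le> h" for t
      using dv[of "pd [i] (f e)"] D[OF that, of "[i]"] by (simp add: pd_append[symmetric])
    obtain s where s: "0 < s" "s < h" "?g h - ?g 0 = (h - 0) * ?g' s"
      using MVT2[OF h(1), of ?g ?g'] g by auto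
    obtain u where u: "0 < u" "u < s" "?g' s - ?g' 0 = (s - 0) * ?g'' u"
      using MVT2[OF s(1), of ?g' ?g''] g' s(2) by auto
    have ed: "e < d" using e d(1) by auto
    have b2: "\<bar>?g'' u\<bar> \<le> 1 / e ^ N" using d(2)[OF e(1) ed near[of u]] u s by auto
    have b0: "\<bar>?g h\<bar> \<le> e ^ (a + m + 1)" "\<bar>?g 0\<bar> \<le> e ^ (a + m + 1)"
      using d(2)[OF e(1) ed near[of h]] d(2)[OF e(1) ed near[of 0]] h by auto
    have "h * \<bar>?g' s\<bar> \<le> 2 * e ^ (a + m + 1)" using s(3) b0 h(1) by (simp add: abs_mult[symmetric])
    then have 1: "\<bar>?g' s\<bar> \<le> 2 * e ^ (m + 1)" using h(1) unfolding h_def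
      by (simp add: power_add mult.assoc mult.left_commute[of 2])
    have "s * \<bar>?g'' u\<bar> \<le> h * (1 / e ^ N)" using s u b2 h by (intro mult_mono) auto
    also have "\<dots> = e ^ (m + 1)" unfolding h_def a_def using e by (simp add: power_add)
    finally have 2: "\<bar>?g' s - ?g' 0\<bar> \<le> e ^ (m + 1)" using u(3) s by (simp add: abs_mult)
    \<comment> \<open>the constant 3 is absorbed because e < 1/3\<close>
    have "\<bar>?g' 0\<bar> \<le> 3 * e ^ (m + 1)" using 1 2 by linarith
    also have "\<dots> \<le> e ^ m" using e mult_right_mono[of "3 * e" 1 "e ^ m"] by (simp add: mult.assoc)
    finally show "\<bar>pd [i] (f e) y\<bar> \<le> e ^ m" by simp
  qed
qed

text \<open>Negligible tensor fields are defined by bounds on the values only. For moderate nets this suffices for all derivatives.\<close>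

lemma NegI:
  assumes S: "open S" and f: "Mod S f" and n: "\<And>x. x \<in> S \<Longrightarrow> eneg x f"
  shows "Neg S f"
proof -
  have "\<forall>x\<in>S. eneg x (\<lambda>e. pd \<alpha> (f e))" for \<alpha>
  proof (induction \<alpha>)
    case Nil then show ?case using n by simp
  next
    case (Cons i \<alpha>)
    show ?case using eneg_pd[OF S Mod_pd[OF f, of \<alpha>]] Cons by (auto simp: pd_append[symmetric])
  qed
  then show ?thesis using f unfolding Neg_iff Mod_iff by blast
qed

section \<open>Convergent nets\<close>

lemma Conv_cong: 
  assumes "open S" "\<And>e y. e \<in> {0<..1} \<Longrightarrow> y \<in> S \<Longrightarrow> f e y = g e y" "\<And>y. y \<in> S \<Longrightarrow> f0 y = g0 y" "Conv k S f f0"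
  shows "Conv k S g g0"
proof -
  have "(f(0 := f0)) e y = (g(0 := g0)) e y" if "e \<in> {0..1}" "y \<in> S" for e y
    using assms(2)[OF _ that(2)] assms(3)[OF that(2)] that(1) by auto
  then have "grade {0..1} econv n S (g(0 := g0))" if "grade {0..1} econv n S (f(0 := f0))" for n
    using conv.R.G_cong[OF assms(1) _ that] by blast
  then show ?thesis using assms(4) unfolding Conv_def by blast
qed

lemma Conv_add: "open S \<Longrightarrow> Conv k S f f0 \<Longrightarrow> Conv k S g g0 \<Longrightarrow> Conv k S (\<lambda>e y. f e y + g e y) (\<lambda>y. f0 y + g0 y)"
proof -
  have *: "(\<lambda>e y. f e y + g e y)(0 := \<lambda>y. f0 y + g0 y) = (\<lambda>e y. (f(0 := f0)) e y + (g(0 := g0)) e y)" by auto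
  show "open S \<Longrightarrow> Conv k S f f0 \<Longrightarrow> Conv k S g g0 \<Longrightarrow> ?thesis" unfolding Conv_def * by (blast intro: conv.R.G_add)
qed

lemma Conv_mult: "open S \<Longrightarrow> Conv k S f f0 \<Longrightarrow> Conv k S g g0 \<Longrightarrow> Conv k S (\<lambda>e y. f e y * g e y) (\<lambda>y. f0 y * g0 y)"
proof -
  have *: "(\<lambda>e y. f e y * g e y)(0 := \<lambda>y. f0 y * g0 y) = (\<lambda>e y. (f(0 := f0)) e y * (g(0 := g0)) e y)" by auto
  show "open S \<Longrightarrow> Conv k S f f0 \<Longrightarrow> Conv k S g g0 \<Longrightarrow> ?thesis" unfolding Conv_def * by (blast intro: conv.G_mult)
qed

lemma Conv_const: "open S \<Longrightarrow> Ck_on k S \<phi> \<Longrightarrow> Conv k S (\<lambda>e. \<phi>) \<phi>"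
proof -
  have *: "(\<lambda>e. \<phi>)(0 := \<phi>) = (\<lambda>e. \<phi>)" by auto
  show "open S \<Longrightarrow> Ck_on k S \<phi> \<Longrightarrow> ?thesis" unfolding Conv_def * by (blast intro: conv.G_const Ck_mono)
qed

lemma Conv_diff: "open S \<Longrightarrow> Conv k S f f0 \<Longrightarrow> Conv k S g g0 \<Longrightarrow> Conv k S (\<lambda>e y. f e y - g e y) (\<lambda>y. f0 y - g0 y)"
  using Conv_add[of S k f f0 "\<lambda>e y. (-1) * g e y" "\<lambda>y. (-1) * g0 y"]
    Conv_mult[of S k "\<lambda>e y. -1" "\<lambda>y. -1" g g0] Conv_const[of S k "\<lambda>y. -1"] Ck_const[of k S "-1"] by simp

lemma Conv_sum:
  assumes "open S" "\<And>j. j \<in> J \<Longrightarrow> Conv k S (f j) (f0 j)"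
  shows "Conv k S (\<lambda>e y. \<Sum>j\<in>J. f j e y) (\<lambda>y. \<Sum>j\<in>J. f0 j y)"
  using assms(2)
  by (induction J rule: infinite_finite_induct) (auto intro: Conv_const Ck_const Conv_add assms(1))

lemma Conv_prod:
  assumes "open S" "\<And>j. j \<in> J \<Longrightarrow> Conv k S (f j) (f0 j)"
  shows "Conv k S (\<lambda>e y. \<Prod>j\<in>J. f j e y) (\<lambda>y. \<Prod>j\<in>J. f0 j y)"
  using assms(2)
  by (induction J rule: infinite_finite_induct) (auto intro: Conv_const Ck_const Conv_mult assms(1))

lemma Conv_mono: "Conv k S f f0 \<Longrightarrow> k' \<le> k \<Longrightarrow> T \<subseteq> S \<Longrightarrow> Conv k' T f f0"
  unfolding Conv_def by (meson grade_mono order_refl order_trans)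

lemma Conv_pd: "Conv (k + 1) S f f0 \<Longrightarrow> Conv k S (\<lambda>e. pd [i] (f e)) (pd [i] f0)"
proof -
  have *: "(\<lambda>e. pd [i] (f e))(0 := pd [i] f0) = (\<lambda>e. pd [i] ((f(0 := f0)) e))" by auto
  assume a: "Conv (k + 1) S f f0"
  have "grade {0..1} econv (n + length [i]) S (f(0 := f0))" if "enat n \<le> k" for n
  proof -
    have "enat (n + length [i]) \<le> k + 1" using add_right_mono[OF that, of 1] by (simp add: one_enat_def)
    then show ?thesis using a unfolding Conv_def by blast
  qed
  from grade_pd[OF this] show ?thesis unfolding Conv_def * by blast
qed

lemma Neg_Conv:
  assumes "open S" "Neg S f" shows "Conv k S f (\<lambda>y. 0)"
proof -
  have e: "econv x g" if "eneg x g" "g 0 = (\<lambda>y. 0)" for x :: "real^'n" and g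
  proof -
    have "ev x (\<lambda>e y. \<bar>g e y - g 0 x\<bar> < r)" if "r > 0" for r
    proof -
      have "ev x (\<lambda>e y. \<bar>g e y\<bar> \<le> e ^ 1)" using \<open>eneg x g\<close> unfolding eneg_def by blast
      from ev_conj[OF this ev_small[OF that]] show ?thesis by (rule ev_mono) (auto simp: \<open>g 0 = _\<close>)
    qed
    then show ?thesis unfolding econv_ev using that by auto
  qed
  define g where "g = f(0 := (\<lambda>y. 0))"
  have g0: "g 0 = (\<lambda>y. 0)" by (simp add: g_def)
  have N: "Neg S g" using assms by (rule_tac Neg_cong[of S f g]) (auto simp: g_def)
  have "grade {0..1} econv n S g" for n
    unfolding grade_iff
  proof (intro conjI allI impI ballI)
    fix \<alpha> x assume "x \<in> S"
    have "pd \<alpha> (g 0) = (\<lambda>y. 0)" unfolding g0 pd_const_list by auto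
    then show "econv x (\<lambda>e. pd \<alpha> (g e))" using N \<open>x \<in> S\<close> unfolding Neg_iff by (intro e) auto
    fix e :: real assume "e \<in> {0..1}"
    show "pd \<alpha> (g e) differentiable at x"
    proof (cases "e = 0")
      case True then show ?thesis using \<open>pd \<alpha> (g 0) = _\<close> by simp
    next
      case False then show ?thesis using N \<open>x \<in> S\<close> \<open>e \<in> _\<close> unfolding Neg_iff by auto
    qed
  qed
  then show ?thesis unfolding Conv_def g_def by blast
qed

text \<open>A generalized inverse \<open>h\<close> of \<open>d\<close> is an inverse only up to a negligible error \<open>E = h d - 1\<close>. At order zero \<open>h = (1 + E) / d\<close> near a point.
For the derivatives, differentiating \<open>h d = 1 + E\<close> and multiplying by \<open>h\<close> gives
\<open>\<partial>h = h (\<partial>E - h \<partial>d) - E \<partial>h\<close>. The last term contains \<open>\<partial>h\<close>, but it is negligible because \<open>h\<close> is moderate;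
everything else has converging derivatives by induction.\<close>

lemma Conv_inverse:
  assumes S: "open S" and d: "Conv k S d d0" and ds: "Mod S d" and h: "Mod S h"
    and n: "Neg S (\<lambda>e y. h e y * d e y - 1)" and d0: "\<And>x. x \<in> S \<Longrightarrow> d0 x \<noteq> 0" and dC: "Ck_on k S d0"
  shows "Conv k S h (\<lambda>x. 1 / d0 x)"
proof -
  define H where "H = h(0 := \<lambda>x. 1 / d0 x)"
  define D where "D = d(0 := d0)"
  define E where "E = (\<lambda>e y. h e y * d e y - 1)(0 := \<lambda>y. 0)"
  have E: "E e y = H e y * D e y - 1" if "y \<in> S" for e y using d0[OF that] by (simp add: E_def H_def D_def)
  have NE: "Neg S E" by (rule Neg_cong[OF S _ n]) (auto simp: E_def)
  have MH: "Mod S H" by (rule Mod_cong[OF S _ h]) (auto simp: H_def)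
  have EC: "grade {0..1} econv m S E" for m
    using Neg_Conv[OF S n, of \<infinity>] unfolding Conv_def E_def by simp
  have "grade {0..1} econv m S H" if "enat m \<le> k" for m
    using that
  proof (induction m)
    case 0
    have "econv x H" if "x \<in> S" for x
    proof -
      have Dx: "econv x D" using d 0 that unfolding Conv_def D_def by (metis grade.simps(1))
      have Ex: "econv x E" using EC[of 0] that by simp
      have cD: "isCont d0 x" using Dx unfolding econv_def D_def by simp
      then have c: "isCont (H 0) x" unfolding H_def using d0[OF that] by (auto intro!: continuous_intros)
      have l: "((\<lambda>p. (1 + E (fst p) (snd p)) / D (fst p) (snd p)) \<longlongrightarrow> (1 + 0) / d0 x) (at_right 0 \<times>\<^sub>F nhds x)"
        using Dx Ex d0[OF that] unfolding econv_def D_def E_def by (intro tendsto_divide tendsto_add) auto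
      have "eventually (\<lambda>p. D (fst p) (snd p) \<noteq> 0) (at_right 0 \<times>\<^sub>F nhds x)"
        using tendsto_imp_eventually_ne[of "\<lambda>p. D (fst p) (snd p)" "d0 x" _ 0] Dx d0[OF that] unfolding econv_def D_def by simp
      moreover have "eventually (\<lambda>p. snd p \<in> S) (at_right (0::real) \<times>\<^sub>F nhds x)"
        using ev_open[OF S that] unfolding ev_filter by simp
      ultimately have "eventually (\<lambda>p. (1 + E (fst p) (snd p)) / D (fst p) (snd p) = H (fst p) (snd p)) (at_right 0 \<times>\<^sub>F nhds x)"
        by eventually_elim (simp add: E)
      from tendsto_cong[THEN iffD1, OF this l] show ?thesis using c unfolding econv_def H_def by simp
    qed
    then show ?case by simp
  next
    case (Suc m)
    have m: "enat m \<le> k" using Suc.prems by (meson Suc_ile_eq less_imp_le)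
    note IH = Suc.IH[OF m]
    have Dm: "grade {0..1} econv (Suc m) S D" using d Suc.prems unfolding Conv_def D_def by blast
    have Hdiff: "H e differentiable at x" if "e \<in> {0..1}" "x \<in> S" for e x
    proof (cases "e = 0")
      case True
      have "Ck_on (enat (Suc m)) S (\<lambda>x. 1 / d0 x)"
        using Ck_inverse[OF S Ck_mono[OF dC Suc.prems order_refl] d0] by simp
      from C_diff[OF this that(2)] show ?thesis using True by (simp add: H_def)
    next
      case False
      then have "e \<in> {0<..1}" using that by auto
      then show ?thesis using MH that(2) unfolding Mod_iff by (metis pd.simps(1))
    qed
    have "grade {0..1} econv m S (\<lambda>e. pd [i] (H e))" for i
    proof (rule conv.R.G_cong[OF S])
      have NN: "Neg S (\<lambda>e y. pd [i] (H e) y * E e y)" by (rule Neg_mult[OF S Mod_pd[OF MH] NE])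
      have "grade {0..1} econv m S ((\<lambda>e y. pd [i] (H e) y * E e y)(0 := \<lambda>y. 0))"
        using Neg_Conv[OF S NN, of \<infinity>] unfolding Conv_def by simp
      \<comment> \<open>E times a derivative of H is negligible, so no convergence of that derivative is needed\<close>
      then have HE: "grade {0..1} econv m S (\<lambda>e y. pd [i] (H e) y * E e y)"
        by (rule conv.R.G_cong[OF S, rotated]) (simp add: E_def)
      show "grade {0..1} econv m S (\<lambda>e y. H e y * (pd [i] (E e) y - H e y * pd [i] (D e) y) - pd [i] (H e) y * E e y)"
        using EC[of "Suc m"] Dm by (intro conv.G_diff[OF S _ HE] conv.G_mult[OF S IH] conv.G_diff[OF S]) (simp_all add: IH)
      fix e :: real and y assume ey: "e \<in> {0..1}" "y \<in> S"
      have Dd: "D e differentiable at y" using Dm ey by simp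
      have "pd [i] (E e) y = pd [i] (\<lambda>y. H e y * D e y + (-1)) y"
        by (rule pd_cong_open[OF S ey(2)]) (simp add: E)
      also have "\<dots> = pd [i] (H e) y * D e y + H e y * pd [i] (D e) y"
        using Hdiff[OF ey] Dd by (subst pd_add) (auto simp: pd_mult)
      finally show "H e y * (pd [i] (E e) y - H e y * pd [i] (D e) y) - pd [i] (H e) y * E e y = pd [i] (H e) y"
        unfolding E[OF ey(2)] by (simp add: algebra_simps)
    qed
    then show ?case using IH grade_mono[OF IH, of 0 S] Hdiff by simp
  qed
  then show ?thesis unfolding Conv_def H_def by blast
qed

lemma Conv_uniform:
  assumes "Conv k S f f0" "compact K" "K \<subseteq> S" "enat (length \<alpha>) \<le> k"
  shows "uniform_limit K (\<lambda>e. pd \<alpha> (f e)) (pd \<alpha> f0) (at_right 0)"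
proof (rule uniform_limitI)
  fix r :: real assume r: "r > 0"
  have "ev x (\<lambda>e y. dist (pd \<alpha> (f e) y) (pd \<alpha> f0 y) < r)" if "x \<in> K" for x
  proof -
    let ?F = "\<lambda>e. pd \<alpha> ((f(0 := f0)) e)"
    have "econv x ?F" using assms(1,3,4) that unfolding Conv_def grade_iff by (meson order_refl subsetD)
    then have "ev x (\<lambda>e y. \<bar>?F e y - ?F 0 x\<bar> < r/2)" and c: "isCont (?F 0) x"
      unfolding econv_ev using r half_gt_zero by (blast, blast)
    moreover have "ev x (\<lambda>e y. \<bar>?F 0 y - ?F 0 x\<bar> < r/2)"
    proof -
      obtain d where "d > 0" "\<And>y. dist y x < d \<Longrightarrow> dist (?F 0 y) (?F 0 x) < r/2"
        using isCont_near[OF c half_gt_zero[OF r]] by blast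
      then show ?thesis unfolding ev_def dist_real_def by (intro exI[of _ d]) auto
    qed
    ultimately have "ev x (\<lambda>e y. (\<bar>?F e y - ?F 0 x\<bar> < r/2 \<and> \<bar>?F 0 y - ?F 0 x\<bar> < r/2) \<and> 0 < e \<and> e < 1)"
      by (intro ev_conj ev_one)
    then show ?thesis
    proof (rule ev_mono)
      fix e y assume "(\<bar>?F e y - ?F 0 x\<bar> < r/2 \<and> \<bar>?F 0 y - ?F 0 x\<bar> < r/2) \<and> 0 < e \<and> e < 1"
      then have "\<bar>pd \<alpha> (f e) y - pd \<alpha> f0 x\<bar> < r/2" "\<bar>pd \<alpha> f0 y - pd \<alpha> f0 x\<bar> < r/2" by auto
      then show "dist (pd \<alpha> (f e) y) (pd \<alpha> f0 y) < r" unfolding dist_real_def by linarith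
    qed
  qed
  from ev_compact[OF assms(2) this]
  show "\<forall>\<^sub>F e in at_right 0. \<forall>x\<in>K. dist (pd \<alpha> (f e) x) (pd \<alpha> f0 x) < r" .
qed

lemma ConvI:
  fixes f :: "real \<Rightarrow> real^'n::finite \<Rightarrow> real" and k :: enat
  assumes S: "open S" and f: "\<And>e. e \<in> {0<..1} \<Longrightarrow> Ck_on \<infinity> S (f e)" and f0: "Ck_on k S f0"
    and u: "\<And>(\<alpha>::'n list) K. enat (length \<alpha>) \<le> k \<Longrightarrow> compact K \<Longrightarrow> K \<subseteq> S \<Longrightarrow>
        uniform_limit K (\<lambda>e. pd \<alpha> (f e)) (pd \<alpha> f0) (at_right 0)"
  shows "Conv k S f f0"
  unfolding Conv_def grade_iff
proof (intro allI impI conjI ballI)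
  fix n and \<alpha> :: "'n list" and x assume n: "enat n \<le> k" and a: "length \<alpha> \<le> n" and x: "x \<in> S"
  have a': "enat (length \<alpha>) \<le> k" using n a by (meson enat_ord_simps(1) order_trans)
  have c: "isCont (pd \<alpha> f0) x" using f0 a' x S unfolding Ck_on_def by (metis continuous_on_eq_continuous_at)
  obtain Q where Q: "Q > 0" "cball x Q \<subseteq> S" using S x open_contains_cball by blast
  have "ev x (\<lambda>e y. \<bar>pd \<alpha> ((f(0 := f0)) e) y - pd \<alpha> f0 x\<bar> < r)" if r: "r > 0" for r
  proof -
    have "eventually (\<lambda>e. \<forall>y\<in>cball x Q. dist (pd \<alpha> (f e) y) (pd \<alpha> f0 y) < r/2) (at_right 0)"
      using u[OF a' compact_cball Q(2)] half_gt_zero[OF r] unfolding uniform_limit_iff by blast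
    from ev_cball[OF Q(1) this] have 1: "ev x (\<lambda>e y. dist (pd \<alpha> (f e) y) (pd \<alpha> f0 y) < r/2)" .
    obtain d where "d > 0" "\<And>y. dist y x < d \<Longrightarrow> dist (pd \<alpha> f0 y) (pd \<alpha> f0 x) < r/2"
      using isCont_near[OF c half_gt_zero[OF r]] by blast
    then have "ev x (\<lambda>e y. dist (pd \<alpha> f0 y) (pd \<alpha> f0 x) < r/2)" unfolding ev_def by (intro exI[of _ d]) auto
    from ev_conj[OF 1 ev_conj[OF this ev_one]] show ?thesis
    proof (rule ev_mono)
      fix e y assume A: "dist (pd \<alpha> (f e) y) (pd \<alpha> f0 y) < r/2 \<and> dist (pd \<alpha> f0 y) (pd \<alpha> f0 x) < r/2 \<and> 0 < e \<and> e < 1"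
      then have "\<bar>pd \<alpha> (f e) y - pd \<alpha> f0 x\<bar> < r" unfolding dist_real_def by linarith
      then show "\<bar>pd \<alpha> ((f(0 := f0)) e) y - pd \<alpha> f0 x\<bar> < r" using A by simp
    qed
  qed
  then show "econv x (\<lambda>e. pd \<alpha> ((f(0 := f0)) e))" unfolding econv_ev using c by simp
next
  fix n and \<alpha> :: "'n list" and x and e :: real assume n: "enat n \<le> k" and a: "length \<alpha> < n" and x: "x \<in> S" and Q: "e \<in> {0..1}"
  have a': "enat (length \<alpha>) < k" using n a by (meson enat_ord_simps(2) less_le_trans)
  show "pd \<alpha> ((f(0 := f0)) e) differentiable at x"
  proof (cases "e = 0")
    case True then show ?thesis using f0 a' x unfolding Ck_on_def by simp
  next
    case False then have "e \<in> {0<..1}" using Q by auto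
    from f[OF this] show ?thesis using False x S by (simp add: Ck_inf_iff)
  qed
qed

section \<open>Smooth bump functions\<close>

text \<open>\<open>flat 0\<close> is the standard smooth function \<open>exp (- 1 / t)\<close> that vanishes for \<open>t \<le> 0\<close>. The family is closed under derivatives up to
linear combinations (\<open>flat_deriv\<close>), so that smoothness is one induction over all members at once.\<close>

definition flat :: "nat \<Rightarrow> real \<Rightarrow> real" where
  "flat m t = (if t > 0 then (1 / t) ^ m * exp (- (1 / t)) else 0)"

lemma power_le_fact_exp: "0 \<le> u \<Longrightarrow> u ^ n \<le> fact n * exp (u::real)"
proof -
  assume u: "0 \<le> u"
  have "sum (\<lambda>k. u ^ k /\<^sub>R fact k) {n} \<le> (\<Sum>k. u ^ k /\<^sub>R fact k)"
    using exp_converges[of u] u by (intro sum_le_suminf) (auto simp: sums_iff)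
  then have "u ^ n / fact n \<le> exp u" using exp_converges[of u] by (simp add: sums_iff divide_inverse mult.commute)
  then show ?thesis by (simp add: field_simps)
qed

lemma flat_bound: "\<bar>flat m t\<bar> \<le> fact (m + 2) * t\<^sup>2"
proof (cases "t > 0")
  case True
  have "(1/t) ^ (m + 2) \<le> fact (m + 2) * exp (1/t)" using True by (intro power_le_fact_exp) simp
  then have "(1/t) ^ (m + 2) / exp (1/t) \<le> fact (m + 2)" by (subst pos_divide_le_eq) auto
  then have "(1/t) ^ m * exp (- (1/t)) * ((1/t)\<^sup>2) \<le> fact (m + 2)"
    by (simp only: power_add exp_minus divide_inverse mult_ac)
  then have "flat m t * (1/t)\<^sup>2 \<le> fact (m + 2)" using True by (simp add: flat_def)
  then show ?thesis using True by (simp add: field_simps flat_def)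
qed (simp add: flat_def)

lemma flat_deriv: "(flat m has_real_derivative (- real m * flat (m + 1) t + flat (m + 2) t)) (at t)"
proof -
  consider "t > 0" | "t < 0" | "t = 0" by linarith
  then show ?thesis
  proof cases
    case 1
    have "((\<lambda>t. (1 / t) ^ m * exp (- (1 / t))) has_real_derivative (- real m * flat (m + 1) t + flat (m + 2) t)) (at t)"
      using 1 by (auto intro!: derivative_eq_intros simp: flat_def power2_eq_square divide_simps power_Suc[symmetric] simp del: power_Suc)
        (cases m; auto simp: algebra_simps power_add)
    then show ?thesis
      by (rule has_field_derivative_transform_within_open[of _ _ _ "{0<..}"]) (use 1 in \<open>auto simp: flat_def\<close>)
  next
    case 2
    have "((\<lambda>t. 0) has_real_derivative (- real m * flat (m + 1) t + flat (m + 2) t)) (at t)"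
      using 2 by (simp add: flat_def)
    then show ?thesis
      by (rule has_field_derivative_transform_within_open[of _ _ _ "{..<0}"]) (use 2 in \<open>auto simp: flat_def\<close>)
  next
    case 3
    have "((\<lambda>h. flat m h / h) \<longlongrightarrow> 0) (at 0)"
    proof (rule tendsto_rabs_zero_cancel, rule tendsto_sandwich[of "\<lambda>_. 0" _ _ "\<lambda>h. fact (m + 2) * \<bar>h\<bar>"])
      show "\<forall>\<^sub>F h in at 0. \<bar>flat m h / h\<bar> \<le> fact (m + 2) * \<bar>h\<bar>"
        using flat_bound[of m] by (auto intro!: always_eventually simp: divide_simps power2_eq_square)
          (metis abs_mult_self_eq mult.assoc)
      show "((\<lambda>h. fact (m + 2) * \<bar>h\<bar>) \<longlongrightarrow> (0::real)) (at 0)"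
        by (intro tendsto_mult_right_zero tendsto_rabs_zero tendsto_ident_at)
    qed auto
    then show ?thesis using 3 by (simp add: DERIV_def flat_def)
  qed
qed

lemma flat_smooth:
  assumes "Ck_on \<infinity> UNIV s"
  shows "Ck_on \<infinity> UNIV (\<lambda>x. flat m (s x))"
proof -
  have "Ck_on (enat k) UNIV (\<lambda>x. flat m (s x))" for k
  proof (induction k arbitrary: m)
    case 0
    have "isCont s x" for x
      using assms unfolding Ck_on_def
      by (metis UNIV_I continuous_on_eq_continuous_at enat_ord_code(3) open_UNIV pd.simps(1))
    then have "isCont (\<lambda>x. flat m (s x)) x" for x using DERIV_isCont[OF flat_deriv] isCont_o2 by blast
    then show ?case by (auto simp: Ck_on_def zero_enat_def continuous_at_imp_continuous_on)
  next
    case (Suc k)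
    have sd: "s differentiable at x" for x using C_diff[OF Ck_nat[OF assms]] by blast
    have D: "((\<lambda>x. flat m (s x)) has_derivative
       (\<lambda>v. frechet_derivative s (at x) v * (- real m * flat (m + 1) (s x) + flat (m + 2) (s x)))) (at x)" for x
      using has_derivative_compose[OF sd[unfolded frechet_derivative_works] flat_deriv[unfolded has_field_derivative_def]]
      by (simp add: mult.commute)
    have p: "pd [i] (\<lambda>x. flat m (s x)) x = pd [i] s x * (- real m * flat (m + 1) (s x) + flat (m + 2) (s x))" for i x
      by (subst pd_one[OF D]) (simp add: pd_frechet)
    show ?case
    proof (rule Ck_SucI)
      show "(\<lambda>x. flat m (s x)) differentiable at x" for x using D unfolding differentiable_def by blast
      have "Ck_on (enat k) UNIV (\<lambda>x. pd [i] s x * ((- real m) * flat (m + 1) (s x) + flat (m + 2) (s x)))" for i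
        by (intro Ck_mult Ck_add Ck_const Suc open_UNIV Ck_nat Ck_pd_inf assms)
      then show "Ck_on (enat k) UNIV (pd [i] (\<lambda>x. flat m (s x)))" for i
        by (subst ext[OF p]) simp
    qed simp
  qed
  then show ?thesis using Ck_enat[of \<infinity>] by blast
qed

text \<open>The quotient \<open>u / (u + v)\<close>, where \<open>u\<close> vanishes outside the ball of radius \<open>R\<close>, \<open>v\<close> vanishes inside the ball of radius \<open>r\<close>, and they
have no common zero.\<close>

lemma bump_exists:
  fixes a :: "real^'n::finite"
  assumes "0 < r" "r < R"
  obtains \<phi> where "Ck_on \<infinity> UNIV \<phi>" "\<And>x. dist x a \<le> r \<Longrightarrow> \<phi> x = 1" "\<And>x. R \<le> dist x a \<Longrightarrow> \<phi> x = (0::real)"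
proof -
  define s where "s = (\<lambda>x::real^'n. \<Sum>j\<in>UNIV. (x $ j - a $ j) * (x $ j - a $ j))"
  have s: "s x = (dist x a)\<^sup>2" for x
    unfolding s_def dist_norm power2_norm_eq_inner inner_vec_def by simp
  have S: "Ck_on \<infinity> UNIV s" unfolding s_def
    by (intro Ck_sum Ck_mult Ck_diff Ck_coord Ck_const open_UNIV)
  define u where "u = (\<lambda>x. flat 0 (R\<^sup>2 - s x))"
  define v where "v = (\<lambda>x. flat 0 (s x - r\<^sup>2))"
  have uv: "Ck_on \<infinity> UNIV u" "Ck_on \<infinity> UNIV v" unfolding u_def v_def
    by (intro flat_smooth Ck_diff S Ck_const open_UNIV)+
  have pos: "flat 0 t > 0 \<longleftrightarrow> t > 0" "flat 0 t \<ge> 0" for t by (auto simp: flat_def)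
  have rR: "r\<^sup>2 < R\<^sup>2" using assms by (intro power_strict_mono) auto
  have nz: "u x + v x \<noteq> 0" for x
  proof -
    have "R\<^sup>2 - s x > 0 \<or> s x - r\<^sup>2 > 0" using rR by linarith
    then show ?thesis unfolding u_def v_def
      by (metis pos add_pos_nonneg add_nonneg_pos less_irrefl)
  qed
  show ?thesis
  proof
    show "Ck_on \<infinity> UNIV (\<lambda>x. u x * (1 / (u x + v x)))"
      by (intro Ck_mult Ck_inverse Ck_add uv open_UNIV nz)
    show "u x * (1 / (u x + v x)) = 1" if "dist x a \<le> r" for x
    proof -
      have "s x \<le> r\<^sup>2" using that unfolding s by (intro power_mono) auto
      then have "v x = 0" by (simp add: v_def flat_def)
      then show ?thesis using nz[of x] by simp
    qed
    show "u x * (1 / (u x + v x)) = 0" if "R \<le> dist x a" for x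
    proof -
      have "R\<^sup>2 \<le> s x" using that assms unfolding s by (intro power_mono) auto
      then have "u x = 0" by (simp add: u_def flat_def)
      then show ?thesis by simp
    qed
  qed
qed

section \<open>Charts and transition maps\<close>

lemma Ck_inf: "Ck_on \<infinity> S f \<Longrightarrow> Ck_on k S f"
  by (rule Ck_mono) auto

text \<open>What is used of a smooth structure: compatible charts that can be restricted to open sets. In contrast to the smooth structures on the whole type,
these are inherited by the charts of an open submanifold (\<open>restr_atlas\<close>).\<close>

locale atlas =
  fixes A :: "('a::t2_space, 'n::finite) chart set"
  assumes chart: "c \<in> A \<Longrightarrow> is_chart c"
    and compat: "c \<in> A \<Longrightarrow> c' \<in> A \<Longrightarrow> compatible c c'"
    and restr_mem: "c \<in> A \<Longrightarrow> open U \<Longrightarrow> (cdom c \<inter> U, cmap c) \<in> A"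

definition ov :: "('a, 'n::finite) chart \<Rightarrow> ('a, 'n) chart \<Rightarrow> (real^'n) set" where
  "ov c c' = cmap c ` (cdom c \<inter> cdom c')"

lemma is_chartD:
  assumes "is_chart c"
  shows "open (cdom c)" "open (cran c)" "p \<in> cdom c \<Longrightarrow> cinv c (cmap c p) = p"
    "x \<in> cran c \<Longrightarrow> cmap c (cinv c x) = x" "p \<in> cdom c \<Longrightarrow> cmap c p \<in> cran c"
    "x \<in> cran c \<Longrightarrow> cinv c x \<in> cdom c" "continuous_on (cdom c) (cmap c)" "continuous_on (cran c) (cinv c)"
proof -
  have h: "homeomorphism (cdom c) (cran c) (cmap c) (cinv c)" and o: "open (cdom c)" "open (cran c)"
    using assms unfolding is_chart_def by blast+
  note h' = h[unfolded homeomorphism_def]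
  show "open (cdom c)" "open (cran c)" using o by blast+
  show "p \<in> cdom c \<Longrightarrow> cinv c (cmap c p) = p" "x \<in> cran c \<Longrightarrow> cmap c (cinv c x) = x"
    "p \<in> cdom c \<Longrightarrow> cmap c p \<in> cran c" "x \<in> cran c \<Longrightarrow> cinv c x \<in> cdom c"
    "continuous_on (cdom c) (cmap c)" "continuous_on (cran c) (cinv c)"
    using h' by blast+
qed

lemma chart_image_open:
  assumes "is_chart c" "open U" shows "open (cmap c ` (cdom c \<inter> U))"
proof -
  have "cmap c ` (cdom c \<inter> U) = cinv c -` U \<inter> cran c"
  proof (intro equalityI subsetI)
    fix x assume "x \<in> cmap c ` (cdom c \<inter> U)"
    then obtain p where p: "p \<in> cdom c" "p \<in> U" "x = cmap c p" by blast
    then show "x \<in> cinv c -` U \<inter> cran c" using is_chartD(3,5)[OF assms(1) p(1)] by simp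
  next
    fix x assume "x \<in> cinv c -` U \<inter> cran c"
    then have x: "x \<in> cran c" "cinv c x \<in> U" by auto
    show "x \<in> cmap c ` (cdom c \<inter> U)"
      using is_chartD(4,6)[OF assms(1) x(1)] x(2) by (intro image_eqI[of _ _ "cinv c x"]) auto
  qed
  moreover have "open (cran c \<inter> cinv c -` U)"
    by (rule continuous_open_preimage[OF is_chartD(8,2)[OF assms(1)] assms(2)])
  ultimately show ?thesis by (simp add: Int_commute)
qed

lemma chart_inj: "is_chart c \<Longrightarrow> inj_on (cmap c) (cdom c)"
  by (metis inj_onI is_chartD(3))

lemma restr_cinv:
  assumes "is_chart c" "x \<in> cmap c ` (cdom c \<inter> U)"
  shows "cinv (cdom c \<inter> U, cmap c) x = cinv c x"
proof -
  obtain p where p: "p \<in> cdom c \<inter> U" "x = cmap c p" using assms(2) by blast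
  have "cinv (cdom c \<inter> U, cmap c) x = p"
    unfolding cinv_def p(2) by simp (meson chart_inj[OF assms(1)] inf_le1 inj_on_subset inv_into_f_f p(1))
  then show ?thesis using p is_chartD(3)[OF assms(1)] by simp
qed

lemma restr_is_chart:
  assumes "is_chart c" "open U" shows "is_chart (cdom c \<inter> U, cmap c)"
proof -
  let ?d = "(cdom c \<inter> U, cmap c)"
  have r: "cran ?d = cmap c ` (cdom c \<inter> U)" by (simp add: cran_def)
  note D = is_chartD[OF assms(1)]
  have sub: "cran ?d \<subseteq> cran c" unfolding r cran_def by auto
  have "continuous_on (cran ?d) (cinv ?d)"
    by (rule continuous_on_eq[OF continuous_on_subset[OF D(8) sub]]) (use restr_cinv[OF assms(1)] r in auto)
  moreover have "cinv ?d ` cran ?d = cdom ?d"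
  proof -
    have "cinv ?d (cmap c p) = p" if "p \<in> cdom c \<inter> U" for p
      using restr_cinv[OF assms(1), of "cmap c p" U] that D(3) by simp
    then show ?thesis unfolding r by (force simp: image_iff)
  qed
  moreover have "cinv ?d (cmap ?d p) = p" if "p \<in> cdom ?d" for p
    using restr_cinv[OF assms(1), of "cmap c p" U] that D(3) by simp
  moreover have "cmap ?d (cinv ?d x) = x" if "x \<in> cran ?d" for x
    using restr_cinv[OF assms(1), of x U] that D(4) sub unfolding r by auto
  moreover have "continuous_on (cdom ?d) (cmap ?d)" using continuous_on_subset[OF D(7)] by simp
  moreover have "open (cran ?d)" unfolding r by (rule chart_image_open[OF assms])
  ultimately show ?thesis
    unfolding is_chart_def homeomorphism_def using open_Int[OF D(1) assms(2)] by (simp add: r)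
qed

lemma restr_transition:
  assumes "is_chart c" "is_chart c'" "compatible c c'" "open U"
  shows "compatible (cdom c \<inter> U, cmap c) c'"
  unfolding compatible_def transition_smooth_def
proof (intro conjI allI)
  fix k
  let ?d = "(cdom c \<inter> U, cmap c)" and ?S = "cmap c ` (cdom c \<inter> (U \<inter> cdom c'))"
  have S: "open ?S" by (rule chart_image_open[OF assms(1) open_Int[OF assms(4) is_chartD(1)[OF assms(2)]]])
  have e: "cmap ?d ` (cdom ?d \<inter> cdom c') = ?S" by (simp add: Int_assoc)
  have "Ck_on \<infinity> ?S (\<lambda>x. cmap c' (cinv c x) $ k)"
    by (rule Ck_mono[of _ "cmap c ` (cdom c \<inter> cdom c')"])
      (use assms(3) in \<open>auto simp: compatible_def transition_smooth_def\<close>)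
  then have "Ck_on \<infinity> ?S (\<lambda>x. cmap c' (cinv ?d x) $ k)"
  proof (rule Ck_cong[OF S, rotated])
    fix y assume "y \<in> ?S"
    then have "y \<in> cmap c ` (cdom c \<inter> U)" by auto
    from restr_cinv[OF assms(1) this] show "cmap c' (cinv c y) $ k = cmap c' (cinv ?d y) $ k" by simp
  qed
  then show "Ck_on \<infinity> (cmap ?d ` (cdom ?d \<inter> cdom c')) (\<lambda>x. cmap c' (cinv ?d x) $ k)" unfolding e .
  show "Ck_on \<infinity> (cmap c' ` (cdom c' \<inter> cdom ?d)) (\<lambda>x. cmap ?d (cinv c' x) $ k)"
    by (rule Ck_mono[of _ "cmap c' ` (cdom c' \<inter> cdom c)"])
      (use assms(3) in \<open>auto simp: compatible_def transition_smooth_def\<close>)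
qed

lemma smooth_manifold_atlas: 
  assumes "smooth_manifold A" shows "atlas A"
proof
  have S: "smooth_structure A" using assms unfolding smooth_manifold_def by blast
  show ch: "is_chart c" if "c \<in> A" for c using S that unfolding smooth_structure_def by blast
  show co: "compatible c c'" if "c \<in> A" "c' \<in> A" for c c' using S that unfolding smooth_structure_def by blast
  show "(cdom c \<inter> U, cmap c) \<in> A" if "c \<in> A" "open U" for c U
    using S restr_is_chart[OF ch that(2)] restr_transition[OF ch ch co that(2)] that(1)
    unfolding smooth_structure_def by blast
qed

lemma (in atlas) restr_atlas: "open V \<Longrightarrow> atlas (restr A V)"
  by standard (auto simp: restr_def chart compat restr_mem)

context atlas
begin

lemmas ch = is_chartD[OF chart]

lemma ov_open: "c \<in> A \<Longrightarrow> c' \<in> A \<Longrightarrow> open (ov c c')"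
  unfolding ov_def using chart_image_open[OF chart ch(1)] .

lemma ovD: "c \<in> A \<Longrightarrow> x \<in> ov c c' \<Longrightarrow> x \<in> cran c \<and> cinv c x \<in> cdom c \<and> cinv c x \<in> cdom c' \<and> cmap c (cinv c x) = x"
  using ch(3)[of c] by (auto simp: ov_def cran_def)

lemma ovI: "p \<in> cdom c \<Longrightarrow> p \<in> cdom c' \<Longrightarrow> cmap c p \<in> ov c c'"
  unfolding ov_def by blast

lemma ovI': "c \<in> A \<Longrightarrow> x \<in> cran c \<Longrightarrow> cinv c x \<in> cdom c' \<Longrightarrow> x \<in> ov c c'"
  using ovI[of "cinv c x" c c'] ch(4,6) by metis

lemma ov_sub: "ov c c' \<subseteq> cran c" by (auto simp: ov_def cran_def)

lemma trans_in: "c \<in> A \<Longrightarrow> x \<in> ov c c' \<Longrightarrow> cmap c' (cinv c x) \<in> ov c' c"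
  using ovD[of c x c'] by (auto intro: ovI)

lemma trans_inv: "c \<in> A \<Longrightarrow> c' \<in> A \<Longrightarrow> x \<in> ov c c' \<Longrightarrow> cinv c' (cmap c' (cinv c x)) = cinv c x"
  using ovD ch(3) by blast

lemma trans_smooth: "c \<in> A \<Longrightarrow> c' \<in> A \<Longrightarrow> Ck_on \<infinity> (ov c c') (\<lambda>x. cmap c' (cinv c x) $ k)"
  using compat unfolding ov_def compatible_def transition_smooth_def by blast

lemma fun_change:
  assumes "c \<in> A" "c' \<in> A" "Ck_on k (ov c c') (\<lambda>x. F (cinv c x))"
  shows "Ck_on k (ov c' c) (\<lambda>x. F (cinv c' x))"
proof -
  have "Ck_on k (ov c' c) (\<lambda>x. F (cinv c (cmap c (cinv c' x))))"
    by (rule Ck_comp[OF ov_open ov_open assms(3)])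
      (use trans_in[OF assms(2)] Ck_inf[OF trans_smooth[OF assms(2,1)]] assms in auto)
  then show ?thesis
    by (rule Ck_cong[OF ov_open[OF assms(2,1)], rotated]) (use trans_inv[OF assms(2,1)] in auto)
qed

lemma trans_diff: "c \<in> A \<Longrightarrow> c' \<in> A \<Longrightarrow> x \<in> ov c c' \<Longrightarrow> (\<lambda>x. cmap c' (cinv c x) $ k) differentiable at x"
  using trans_smooth Ck_inf_iff[OF ov_open] by (metis pd.simps(1))

lemma jac_nth: "jac c c' p $ k $ i = pd [i] (\<lambda>x. cmap c' (cinv c x) $ k) (cmap c p)"
  by (simp add: jac_def)

lemma jac_chain:
  assumes "c \<in> A" "c' \<in> A" "c'' \<in> A" "p \<in> cdom c" "p \<in> cdom c'" "p \<in> cdom c''"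
  shows "jac c c'' p = jac c' c'' p ** jac c c' p"
proof -
  let ?S = "cmap c ` (cdom c \<inter> (cdom c' \<inter> cdom c''))"
  have S: "open ?S" by (rule chart_image_open[OF chart[OF assms(1)] open_Int[OF ch(1)[OF assms(2)] ch(1)[OF assms(3)]]])
  have x: "cmap c p \<in> ?S" using assms by auto
  have "jac c c'' p $ k $ i = (jac c' c'' p ** jac c c' p) $ k $ i" for k i
  proof -
    have "jac c c'' p $ k $ i = pd [i] (\<lambda>x. cmap c'' (cinv c' (cmap c' (cinv c x))) $ k) (cmap c p)"
      unfolding jac_nth by (rule pd_cong_open[OF S x]) (use ch(3)[OF assms(1)] ch(3)[OF assms(2)] in auto)
    also have "\<dots> = (\<Sum>j\<in>UNIV. pd [i] (\<lambda>y. cmap c' (cinv c y) $ j) (cmap c p) *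
        pd [j] (\<lambda>x. cmap c'' (cinv c' x) $ k) (cmap c' (cinv c (cmap c p))))"
      using trans_diff[OF assms(2,3)] trans_diff[OF assms(1,2) ovI[OF assms(4,5)]] assms ch(3)[OF assms(1)]
      by (intro pd_comp(1)[where f="\<lambda>x. cmap c'' (cinv c' x) $ k" and \<tau>="\<lambda>x. cmap c' (cinv c x)"])
        (auto intro: ovI)
    also have "\<dots> = (jac c' c'' p ** jac c c' p) $ k $ i"
      using ch(3)[OF assms(1,4)] by (simp add: matrix_matrix_mult_def jac_nth mult.commute)
    finally show ?thesis .
  qed
  then show ?thesis by (simp add: vec_eq_iff)
qed

text \<open>Shrinking the domain of a chart does not change components.\<close>

lemma jac_same_map:
  assumes "c \<in> A" "d \<in> A" "cmap d = cmap c" "p \<in> cdom c" "p \<in> cdom d"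
  shows "jac c d p = mat 1"
proof -
  have "jac c d p $ k $ i = mat 1 $ k $ i" for k i
  proof -
    have "jac c d p $ k $ i = pd [i] (\<lambda>x. x $ k) (cmap c p)"
      unfolding jac_nth by (rule pd_cong_open[OF ov_open[OF assms(1,2)] ovI]) (use assms ovD in auto)
    then show ?thesis by (auto simp: pd_coord mat_def)
  qed
  then show ?thesis by (simp add: vec_eq_iff)
qed

lemma jac_id: "c \<in> A \<Longrightarrow> p \<in> cdom c \<Longrightarrow> jac c c p = mat 1"
  by (rule jac_same_map) auto

lemma jac_inv: "c \<in> A \<Longrightarrow> c' \<in> A \<Longrightarrow> p \<in> cdom c \<Longrightarrow> p \<in> cdom c' \<Longrightarrow> jac c' c p ** jac c c' p = mat 1"
  using jac_chain[of c c' c p] jac_id by metis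

lemma jac_smooth:
  assumes "c \<in> A" "c' \<in> A"
  shows "Ck_on \<infinity> (ov c c') (\<lambda>x. jac c c' (cinv c x) $ k $ i)"
    and "Ck_on \<infinity> (ov c c') (\<lambda>x. jac c' c (cinv c x) $ k $ i)"
proof -
  have J: "Ck_on \<infinity> (ov c c') (\<lambda>x. jac c c' (cinv c x) $ k $ i)" if "c \<in> A" "c' \<in> A" for c c'
    by (rule Ck_cong[OF ov_open[OF that] _ Ck_pd_inf[OF trans_smooth[OF that]]])
      (use ovD[OF that(1)] in \<open>auto simp: jac_nth\<close>)
  show "Ck_on \<infinity> (ov c c') (\<lambda>x. jac c' c (cinv c x) $ k $ i)"
    by (rule fun_change[OF assms(2,1) J[OF assms(2,1)]])
  show "Ck_on \<infinity> (ov c c') (\<lambda>x. jac c c' (cinv c x) $ k $ i)" by (rule J[OF assms])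
qed

end

section \<open>The transformation law\<close>

lemma finite_idx [simp]: "finite (idx r :: 'n::finite list set)"
  unfolding idx_def using finite_lists_length_eq[OF finite, of UNIV r] by simp

lemma idx_0 [simp]: "idx 0 = {[]}" by (auto simp: idx_def)

lemma idx_Suc: "idx (Suc r) = (\<lambda>(k, I). k # I) ` (UNIV \<times> idx r)"
  by (force simp: idx_def length_Suc_conv)

lemma sum_idx_Suc: "(\<Sum>I\<in>idx (Suc r). f I) = (\<Sum>k\<in>UNIV. \<Sum>I\<in>idx r. f (k # I))"
  unfolding idx_Suc by (subst sum.reindex) (auto simp: inj_on_def sum.cartesian_product case_prod_beta)

lemma idx_1: "idx (Suc 0) = range (\<lambda>k. [k])"
  unfolding idx_Suc by auto

lemma sum_idx_1: "(\<Sum>I\<in>idx (Suc 0). f I) = (\<Sum>k\<in>UNIV. f [k])"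
  by (simp add: sum_idx_Suc)

lemma prod_sum_idx:
  fixes f :: "nat \<Rightarrow> 'n::finite \<Rightarrow> real"
  shows "(\<Sum>I\<in>idx r. \<Prod>a<r. f a (I ! a)) = (\<Prod>a<r. \<Sum>k\<in>UNIV. f a k)"
proof (induction r arbitrary: f)
  case 0 then show ?case by simp
next
  case (Suc r)
  have "(\<Sum>I\<in>idx (Suc r). \<Prod>a<Suc r. f a (I ! a)) =
    (\<Sum>k\<in>UNIV. f 0 k * (\<Sum>I\<in>idx r. \<Prod>a<r. f (Suc a) (I ! a)))"
    unfolding sum_idx_Suc by (simp only: prod.lessThan_Suc_shift nth_Cons_0 nth_Cons_Suc sum_distrib_left)
  also have "\<dots> = (\<Prod>a<Suc r. \<Sum>k\<in>UNIV. f a k)"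
    unfolding Suc.IH[of "\<lambda>a. f (Suc a)"] prod.lessThan_Suc_shift sum_distrib_right[symmetric] by simp
  finally show ?case .
qed

text \<open>The transformation of components: \<open>M\<close> acts on the upper and \<open>N\<close> on the lower indices. With \<open>M\<close> and \<open>N\<close> as the two Jacobians this is
the law in the definition of tensor fields; as an operation of matrices it composes (\<open>trf_comp\<close>).\<close>

definition trf :: "nat \<Rightarrow> nat \<Rightarrow> real^'n::finite^'n \<Rightarrow> real^'n^'n \<Rightarrow> ('n list \<Rightarrow> 'n list \<Rightarrow> real) \<Rightarrow> 'n list \<Rightarrow> 'n list \<Rightarrow> real" where
  "trf r s M N F I J = (\<Sum>I'\<in>idx r. \<Sum>J'\<in>idx s.
     (\<Prod>a<r. M $ (I ! a) $ (I' ! a)) * (\<Prod>b<s. N $ (J' ! b) $ (J ! b)) * F I' J')"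

lemma prod_matrix_mult:
  fixes M N :: "real^'n::finite^'n"
  shows "(\<Prod>a<r. (M ** N) $ (I ! a) $ (J ! a)) =
    (\<Sum>K\<in>idx r. (\<Prod>a<r. M $ (I ! a) $ (K ! a)) * (\<Prod>a<r. N $ (K ! a) $ (J ! a)))"
  unfolding prod.distrib[symmetric] prod_sum_idx[of "\<lambda>a k. M $ (I ! a) $ k * N $ k $ (J ! a)"]
  by (simp add: matrix_matrix_mult_def)

lemma sum_swap4:
  "(\<Sum>a\<in>A. \<Sum>b\<in>B. \<Sum>c\<in>C. \<Sum>d\<in>D. f a b c d) = (\<Sum>c\<in>C. \<Sum>d\<in>D. \<Sum>a\<in>A. \<Sum>b\<in>B. f a b c d)"
proof -
  have *: "(\<Sum>a\<in>A. \<Sum>b\<in>B. \<Sum>c\<in>C. g a b c) = (\<Sum>c\<in>C. \<Sum>a\<in>A. \<Sum>b\<in>B. g a b c)" for C and g :: "_ \<Rightarrow> _ \<Rightarrow> _ \<Rightarrow> _"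
    by (rule trans[OF sum.cong[OF refl sum.swap] sum.swap])
  show ?thesis unfolding *[of _ C] by (intro sum.cong refl *)
qed

lemma trf_comp:
  fixes M M' N N' :: "real^'n::finite^'n"
  shows "trf r s M' N' (trf r s M N F) I J = trf r s (M' ** M) (N ** N') F I J"
proof -
  let ?PM = "\<lambda>M I I'. \<Prod>a<r. M $ (I ! a) $ (I' ! a)" and ?PN = "\<lambda>N J' J. \<Prod>b<s. N $ (J' ! b) $ (J ! b)"
  have "trf r s M' N' (trf r s M N F) I J =
     (\<Sum>I'\<in>idx r. \<Sum>J'\<in>idx s. \<Sum>K\<in>idx r. \<Sum>L\<in>idx s. ?PM M' I I' * ?PN N' J' J * (?PM M I' K * ?PN N L J' * F K L))"
    unfolding trf_def sum_distrib_left ..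
  also have "\<dots> = (\<Sum>K\<in>idx r. \<Sum>L\<in>idx s. \<Sum>I'\<in>idx r. \<Sum>J'\<in>idx s. ?PM M' I I' * ?PN N' J' J * (?PM M I' K * ?PN N L J' * F K L))"
    by (rule sum_swap4)
  also have "\<dots> = (\<Sum>K\<in>idx r. \<Sum>L\<in>idx s. (\<Sum>I'\<in>idx r. ?PM M' I I' * ?PM M I' K) * (\<Sum>J'\<in>idx s. ?PN N L J' * ?PN N' J' J) * F K L)"
    unfolding sum_product sum_distrib_right by (intro sum.cong refl) (simp add: sum_distrib_left mult_ac)
  also have "\<dots> = trf r s (M' ** M) (N ** N') F I J"
    unfolding trf_def prod_matrix_mult ..
  finally show ?thesis .
qed

lemma prod_mat_1:
  assumes "I \<in> idx r" "I' \<in> idx r"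
  shows "(\<Prod>a<r. (mat 1 :: real^'n::finite^'n) $ (I ! a) $ (I' ! a)) = (if I = I' then 1 else 0)"
proof (cases "I = I'")
  case True then show ?thesis by (simp add: mat_def)
next
  case False
  then obtain a where "a < r" "I ! a \<noteq> I' ! a" using assms by (auto simp: idx_def list_eq_iff_nth_eq)
  then have "\<exists>a\<in>{..<r}. (mat 1 :: real^'n^'n) $ (I ! a) $ (I' ! a) = 0" by (auto simp: mat_def)
  then show ?thesis using False by (simp add: prod_zero)
qed

lemma trf_id:
  assumes "I \<in> idx r" "J \<in> idx s"
  shows "trf r s (mat 1) (mat 1) F I J = F I J"
proof -
  have "trf r s (mat 1) (mat 1) F I J = (\<Sum>I'\<in>idx r. \<Sum>J'\<in>idx s. if I = I' then (if J' = J then F I' J' else 0) else 0)"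
    unfolding trf_def by (intro sum.cong refl) (auto simp: prod_mat_1 assms)
  also have "\<dots> = F I J" using assms by (simp add: if_distrib[of "sum _"] sum.If_cases cong: if_cong)
  finally show ?thesis .
qed

lemma trf_cong: "(\<And>I' J'. I' \<in> idx r \<Longrightarrow> J' \<in> idx s \<Longrightarrow> F I' J' = F' I' J') \<Longrightarrow> trf r s M N F I J = trf r s M N F' I J"
  unfolding trf_def by (intro sum.cong refl) auto

lemma trf_zero: "trf r s M N (\<lambda>I J. 0) I J = 0" by (simp add: trf_def)

lemma trf_vec: "trf (Suc 0) 0 M N F [k] [] = (\<Sum>i\<in>UNIV. M $ k $ i * F [i] [])"
  by (simp add: trf_def sum_idx_1)

lemma trf_fun: "trf 0 0 M N F [] [] = F [] []"
  by (simp add: trf_def)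

lemma tensor_law:
  assumes "t \<in> Ck_tensor k A r s" "c \<in> A" "c' \<in> A" "p \<in> cdom c" "p \<in> cdom c'" "I \<in> idx r" "J \<in> idx s"
  shows "t c' p I J = trf r s (jac c c' p) (jac c' c p) (t c p) I J"
  using assms unfolding Ck_tensor_def trf_def by blast

lemma tensor_Ck:
  assumes "t \<in> Ck_tensor k A r s" "c \<in> A" "I \<in> idx r" "J \<in> idx s"
  shows "Ck_on k (cran c) (coord c t I J)"
  using assms unfolding Ck_tensor_def by blast

lemma tensor_tens: "t \<in> Ck_tensor k A r s \<Longrightarrow> tens A r s t = t"
  unfolding Ck_tensor_def by simp

lemma tensor_zero:
  assumes "t \<in> Ck_tensor k A r s" "\<not> (c \<in> A \<and> p \<in> cdom c \<and> I \<in> idx r \<and> J \<in> idx s)"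
  shows "t c p I J = 0"
proof -
  have "t c p I J = tens A r s t c p I J" using tensor_tens[OF assms(1)] by simp
  then show ?thesis using assms(2) by (auto simp: tens_def)
qed

lemma tensorI:
  assumes "\<And>c p I J. \<not> (c \<in> A \<and> p \<in> cdom c \<and> I \<in> idx r \<and> J \<in> idx s) \<Longrightarrow> t c p I J = 0"
    and "\<And>c c' p I J. c \<in> A \<Longrightarrow> c' \<in> A \<Longrightarrow> p \<in> cdom c \<Longrightarrow> p \<in> cdom c' \<Longrightarrow> I \<in> idx r \<Longrightarrow> J \<in> idx s \<Longrightarrow>
       t c' p I J = trf r s (jac c c' p) (jac c' c p) (t c p) I J"
    and "\<And>c I J. c \<in> A \<Longrightarrow> I \<in> idx r \<Longrightarrow> J \<in> idx s \<Longrightarrow> Ck_on k (cran c) (coord c t I J)"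
  shows "t \<in> Ck_tensor k A r s"
proof -
  have "t = tens A r s t" unfolding tens_def by (intro ext) (use assms(1) in auto)
  then show ?thesis using assms(2,3) unfolding Ck_tensor_def trf_def by blast
qed

lemma tensor_mono: "t \<in> Ck_tensor k A r s \<Longrightarrow> k' \<le> k \<Longrightarrow> t \<in> Ck_tensor k' A r s"
  unfolding Ck_tensor_def using Ck_mono by blast

text \<open>By the transformation law one chart around each point determines the components in all charts.\<close>

lemma tensor_ext:
  assumes "t \<in> Ck_tensor k A r s" "u \<in> Ck_tensor k' A r s"
    and "\<And>p. p \<in> carrier_of A \<Longrightarrow> \<exists>c\<in>A. p \<in> cdom c \<and> (\<forall>I\<in>idx r. \<forall>J\<in>idx s. t c p I J = u c p I J)"
  shows "t = u"
proof (intro ext)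
  fix c p I J
  show "t c p I J = u c p I J"
  proof (cases "c \<in> A \<and> p \<in> cdom c \<and> I \<in> idx r \<and> J \<in> idx s")
    case True
    then have "p \<in> carrier_of A" unfolding carrier_of_def by auto
    from assms(3)[OF this] obtain c' where c': "c' \<in> A" "p \<in> cdom c'" "\<forall>I\<in>idx r. \<forall>J\<in>idx s. t c' p I J = u c' p I J" by blast
    have "t c p I J = trf r s (jac c' c p) (jac c c' p) (t c' p) I J" using tensor_law[OF assms(1) c'(1)] True c'(2) by blast
    also have "\<dots> = trf r s (jac c' c p) (jac c c' p) (u c' p) I J" by (rule trf_cong) (use c'(3) in auto)
    also have "\<dots> = u c p I J" using tensor_law[OF assms(2) c'(1)] True c'(2) by metis
    finally show ?thesis .
  next
    case False then show ?thesis using tensor_zero assms by metis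
  qed
qed

section \<open>Tensor fields given in one chart\<close>

text \<open>The tensor field with components \<open>F\<close> in the chart \<open>c\<close>, transformed to all other charts and zero off the domain of \<open>c\<close>.\<close>

definition from_chart :: "('a, 'n::finite) chart set \<Rightarrow> ('a, 'n) chart \<Rightarrow> nat \<Rightarrow> nat \<Rightarrow>
    (real^'n \<Rightarrow> 'n list \<Rightarrow> 'n list \<Rightarrow> real) \<Rightarrow> ('a, 'n) tensor" where
  "from_chart A c r s F = tens A r s (\<lambda>c' p I J.
     if p \<in> cdom c then trf r s (jac c c' p) (jac c' c p) (F (cmap c p)) I J else 0)"

context atlas
begin

lemma image_ov: "c \<in> A \<Longrightarrow> open Z \<Longrightarrow> open (cmap c ` (cdom c \<inter> Z))"
  by (rule chart_image_open[OF chart])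

lemma from_chart_coord:
  assumes "c \<in> A" "x \<in> cran c" "I \<in> idx r" "J \<in> idx s"
  shows "coord c (from_chart A c r s F) I J x = F x I J"
  using assms ch(4,6)[OF assms(1,2)] jac_id by (simp add: coord_def from_chart_def tens_def trf_id)

lemma from_chart_at:
  assumes "c \<in> A" "p \<in> cdom c" "I \<in> idx r" "J \<in> idx s"
  shows "from_chart A c r s F c p I J = F (cmap c p) I J"
  using assms jac_id by (simp add: from_chart_def tens_def trf_id)

text \<open>The set \<open>Z\<close> is where the field is known to vanish. It covers two uses: fields with compact support in the chart,
with the complement of the support as \<open>Z\<close> (\<open>from_chart_supp\<close>), and fields on the domain of \<open>c\<close> itself, with \<open>Z\<close> empty (\<open>from_chart_cover\<close>).\<close>

lemma from_chart_tensor: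
  assumes c: "c \<in> A" and F: "\<And>I J. I \<in> idx r \<Longrightarrow> J \<in> idx s \<Longrightarrow> Ck_on k (cran c) (\<lambda>x. F x I J)"
    and Z: "open Z" "carrier_of A \<subseteq> cdom c \<union> Z"
    and F0: "\<And>p I J. p \<in> cdom c \<Longrightarrow> p \<in> Z \<Longrightarrow> I \<in> idx r \<Longrightarrow> J \<in> idx s \<Longrightarrow> F (cmap c p) I J = 0"
  shows "from_chart A c r s F \<in> Ck_tensor k A r s"
proof (rule tensorI)
  let ?t = "from_chart A c r s F"
  show "?t c' p I J = 0" if "\<not> (c' \<in> A \<and> p \<in> cdom c' \<and> I \<in> idx r \<and> J \<in> idx s)" for c' p I J
    using that by (auto simp: from_chart_def tens_def)
  show "?t c2 p I J = trf r s (jac c1 c2 p) (jac c2 c1 p) (?t c1 p) I J"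
    if a: "c1 \<in> A" "c2 \<in> A" "p \<in> cdom c1" "p \<in> cdom c2" "I \<in> idx r" "J \<in> idx s" for c1 c2 p I J
  proof (cases "p \<in> cdom c")
    case True
    have "trf r s (jac c1 c2 p) (jac c2 c1 p) (?t c1 p) I J =
       trf r s (jac c1 c2 p) (jac c2 c1 p) (trf r s (jac c c1 p) (jac c1 c p) (F (cmap c p))) I J"
      by (rule trf_cong) (use a True in \<open>auto simp: from_chart_def tens_def\<close>)
    also have "\<dots> = trf r s (jac c c2 p) (jac c2 c p) (F (cmap c p)) I J"
      unfolding trf_comp using jac_chain[of c c1 c2 p] jac_chain[of c2 c1 c p] a True c by metis
    finally show ?thesis using a True by (simp add: from_chart_def tens_def)
  next
    case False
    have "trf r s (jac c1 c2 p) (jac c2 c1 p) (?t c1 p) I J = trf r s (jac c1 c2 p) (jac c2 c1 p) (\<lambda>I J. 0) I J"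
      by (rule trf_cong) (use False in \<open>auto simp: from_chart_def tens_def\<close>)
    then show ?thesis using False by (simp add: from_chart_def tens_def trf_zero)
  qed
  fix c1 and I J :: "'n list" assume a: "c1 \<in> A" "I \<in> idx r" "J \<in> idx s"
  show "Ck_on k (cran c1) (coord c1 ?t I J)"
  proof (rule Ck_local[OF _ ch(2)[OF a(1)]])
    fix x assume x: "x \<in> cran c1"
    have p: "cinv c1 x \<in> cdom c1" using ch(6)[OF a(1) x] .
    then have "cinv c1 x \<in> carrier_of A" using a(1) by (auto simp: carrier_of_def)
    then consider "cinv c1 x \<in> cdom c" | "cinv c1 x \<in> Z" using Z(2) by blast
    then show "\<exists>U. open U \<and> x \<in> U \<and> Ck_on k U (coord c1 ?t I J)"
    proof cases
      case 1
      have o: "open (ov c1 c)" using ov_open a c by blast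
      have "Ck_on k (ov c1 c) (\<lambda>x. trf r s (jac c c1 (cinv c1 x)) (jac c1 c (cinv c1 x)) (F (cmap c (cinv c1 x))) I J)"
        unfolding trf_def
      proof (intro Ck_sum Ck_mult Ck_prod o)
        fix I' J' :: "'n list" assume i: "I' \<in> idx r" "J' \<in> idx s"
        show "Ck_on k (ov c1 c) (\<lambda>x. F (cmap c (cinv c1 x)) I' J')"
          by (rule Ck_comp[OF o ch(2)[OF c] F[OF i]])
            (use trans_in[OF a(1)] ov_sub trans_smooth[OF a(1) c] Ck_inf in blast)+
      qed (use jac_smooth[OF a(1) c] Ck_inf in blast)+
      then have "Ck_on k (ov c1 c) (coord c1 ?t I J)"
        by (rule Ck_cong[OF o, rotated]) (use a ovD[OF a(1)] in \<open>auto simp: coord_def from_chart_def tens_def\<close>)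
      moreover have "x \<in> ov c1 c" using ovI'[OF a(1) x 1] .
      ultimately show ?thesis using o by blast
    next
      case 2
      let ?U = "cmap c1 ` (cdom c1 \<inter> Z)"
      have o: "open ?U" by (rule image_ov[OF a(1) Z(1)])
      have "coord c1 ?t I J y = 0" if "y \<in> ?U" for y
      proof -
        have q: "cinv c1 y \<in> cdom c1" "cinv c1 y \<in> Z" using that ch(3)[OF a(1)] by auto
        show ?thesis
        proof (cases "cinv c1 y \<in> cdom c")
          case True
          have "trf r s (jac c c1 (cinv c1 y)) (jac c1 c (cinv c1 y)) (F (cmap c (cinv c1 y))) I J =
            trf r s (jac c c1 (cinv c1 y)) (jac c1 c (cinv c1 y)) (\<lambda>I J. 0) I J"
            by (rule trf_cong) (use F0[OF True q(2)] in auto)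
          then show ?thesis by (simp add: coord_def from_chart_def tens_def trf_zero)
        qed (simp add: coord_def from_chart_def tens_def)
      qed
      then have "Ck_on k ?U (coord c1 ?t I J)"
        using Ck_cong[OF o _ Ck_const[of k ?U 0]] by metis
      moreover have "x \<in> ?U" using 2 p ch(4)[OF a(1) x] by (metis IntI imageI)
      ultimately show ?thesis using o by blast
    qed
  qed
qed

lemma from_chart_supp:
  assumes "c \<in> A" "\<And>I J. I \<in> idx r \<Longrightarrow> J \<in> idx s \<Longrightarrow> Ck_on k (cran c) (\<lambda>x. F x I J)"
    and K: "compact K" "K \<subseteq> cran c" and F0: "\<And>x I J. x \<in> cran c \<Longrightarrow> x \<notin> K \<Longrightarrow> F x I J = 0"
  shows "from_chart A c r s F \<in> Ck_tensor k A r s"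
proof (rule from_chart_tensor[OF assms(1,2)])
  have "compact (cinv c ` K)"
    using compact_continuous_image continuous_on_subset[OF ch(8)[OF assms(1)] K(2)] K(1) by blast
  then show "open (- cinv c ` K)" using compact_imp_closed by auto
  show "carrier_of A \<subseteq> cdom c \<union> - cinv c ` K" using ch(6)[OF assms(1)] K(2) by auto
  show "F (cmap c p) I J = 0" if "p \<in> cdom c" "p \<in> - cinv c ` K" for p I J
    using F0[OF ch(5)[OF assms(1) that(1)]] that ch(3)[OF assms(1)] by (metis ComplD imageI)
qed

lemma from_chart_cover:
  assumes "c \<in> A" "\<And>I J. I \<in> idx r \<Longrightarrow> J \<in> idx s \<Longrightarrow> Ck_on k (cran c) (\<lambda>x. F x I J)"
    and "carrier_of A \<subseteq> cdom c"
  shows "from_chart A c r s F \<in> Ck_tensor k A r s"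
  by (rule from_chart_tensor[OF assms(1,2), where Z="{}"]) (use assms(3) in auto)

end

section \<open>Differential operators in other charts\<close>

text \<open>The operator \<open>L\<close>, with values functions on \<open>W\<close>, is a differential operator of order at most \<open>m\<close> in the chart \<open>c\<close>.\<close>

definition nf :: "('a::t2_space, 'n::finite) chart set \<Rightarrow> nat \<Rightarrow> nat \<Rightarrow> ('a, 'n) chart \<Rightarrow> (real^'n) set \<Rightarrow> nat \<Rightarrow>
    (('a, 'n) tensor \<Rightarrow> real^'n \<Rightarrow> real) \<Rightarrow> bool" where
  "nf A r s c W m L \<longleftrightarrow> (\<exists>a. (\<forall>\<beta> I' J'. Ck_on \<infinity> W (a \<beta> I' J')) \<and>
     (\<forall>t\<in>smooth_tensor A r s. \<forall>y\<in>W. L t y =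
        (\<Sum>\<beta> | length \<beta> \<le> m. \<Sum>I'\<in>idx r. \<Sum>J'\<in>idx s. a \<beta> I' J' y * pd \<beta> (coord c t I' J') y)))"

lemma finite_lists_le [simp]: "finite {\<beta> :: 'n::finite list. length \<beta> \<le> m}"
  using finite_lists_length_le[OF finite, of UNIV m] by simp

lemma nf_cong:
  assumes "nf A r s c W m L" "\<And>t y. t \<in> smooth_tensor A r s \<Longrightarrow> y \<in> W \<Longrightarrow> L t y = L' t y"
  shows "nf A r s c W m L'"
proof -
  obtain a where a: "\<forall>\<beta> I' J'. Ck_on \<infinity> W (a \<beta> I' J')" and
    e: "\<forall>t\<in>smooth_tensor A r s. \<forall>y\<in>W. L t y =
        (\<Sum>\<beta> | length \<beta> \<le> m. \<Sum>I'\<in>idx r. \<Sum>J'\<in>idx s. a \<beta> I' J' y * pd \<beta> (coord c t I' J') y)"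
    using assms(1) unfolding nf_def by blast
  show ?thesis unfolding nf_def
    by (rule exI[of _ a]) (use a e assms(2) in simp)
qed

lemma sum_delta3:
  fixes f :: "_ \<Rightarrow> _ \<Rightarrow> _ \<Rightarrow> real"
  assumes "finite B" "finite X" "finite Y" "b \<in> B" "i \<in> X" "j \<in> Y"
  shows "(\<Sum>b'\<in>B. \<Sum>i'\<in>X. \<Sum>j'\<in>Y. (if b' = b \<and> i' = i \<and> j' = j then f b' i' j' else 0)) = f b i j"
proof -
  have 1: "(\<Sum>j'\<in>Y. (if b' = b \<and> i' = i \<and> j' = j then f b' i' j' else 0)) = (if b' = b \<and> i' = i then f b i j else 0)" for b' i'
    using assms by (cases "b' = b \<and> i' = i") auto
  have 2: "(\<Sum>i'\<in>X. (if b' = b \<and> i' = i then f b i j else 0)) = (if b' = b then f b i j else 0)" for b'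
    using assms by (cases "b' = b") auto
  show ?thesis unfolding 1 2 using assms by simp
qed

lemma sum_delta2:
  fixes f :: "_ \<Rightarrow> _ \<Rightarrow> real"
  assumes "finite X" "finite Y" "i \<in> X" "j \<in> Y"
  shows "(\<Sum>i'\<in>X. \<Sum>j'\<in>Y. (if i' = i \<and> j' = j then f i' j' else 0)) = f i j"
  using sum_delta3[of "{()}" X Y "()" i j "\<lambda>_. f"] assms by simp

lemma nf_single:
  assumes "Ck_on \<infinity> W b" "length \<beta> \<le> m" "I \<in> idx r" "J \<in> idx s"
  shows "nf A r s c W m (\<lambda>t y. b y * pd \<beta> (coord c t I J) y)"
proof -
  let ?a = "\<lambda>\<beta>' I' J' y. if \<beta>' = \<beta> \<and> I' = I \<and> J' = J then b y else 0"
  have C: "Ck_on \<infinity> W (?a \<beta>' I' J')" for \<beta>' I' J'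
    using assms(1) by (cases "\<beta>' = \<beta> \<and> I' = I \<and> J' = J") (auto simp: Ck_const)
  have "(\<Sum>\<beta>' | length \<beta>' \<le> m. \<Sum>I'\<in>idx r. \<Sum>J'\<in>idx s. ?a \<beta>' I' J' y * pd \<beta>' (coord c t I' J') y) =
     (\<Sum>\<beta>' | length \<beta>' \<le> m. \<Sum>I'\<in>idx r. \<Sum>J'\<in>idx s.
        if \<beta>' = \<beta> \<and> I' = I \<and> J' = J then b y * pd \<beta>' (coord c t I' J') y else 0)" for t y
    by (intro sum.cong refl) auto
  then have "(\<Sum>\<beta>' | length \<beta>' \<le> m. \<Sum>I'\<in>idx r. \<Sum>J'\<in>idx s. ?a \<beta>' I' J' y * pd \<beta>' (coord c t I' J') y)
    = b y * pd \<beta> (coord c t I J) y" for t y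
    using assms by (simp add: sum_delta3)
  then show ?thesis unfolding nf_def using C by (intro exI[of _ ?a]) simp
qed

lemma nf_add:
  assumes "open W" "nf A r s c W m L" "nf A r s c W m L'"
  shows "nf A r s c W m (\<lambda>t y. L t y + L' t y)"
proof -
  obtain a where a: "\<And>\<beta> I' J'. Ck_on \<infinity> W (a \<beta> I' J')"
    and e: "\<And>t y. t \<in> smooth_tensor A r s \<Longrightarrow> y \<in> W \<Longrightarrow> L t y =
        (\<Sum>\<beta> | length \<beta> \<le> m. \<Sum>I'\<in>idx r. \<Sum>J'\<in>idx s. a \<beta> I' J' y * pd \<beta> (coord c t I' J') y)"
    using assms(2) unfolding nf_def by blast
  obtain a' where a': "\<And>\<beta> I' J'. Ck_on \<infinity> W (a' \<beta> I' J')"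
    and e': "\<And>t y. t \<in> smooth_tensor A r s \<Longrightarrow> y \<in> W \<Longrightarrow> L' t y =
        (\<Sum>\<beta> | length \<beta> \<le> m. \<Sum>I'\<in>idx r. \<Sum>J'\<in>idx s. a' \<beta> I' J' y * pd \<beta> (coord c t I' J') y)"
    using assms(3) unfolding nf_def by blast
  show ?thesis unfolding nf_def
    by (rule exI[of _ "\<lambda>\<beta> I' J' y. a \<beta> I' J' y + a' \<beta> I' J' y"])
      (simp add: Ck_add assms(1) a e a' e' algebra_simps sum.distrib)
qed

lemma nf_zero: "nf A r s c W m (\<lambda>t y. 0)"
  unfolding nf_def by (intro exI[of _ "\<lambda>_ _ _ _. 0"]) (simp add: Ck_const)

lemma nf_sum:
  assumes "open W" "\<And>j. j \<in> X \<Longrightarrow> nf A r s c W m (L j)"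
  shows "nf A r s c W m (\<lambda>t y. \<Sum>j\<in>X. L j t y)"
  using assms(2) by (induction X rule: infinite_finite_induct) (auto simp: nf_zero nf_add[OF assms(1)])

lemma nf_mult:
  assumes "open W" "Ck_on \<infinity> W b" "nf A r s c W m L"
  shows "nf A r s c W m (\<lambda>t y. b y * L t y)"
proof -
  obtain a where a: "\<And>\<beta> I' J'. Ck_on \<infinity> W (a \<beta> I' J')"
    and e: "\<And>t y. t \<in> smooth_tensor A r s \<Longrightarrow> y \<in> W \<Longrightarrow> L t y =
        (\<Sum>\<beta> | length \<beta> \<le> m. \<Sum>I'\<in>idx r. \<Sum>J'\<in>idx s. a \<beta> I' J' y * pd \<beta> (coord c t I' J') y)"
    using assms(3) unfolding nf_def by blast
  show ?thesis unfolding nf_def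
    by (rule exI[of _ "\<lambda>\<beta> I' J' y. b y * a \<beta> I' J' y"])
      (simp add: Ck_mult assms(1,2) a e sum_distrib_left mult.assoc)
qed

lemma pd_sum:
  assumes "\<And>j. j \<in> X \<Longrightarrow> f j differentiable at x"
  shows "pd [i] (\<lambda>y. \<Sum>j\<in>X. f j y) x = (\<Sum>j\<in>X. pd [i] (f j) x)" "(\<lambda>y. \<Sum>j\<in>X. f j y) differentiable at x"
  using assms by (induction X rule: infinite_finite_induct) (auto simp: pd_add)

lemma nf_pd:
  assumes W: "open W" "W \<subseteq> cran c" and c: "c \<in> A" and L: "nf A r s c W m L"
  shows "nf A r s c W (Suc m) (\<lambda>t. pd [k] (L t))"
proof -
  obtain a where a: "\<And>\<beta> I' J'. Ck_on \<infinity> W (a \<beta> I' J')"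
    and e: "\<And>t y. t \<in> smooth_tensor A r s \<Longrightarrow> y \<in> W \<Longrightarrow> L t y =
        (\<Sum>\<beta> | length \<beta> \<le> m. \<Sum>I'\<in>idx r. \<Sum>J'\<in>idx s. a \<beta> I' J' y * pd \<beta> (coord c t I' J') y)"
    using L unfolding nf_def by blast
  have "nf A r s c W (Suc m) (\<lambda>t y. \<Sum>\<beta> | length \<beta> \<le> m. \<Sum>I'\<in>idx r. \<Sum>J'\<in>idx s.
     pd [k] (a \<beta> I' J') y * pd \<beta> (coord c t I' J') y + a \<beta> I' J' y * pd (k # \<beta>) (coord c t I' J') y)"
    by (intro nf_sum W nf_add nf_single a Ck_pd_inf) auto
  then show ?thesis
  proof (rule nf_cong)
    fix t y assume t: "t \<in> smooth_tensor A r s" and y: "y \<in> W"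
    have da: "a \<beta> I' J' differentiable at y" for \<beta> I' J'
      using a[of \<beta> I' J'] Ck_inf_iff[OF W(1)] y by (metis pd.simps(1))
    have dt: "pd \<beta> (coord c t I' J') differentiable at y" if "I' \<in> idx r" "J' \<in> idx s" for \<beta> I' J'
      using Ck_inf_iff[OF W(1)] y Ck_mono[OF tensor_Ck[OF t c that] order_refl W(2)] by blast
    have d: "(\<lambda>y. a \<beta> I' J' y * pd \<beta> (coord c t I' J') y) differentiable at y"
      if "I' \<in> idx r" "J' \<in> idx s" for \<beta> I' J' using da dt[OF that] by (intro differentiable_mult)
    have "pd [k] (L t) y = pd [k] (\<lambda>y. \<Sum>\<beta> | length \<beta> \<le> m. \<Sum>I'\<in>idx r. \<Sum>J'\<in>idx s. a \<beta> I' J' y * pd \<beta> (coord c t I' J') y) y"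
      by (rule pd_cong_open[OF W(1) y]) (rule e[OF t])
    also have "\<dots> = (\<Sum>\<beta> | length \<beta> \<le> m. \<Sum>I'\<in>idx r. \<Sum>J'\<in>idx s. pd [k] (\<lambda>y. a \<beta> I' J' y * pd \<beta> (coord c t I' J') y) y)"
      using d by (simp add: pd_sum)
    also have "\<dots> = (\<Sum>\<beta> | length \<beta> \<le> m. \<Sum>I'\<in>idx r. \<Sum>J'\<in>idx s.
      pd [k] (a \<beta> I' J') y * pd \<beta> (coord c t I' J') y + a \<beta> I' J' y * pd (k # \<beta>) (coord c t I' J') y)"
      using da dt by (intro sum.cong refl) (simp add: pd_mult pd_append[of "[k]", simplified, symmetric])
    finally show "(\<Sum>\<beta> | length \<beta> \<le> m. \<Sum>I'\<in>idx r. \<Sum>J'\<in>idx s.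
      pd [k] (a \<beta> I' J') y * pd \<beta> (coord c t I' J') y + a \<beta> I' J' y * pd (k # \<beta>) (coord c t I' J') y) = pd [k] (L t) y"
      by simp
  qed
qed

context atlas
begin

text \<open>A partial derivative of a component in the chart \<open>c\<close> is a differential operator in every other chart. By induction on the order: the
transformation law for order zero, then the chain rule.\<close>

lemma nf_change:
  assumes "c \<in> A" "c' \<in> A" "I \<in> idx r" "J \<in> idx s"
  shows "nf A r s c' (ov c' c) (length \<alpha>) (\<lambda>t y. pd \<alpha> (coord c t I J) (cmap c (cinv c' y)))"
proof (induction \<alpha>)
  case Nil
  let ?p = "\<lambda>y. cinv c' y"
  have "nf A r s c' (ov c' c) 0 (\<lambda>t y. \<Sum>I'\<in>idx r. \<Sum>J'\<in>idx s.
     ((\<Prod>a<r. jac c' c (?p y) $ (I ! a) $ (I' ! a)) * (\<Prod>b<s. jac c c' (?p y) $ (J' ! b) $ (J ! b))) * pd [] (coord c' t I' J') y)"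
    by (intro nf_sum nf_single ov_open assms Ck_mult Ck_prod jac_smooth) auto
  then have "nf A r s c' (ov c' c) 0 (\<lambda>t y. pd [] (coord c t I J) (cmap c (cinv c' y)))"
  proof (rule nf_cong)
    fix t y assume t: "t \<in> smooth_tensor A r s" and y: "y \<in> ov c' c"
    note o = ovD[OF assms(2) y]
    have "t c (?p y) I J = trf r s (jac c' c (?p y)) (jac c c' (?p y)) (t c' (?p y)) I J"
      using tensor_law[OF t assms(2,1)] o assms by blast
    then show "(\<Sum>I'\<in>idx r. \<Sum>J'\<in>idx s.
       ((\<Prod>a<r. jac c' c (?p y) $ (I ! a) $ (I' ! a)) * (\<Prod>b<s. jac c c' (?p y) $ (J' ! b) $ (J ! b))) * pd [] (coord c' t I' J') y)
       = pd [] (coord c t I J) (cmap c (cinv c' y))"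
      using o ch(3)[OF assms(1)] by (simp add: trf_def coord_def)
  qed
  then show ?case by simp
next
  case (Cons i \<alpha>)
  have W: "open (ov c' c)" "ov c' c \<subseteq> cran c'" using ov_open ov_sub assms by blast+
  let ?H = "\<lambda>t y. pd \<alpha> (coord c t I J) (cmap c (cinv c' y))"
  have "nf A r s c' (ov c' c) (Suc (length \<alpha>)) (\<lambda>t y. \<Sum>k\<in>UNIV. jac c c' (cinv c' y) $ k $ i * pd [k] (?H t) y)"
    by (intro nf_sum nf_mult W jac_smooth assms nf_pd Cons)
  then have "nf A r s c' (ov c' c) (Suc (length \<alpha>)) (\<lambda>t y. pd (i # \<alpha>) (coord c t I J) (cmap c (cinv c' y)))"
  proof (rule nf_cong)
    fix t y assume t: "t \<in> smooth_tensor A r s" and y: "y \<in> ov c' c"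
    note o = ovD[OF assms(2) y]
    let ?x = "cmap c (cinv c' y)" let ?s = "\<lambda>x. cmap c' (cinv c x)"
    have x: "?x \<in> ov c c'" by (rule trans_in[OF assms(2) y])
    have sx: "?s ?x = y" using o ch(3)[OF assms(1)] by auto
    have dF: "pd \<alpha> (coord c t I J) differentiable at ?x"
      using tensor_Ck[OF t assms(1,3,4)] Ck_inf_iff[OF ch(2)[OF assms(1)]] x ov_sub by blast
    have dH: "?H t differentiable at (?s ?x)"
      unfolding sx using pd_comp(2)[OF dF trans_diff[OF assms(2,1) y]] .
    have "pd (i # \<alpha>) (coord c t I J) ?x = pd [i] (\<lambda>x. ?H t (?s x)) ?x"
      unfolding pd_Cons[of i \<alpha>]
      by (rule pd_cong_open[OF ov_open[OF assms(1,2)] x]) (use ovD[OF assms(1)] trans_inv[OF assms(1,2)] in auto)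
    also have "\<dots> = (\<Sum>k\<in>UNIV. pd [i] (\<lambda>x. ?s x $ k) ?x * pd [k] (?H t) (?s ?x))"
      by (rule pd_comp(1)[where f="?H t" and \<tau>="?s", OF dH trans_diff[OF assms(1,2) x]])
    finally show "(\<Sum>k\<in>UNIV. jac c c' (cinv c' y) $ k $ i * pd [k] (?H t) y) = pd (i # \<alpha>) (coord c t I J) ?x"
      unfolding sx jac_nth by simp
  qed
  then show ?case by simp
qed

section \<open>Localized partial derivatives are differential operators\<close>

lemma chart_cutoff:
  assumes "c \<in> A" "x0 \<in> cran c"
  obtains \<phi> r where "r > 0" "cball x0 r \<subseteq> cran c" "Ck_on \<infinity> UNIV \<phi>"
    "\<And>x. x \<in> cball x0 (r/2) \<Longrightarrow> \<phi> x = 1" "\<And>x. x \<notin> cball x0 r \<Longrightarrow> \<phi> x = (0::real)"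
proof -
  obtain r where r: "r > 0" "cball x0 r \<subseteq> cran c"
    using open_contains_cball ch(2)[OF assms(1)] assms(2) by blast
  obtain \<phi> where "Ck_on \<infinity> UNIV \<phi>" "\<And>x. dist x x0 \<le> r/2 \<Longrightarrow> \<phi> x = 1" "\<And>x. r \<le> dist x x0 \<Longrightarrow> \<phi> x = (0::real)"
    using bump_exists[of "r/2" r x0] r(1) by auto
  then show ?thesis using that[OF r, of \<phi>] by (auto simp: dist_commute)
qed

text \<open>Compact sets are closed since the manifold is Hausdorff.\<close>

lemma compl_image_open:
  assumes "c \<in> A" "compact K" "K \<subseteq> cran c"
  shows "open (- cinv c ` K)"
  using compact_continuous_image[OF continuous_on_subset[OF ch(8)[OF assms(1)] assms(3)] assms(2)]
    compact_imp_closed by blast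

text \<open>A single partial derivative of a single component is no operation on tensor fields, but after multiplication by a cut-off function
it defines a tensor field supported in the chart. So the condition on all linear differential operators controls all
partial derivatives of components.\<close>

lemma local_pd_op:
  assumes c: "c \<in> A" and I: "I \<in> idx r" "J \<in> idx s" and K: "compact K" "K \<subseteq> cran c"
    and \<phi>: "Ck_on \<infinity> UNIV \<phi>" "\<And>x. x \<notin> K \<Longrightarrow> \<phi> x = 0"
  shows "lin_diff_op A r s (\<lambda>t. from_chart A c r s (\<lambda>x I' J'. if I' = I \<and> J' = J then \<phi> x * pd \<alpha> (coord c t I J) x else 0))"
    (is "lin_diff_op A r s ?P")
  unfolding lin_diff_op_def
proof (intro conjI ballI exI[of _ "length \<alpha>"])
  fix t assume t: "t \<in> smooth_tensor A r s"
  show "?P t \<in> smooth_tensor A r s"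
  proof (rule from_chart_supp[OF c _ K])
    fix I' J'
    have "Ck_on \<infinity> (cran c) (\<lambda>x. \<phi> x * pd \<alpha> (coord c t I J) x)"
      by (intro Ck_mult ch(2)[OF c] Ck_pd_inf tensor_Ck[OF t c I] Ck_mono[OF \<phi>(1)]) auto
    then show "Ck_on \<infinity> (cran c) (\<lambda>x. if I' = I \<and> J' = J then \<phi> x * pd \<alpha> (coord c t I J) x else 0)"
      by (cases "I' = I \<and> J' = J") (auto simp: Ck_const)
  qed (use \<phi>(2) in auto)
next
  fix c' assume c': "c' \<in> A"
  let ?W = "ov c' c"
  have W: "open ?W" using ov_open c c' by blast
  obtain b where b: "\<And>\<beta> I' J'. Ck_on \<infinity> ?W (b \<beta> I' J')" and
    e: "\<And>t y. t \<in> smooth_tensor A r s \<Longrightarrow> y \<in> ?W \<Longrightarrow> pd \<alpha> (coord c t I J) (cmap c (cinv c' y)) =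
        (\<Sum>\<beta> | length \<beta> \<le> length \<alpha>. \<Sum>I'\<in>idx r. \<Sum>J'\<in>idx s. b \<beta> I' J' y * pd \<beta> (coord c' t I' J') y)"
    using nf_change[OF c c' I, of \<alpha>] unfolding nf_def by blast
  define j where "j = (\<lambda>X Y y. (\<Prod>a<r. jac c c' (cinv c' y) $ (X ! a) $ (I ! a)) * (\<Prod>b<s. jac c' c (cinv c' y) $ (J ! b) $ (Y ! b)))"
  have jC: "Ck_on \<infinity> ?W (j X Y)" for X Y
    unfolding j_def by (intro Ck_mult Ck_prod W jac_smooth c c')
  \<comment> \<open>in another chart: the coefficients of the derivative, transformed as tensor components, and zero off the overlap\<close>
  define a where "a = (\<lambda>\<beta> X Y I' J' y. if y \<in> ?W then j X Y y * (\<phi> (cmap c (cinv c' y)) * b \<beta> I' J' y) else 0)"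
  show "\<exists>a. (\<forall>\<alpha> I J I' J'. Ck_on \<infinity> (cran c') (a \<alpha> I J I' J')) \<and>
     (\<forall>t\<in>smooth_tensor A r s. \<forall>p\<in>cdom c'. \<forall>I\<in>idx r. \<forall>J\<in>idx s. ?P t c' p I J =
       (\<Sum>\<beta> | length \<beta> \<le> length \<alpha>. \<Sum>I'\<in>idx r. \<Sum>J'\<in>idx s. a \<beta> I J I' J' (cmap c' p) * pd \<beta> (coord c' t I' J') (cmap c' p)))"
  proof (rule exI[of _ a], intro conjI allI ballI)
    fix \<beta> X Y I' J' :: "'n list"
    show "Ck_on \<infinity> (cran c') (a \<beta> X Y I' J')"
    proof (rule Ck_local[OF _ ch(2)[OF c']])
      fix y assume y: "y \<in> cran c'"
      show "\<exists>U. open U \<and> y \<in> U \<and> Ck_on \<infinity> U (a \<beta> X Y I' J')"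
      proof (cases "y \<in> ?W")
        case True
        have "Ck_on \<infinity> ?W (\<lambda>y. j X Y y * (\<phi> (cmap c (cinv c' y)) * b \<beta> I' J' y))"
          by (intro Ck_mult W jC b Ck_comp[OF W open_UNIV \<phi>(1)] trans_smooth[OF c' c]) auto
        then have "Ck_on \<infinity> ?W (a \<beta> X Y I' J')" by (rule Ck_cong[OF W, rotated]) (simp add: a_def)
        then show ?thesis using W True by blast
      next
        case False
        \<comment> \<open>off the overlap the coefficients vanish near y, because the support of the cut-off is closed on the manifold\<close>
        let ?U = "cmap c' ` (cdom c' \<inter> - cinv c ` K)"
        have U: "open ?U" by (rule image_ov[OF c' compl_image_open[OF c K]])
        have "cinv c' y \<notin> cdom c" using False ovI'[OF c' y] by blast
        then have "cinv c' y \<in> - cinv c ` K" using ch(6)[OF c] K(2) by auto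
        then have "y \<in> ?U" using ch(4,6)[OF c' y] by (metis IntI imageI)
        moreover have "0 = a \<beta> X Y I' J' z" if "z \<in> ?U" for z
        proof (cases "z \<in> ?W")
          case True
          have "cmap c (cinv c' z) \<notin> K"
            using that ovD[OF c' True] ch(3)[OF c] ch(3)[OF c'] by (force simp: image_iff)
          then show ?thesis by (simp add: a_def \<phi>(2))
        qed (simp add: a_def)
        then have "Ck_on \<infinity> ?U (a \<beta> X Y I' J')" by (rule Ck_cong[OF U _ Ck_const[where c=0]])
        ultimately show ?thesis using U by blast
      qed
    qed
  next
    fix t p and X Y :: "'n list" assume t: "t \<in> smooth_tensor A r s" and p: "p \<in> cdom c'" and X: "X \<in> idx r" "Y \<in> idx s"
    let ?y = "cmap c' p"
    show "?P t c' p X Y = (\<Sum>\<beta> | length \<beta> \<le> length \<alpha>. \<Sum>I'\<in>idx r. \<Sum>J'\<in>idx s. a \<beta> X Y I' J' ?y * pd \<beta> (coord c' t I' J') ?y)"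
    proof (cases "p \<in> cdom c")
      case True
      have y: "?y \<in> ?W" using ovI[OF p True] .
      have py: "cinv c' ?y = p" using ch(3)[OF c' p] .
      have "?P t c' p X Y = (\<Sum>I'\<in>idx r. \<Sum>J'\<in>idx s. if I' = I \<and> J' = J then j X Y ?y * (\<phi> (cmap c p) * pd \<alpha> (coord c t I J) (cmap c p)) else 0)"
        using True c' p X unfolding from_chart_def tens_def trf_def j_def py by (auto intro!: sum.cong)
      also have "\<dots> = j X Y ?y * (\<phi> (cmap c p) * pd \<alpha> (coord c t I J) (cmap c p))"
        by (rule sum_delta2) (use I in auto)
      also have "\<dots> = (\<Sum>\<beta> | length \<beta> \<le> length \<alpha>. \<Sum>I'\<in>idx r. \<Sum>J'\<in>idx s. a \<beta> X Y I' J' ?y * pd \<beta> (coord c' t I' J') ?y)"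
        using e[OF t y] y unfolding py by (simp add: a_def py sum_distrib_left mult.assoc)
      finally show ?thesis .
    next
      case False
      then have "?y \<notin> ?W" using ovD[OF c', of ?y c] ch(3)[OF c' p] by auto
      then show ?thesis using False by (simp add: from_chart_def tens_def a_def)
    qed
  qed
qed

end

section \<open>Fibre norms\<close>

lemma idx_2: "J \<in> idx 2 \<longleftrightarrow> (\<exists>i j. J = [i, j])"
  unfolding numeral_2_eq_2 by (auto simp: idx_def length_Suc_conv)

lemma trf_02: "trf 0 2 M N F [] [i, j] = (\<Sum>k\<in>UNIV. \<Sum>l\<in>UNIV. N $ k $ i * N $ l $ j * F [] [k, l])"
  by (simp add: trf_def numeral_2_eq_2 sum_idx_Suc)

lemma congruence_nth:
  fixes J M :: "real^'n::finite^'n"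
  shows "(transpose J ** M ** J) $ i $ j = (\<Sum>k\<in>UNIV. \<Sum>l\<in>UNIV. J $ k $ i * J $ l $ j * M $ k $ l)"
  unfolding matrix_matrix_mult_def transpose_def
  by (simp add: sum_distrib_right) (subst sum.swap, intro sum.cong refl, simp)

lemma (in atlas) gmat_law:
  assumes "g \<in> Ck_tensor k A 0 2" "c \<in> A" "c' \<in> A" "p \<in> cdom c" "p \<in> cdom c'"
  shows "gmat g c p = transpose (jac c c' p) ** gmat g c' p ** jac c c' p"
proof -
  have "gmat g c p $ i $ j = (transpose (jac c c' p) ** gmat g c' p ** jac c c' p) $ i $ j" for i j
    using tensor_law[OF assms(1,3,2,5,4), of "[]" "[i, j]"] unfolding congruence_nth
    by (simp add: trf_02 gmat_def idx_2)
  then show ?thesis by (simp add: vec_eq_iff)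
qed

lemma gmat_smooth:
  assumes "g \<in> Ck_tensor k A 0 2" "c \<in> A"
  shows "Ck_on k (cran c) (\<lambda>x. gmat g c (cinv c x) $ i $ j)"
  using tensor_Ck[OF assms, of "[]" "[i, j]"] by (simp add: idx_2 coord_def[abs_def] gmat_def)

text \<open>The square of the fibre norm of a tensor with upper indices only.\<close>

definition upper_form :: "nat \<Rightarrow> real^'n::finite^'n \<Rightarrow> ('n list \<Rightarrow> real) \<Rightarrow> real" where
  "upper_form r M T = (\<Sum>I\<in>idx r. \<Sum>I'\<in>idx r. (\<Prod>a<r. M $ (I ! a) $ (I' ! a)) * T I * T I')"

lemma fibre_norm_upper: "fibre_norm h r 0 c p T = sqrt (upper_form r (gmat h c p) (\<lambda>I. T I []))"
  by (simp add: fibre_norm_def upper_form_def)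

lemma upper_form_trf:
  fixes M J N :: "real^'n::finite^'n"
  shows "upper_form r M (\<lambda>I. trf r 0 J N T I []) = upper_form r (transpose J ** M ** J) (\<lambda>I. T I [])"
proof -
  let ?P = "\<lambda>M I K. \<Prod>a<r. M $ (I ! a) $ (K ! a)"
  have "upper_form r M (\<lambda>I. trf r 0 J N T I []) =
    (\<Sum>I\<in>idx r. \<Sum>I'\<in>idx r. \<Sum>K\<in>idx r. \<Sum>K'\<in>idx r. ?P M I I' * (?P J I K * T K []) * (?P J I' K' * T K' []))"
    unfolding upper_form_def trf_def by (simp add: sum_distrib_left sum_distrib_right) (intro sum.cong refl sum.swap)
  also have "\<dots> = (\<Sum>K\<in>idx r. \<Sum>K'\<in>idx r. \<Sum>I\<in>idx r. \<Sum>I'\<in>idx r. ?P M I I' * (?P J I K * T K []) * (?P J I' K' * T K' []))"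
    by (rule sum_swap4)
  also have "\<dots> = (\<Sum>K\<in>idx r. \<Sum>K'\<in>idx r. (\<Sum>I'\<in>idx r. (\<Sum>I\<in>idx r. ?P (transpose J) K I * ?P M I I') * ?P J I' K') * T K [] * T K' [])"
    by (intro sum.cong refl, subst sum.swap) (simp add: sum_distrib_left sum_distrib_right transpose_def mult_ac)
  also have "\<dots> = upper_form r (transpose J ** M ** J) (\<lambda>I. T I [])"
    unfolding upper_form_def prod_matrix_mult ..
  finally show ?thesis .
qed

text \<open>For upper indices only, which suffices: the metric itself enters just through its components, and all nets that have to be shown moderate or
negligible consist of functions or vector fields.\<close>

lemma (in atlas) fibre_norm_indep:
  assumes h: "h \<in> Ck_tensor k A 0 2" and t: "t \<in> Ck_tensor k' A r 0"
    and c: "c \<in> A" "c' \<in> A" "p \<in> cdom c" "p \<in> cdom c'"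
  shows "fibre_norm h r 0 c' p (t c' p) = fibre_norm h r 0 c p (t c p)"
proof -
  have "upper_form r (gmat h c' p) (\<lambda>I. t c' p I []) = upper_form r (gmat h c' p) (\<lambda>I. trf r 0 (jac c c' p) (jac c' c p) (t c p) I [])"
    unfolding upper_form_def using tensor_law[OF t c, where J="[]"] by simp
  also have "\<dots> = upper_form r (gmat h c p) (\<lambda>I. t c p I [])"
    unfolding upper_form_trf gmat_law[OF h c] ..
  finally show ?thesis unfolding fibre_norm_upper by simp
qed

lemma upper_form_bound:
  assumes "\<And>i j. \<bar>M $ i $ j\<bar> \<le> B" "\<And>I. I \<in> idx r \<Longrightarrow> \<bar>T I\<bar> \<le> b"
  shows "upper_form r (M :: real^'n::finite^'n) T \<le> (real (card (idx r :: 'n list set)))\<^sup>2 * B ^ r * b\<^sup>2"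
proof -
  let ?N = "card (idx r :: 'n list set)"
  have B: "0 \<le> B" using assms(1)[of undefined undefined] by linarith
  have "(\<Prod>a<r. M $ (I ! a) $ (I' ! a)) * T I * T I' \<le> B ^ r * b * b" if "I \<in> idx r" "I' \<in> idx r" for I I'
  proof -
    have "\<bar>\<Prod>a<r. M $ (I ! a) $ (I' ! a)\<bar> \<le> (\<Prod>a<r. B)"
      unfolding abs_prod by (rule prod_mono) (use assms(1) in auto)
    then have "\<bar>\<Prod>a<r. M $ (I ! a) $ (I' ! a)\<bar> * \<bar>T I\<bar> * \<bar>T I'\<bar> \<le> B ^ r * b * b"
      using assms(2)[OF that(1)] assms(2)[OF that(2)] B by (intro mult_mono) auto
    moreover have "(\<Prod>a<r. M $ (I ! a) $ (I' ! a)) * T I * T I' \<le> \<bar>\<Prod>a<r. M $ (I ! a) $ (I' ! a)\<bar> * \<bar>T I\<bar> * \<bar>T I'\<bar>"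
      unfolding abs_mult[symmetric] by (rule abs_ge_self)
    ultimately show ?thesis by linarith
  qed
  then have "upper_form r M T \<le> (\<Sum>I\<in>(idx r :: 'n list set). \<Sum>I'\<in>(idx r :: 'n list set). B ^ r * b * b)"
    unfolding upper_form_def by (intro sum_mono)
  then show ?thesis by (simp add: power2_eq_square mult_ac)
qed

text \<open>The Riemannian metric on the domain of \<open>c\<close> that has the unit matrix in \<open>c\<close>. The definition of moderateness allows any metric near the
compact set; this one turns the fibre norm into the Euclidean norm of the components.\<close>

definition euclid :: "('a, 'n::finite) chart set \<Rightarrow> ('a, 'n) chart \<Rightarrow> ('a, 'n) tensor" where
  "euclid A c = from_chart (restr A (cdom c)) c 0 2 (\<lambda>x I J. if J ! 0 = J ! 1 then 1 else 0)"

lemma carrier_restr: "carrier_of (restr A V) \<subseteq> V"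
  by (auto simp: carrier_of_def restr_def)

lemma fibre_norm_mat1:
  assumes "gmat h c p = mat 1" "I \<in> idx r" "J \<in> idx s"
  shows "\<bar>T I J\<bar> \<le> fibre_norm h r s c p T"
proof -
  have m: "matrix_inv (mat 1 :: real^'n^'n) = mat 1" 
    unfolding matrix_inv_def by (rule some_equality) auto
  have "(\<Sum>I\<in>idx r. \<Sum>I'\<in>idx r. \<Sum>J\<in>idx s. \<Sum>J'\<in>idx s.
     (\<Prod>a<r. gmat h c p $ (I ! a) $ (I' ! a)) * (\<Prod>b<s. matrix_inv (gmat h c p) $ (J ! b) $ (J' ! b)) * T I J * T I' J')
     = (\<Sum>I\<in>idx r. \<Sum>J\<in>idx s. T I J * T I J)"
  proof (rule sum.cong[OF refl])
    fix I :: "'a list" assume I: "I \<in> idx r"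
    have "(\<Sum>I'\<in>idx r. \<Sum>J\<in>idx s. \<Sum>J'\<in>idx s.
     (\<Prod>a<r. gmat h c p $ (I ! a) $ (I' ! a)) * (\<Prod>b<s. matrix_inv (gmat h c p) $ (J ! b) $ (J' ! b)) * T I J * T I' J') =
     (\<Sum>I'\<in>idx r. \<Sum>J\<in>idx s. \<Sum>J'\<in>idx s. if I' = I \<and> J' = J then T I J * T I J else 0)"
      using I by (intro sum.cong refl) (auto simp: assms(1) m prod_mat_1)
    also have "\<dots> = (\<Sum>J\<in>idx s. \<Sum>I'\<in>idx r. \<Sum>J'\<in>idx s. if I' = I \<and> J' = J then T I J * T I J else 0)"
      by (rule sum.swap)
    also have "\<dots> = (\<Sum>J\<in>idx s. T I J * T I J)"
    proof (rule sum.cong[OF refl])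
      fix J :: "'a list" assume J: "J \<in> idx s"
      show "(\<Sum>I'\<in>idx r. \<Sum>J'\<in>idx s. if I' = I \<and> J' = J then T I J * T I J else 0) = T I J * T I J"
        by (rule sum_delta2[OF finite_idx finite_idx I J])
    qed
    finally show "(\<Sum>I'\<in>idx r. \<Sum>J\<in>idx s. \<Sum>J'\<in>idx s.
     (\<Prod>a<r. gmat h c p $ (I ! a) $ (I' ! a)) * (\<Prod>b<s. matrix_inv (gmat h c p) $ (J ! b) $ (J' ! b)) * T I J * T I' J') = (\<Sum>J\<in>idx s. T I J * T I J)" .
  qed
  moreover have "T I J * T I J \<le> (\<Sum>I\<in>idx r. \<Sum>J\<in>idx s. T I J * T I J)"
  proof -
    have "T I J * T I J \<le> (\<Sum>J\<in>idx s. T I J * T I J)" by (rule member_le_sum) (use assms in auto)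
    also have "\<dots> \<le> (\<Sum>I\<in>idx r. \<Sum>J\<in>idx s. T I J * T I J)"
      by (rule member_le_sum[of I _ "\<lambda>I. \<Sum>J\<in>idx s. T I J * T I J"]) (use assms in \<open>auto intro: sum_nonneg\<close>)
    finally show ?thesis .
  qed
  ultimately show ?thesis unfolding fibre_norm_def real_sqrt_abs2[symmetric] by (intro real_sqrt_le_mono) linarith
qed

context atlas
begin

lemma mem_restr: "c \<in> A \<Longrightarrow> c \<in> restr A (cdom c)" by (simp add: restr_def)

lemma euclid_riem:
  assumes "c \<in> A"
  shows "riem_metric (restr A (cdom c)) (euclid A c)" "p \<in> cdom c \<Longrightarrow> gmat (euclid A c) c p = mat 1"
proof -
  interpret B: atlas "restr A (cdom c)" by (rule restr_atlas[OF ch(1)[OF assms]])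
  let ?B = "restr A (cdom c)"
  note cB = mem_restr[OF assms]
  have T: "euclid A c \<in> smooth_tensor ?B 0 2"
    unfolding euclid_def by (rule B.from_chart_cover[OF cB _ carrier_restr]) (simp add: Ck_const)
  show 1: "gmat (euclid A c) c p = mat 1" if "p \<in> cdom c" for p
    unfolding gmat_def euclid_def mat_def vec_eq_iff
    using B.from_chart_at[OF cB that, of "[]" 0 _ 2] by (auto simp: idx_2)
  show "riem_metric ?B (euclid A c)" unfolding riem_metric_def
  proof (intro conjI T ballI allI impI)
    fix c' p assume c': "c' \<in> ?B" and p: "p \<in> cdom c'"
    then have pc: "p \<in> cdom c" by (auto simp: restr_def)
    have g: "gmat (euclid A c) c' p = transpose (jac c' c p) ** jac c' c p"
      using B.gmat_law[OF T c' cB p pc] 1[OF pc] by simp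
    show "transpose (gmat (euclid A c) c' p) = gmat (euclid A c) c' p"
      unfolding g by (simp add: matrix_transpose_mul)
    fix v :: "real^'n" assume v: "v \<noteq> 0"
    have "v \<bullet> (gmat (euclid A c) c' p *v v) = (jac c' c p *v v) \<bullet> (jac c' c p *v v)"
      unfolding g by (simp add: matrix_vector_mul_assoc[symmetric] dot_lmul_matrix[symmetric] vector_transpose_matrix)
        (metis dot_lmul_matrix transpose_matrix_vector transpose_transpose)
    moreover have "jac c' c p *v v \<noteq> 0"
    proof
      assume "jac c' c p *v v = 0"
      then have "(jac c c' p ** jac c' c p) *v v = 0" by (simp add: matrix_vector_mul_assoc[symmetric])
      then show False using B.jac_inv[OF c' cB p pc] v by simp
    qed
    ultimately show "0 < v \<bullet> (gmat (euclid A c) c' p *v v)" by simp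
  qed
qed

text \<open>From norms to components, by the choice of the Euclidean metric of the chart.\<close>

lemma net_bigo_comp:
  assumes q: "net_bigo A r s K q b" and c: "c \<in> A" "K \<subseteq> cdom c"
  shows "\<exists>C. \<forall>\<^sub>F e in at_right 0. \<forall>p\<in>K. \<forall>I\<in>idx r. \<forall>J\<in>idx s. \<bar>q e c p I J\<bar> \<le> C * b e"
proof -
  obtain C where "\<forall>\<^sub>F e in at_right 0. \<forall>c'\<in>restr A (cdom c). \<forall>p \<in> K \<inter> cdom c'.
            fibre_norm (euclid A c) r s c' p (q e c' p) \<le> C * b e"
    using q[unfolded net_bigo_def, rule_format, of "cdom c" "euclid A c"] ch(1)[OF c(1)] c(2) euclid_riem(1)[OF c(1)] by blast
  then have "\<forall>\<^sub>F e in at_right 0. \<forall>p\<in>K. \<forall>I\<in>idx r. \<forall>J\<in>idx s. \<bar>q e c p I J\<bar> \<le> C * b e"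
  proof eventually_elim
    case (elim e)
    show ?case
    proof (intro ballI)
      fix p and I J :: "'n list" assume a: "p \<in> K" "I \<in> idx r" "J \<in> idx s"
      then have p: "p \<in> cdom c" using c(2) by blast
      have "\<bar>q e c p I J\<bar> \<le> fibre_norm (euclid A c) r s c p (q e c p)"
        by (rule fibre_norm_mat1[OF euclid_riem(2)[OF c(1) p] a(2,3)])
      also have "\<dots> \<le> C * b e" using elim mem_restr[OF c(1)] a(1) p by blast
      finally show "\<bar>q e c p I J\<bar> \<le> C * b e" .
    qed
  qed
  then show ?thesis by blast
qed

section \<open>Moderateness and negligibility in charts\<close>

text \<open>The partial derivatives are recovered from a cut-off differential operator on a ball where the cut-off function is \<open>1\<close>.\<close>

lemma moderate_Mod:
  assumes t: "t \<in> moderate A r s" and c: "c \<in> A" and I: "I \<in> idx r" "J \<in> idx s"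
  shows "Mod (cran c) (\<lambda>e. coord c (t e) I J)"
proof (rule ModI[OF ch(2)[OF c]])
  show "Ck_on \<infinity> (cran c) (coord c (t e) I J)" if "e \<in> {0<..1}" for e
    using t that tensor_Ck[OF _ c I] unfolding moderate_def by blast
  fix \<alpha> x0 assume x0: "x0 \<in> cran c"
  obtain \<phi> \<rho> where \<rho>: "\<rho> > 0" "cball x0 \<rho> \<subseteq> cran c" and \<phi>: "Ck_on \<infinity> UNIV \<phi>"
    "\<And>x. x \<in> cball x0 (\<rho>/2) \<Longrightarrow> \<phi> x = 1" "\<And>x. x \<notin> cball x0 \<rho> \<Longrightarrow> \<phi> x = (0::real)"
    using chart_cutoff[OF c x0] by metis
  define P where "P = (\<lambda>t. from_chart A c r s (\<lambda>x I' J'. if I' = I \<and> J' = J then \<phi> x * pd \<alpha> (coord c t I J) x else 0))"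
  have P: "lin_diff_op A r s P" unfolding P_def by (rule local_pd_op[OF c I compact_cball \<rho>(2) \<phi>(1,3)])
  let ?K = "cinv c ` cball x0 \<rho>"
  have K: "compact ?K" by (rule compact_continuous_image[OF continuous_on_subset[OF ch(8)[OF c] \<rho>(2)] compact_cball])
  have Kc: "?K \<subseteq> cdom c" using ch(6)[OF c] \<rho>(2) by blast
  then have "?K \<subseteq> carrier_of A" using c by (auto simp: carrier_of_def)
  then obtain N :: nat where "net_bigo A r s ?K (\<lambda>e. P (t e)) (\<lambda>e. 1 / e ^ N)"
    using t K P unfolding moderate_def by blast
  from net_bigo_comp[OF this c Kc] obtain C where
    C: "\<forall>\<^sub>F e in at_right 0. \<forall>p\<in>?K. \<forall>I\<in>idx r. \<forall>J\<in>idx s. \<bar>P (t e) c p I J\<bar> \<le> C * (1 / e ^ N)" by blast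
  \<comment> \<open>the constant C is absorbed by one more power of 1 / e\<close>
  have "\<forall>\<^sub>F e in at_right (0::real). 0 < e \<and> e < 1 / (\<bar>C\<bar> + 1)"
    unfolding eventually_at_right_field by (intro exI[of _ "1 / (\<bar>C\<bar> + 1)"]) auto
  with C have "\<forall>\<^sub>F e in at_right 0. \<forall>y\<in>cball x0 (\<rho>/2). \<bar>pd \<alpha> (coord c (t e) I J) y\<bar> \<le> 1 / e ^ Suc N"
  proof eventually_elim
    case (elim e)
    show ?case
    proof
      fix y assume y: "y \<in> cball x0 (\<rho>/2)"
      have yr: "y \<in> cball x0 \<rho>" using y \<rho>(1) by auto
      have "P (t e) c (cinv c y) I J = pd \<alpha> (coord c (t e) I J) y"
        using from_chart_coord[OF c _ I, of y] \<phi>(2)[OF y] yr \<rho>(2) unfolding P_def coord_def by auto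
      then have "\<bar>pd \<alpha> (coord c (t e) I J) y\<bar> \<le> C * (1 / e ^ N)" using elim(1) yr I by (metis imageI)
      also have "\<dots> \<le> (1 / e) * (1 / e ^ N)"
      proof (rule mult_right_mono)
        have "\<bar>C\<bar> + 1 \<le> 1 / e" using elim(2) by (simp add: field_simps)
        then show "C \<le> 1 / e" by linarith
      qed (use elim(2) in auto)
      finally show "\<bar>pd \<alpha> (coord c (t e) I J) y\<bar> \<le> 1 / e ^ Suc N" by simp
    qed
  qed
  from ev_cball[OF half_gt_zero[OF \<rho>(1)] this] show "emod x0 (\<lambda>e. pd \<alpha> (coord c (t e) I J))"
    unfolding emod_def by blast
qed

lemma negligible_Neg:
  assumes t: "t \<in> negligible_nets A r s" and c: "c \<in> A" and I: "I \<in> idx r" "J \<in> idx s"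
  shows "Neg (cran c) (\<lambda>e. coord c (t e) I J)"
proof (rule NegI[OF ch(2)[OF c]])
  show "Mod (cran c) (\<lambda>e. coord c (t e) I J)"
    using t moderate_Mod[OF _ c I] unfolding negligible_nets_def by blast
  fix x0 assume x0: "x0 \<in> cran c"
  obtain \<rho> where \<rho>: "\<rho> > 0" "cball x0 \<rho> \<subseteq> cran c"
    using open_contains_cball ch(2)[OF c] x0 by blast
  let ?K = "cinv c ` cball x0 \<rho>"
  have K: "compact ?K" by (rule compact_continuous_image[OF continuous_on_subset[OF ch(8)[OF c] \<rho>(2)] compact_cball])
  have Kc: "?K \<subseteq> cdom c" using ch(6)[OF c] \<rho>(2) by blast
  then have Ka: "?K \<subseteq> carrier_of A" using c by (auto simp: carrier_of_def)
  show "eneg x0 (\<lambda>e. coord c (t e) I J)" unfolding eneg_def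
  proof
    fix m :: nat
    have "net_bigo A r s ?K t (\<lambda>e. e ^ Suc m)" using t K Ka unfolding negligible_nets_def by blast
    from net_bigo_comp[OF this c Kc] obtain C where
      C: "\<forall>\<^sub>F e in at_right 0. \<forall>p\<in>?K. \<forall>I\<in>idx r. \<forall>J\<in>idx s. \<bar>t e c p I J\<bar> \<le> C * e ^ Suc m" by blast
    have "\<forall>\<^sub>F e in at_right (0::real). 0 < e \<and> e < 1 / (\<bar>C\<bar> + 1)"
      unfolding eventually_at_right_field by (intro exI[of _ "1 / (\<bar>C\<bar> + 1)"]) auto
    with C have "\<forall>\<^sub>F e in at_right 0. \<forall>y\<in>cball x0 \<rho>. \<bar>coord c (t e) I J y\<bar> \<le> e ^ m"
    proof eventually_elim
      case (elim e)
      show ?case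
      proof
        fix y assume y: "y \<in> cball x0 \<rho>"
        have "\<bar>coord c (t e) I J y\<bar> \<le> C * e ^ Suc m" unfolding coord_def using elim(1) y I by (metis imageI)
        also have "\<dots> = (C * e) * e ^ m" by simp
        also have "\<dots> \<le> 1 * e ^ m"
        proof (rule mult_right_mono)
          have "(\<bar>C\<bar> + 1) * e \<le> 1" using elim(2) by (simp add: field_simps)
          moreover have "C * e \<le> (\<bar>C\<bar> + 1) * e" using elim(2) by (intro mult_right_mono) auto
          ultimately show "C * e \<le> 1" by linarith
        qed (use elim(2) in auto)
        finally show "\<bar>coord c (t e) I J y\<bar> \<le> e ^ m" by simp
      qed
    qed
    from ev_cball[OF \<rho>(1) this] show "ev x0 (\<lambda>e y. \<bar>coord c (t e) I J y\<bar> \<le> e ^ m)" .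
  qed
qed

lemma restr_tensor:
  assumes V: "open V" and t: "t \<in> Ck_tensor k A r s"
  shows "tens (restr A V) r s t \<in> Ck_tensor k (restr A V) r s"
proof (rule tensorI)
  interpret B: atlas "restr A V" by (rule restr_atlas[OF V])
  show "tens (restr A V) r s t c p I J = 0" if "\<not> (c \<in> restr A V \<and> p \<in> cdom c \<and> I \<in> idx r \<and> J \<in> idx s)" for c p I J
    using that by (auto simp: tens_def)
  show "tens (restr A V) r s t c'' p I J = trf r s (jac c c'' p) (jac c'' c p) (tens (restr A V) r s t c p) I J"
    if "c \<in> restr A V" "c'' \<in> restr A V" "p \<in> cdom c" "p \<in> cdom c''" "I \<in> idx r" "J \<in> idx s" for c c'' p I J
  proof -
    have "t c'' p I J = trf r s (jac c c'' p) (jac c'' c p) (t c p) I J"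
      using tensor_law[OF t _ _ that(3,4,5,6)] that(1,2) by (simp add: restr_def)
    moreover have "trf r s (jac c c'' p) (jac c'' c p) (t c p) I J = trf r s (jac c c'' p) (jac c'' c p) (tens (restr A V) r s t c p) I J"
      by (rule trf_cong) (use that in \<open>simp add: tens_def\<close>)
    ultimately show ?thesis using that by (simp add: tens_def)
  qed
  fix c and I J :: "'n list" assume cc: "c \<in> restr A V" "I \<in> idx r" "J \<in> idx s"
  have "Ck_on k (cran c) (coord c t I J)" using tensor_Ck[OF t _ cc(2,3)] cc(1) by (simp add: restr_def)
  then show "Ck_on k (cran c) (coord c (tens (restr A V) r s t) I J)"
    by (rule Ck_cong[OF B.ch(2)[OF cc(1)], rotated]) (use B.ch(6)[OF cc(1)] cc in \<open>simp add: coord_def tens_def\<close>)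
qed

text \<open>From components to norms. Near a point the matrix of an arbitrary metric is bounded in one chart, which bounds the fibre norm by the components.
The norm is the same in all charts, so finitely many charts cover the compact set.\<close>

lemma net_bigo_local:
  assumes q: "\<And>e. e \<in> {0<..1} \<Longrightarrow> q e \<in> smooth_tensor A r 0" and K: "compact K"
    and b: "\<And>e. 0 < e \<Longrightarrow> 0 \<le> b e"
    and l: "\<And>p. p \<in> K \<Longrightarrow> \<exists>c\<in>A. p \<in> cdom c \<and> (\<forall>I\<in>idx r. ev (cmap c p) (\<lambda>e y. \<bar>coord c (q e) I [] y\<bar> \<le> b e))"
  shows "net_bigo A r 0 K q b"
  unfolding net_bigo_def
proof (intro allI impI)
  fix V h assume "open V \<and> K \<subseteq> V \<and> riem_metric (restr A V) h"
  then have V: "open V" "K \<subseteq> V" and h: "h \<in> smooth_tensor (restr A V) 0 2" unfolding riem_metric_def by blast+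
  interpret B: atlas "restr A V" by (rule restr_atlas[OF V(1)])
  have "\<exists>U C d. open U \<and> p \<in> U \<and> 0 < d \<and> 0 \<le> C \<and> (\<forall>e c q'. 0 < e \<longrightarrow> e < d \<longrightarrow> q' \<in> U \<longrightarrow> c \<in> restr A V \<longrightarrow> q' \<in> cdom c \<longrightarrow>
      fibre_norm h r 0 c q' (q e c q') \<le> C * b e)" if p: "p \<in> K" for p
  proof -
    obtain c where c: "c \<in> A" "p \<in> cdom c" and e: "\<And>I. I \<in> idx r \<Longrightarrow> ev (cmap c p) (\<lambda>e y. \<bar>coord c (q e) I [] y\<bar> \<le> b e)"
      using l[OF p] by blast
    \<comment> \<open>the metric h lives on V only, so the chart is shrunk to V; this does not change components\<close>
    define c2 where "c2 = (cdom c \<inter> V, cmap c)"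
    have c2A: "c2 \<in> A" unfolding c2_def by (rule restr_mem[OF c(1) V(1)])
    then have c2: "c2 \<in> restr A V" by (simp add: restr_def c2_def)
    have p2: "p \<in> cdom c2" using c p V by (auto simp: c2_def)
    let ?x = "cmap c2 p"
    have x: "?x \<in> cran c2" using B.ch(5)[OF c2 p2] .
    have "eventually (\<lambda>ey. \<forall>I\<in>idx r. \<bar>coord c (q (fst ey)) I [] (snd ey)\<bar> \<le> b (fst ey)) (at_right 0 \<times>\<^sub>F nhds (cmap c p))"
      using e unfolding ev_filter by (intro eventually_ball_finite) auto
    then have ev1: "ev ?x (\<lambda>e y. \<forall>I\<in>idx r. \<bar>coord c (q e) I [] y\<bar> \<le> b e)" unfolding ev_filter c2_def by simp
    have ev2: "ev ?x (\<lambda>e y. \<forall>i j. \<bar>gmat h c2 (cinv c2 y) $ i $ j\<bar> < (\<Sum>i\<in>UNIV. \<Sum>j\<in>UNIV. \<bar>gmat h c2 (cinv c2 ?x) $ i $ j\<bar>) + 1)"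
    proof -
      let ?B = "(\<Sum>i\<in>UNIV. \<Sum>j\<in>UNIV. \<bar>gmat h c2 (cinv c2 ?x) $ i $ j\<bar>)"
      have "ev ?x (\<lambda>e y. \<bar>gmat h c2 (cinv c2 y) $ i $ j\<bar> < ?B + 1)" for i j
      proof -
        have "isCont (\<lambda>y. gmat h c2 (cinv c2 y) $ i $ j) ?x"
          using gmat_smooth[OF h c2] x B.ch(2)[OF c2] unfolding Ck_on_def
          by (metis continuous_on_eq_continuous_at enat_ord_code(3) pd.simps(1))
        from isCont_bounded[OF this]
        show ?thesis
        proof (rule ev_mono)
          have "\<bar>gmat h c2 (cinv c2 ?x) $ i $ j\<bar> \<le> (\<Sum>j\<in>UNIV. \<bar>gmat h c2 (cinv c2 ?x) $ i $ j\<bar>)"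
            by (rule member_le_sum) auto
          also have "\<dots> \<le> ?B" by (rule member_le_sum[of i UNIV "\<lambda>i. \<Sum>j\<in>UNIV. \<bar>gmat h c2 (cinv c2 ?x) $ i $ j\<bar>"]) (auto intro: sum_nonneg)
          finally show "\<bar>gmat h c2 (cinv c2 y) $ i $ j\<bar> < ?B + 1"
            if "\<bar>gmat h c2 (cinv c2 y) $ i $ j\<bar> < \<bar>gmat h c2 (cinv c2 ?x) $ i $ j\<bar> + 1" for e :: real and y using that by linarith
        qed
      qed
      then have "eventually (\<lambda>ey. \<forall>i j. \<bar>gmat h c2 (cinv c2 (snd ey)) $ i $ j\<bar> < ?B + 1) (at_right (0::real) \<times>\<^sub>F nhds ?x)"
        unfolding ev_filter by (intro eventually_all_finite)
      then show ?thesis unfolding ev_filter by simp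
    qed
    obtain d where d: "d > 0" "\<And>e y. 0 < e \<Longrightarrow> e < d \<Longrightarrow> dist y ?x < d \<Longrightarrow>
      (\<forall>I\<in>idx r. \<bar>coord c (q e) I [] y\<bar> \<le> b e) \<and>
      (\<forall>i j. \<bar>gmat h c2 (cinv c2 y) $ i $ j\<bar> < (\<Sum>i\<in>UNIV. \<Sum>j\<in>UNIV. \<bar>gmat h c2 (cinv c2 ?x) $ i $ j\<bar>) + 1)"
      using ev_conj[OF ev1 ev2] unfolding ev_def by blast
    define B where "B = (\<Sum>i\<in>UNIV. \<Sum>j\<in>UNIV. \<bar>gmat h c2 (cinv c2 ?x) $ i $ j\<bar>) + 1"
    have B: "B \<ge> 0" unfolding B_def by (intro add_nonneg_nonneg sum_nonneg) auto
    define U where "U = cdom c2 \<inter> cmap c2 -` ball ?x d"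
    have U: "open U" unfolding U_def by (rule continuous_open_preimage[OF B.ch(7)[OF c2] B.ch(1)[OF c2] open_ball])
    let ?N = "real (card (idx r :: 'n list set))"
    define C where "C = sqrt (?N\<^sup>2 * B ^ r)"
    have "fibre_norm h r 0 c' q' (q e c' q') \<le> C * b e"
      if a: "0 < e" "e < min d 1" "q' \<in> U" "c' \<in> restr A V" "q' \<in> cdom c'" for e c' q'
    proof -
      have q2: "q' \<in> cdom c2" "dist (cmap c2 q') ?x < d" using a(3) by (auto simp: U_def dist_commute)
      have qc: "q' \<in> cdom c" using q2 by (simp add: c2_def)
      have tq: "q e \<in> smooth_tensor A r 0" using q a by auto
      have tB: "tens (restr A V) r 0 (q e) \<in> smooth_tensor (restr A V) r 0"
        by (rule restr_tensor[OF V(1) tq])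
      have e1: "fibre_norm h r 0 c'' q' (q e c'' q') = fibre_norm h r 0 c'' q' (tens (restr A V) r 0 (q e) c'' q')"
        if "c'' \<in> restr A V" "q' \<in> cdom c''" for c''
        unfolding fibre_norm_upper upper_form_def using that by (simp add: tens_def)
      have "fibre_norm h r 0 c' q' (q e c' q') = fibre_norm h r 0 c2 q' (q e c2 q')"
        unfolding e1[OF a(4,5)] e1[OF c2 q2(1)] by (rule B.fibre_norm_indep[OF h tB c2 a(4) q2(1) a(5)])
      also have "\<dots> \<le> sqrt (?N\<^sup>2 * B ^ r * (b e)\<^sup>2)"
        unfolding fibre_norm_upper
      proof (rule real_sqrt_le_mono, rule upper_form_bound)
        note D = d(2)[OF a(1) _ q2(2)]
        show "\<bar>gmat h c2 q' $ i $ j\<bar> \<le> B" for i j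
        proof -
          have "\<bar>gmat h c2 (cinv c2 (cmap c2 q')) $ i $ j\<bar> < B" using D a(2) unfolding B_def by auto
          then show ?thesis using B.ch(3)[OF c2 q2(1)] by simp
        qed
        fix I :: "'n list" assume I: "I \<in> idx r"
        have "q e c2 q' I [] = q e c q' I []"
          using tensor_law[OF tq c(1) c2A qc q2(1) I, of "[]"]
            jac_same_map[OF c(1) c2A _ qc q2(1)] jac_same_map[OF c2A c(1) _ q2(1) qc] I
          by (simp add: c2_def trf_id)
        also have "\<dots> = coord c (q e) I [] (cmap c2 q')" using ch(3)[OF c(1) qc] by (simp add: coord_def c2_def)
        finally show "\<bar>q e c2 q' I []\<bar> \<le> b e" using D a(2) I by auto
      qed
      also have "\<dots> = C * b e" unfolding C_def using b[OF a(1)] by (simp add: real_sqrt_mult)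
      finally show ?thesis .
    qed
    moreover have "p \<in> U" using p2 d(1) by (simp add: U_def)
    moreover have "C \<ge> 0" unfolding C_def using B by simp
    ultimately show ?thesis using U d(1) by (intro exI[of _ U] exI[of _ C] exI[of _ "min d 1"]) auto
  qed
  then obtain U C d where *: "\<And>p. p \<in> K \<Longrightarrow> open (U p) \<and> p \<in> U p \<and> 0 < d p \<and> (0::real) \<le> C p \<and> (\<forall>e c q'. 0 < e \<longrightarrow> e < d p \<longrightarrow> q' \<in> U p \<longrightarrow> c \<in> restr A V \<longrightarrow> q' \<in> cdom c \<longrightarrow>
      fibre_norm h r 0 c q' (q e c q') \<le> C p * b e)" by metis
  have "K \<subseteq> (\<Union>p\<in>K. U p)" using * by blast
  then obtain F where F: "F \<subseteq> K" "finite F" "K \<subseteq> (\<Union>p\<in>F. U p)"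
    using compactE_image[OF K, of K U] * by metis
  have "eventually (\<lambda>e. 0 < e \<and> e < d x) (at_right (0::real))" if "x \<in> F" for x
    using *[of x] that F(1) eventually_at_right_field[of "\<lambda>e. 0 < e \<and> e < d x" 0] by blast
  then have "eventually (\<lambda>e. \<forall>x\<in>F. 0 < e \<and> e < d x) (at_right (0::real))"
    using F(2) by (intro eventually_ball_finite ballI) auto
  moreover have "eventually (\<lambda>e. 0 < e) (at_right (0::real))" unfolding eventually_at_right_field by (intro exI[of _ 1]) auto
  ultimately have "\<forall>\<^sub>F e in at_right 0. \<forall>c\<in>restr A V. \<forall>p\<in>K \<inter> cdom c. fibre_norm h r 0 c p (q e c p) \<le> (\<Sum>x\<in>F. C x) * b e"
  proof eventually_elim
    case (elim e)
    show ?case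
    proof (intro ballI)
      fix c p assume c: "c \<in> restr A V" and p: "p \<in> K \<inter> cdom c"
      then obtain x where x: "x \<in> F" "p \<in> U x" using F(3) by blast
      have "fibre_norm h r 0 c p (q e c p) \<le> C x * b e" using * elim x F(1) c p by blast
      also have "\<dots> \<le> (\<Sum>x\<in>F. C x) * b e"
        using x F(1,2) * b elim(2) by (intro mult_right_mono member_le_sum) auto
      finally show "fibre_norm h r 0 c p (q e c p) \<le> (\<Sum>x\<in>F. C x) * b e" .
    qed
  qed
  then show "\<exists>C. \<forall>\<^sub>F e in at_right 0. \<forall>c\<in>restr A V. \<forall>p\<in>K \<inter> cdom c. fibre_norm h r 0 c p (q e c p) \<le> C * b e" by blast
qed

text \<open>It is enough to check one chart around each point: in that chart every differential operator has smooth coefficients and preserves moderateness. The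
exponent depends on the point, and a compact set needs finitely many of them, which are bounded by their sum.\<close>

lemma moderateI:
  assumes t: "\<And>e. e \<in> {0<..1} \<Longrightarrow> t e \<in> smooth_tensor A r 0"
    and l: "\<And>p. p \<in> carrier_of A \<Longrightarrow> \<exists>c\<in>A. p \<in> cdom c \<and> (\<forall>I\<in>idx r. Mod (cran c) (\<lambda>e. coord c (t e) I []))"
  shows "t \<in> moderate A r 0"
  unfolding moderate_def
proof (intro CollectI conjI ballI allI impI)
  show "t e \<in> smooth_tensor A r 0" if "e \<in> {0<..1}" for e using t that .
  fix K P assume "compact K \<and> K \<subseteq> carrier_of A \<and> lin_diff_op A r 0 P"
  then have K: "compact K" "K \<subseteq> carrier_of A" and P: "lin_diff_op A r 0 P" by blast+
  have Pt: "P (t e) \<in> smooth_tensor A r 0" if "e \<in> {0<..1}" for e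
    using P t[OF that] unfolding lin_diff_op_def by blast
  have PM: "Mod (cran c) (\<lambda>e. coord c (P (t e)) I [])"
    if c: "c \<in> A" and M: "\<And>I. I \<in> idx r \<Longrightarrow> Mod (cran c) (\<lambda>e. coord c (t e) I [])" and I: "I \<in> idx r" for c I
  proof -
    obtain m where "\<forall>c\<in>A. \<exists>a. (\<forall>\<alpha> I J I' J'. Ck_on \<infinity> (cran c) (a \<alpha> I J I' J')) \<and>
        (\<forall>t\<in>smooth_tensor A r 0. \<forall>p\<in>cdom c. \<forall>I\<in>idx r. \<forall>J\<in>idx 0.
           P t c p I J = (\<Sum>\<alpha> | length \<alpha> \<le> m. \<Sum>I'\<in>idx r. \<Sum>J'\<in>idx 0.
             a \<alpha> I J I' J' (cmap c p) * pd \<alpha> (coord c t I' J') (cmap c p)))"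
      using P unfolding lin_diff_op_def by (elim conjE exE)
    from bspec[OF this c] obtain a where a: "\<And>\<alpha> I J I' J'. Ck_on \<infinity> (cran c) (a \<alpha> I J I' J')" and
      e: "\<And>t p I J. t\<in>smooth_tensor A r 0 \<Longrightarrow> p\<in>cdom c \<Longrightarrow> I\<in>idx r \<Longrightarrow> J\<in>idx 0 \<Longrightarrow>
           P t c p I J = (\<Sum>\<alpha> | length \<alpha> \<le> m. \<Sum>I'\<in>idx r. \<Sum>J'\<in>idx 0.
             a \<alpha> I J I' J' (cmap c p) * pd \<alpha> (coord c t I' J') (cmap c p))"
      by (elim exE conjE) blast
    have "Mod (cran c) (\<lambda>e y. \<Sum>\<alpha> | length \<alpha> \<le> m. \<Sum>I'\<in>idx r. \<Sum>J'\<in>idx 0.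
             a \<alpha> I [] I' J' y * pd \<alpha> (coord c (t e) I' J') y)"
      by (intro Mod_sum Mod_mult Mod_const Mod_pd a ch(2)[OF c]) (auto intro: M)
    then show ?thesis
    proof (rule Mod_cong[OF ch(2)[OF c], rotated])
      fix e :: real and y assume "e \<in> {0<..1}" "y \<in> cran c"
      then show "(\<Sum>\<alpha> | length \<alpha> \<le> m. \<Sum>I'\<in>idx r. \<Sum>J'\<in>idx 0. a \<alpha> I [] I' J' y * pd \<alpha> (coord c (t e) I' J') y)
         = coord c (P (t e)) I [] y"
        using e[OF t ch(6)[OF c] I, of e y "[]"] ch(4)[OF c] by (simp add: coord_def)
    qed
  qed
  define Q where "Q = (\<lambda>p c (N::nat) d. c \<in> A \<and> p \<in> cdom c \<and> 0 < d \<and> (\<forall>I\<in>idx r. \<forall>e y. 0 < e \<longrightarrow> e < d \<longrightarrow> dist y (cmap c p) < d \<longrightarrow>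
      \<bar>coord c (P (t e)) I [] y\<bar> \<le> 1 / e ^ N))"
  have "\<exists>c N d. Q p c N d" if p: "p \<in> K" for p
  proof -
    obtain c where c: "c \<in> A" "p \<in> cdom c" and M: "\<And>I. I \<in> idx r \<Longrightarrow> Mod (cran c) (\<lambda>e. coord c (t e) I [])"
      using l K p by blast
    have "emod (cmap c p) (\<lambda>e. pd [] (coord c (P (t e)) I []))" if "I \<in> idx r" for I
      using PM[OF c(1) M that] ch(5)[OF c] unfolding Mod_iff by blast
    then have "\<forall>I\<in>idx r. \<exists>N::nat. ev (cmap c p) (\<lambda>e y. \<bar>coord c (P (t e)) I [] y\<bar> \<le> 1 / e ^ N)"
      unfolding emod_def by simp
    from bchoice[OF this] obtain N :: "'n list \<Rightarrow> nat"
      where N: "\<And>I. I \<in> idx r \<Longrightarrow> ev (cmap c p) (\<lambda>e y. \<bar>coord c (P (t e)) I [] y\<bar> \<le> 1 / e ^ N I)"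
      by blast
    have "ev (cmap c p) (\<lambda>e y. \<bar>coord c (P (t e)) I [] y\<bar> \<le> 1 / e ^ (\<Sum>I\<in>idx r. N I))" if "I \<in> idx r" for I
      by (rule emod_mono[OF N[OF that]]) (rule member_le_sum, use that in auto)
    then have "eventually (\<lambda>z. \<forall>I\<in>idx r. \<bar>coord c (P (t (fst z))) I [] (snd z)\<bar> \<le> 1 / fst z ^ (\<Sum>I\<in>idx r. N I)) (at_right 0 \<times>\<^sub>F nhds (cmap c p))"
      unfolding ev_filter by (intro eventually_ball_finite) auto
    then have "ev (cmap c p) (\<lambda>e y. \<forall>I\<in>idx r. \<bar>coord c (P (t e)) I [] y\<bar> \<le> 1 / e ^ (\<Sum>I\<in>idx r. N I))"
      unfolding ev_filter by simp
    then show ?thesis unfolding ev_def Q_def using c by blast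
  qed
  then obtain c N d where Q: "\<And>p. p \<in> K \<Longrightarrow> Q p (c p) (N p) (d p)" by metis
  have *: "c p \<in> A \<and> p \<in> cdom (c p) \<and> 0 < d p \<and> (\<forall>I\<in>idx r. \<forall>e y. 0 < e \<longrightarrow> e < d p \<longrightarrow> dist y (cmap (c p) p) < d p \<longrightarrow>
      \<bar>coord (c p) (P (t e)) I [] y\<bar> \<le> 1 / e ^ N p)" if "p \<in> K" for p
    using Q[OF that] unfolding Q_def .
  define U where "U = (\<lambda>p. cdom (c p) \<inter> cmap (c p) -` ball (cmap (c p) p) (d p))"
  have U: "open (U p)" if "p \<in> K" for p unfolding U_def
    using * that ch(7,1) by (intro continuous_open_preimage) auto
  have "K \<subseteq> (\<Union>p\<in>K. U p)" using * by (auto simp: U_def)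
  then obtain F where F: "F \<subseteq> K" "finite F" "K \<subseteq> (\<Union>p\<in>F. U p)"
    using compactE_image[OF K(1), of K U] U by metis
  have "net_bigo A r 0 K (\<lambda>e. P (t e)) (\<lambda>e. 1 / e ^ (\<Sum>x\<in>F. N x))"
  proof (rule net_bigo_local[OF Pt K(1)])
    fix p assume p: "p \<in> K"
    then obtain x where x: "x \<in> F" "p \<in> U x" using F(3) by blast
    then have xK: "x \<in> K" using F(1) by blast
    have "ev (cmap (c x) p) (\<lambda>e y. \<bar>coord (c x) (P (t e)) I [] y\<bar> \<le> 1 / e ^ (\<Sum>x\<in>F. N x))" if "I \<in> idx r" for I
    proof (rule emod_mono)
      have "cmap (c x) p \<in> ball (cmap (c x) x) (d x)" using x(2) by (simp add: U_def)
      from ev_conj[OF ev_open[OF open_ball this] ev_small[of "d x"]] *[OF xK]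
      have "ev (cmap (c x) p) (\<lambda>e y. y \<in> ball (cmap (c x) x) (d x) \<and> 0 < e \<and> e < d x)" by blast
      then show "ev (cmap (c x) p) (\<lambda>e y. \<bar>coord (c x) (P (t e)) I [] y\<bar> \<le> 1 / e ^ N x)"
        by (rule ev_mono) (use *[OF xK] that in \<open>simp add: dist_commute\<close>)
    qed (use x F(2) in \<open>auto intro: member_le_sum\<close>)
    then show "\<exists>c\<in>A. p \<in> cdom c \<and> (\<forall>I\<in>idx r. ev (cmap c p) (\<lambda>e y. \<bar>coord c (P (t e)) I [] y\<bar> \<le> 1 / e ^ (\<Sum>x\<in>F. N x)))"
      using *[OF xK] x(2) by (intro bexI[of _ "c x"]) (auto simp: U_def)
  qed auto
  then show "\<exists>N::nat. net_bigo A r 0 K (\<lambda>e. P (t e)) (\<lambda>e. 1 / e ^ N)" by blast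
qed

lemma negligibleI:
  assumes t: "\<And>e. e \<in> {0<..1} \<Longrightarrow> t e \<in> smooth_tensor A r 0"
    and l: "\<And>p. p \<in> carrier_of A \<Longrightarrow> \<exists>c\<in>A. p \<in> cdom c \<and> (\<forall>I\<in>idx r. Neg (cran c) (\<lambda>e. coord c (t e) I []))"
  shows "t \<in> negligible_nets A r 0"
  unfolding negligible_nets_def
proof (intro CollectI conjI allI impI)
  show "t \<in> moderate A r 0" by (rule moderateI[OF t]) (use l Neg_Mod in blast)+
  fix K and m :: nat assume K: "compact K \<and> K \<subseteq> carrier_of A"
  show "net_bigo A r 0 K t (\<lambda>e. e ^ m)"
  proof (rule net_bigo_local[OF t])
    fix p assume "p \<in> K"
    then obtain c where c: "c \<in> A" "p \<in> cdom c" and M: "\<And>I. I \<in> idx r \<Longrightarrow> Neg (cran c) (\<lambda>e. coord c (t e) I [])"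
      using l K by blast
    have "eneg (cmap c p) (\<lambda>e. pd [] (coord c (t e) I []))" if "I \<in> idx r" for I
      using M[OF that] ch(5)[OF c] unfolding Neg_iff by blast
    then show "\<exists>c\<in>A. p \<in> cdom c \<and> (\<forall>I\<in>idx r. ev (cmap c p) (\<lambda>e y. \<bar>coord c (t e) I [] y\<bar> \<le> e ^ m))"
      using c unfolding eneg_def by auto
  qed (use K in auto)
qed

end

section \<open>Algebra of tensor fields\<close>

lemma trf_add: "trf r s M N (\<lambda>I J. F I J + G I J) I J = trf r s M N F I J + trf r s M N G I J"
  by (simp add: trf_def algebra_simps sum.distrib)

lemma trf_scale: "trf r s M N (\<lambda>I J. a * F I J) I J = a * trf r s M N F I J"
  by (simp add: trf_def sum_distrib_left mult_ac)

lemma from_chart_add: "tadd (from_chart A c r s F) (from_chart A c r s G) = from_chart A c r s (\<lambda>x I J. F x I J + G x I J)"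
  by (intro ext) (simp add: tadd_def from_chart_def tens_def trf_add)

lemma from_chart_fscale:
  "fscale (from_chart A c 0 0 U) (from_chart A c r s F) = from_chart A c r s (\<lambda>x I J. U x [] [] * F x I J)"
  by (intro ext) (simp add: fscale_def from_chart_def tens_def trf_fun trf_scale)

lemma from_chart_cong:
  assumes "is_chart c" "\<And>x I J. x \<in> cran c \<Longrightarrow> I \<in> idx r \<Longrightarrow> J \<in> idx s \<Longrightarrow> F x I J = G x I J"
  shows "from_chart A c r s F = from_chart A c r s G"
proof (intro ext)
  fix c' p I J
  have "trf r s M N (F (cmap c p)) I J = trf r s M N (G (cmap c p)) I J" if "p \<in> cdom c" for M N
    by (rule trf_cong) (use assms(2)[OF is_chartD(5)[OF assms(1) that]] in auto)
  then show "from_chart A c r s F c' p I J = from_chart A c r s G c' p I J"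
    by (simp add: from_chart_def tens_def)
qed

lemma from_chart_cut:
  assumes "t \<in> Ck_tensor k A r s" "c \<in> A" and that: "is_chart c"
  shows "fscale (from_chart A c 0 0 U) t = from_chart A c r s (\<lambda>x I J. U x [] [] * coord c t I J x)"
proof (intro ext)
  fix c' p I J
  show "fscale (from_chart A c 0 0 U) t c' p I J = from_chart A c r s (\<lambda>x I J. U x [] [] * coord c t I J x) c' p I J"
  proof (cases "c' \<in> A \<and> p \<in> cdom c' \<and> p \<in> cdom c \<and> I \<in> idx r \<and> J \<in> idx s")
    case True
    then have "t c' p I J = trf r s (jac c c' p) (jac c' c p) (t c p) I J" using tensor_law[OF assms(1,2)] by blast
    then show ?thesis using True is_chartD(3)[OF that]
      by (simp add: fscale_def from_chart_def tens_def trf_fun trf_scale coord_def)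
  next
    case False
    then have "t c' p I J = 0 \<or> p \<notin> cdom c" using tensor_zero[OF assms(1)] by blast
    then show ?thesis using False by (auto simp: fscale_def from_chart_def tens_def)
  qed
qed

context atlas
begin

lemma tadd_tensor: "t \<in> Ck_tensor k A r s \<Longrightarrow> u \<in> Ck_tensor k A r s \<Longrightarrow> tadd t u \<in> Ck_tensor k A r s"
  by (rule tensorI)
    (auto simp: tadd_def tensor_zero tensor_law trf_add coord_def[abs_def] intro!: Ck_add ch(2) tensor_Ck[unfolded coord_def[abs_def]])

lemma tsub_tensor: "t \<in> Ck_tensor k A r s \<Longrightarrow> u \<in> Ck_tensor k A r s \<Longrightarrow> tsub t u \<in> Ck_tensor k A r s"
proof (rule tensorI)
  assume t: "t \<in> Ck_tensor k A r s" and u: "u \<in> Ck_tensor k A r s"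
  show "tsub t u c p I J = 0" if "\<not> (c \<in> A \<and> p \<in> cdom c \<and> I \<in> idx r \<and> J \<in> idx s)" for c p I J
    using tensor_zero[OF t that] tensor_zero[OF u that] by (simp add: tsub_def)
  show "tsub t u c' p I J = trf r s (jac c c' p) (jac c' c p) (tsub t u c p) I J"
    if "c \<in> A" "c' \<in> A" "p \<in> cdom c" "p \<in> cdom c'" "I \<in> idx r" "J \<in> idx s" for c c' p I J
    using tensor_law[OF t that] tensor_law[OF u that] by (simp add: tsub_def trf_def algebra_simps sum_subtractf)
  show "Ck_on k (cran c) (coord c (tsub t u) I J)" if "c \<in> A" "I \<in> idx r" "J \<in> idx s" for c I J
    using Ck_diff[OF ch(2)[OF that(1)] tensor_Ck[OF t that] tensor_Ck[OF u that]]
    by (simp add: coord_def[abs_def] tsub_def)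
qed

lemma fun_inv:
  assumes "u \<in> Ck_tensor k A 0 0" "c \<in> A" "c' \<in> A" "p \<in> cdom c" "p \<in> cdom c'"
  shows "u c' p [] [] = u c p [] []"
  using tensor_law[OF assms, of "[]" "[]"] by (simp add: trf_fun)

lemma fscale_tensor: "u \<in> Ck_tensor k A 0 0 \<Longrightarrow> t \<in> Ck_tensor k A r s \<Longrightarrow> fscale u t \<in> Ck_tensor k A r s"
proof (rule tensorI)
  assume u: "u \<in> Ck_tensor k A 0 0" and t: "t \<in> Ck_tensor k A r s"
  show "fscale u t c p I J = 0" if "\<not> (c \<in> A \<and> p \<in> cdom c \<and> I \<in> idx r \<and> J \<in> idx s)" for c p I J
    using tensor_zero[OF t that] by (simp add: fscale_def)
  show "fscale u t c' p I J = trf r s (jac c c' p) (jac c' c p) (fscale u t c p) I J"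
    if "c \<in> A" "c' \<in> A" "p \<in> cdom c" "p \<in> cdom c'" "I \<in> idx r" "J \<in> idx s" for c c' p I J
    using tensor_law[OF t that] fun_inv[OF u that(1-4)] by (simp add: fscale_def trf_scale)
  show "Ck_on k (cran c) (coord c (fscale u t) I J)" if "c \<in> A" "I \<in> idx r" "J \<in> idx s" for c I J
    using Ck_mult[OF ch(2)[OF that(1)] tensor_Ck[OF u that(1), of "[]" "[]"] tensor_Ck[OF t that]]
    by (simp add: coord_def[abs_def] fscale_def)
qed

definition vcomp :: "('a, 'n) tensor \<Rightarrow> ('a, 'n) chart \<Rightarrow> 'a \<Rightarrow> real^'n" where
  "vcomp t c p = (\<chi> k. t c p [k] [])"

lemma vcomp_law:
  assumes "t \<in> Ck_tensor k A 1 0" "c \<in> A" "c' \<in> A" "p \<in> cdom c" "p \<in> cdom c'"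
  shows "vcomp t c' p = jac c c' p *v vcomp t c p"
  using tensor_law[OF assms, of "[_]" "[]"]
  by (simp add: vec_eq_iff vcomp_def matrix_vector_mult_def trf_vec idx_1)

lemma contr2_eq:
  "c \<in> A \<Longrightarrow> p \<in> cdom c \<Longrightarrow> contr2 A g \<eta> \<zeta> c p [] [] = vcomp \<eta> c p \<bullet> (gmat g c p *v vcomp \<zeta> c p)"
  by (simp add: contr2_def tens_def vcomp_def gmat_def inner_vec_def matrix_vector_mult_def sum_distrib_left mult_ac)

text \<open>The pairing is invariant, since the matrix of the metric and the components of the vectors transform by the same Jacobian.\<close>

lemma contr2_tensor:
  assumes g: "g \<in> Ck_tensor k A 0 2" and \<eta>: "\<eta> \<in> Ck_tensor k A 1 0" and \<zeta>: "\<zeta> \<in> Ck_tensor k A 1 0"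
  shows "contr2 A g \<eta> \<zeta> \<in> Ck_tensor k A 0 0"
proof (rule tensorI)
  show "contr2 A g \<eta> \<zeta> c p I J = 0" if "\<not> (c \<in> A \<and> p \<in> cdom c \<and> I \<in> idx 0 \<and> J \<in> idx 0)" for c p I J
    using that by (auto simp: contr2_def tens_def)
  show "contr2 A g \<eta> \<zeta> c' p I J = trf 0 0 (jac c c' p) (jac c' c p) (contr2 A g \<eta> \<zeta> c p) I J"
    if a: "c \<in> A" "c' \<in> A" "p \<in> cdom c" "p \<in> cdom c'" and "I \<in> idx 0" "J \<in> idx 0" for c c' p I J
  proof -
    let ?J = "jac c c' p"
    have "vcomp \<eta> c p \<bullet> (gmat g c p *v vcomp \<zeta> c p) = vcomp \<eta> c p \<bullet> (transpose ?J *v (gmat g c' p *v (?J *v vcomp \<zeta> c p)))"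
      unfolding gmat_law[OF g a] by (simp add: matrix_vector_mul_assoc matrix_mul_assoc)
    also have "\<dots> = (?J *v vcomp \<eta> c p) \<bullet> (gmat g c' p *v (?J *v vcomp \<zeta> c p))"
      unfolding dot_lmul_matrix[symmetric] vector_transpose_matrix ..
    also have "\<dots> = vcomp \<eta> c' p \<bullet> (gmat g c' p *v vcomp \<zeta> c' p)"
      unfolding vcomp_law[OF \<eta> a] vcomp_law[OF \<zeta> a] ..
    finally show ?thesis using that by (simp add: contr2_eq trf_fun)
  qed
  show "Ck_on k (cran c) (coord c (contr2 A g \<eta> \<zeta>) I J)" if c: "c \<in> A" and I: "I \<in> idx 0" "J \<in> idx 0" for c I J
  proof -
    have "Ck_on k (cran c) (\<lambda>x. \<Sum>i\<in>UNIV. \<Sum>j\<in>UNIV. coord c g [] [i, j] x * coord c \<eta> [i] [] x * coord c \<zeta> [j] [] x)"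
      by (intro Ck_sum Ck_mult ch(2)[OF c] tensor_Ck[OF g c] tensor_Ck[OF \<eta> c] tensor_Ck[OF \<zeta> c]) (auto simp: idx_2 idx_1)
    then show ?thesis
      by (rule Ck_cong[OF ch(2)[OF c], rotated]) (use c I ch(6)[OF c] in \<open>simp add: coord_def contr2_def tens_def\<close>)
  qed
qed

section \<open>Classes of nets of tensor fields\<close>

lemma moderate_smooth: "t \<in> moderate A r s \<Longrightarrow> e \<in> {0<..1} \<Longrightarrow> t e \<in> smooth_tensor A r s"
  unfolding moderate_def by blast

end

text \<open>Equality of nets of functions in the sense of generalized functions.\<close>

definition Neq :: "(real^'n::finite) set \<Rightarrow> (real \<Rightarrow> real^'n \<Rightarrow> real) \<Rightarrow> (real \<Rightarrow> real^'n \<Rightarrow> real) \<Rightarrow> bool" where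
  "Neq S f g \<longleftrightarrow> Neg S (\<lambda>e y. f e y - g e y)"

lemma Neq_on: "open S \<Longrightarrow> (\<And>e y. e \<in> {0<..1} \<Longrightarrow> y \<in> S \<Longrightarrow> f e y = g e y) \<Longrightarrow> Neq S f g"
  unfolding Neq_def by (rule Neg_cong[OF _ _ Neg_zero]) auto

lemma Neq_refl: "Neq S f f" unfolding Neq_def by (simp add: Neg_zero)

lemma Neq_sym: "open S \<Longrightarrow> Neq S f g \<Longrightarrow> Neq S g f"
  unfolding Neq_def by (drule Neg_diff[OF _ Neg_zero], assumption) simp

lemma Neq_trans: "open S \<Longrightarrow> Neq S f g \<Longrightarrow> Neq S g h \<Longrightarrow> Neq S f h"
  unfolding Neq_def using Neg_add[of S "\<lambda>e y. f e y - g e y" "\<lambda>e y. g e y - h e y"] by simp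

lemma Neq_add: "open S \<Longrightarrow> Neq S f f' \<Longrightarrow> Neq S g g' \<Longrightarrow> Neq S (\<lambda>e y. f e y + g e y) (\<lambda>e y. f' e y + g' e y)"
  unfolding Neq_def using Neg_add[of S "\<lambda>e y. f e y - f' e y" "\<lambda>e y. g e y - g' e y"]
  by (simp add: algebra_simps)

lemma Neq_mult: "open S \<Longrightarrow> Mod S f \<Longrightarrow> Neq S g g' \<Longrightarrow> Neq S (\<lambda>e y. f e y * g e y) (\<lambda>e y. f e y * g' e y)"
  unfolding Neq_def using Neg_mult[of S f "\<lambda>e y. g e y - g' e y"] by (simp add: algebra_simps)

lemma Neq_mult2:
  assumes S: "open S" and "Mod S f" "Mod S g'" "Neq S f f'" "Neq S g g'"
  shows "Neq S (\<lambda>e y. f e y * g e y) (\<lambda>e y. f' e y * g' e y)"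
  using Neq_trans[OF S Neq_mult[OF S assms(2,5)]] Neq_mult[OF S assms(3,4)] by (simp add: mult.commute)

lemma Neq_sum: "open S \<Longrightarrow> (\<And>j. j \<in> J \<Longrightarrow> Neq S (f j) (g j)) \<Longrightarrow>
    Neq S (\<lambda>e y. \<Sum>j\<in>J. f j e y) (\<lambda>e y. \<Sum>j\<in>J. g j e y)"
  unfolding Neq_def using Neg_sum[of S J "\<lambda>j e y. f j e y - g j e y"] by (simp add: sum_subtractf)

lemma Neq_mono: "Neq S f g \<Longrightarrow> T \<subseteq> S \<Longrightarrow> Neq T f g"
  unfolding Neq_def by (rule Neg_mono)

lemma Mod_diffable: "Mod S f \<Longrightarrow> e \<in> {0<..1} \<Longrightarrow> x \<in> S \<Longrightarrow> pd \<alpha> (f e) differentiable at x"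
  unfolding Mod_iff by blast

lemma Neq_pd:
  assumes S: "open S" and f: "Mod S f" "Mod S g" and "Neq S f g"
  shows "Neq S (\<lambda>e. pd [i] (f e)) (\<lambda>e. pd [i] (g e))"
  unfolding Neq_def
proof (rule Neg_cong[OF S _ Neg_pd[OF assms(4)[unfolded Neq_def], of "[i]"]])
  fix e :: real and y assume e: "e \<in> {0<..1}" "y \<in> S"
  have d: "f e differentiable at y" "g e differentiable at y"
    using Mod_diffable[OF f(1) e, of "[]"] Mod_diffable[OF f(2) e, of "[]"] by simp_all
  then have d2: "(\<lambda>y. - 1 * g e y) differentiable at y" by (intro differentiable_mult) auto
  have "pd [i] (\<lambda>y. f e y - g e y) y = pd [i] (\<lambda>y. f e y + (-1) * g e y) y" by simp
  also have "\<dots> = pd [i] (f e) y + pd [i] (\<lambda>y. (-1) * g e y) y" by (rule pd_add[OF d(1) d2])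
  also have "\<dots> = pd [i] (f e) y - pd [i] (g e) y" using d(2) by (subst pd_mult) auto
  finally show "pd [i] (\<lambda>y. f e y - g e y) y = pd [i] (f e) y - pd [i] (g e) y" .
qed

abbreviation vc :: "('a, 'n::finite) chart \<Rightarrow> (real \<Rightarrow> ('a, 'n) tensor) \<Rightarrow> 'n \<Rightarrow> real \<Rightarrow> real^'n \<Rightarrow> real" where
  "vc c \<xi> l \<equiv> (\<lambda>e. coord c (\<xi> e) [l] [])"

abbreviation fc :: "('a, 'n::finite) chart \<Rightarrow> (real \<Rightarrow> ('a, 'n) tensor) \<Rightarrow> real \<Rightarrow> real^'n \<Rightarrow> real" where
  "fc c u \<equiv> (\<lambda>e. coord c (u e) [] [])"

context atlas
begin

lemma net_rel_Neq:
  assumes "(t, u) \<in> net_rel A r s" "c \<in> A" "I \<in> idx r" "J \<in> idx s"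
  shows "Neq (cran c) (\<lambda>e. coord c (t e) I J) (\<lambda>e. coord c (u e) I J)"
  using negligible_Neg[OF _ assms(2-4), of "\<lambda>e. tsub (t e) (u e)"] assms(1)
  unfolding Neq_def net_rel_def by (simp add: coord_def tsub_def)

text \<open>Equivalence of nets without lower indices can be checked in one chart around each point.\<close>

lemma net_relI:
  assumes t: "t \<in> moderate A r 0" and u: "u \<in> moderate A r 0"
    and l: "\<And>p. p \<in> carrier_of A \<Longrightarrow> \<exists>c\<in>A. p \<in> cdom c \<and>
        (\<forall>I\<in>idx r. Neq (cran c) (\<lambda>e. coord c (t e) I []) (\<lambda>e. coord c (u e) I []))"
  shows "(t, u) \<in> net_rel A r 0"
proof -
  have "(\<lambda>e. tsub (t e) (u e)) \<in> negligible_nets A r 0"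
    by (rule negligibleI)
      (use l moderate_smooth[OF t] moderate_smooth[OF u] tsub_tensor in \<open>auto simp: Neq_def coord_def tsub_def\<close>)
  then show ?thesis using t u unfolding net_rel_def by blast
qed

lemma chart_at: "p \<in> carrier_of A \<Longrightarrow> \<exists>c\<in>A. p \<in> cdom c"
  unfolding carrier_of_def by blast

lemma net_rel_iff:
  "(t, u) \<in> net_rel A r 0 \<longleftrightarrow> t \<in> moderate A r 0 \<and> u \<in> moderate A r 0 \<and>
    (\<forall>c\<in>A. \<forall>I\<in>idx r. Neq (cran c) (\<lambda>e. coord c (t e) I []) (\<lambda>e. coord c (u e) I []))"
proof
  assume a: "(t, u) \<in> net_rel A r 0"
  then show "t \<in> moderate A r 0 \<and> u \<in> moderate A r 0 \<and>
    (\<forall>c\<in>A. \<forall>I\<in>idx r. Neq (cran c) (\<lambda>e. coord c (t e) I []) (\<lambda>e. coord c (u e) I []))"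
    using net_rel_Neq[OF a, where J="[]"] by (auto simp: net_rel_def)
next
  assume a: "t \<in> moderate A r 0 \<and> u \<in> moderate A r 0 \<and>
    (\<forall>c\<in>A. \<forall>I\<in>idx r. Neq (cran c) (\<lambda>e. coord c (t e) I []) (\<lambda>e. coord c (u e) I []))"
  show "(t, u) \<in> net_rel A r 0"
    by (rule net_relI) (use a chart_at in blast)+
qed

lemma net_rel_refl: "t \<in> moderate A r 0 \<Longrightarrow> (t, t) \<in> net_rel A r 0"
  by (simp add: net_rel_iff Neq_refl)

lemma net_rel_sym: "(t, u) \<in> net_rel A r 0 \<Longrightarrow> (u, t) \<in> net_rel A r 0"
  unfolding net_rel_iff using Neq_sym[OF ch(2)] by blast

lemma net_rel_trans: "(t, u) \<in> net_rel A r 0 \<Longrightarrow> (u, v) \<in> net_rel A r 0 \<Longrightarrow> (t, v) \<in> net_rel A r 0"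
  unfolding net_rel_iff using Neq_trans[OF ch(2)] by blast

lemma Gen_moderate: "T \<in> Gen A r s \<Longrightarrow> t \<in> T \<Longrightarrow> t \<in> moderate A r s"
  unfolding Gen_def quotient_def net_rel_def by auto

lemma Gen_Neq:
  assumes "T \<in> Gen A r s" "t \<in> T" "u \<in> T" "c \<in> A" "I \<in> idx r" "J \<in> idx s"
  shows "Neq (cran c) (\<lambda>e. coord c (t e) I J) (\<lambda>e. coord c (u e) I J)"
proof -
  obtain v where "(v, t) \<in> net_rel A r s" "(v, u) \<in> net_rel A r s"
    using assms(1-3) unfolding Gen_def quotient_def by auto
  then show ?thesis
    using net_rel_Neq[OF _ assms(4-6)] Neq_trans[OF ch(2)[OF assms(4)]] Neq_sym[OF ch(2)[OF assms(4)]] by blast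
qed

lemma gcls_Gen: "t \<in> moderate A r 0 \<Longrightarrow> gcls A r 0 t \<in> Gen A r 0"
  unfolding Gen_def gcls_def by (rule quotientI)

lemma gcls_self: "t \<in> moderate A r 0 \<Longrightarrow> t \<in> gcls A r 0 t"
  unfolding gcls_def using net_rel_refl by blast

lemma gcls_eq_iff: "t \<in> moderate A r 0 \<Longrightarrow> gcls A r 0 t = gcls A r 0 u \<longleftrightarrow> (t, u) \<in> net_rel A r 0"
  unfolding gcls_def using net_rel_refl net_rel_sym net_rel_trans by blast

lemma Gen_gcls: "T \<in> Gen A r 0 \<Longrightarrow> t \<in> T \<Longrightarrow> T = gcls A r 0 t"
  unfolding Gen_def quotient_def gcls_def using net_rel_sym net_rel_trans by blast

lemma Gen_ex: "T \<in> Gen A r 0 \<Longrightarrow> \<exists>t. t \<in> T"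
  unfolding Gen_def quotient_def using net_rel_refl by blast

lemma gcls_cong:
  assumes "t \<in> moderate A r 0" "\<And>e. e \<in> {0<..1} \<Longrightarrow> t e = u e" "u \<in> moderate A r 0"
  shows "gcls A r 0 t = gcls A r 0 u"
  using assms gcls_eq_iff by (auto simp: net_rel_iff intro!: Neq_on ch(2))

lemma lift2_elem:
  "x \<in> lift2 A r s F T U \<Longrightarrow> \<exists>t\<in>T. \<exists>u\<in>U. (\<lambda>e. F (t e) (u e), x) \<in> net_rel A r s"
  unfolding lift2_def gcls_def by blast

text \<open>For an operation that respects equivalence the union in the definition of \<open>lift2\<close> is one class. This is not automatic: the class
of a net that is not moderate is empty.\<close>

lemma lift2_eq:
  assumes "t \<in> T" "u \<in> U" "(\<lambda>e. F (t e) (u e)) \<in> moderate A r 0"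
    and "\<And>t' u'. t' \<in> T \<Longrightarrow> u' \<in> U \<Longrightarrow> (\<lambda>e. F (t e) (u e), \<lambda>e. F (t' e) (u' e)) \<in> net_rel A r 0"
  shows "lift2 A r 0 F T U = gcls A r 0 (\<lambda>e. F (t e) (u e))"
proof -
  have "gcls A r 0 (\<lambda>e. F (t' e) (u' e)) = gcls A r 0 (\<lambda>e. F (t e) (u e))" if "t' \<in> T" "u' \<in> U" for t' u'
    using gcls_eq_iff[OF assms(3)] assms(4)[OF that] by blast
  then show ?thesis unfolding lift2_def using assms(1,2) by blast
qed

lemma moderate_vc: "\<xi> \<in> moderate A 1 0 \<Longrightarrow> c \<in> A \<Longrightarrow> Mod (cran c) (vc c \<xi> l)"
  by (rule moderate_Mod) (auto simp: idx_1)

lemma moderate_fc: "u \<in> moderate A 0 0 \<Longrightarrow> c \<in> A \<Longrightarrow> Mod (cran c) (fc c u)"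
  by (rule moderate_Mod) auto

lemma moderateI_all:
  assumes "\<And>e. e \<in> {0<..1} \<Longrightarrow> t e \<in> smooth_tensor A r 0"
    and "\<And>c I. c \<in> A \<Longrightarrow> I \<in> idx r \<Longrightarrow> Mod (cran c) (\<lambda>e. coord c (t e) I [])"
  shows "t \<in> moderate A r 0"
  by (rule moderateI) (use assms chart_at in blast)+

lemma tadd_moderate:
  assumes "t \<in> moderate A r 0" "u \<in> moderate A r 0" shows "(\<lambda>e. tadd (t e) (u e)) \<in> moderate A r 0"
proof (rule moderateI_all)
  show "tadd (t e) (u e) \<in> smooth_tensor A r 0" if "e \<in> {0<..1}" for e
    using moderate_smooth[OF assms(1) that] moderate_smooth[OF assms(2) that] tadd_tensor by blast
  show "Mod (cran c) (\<lambda>e. coord c (tadd (t e) (u e)) I [])" if "c \<in> A" "I \<in> idx r" for c I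
    using Mod_add[OF ch(2)[OF that(1)] moderate_Mod[OF assms(1) that] moderate_Mod[OF assms(2) that], of "[]" "[]"]
    by (simp add: coord_def[abs_def] tadd_def)
qed

lemma tsub_moderate:
  assumes "t \<in> moderate A r 0" "u \<in> moderate A r 0" shows "(\<lambda>e. tsub (t e) (u e)) \<in> moderate A r 0"
proof (rule moderateI_all)
  show "tsub (t e) (u e) \<in> smooth_tensor A r 0" if "e \<in> {0<..1}" for e
    using moderate_smooth[OF assms(1) that] moderate_smooth[OF assms(2) that] tsub_tensor by blast
  show "Mod (cran c) (\<lambda>e. coord c (tsub (t e) (u e)) I [])" if "c \<in> A" "I \<in> idx r" for c I
    using Mod_diff[OF ch(2)[OF that(1)] moderate_Mod[OF assms(1) that] moderate_Mod[OF assms(2) that], of "[]" "[]"]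
    by (simp add: coord_def[abs_def] tsub_def)
qed

lemma fscale_moderate:
  assumes "u \<in> moderate A 0 0" "t \<in> moderate A r 0" shows "(\<lambda>e. fscale (u e) (t e)) \<in> moderate A r 0"
proof (rule moderateI_all)
  show "fscale (u e) (t e) \<in> smooth_tensor A r 0" if "e \<in> {0<..1}" for e
    using moderate_smooth[OF assms(1) that] moderate_smooth[OF assms(2) that] fscale_tensor by blast
  show "Mod (cran c) (\<lambda>e. coord c (fscale (u e) (t e)) I [])" if "c \<in> A" "I \<in> idx r" for c I
    using Mod_mult[OF ch(2)[OF that(1)] moderate_fc[OF assms(1) that(1)] moderate_Mod[OF assms(2) that, of "[]"]]
    by (simp add: coord_def[abs_def] fscale_def)
qed

lemma contr2_coord:
  assumes "c \<in> A" "x \<in> cran c"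
  shows "coord c (contr2 A g \<eta> \<zeta>) [] [] x = (\<Sum>i\<in>UNIV. \<Sum>j\<in>UNIV. coord c g [] [i, j] x * coord c \<eta> [i] [] x * coord c \<zeta> [j] [] x)"
  using assms ch(6)[OF assms] by (simp add: coord_def contr2_def tens_def)

lemma contr2_moderate:
  assumes "g \<in> moderate A 0 2" "\<eta> \<in> moderate A 1 0" "\<zeta> \<in> moderate A 1 0"
  shows "(\<lambda>e. contr2 A (g e) (\<eta> e) (\<zeta> e)) \<in> moderate A 0 0"
proof (rule moderateI_all)
  show "contr2 A (g e) (\<eta> e) (\<zeta> e) \<in> smooth_tensor A 0 0" if "e \<in> {0<..1}" for e
    using moderate_smooth[OF assms(1) that] moderate_smooth[OF assms(2) that] moderate_smooth[OF assms(3) that] contr2_tensor by blast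
  fix c and I :: "'n list" assume c: "c \<in> A" and I: "I \<in> idx 0"
  have "Mod (cran c) (\<lambda>e x. \<Sum>i\<in>UNIV. \<Sum>j\<in>UNIV. coord c (g e) [] [i, j] x * coord c (\<eta> e) [i] [] x * coord c (\<zeta> e) [j] [] x)"
    by (intro Mod_sum Mod_mult ch(2)[OF c] moderate_Mod[OF assms(1) c] moderate_vc[OF assms(2) c] moderate_vc[OF assms(3) c]) (auto simp: idx_2)
  then show "Mod (cran c) (\<lambda>e. coord c (contr2 A (g e) (\<eta> e) (\<zeta> e)) I [])"
    by (rule Mod_cong[OF ch(2)[OF c], rotated]) (use I contr2_coord[OF c] in simp)
qed

lemma const_moderate:
  assumes "t \<in> smooth_tensor A r 0" shows "(\<lambda>e. t) \<in> moderate A r 0"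
  by (rule moderateI_all) (use assms Mod_const[OF ch(2) tensor_Ck[OF assms]] in auto)

lemma from_chart_moderate:
  assumes c: "c \<in> A" and F: "\<And>I. I \<in> idx r \<Longrightarrow> Mod (cran c) (\<lambda>e x. F e x I [])"
    and Z: "open Z" "carrier_of A \<subseteq> cdom c \<union> Z"
    and F0: "\<And>e p I J. p \<in> cdom c \<Longrightarrow> p \<in> Z \<Longrightarrow> F e (cmap c p) I J = 0"
  shows "(\<lambda>e. from_chart A c r 0 (F e)) \<in> moderate A r 0"
proof (rule moderateI)
  show sm: "from_chart A c r 0 (F e) \<in> smooth_tensor A r 0" if e: "e \<in> {0<..1}" for e
    by (rule from_chart_tensor[OF c _ Z]) (use Mod_smooth[OF ch(2)[OF c] F e] F0 in auto)
  fix p assume "p \<in> carrier_of A"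
  then obtain c' where c': "c' \<in> A" "p \<in> cdom c'" and "p \<in> cdom c \<or> p \<in> Z" using chart_at Z(2) by blast
  then consider "p \<in> cdom c" | "p \<in> Z" by blast
  then show "\<exists>c'\<in>A. p \<in> cdom c' \<and> (\<forall>I\<in>idx r. Mod (cran c') (\<lambda>e. coord c' (from_chart A c r 0 (F e)) I []))"
  proof cases
    case 1
    have "Mod (cran c) (\<lambda>e. coord c (from_chart A c r 0 (F e)) I [])" if "I \<in> idx r" for I
      by (rule Mod_cong[OF ch(2)[OF c] _ F[OF that]]) (use from_chart_coord[OF c _ that] in auto)
    then show ?thesis using c 1 by blast
  next
    case 2
    define d where "d = (cdom c' \<inter> Z, cmap c')"
    have d: "d \<in> A" unfolding d_def by (rule restr_mem[OF c'(1) Z(1)])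
    have "Mod (cran d) (\<lambda>e. coord d (from_chart A c r 0 (F e)) I [])" if I: "I \<in> idx r" for I
    proof (rule Mod_cong[OF ch(2)[OF d] _ Mod_const[OF ch(2)[OF d] Ck_const[where c=0]]])
      fix e :: real and y assume y: "y \<in> cran d"
      have q: "cinv d y \<in> Z" using ch(6)[OF d y] by (simp add: d_def)
      show "0 = coord d (from_chart A c r 0 (F e)) I [] y"
      proof (cases "cinv d y \<in> cdom c")
        case True
        then have "F e (cmap c (cinv d y)) = (\<lambda>I J. 0)" using F0[OF True q] by (intro ext)
        then show ?thesis by (simp add: coord_def from_chart_def tens_def trf_zero)
      qed (simp add: coord_def from_chart_def tens_def)
    qed
    moreover have "p \<in> cdom d" using c' 2 by (simp add: d_def)
    ultimately show ?thesis using d by blast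
  qed
qed

end

section \<open>The coordinate formula of a Levi-Civita connection\<close>

text \<open>Nets of vector fields with a connection, in an abstract setting that covers classical and generalized connections. \<open>N\<close> are the null nets of
functions, a module over the nets in \<open>R\<close>. \<open>V1\<close> and \<open>V2\<close> are the fields allowed as first and second argument (\<open>C\<^bsup>k-1\<^esup>\<close> and
\<open>C\<^sup>k\<close> in the classical case), \<open>F1\<close> and \<open>F2\<close> the functions that may multiply them.
\<open>D \<xi> \<eta> w\<close> says that \<open>w\<close> is a value of the connection; it is a relation because
a generalized connection returns a class and not a net. \<open>gi\<close> plays the role of the inverse of the metric \<open>g\<close>.
The axioms \<open>cut1\<close> and \<open>cut2\<close> say that components, cut off to be defined globally, may serve as multipliers.\<close>

locale conn = atlas A for A :: "('a::t2_space, 'n::finite) chart set" +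
  fixes N :: "(real^'n) set \<Rightarrow> (real \<Rightarrow> real^'n \<Rightarrow> real) \<Rightarrow> bool"
    and R :: "(real^'n) set \<Rightarrow> (real \<Rightarrow> real^'n \<Rightarrow> real) \<Rightarrow> bool"
    and V1 V2 F1 F2 :: "(real \<Rightarrow> ('a, 'n) tensor) set"
    and D :: "(real \<Rightarrow> ('a, 'n) tensor) \<Rightarrow> (real \<Rightarrow> ('a, 'n) tensor) \<Rightarrow> (real \<Rightarrow> ('a, 'n) tensor) \<Rightarrow> bool"
    and g :: "real \<Rightarrow> ('a, 'n) tensor"
    and gi :: "('a, 'n) chart \<Rightarrow> 'n \<Rightarrow> 'n \<Rightarrow> real \<Rightarrow> real^'n \<Rightarrow> real"
  assumes N_cong: "open S \<Longrightarrow> (\<And>e y. e \<in> {0<..1} \<Longrightarrow> y \<in> S \<Longrightarrow> f e y = f' e y) \<Longrightarrow> N S f \<Longrightarrow> N S f'"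
    and N_zero: "N S (\<lambda>e y. 0)"
    and N_add: "open S \<Longrightarrow> N S f \<Longrightarrow> N S f' \<Longrightarrow> N S (\<lambda>e y. f e y + f' e y)"
    and N_mult: "open S \<Longrightarrow> R S h \<Longrightarrow> N S f \<Longrightarrow> N S (\<lambda>e y. h e y * f e y)"
    and N_mono: "N S f \<Longrightarrow> T \<subseteq> S \<Longrightarrow> N T f"
    and N_local: "(\<And>x. x \<in> S \<Longrightarrow> \<exists>U. x \<in> U \<and> N U f) \<Longrightarrow> N S f"
    and R_const: "open S \<Longrightarrow> Ck_on \<infinity> S \<phi> \<Longrightarrow> R S (\<lambda>e. \<phi>)"
    and R_mono: "R S f \<Longrightarrow> T \<subseteq> S \<Longrightarrow> R T f"
    and V1_R: "\<xi> \<in> V1 \<Longrightarrow> c \<in> A \<Longrightarrow> R (cran c) (vc c \<xi> l)"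
    and V2_R: "\<xi> \<in> V2 \<Longrightarrow> c \<in> A \<Longrightarrow> R (cran c) (vc c \<xi> l)"
    and D_R: "D \<xi> \<eta> w \<Longrightarrow> c \<in> A \<Longrightarrow> R (cran c) (vc c w l)"
    and g_R: "c \<in> A \<Longrightarrow> R (cran c) (\<lambda>e. coord c (g e) [] [a, b])"
    and gi_R: "c \<in> A \<Longrightarrow> R (cran c) (gi c l m)"
    and V1_tensor: "\<xi> \<in> V1 \<Longrightarrow> e \<in> {0<..1} \<Longrightarrow> \<exists>k. \<xi> e \<in> Ck_tensor k A 1 0"
    and V2_tensor: "\<xi> \<in> V2 \<Longrightarrow> e \<in> {0<..1} \<Longrightarrow> \<exists>k. \<xi> e \<in> Ck_tensor k A 1 0"
    and add1: "\<xi> \<in> V1 \<Longrightarrow> \<xi>' \<in> V1 \<Longrightarrow> (\<lambda>e. tadd (\<xi> e) (\<xi>' e)) \<in> V1"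
    and add2: "\<xi> \<in> V2 \<Longrightarrow> \<xi>' \<in> V2 \<Longrightarrow> (\<lambda>e. tadd (\<xi> e) (\<xi>' e)) \<in> V2"
    and scale1: "u \<in> F1 \<Longrightarrow> \<xi> \<in> V1 \<Longrightarrow> (\<lambda>e. fscale (u e) (\<xi> e)) \<in> V1"
    and scale2: "u \<in> F2 \<Longrightarrow> \<xi> \<in> V2 \<Longrightarrow> (\<lambda>e. fscale (u e) (\<xi> e)) \<in> V2"
    and smooth_V: "t \<in> smooth_tensor A 1 0 \<Longrightarrow> (\<lambda>e. t) \<in> V1 \<inter> V2"
    and smooth_F: "t \<in> smooth_tensor A 0 0 \<Longrightarrow> (\<lambda>e. t) \<in> F1 \<inter> F2"
    and cut1: "\<xi> \<in> V1 \<Longrightarrow> c \<in> A \<Longrightarrow> compact K \<Longrightarrow> K \<subseteq> cran c \<Longrightarrow> Ck_on \<infinity> UNIV \<psi> \<Longrightarrow> (\<And>x. x \<notin> K \<Longrightarrow> \<psi> x = 0) \<Longrightarrow>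
      (\<lambda>e. from_chart A c 0 0 (\<lambda>x I J. \<psi> x * vc c \<xi> i e x)) \<in> F1"
    and cut2: "\<xi> \<in> V2 \<Longrightarrow> c \<in> A \<Longrightarrow> compact K \<Longrightarrow> K \<subseteq> cran c \<Longrightarrow> Ck_on \<infinity> UNIV \<psi> \<Longrightarrow> (\<And>x. x \<notin> K \<Longrightarrow> \<psi> x = 0) \<Longrightarrow>
      (\<lambda>e. from_chart A c 0 0 (\<lambda>x I J. \<psi> x * vc c \<xi> i e x)) \<in> F2"
    and D_ex: "\<xi> \<in> V1 \<Longrightarrow> \<eta> \<in> V2 \<Longrightarrow> \<exists>w. D \<xi> \<eta> w"
    and D_cong: "D \<xi> \<eta> w \<Longrightarrow> \<xi> \<in> V1 \<Longrightarrow> \<xi>' \<in> V1 \<Longrightarrow> \<eta> \<in> V2 \<Longrightarrow> \<eta>' \<in> V2 \<Longrightarrow>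
      (\<And>e. e \<in> {0<..1} \<Longrightarrow> \<xi> e = \<xi>' e) \<Longrightarrow> (\<And>e. e \<in> {0<..1} \<Longrightarrow> \<eta> e = \<eta>' e) \<Longrightarrow> D \<xi>' \<eta>' w"
    and D_add1: "\<xi> \<in> V1 \<Longrightarrow> \<xi>' \<in> V1 \<Longrightarrow> \<eta> \<in> V2 \<Longrightarrow> D \<xi> \<eta> w \<Longrightarrow> D \<xi>' \<eta> w' \<Longrightarrow> D (\<lambda>e. tadd (\<xi> e) (\<xi>' e)) \<eta> w'' \<Longrightarrow> c \<in> A \<Longrightarrow>
      N (cran c) (\<lambda>e y. vc c w'' l e y - (vc c w l e y + vc c w' l e y))"
    and D_scale1: "\<xi> \<in> V1 \<Longrightarrow> u \<in> F1 \<Longrightarrow> \<eta> \<in> V2 \<Longrightarrow> D \<xi> \<eta> w \<Longrightarrow> D (\<lambda>e. fscale (u e) (\<xi> e)) \<eta> w' \<Longrightarrow> c \<in> A \<Longrightarrow>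
      N (cran c) (\<lambda>e y. vc c w' l e y - fc c u e y * vc c w l e y)"
    and D_add2: "\<xi> \<in> V1 \<Longrightarrow> \<eta> \<in> V2 \<Longrightarrow> \<eta>' \<in> V2 \<Longrightarrow> D \<xi> \<eta> w \<Longrightarrow> D \<xi> \<eta>' w' \<Longrightarrow> D \<xi> (\<lambda>e. tadd (\<eta> e) (\<eta>' e)) w'' \<Longrightarrow> c \<in> A \<Longrightarrow>
      N (cran c) (\<lambda>e y. vc c w'' l e y - (vc c w l e y + vc c w' l e y))"
    and D_leib: "\<xi> \<in> V1 \<Longrightarrow> u \<in> F2 \<Longrightarrow> \<eta> \<in> V2 \<Longrightarrow> D \<xi> \<eta> w \<Longrightarrow> D \<xi> (\<lambda>e. fscale (u e) (\<eta> e)) w' \<Longrightarrow> c \<in> A \<Longrightarrow>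
      N (cran c) (\<lambda>e y. vc c w' l e y - (fc c u e y * vc c w l e y + (\<Sum>i\<in>UNIV. vc c \<xi> i e y * pd [i] (fc c u e) y) * vc c \<eta> l e y))"
    and D_torsion: "\<xi> \<in> V1 \<inter> V2 \<Longrightarrow> \<eta> \<in> V1 \<inter> V2 \<Longrightarrow> D \<xi> \<eta> w \<Longrightarrow> D \<eta> \<xi> w' \<Longrightarrow> c \<in> A \<Longrightarrow>
      N (cran c) (\<lambda>e y. (\<Sum>i\<in>UNIV. vc c \<xi> i e y * pd [i] (vc c \<eta> l e) y - vc c \<eta> i e y * pd [i] (vc c \<xi> l e) y)
         - (vc c w l e y - vc c w' l e y))"
    and D_metric: "\<xi> \<in> V1 \<Longrightarrow> \<eta> \<in> V2 \<Longrightarrow> \<zeta> \<in> V2 \<Longrightarrow> D \<xi> \<eta> w \<Longrightarrow> D \<xi> \<zeta> w' \<Longrightarrow> c \<in> A \<Longrightarrow>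
      N (cran c) (\<lambda>e y. (\<Sum>i\<in>UNIV. vc c \<xi> i e y * pd [i] (\<lambda>y. \<Sum>a\<in>UNIV. \<Sum>b\<in>UNIV. coord c (g e) [] [a, b] y * vc c \<eta> a e y * vc c \<zeta> b e y) y)
         - ((\<Sum>a\<in>UNIV. \<Sum>b\<in>UNIV. coord c (g e) [] [a, b] y * vc c w a e y * vc c \<zeta> b e y)
          + (\<Sum>a\<in>UNIV. \<Sum>b\<in>UNIV. coord c (g e) [] [a, b] y * vc c \<eta> a e y * vc c w' b e y)))"
    and g_sym: "c \<in> A \<Longrightarrow> N (cran c) (\<lambda>e y. coord c (g e) [] [a, b] y - coord c (g e) [] [b, a] y)"
    and g_inv: "c \<in> A \<Longrightarrow> N (cran c) (\<lambda>e y. (\<Sum>k\<in>UNIV. coord c (g e) [] [l, k] y * gi c k m e y) - (if l = m then 1 else 0))"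
begin

abbreviation gg where "gg c a b \<equiv> (\<lambda>e. coord c (g e) [] [a, b])"

definition chr :: "('a, 'n) chart \<Rightarrow> 'n \<Rightarrow> 'n \<Rightarrow> 'n \<Rightarrow> real \<Rightarrow> real^'n \<Rightarrow> real" where
  "chr c m i j = (\<lambda>e y. \<Sum>k\<in>UNIV. gi c k m e y *
     (1/2 * (pd [i] (gg c j k e) y + pd [j] (gg c i k e) y - pd [k] (gg c i j e) y)))"

lemma N_sum: "open S \<Longrightarrow> (\<And>j. j \<in> J \<Longrightarrow> N S (f j)) \<Longrightarrow> N S (\<lambda>e y. \<Sum>j\<in>J. f j e y)"
  by (induction J rule: infinite_finite_induct) (auto simp: N_zero N_add)

lemma N_scale: "open S \<Longrightarrow> N S f \<Longrightarrow> N S (\<lambda>e y. a * f e y)"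
  using N_mult[of S "\<lambda>e y. a" f] R_const[of S "\<lambda>y. a"] Ck_const by blast

lemma N_diff: "open S \<Longrightarrow> N S f \<Longrightarrow> N S f' \<Longrightarrow> N S (\<lambda>e y. f e y - f' e y)"
  using N_add[of S f "\<lambda>e y. (-1) * f' e y"] N_scale[of S f' "-1"] by simp

end

context atlas
begin

text \<open>The coordinate vector field of \<open>c\<close>, cut off to a global field.\<close>

definition bumpE :: "('a, 'n) chart \<Rightarrow> (real^'n \<Rightarrow> real) \<Rightarrow> 'n \<Rightarrow> ('a, 'n) tensor" where
  "bumpE c \<phi> i = from_chart A c 1 0 (\<lambda>x I J. if I = [i] then \<phi> x else 0)"

lemma bumpE_smooth:
  assumes "c \<in> A" "Ck_on \<infinity> UNIV \<phi>" "compact K" "K \<subseteq> cran c" "\<And>x. x \<notin> K \<Longrightarrow> \<phi> x = 0"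
  shows "bumpE c \<phi> i \<in> smooth_tensor A 1 0"
  unfolding bumpE_def
proof (rule from_chart_supp[OF assms(1) _ assms(3,4)])
  show "Ck_on \<infinity> (cran c) (\<lambda>x. if I = [i] then \<phi> x else 0)" for I
    by (cases "I = [i]") (auto simp: Ck_const intro: Ck_mono[OF assms(2)])
qed (use assms(5) in auto)

end

text \<open>Two cut-off functions in a chart: \<open>\<psi>\<close> is supported where \<open>\<phi>\<close> is \<open>1\<close>, and both are \<open>1\<close> on \<open>B\<close>. The first cuts the fields,
the second makes the coordinate frame global; on the support of the first the frame is the true one.\<close>

locale conn_cut = conn A N R V1 V2 F1 F2 D g gi
  for A :: "('a::t2_space, 'n::finite) chart set" and N R V1 V2 F1 F2 D g gi +
  fixes c :: "('a, 'n) chart" and K B :: "(real^'n) set" and \<phi> \<psi> :: "real^'n \<Rightarrow> real"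
  assumes cA: "c \<in> A" and K: "compact K" "K \<subseteq> cran c"
    and \<phi>: "Ck_on \<infinity> UNIV \<phi>" "\<And>x. x \<notin> K \<Longrightarrow> \<phi> x = 0"
    and \<psi>: "Ck_on \<infinity> UNIV \<psi>" "\<And>x. x \<notin> K \<Longrightarrow> \<psi> x = 0"
    and \<psi>\<phi>: "\<And>x. \<psi> x * \<phi> x = \<psi> x"
    and B: "open B" "B \<subseteq> cran c" "\<And>x. x \<in> B \<Longrightarrow> \<phi> x = 1 \<and> \<psi> x = 1"
begin

abbreviation Ei where "Ei i \<equiv> bumpE c \<phi> i"

definition cf :: "(real \<Rightarrow> real^'n \<Rightarrow> real) \<Rightarrow> real \<Rightarrow> ('a, 'n) tensor" where
  "cf f = (\<lambda>e. from_chart A c 0 0 (\<lambda>x I J. f e x))"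

text \<open>The partial sum, over directions in \<open>X\<close>, of the expansion of \<open>\<psi> \<xi>\<close> in the frame. Sums of fields are built by adding one
direction at a time, as only binary additivity of the connection is available.\<close>

definition part :: "'n set \<Rightarrow> (real \<Rightarrow> ('a, 'n) tensor) \<Rightarrow> real \<Rightarrow> ('a, 'n) tensor" where
  "part X \<xi> = (\<lambda>e. from_chart A c 1 0 (\<lambda>x I J. if hd I \<in> X then \<psi> x * coord c (\<xi> e) I [] x else 0))"

lemmas cS = ch(2)[OF cA]

lemma smooth_on: "Ck_on \<infinity> UNIV f \<Longrightarrow> Ck_on \<infinity> S f" by (erule Ck_mono) auto

lemma Ei_V: "(\<lambda>e. Ei i) \<in> V1" "(\<lambda>e. Ei i) \<in> V2"
  using smooth_V[OF bumpE_smooth[OF cA \<phi>(1) K \<phi>(2)]] by auto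

lemma Ei_coord: "x \<in> cran c \<Longrightarrow> coord c (Ei i) [l] [] x = (if l = i then \<phi> x else 0)"
  unfolding bumpE_def by (subst from_chart_coord[OF cA]) (auto simp: idx_1)

lemma cf_coord: "x \<in> cran c \<Longrightarrow> fc c (cf f) e x = f e x"
  unfolding cf_def by (subst from_chart_coord[OF cA]) auto

lemma cf_const_F: 
  assumes "\<phi>' = \<phi> \<or> \<phi>' = \<psi> \<or> \<phi>' = (\<lambda>x. 0)" shows "cf (\<lambda>e. \<phi>') \<in> F1 \<inter> F2"
  unfolding cf_def
  by (rule smooth_F, rule from_chart_supp[OF cA _ K])
    (use assms \<phi> \<psi> smooth_on in \<open>auto simp: Ck_const\<close>)

lemma cf_cut: "\<xi> \<in> V1 \<Longrightarrow> cf (\<lambda>e x. \<psi> x * vc c \<xi> i e x) \<in> F1" "\<xi> \<in> V2 \<Longrightarrow> cf (\<lambda>e x. \<psi> x * vc c \<xi> i e x) \<in> F2"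
  unfolding cf_def by (rule cut1[OF _ cA K \<psi>]; assumption) (rule cut2[OF _ cA K \<psi>]; assumption)

lemma part_insert:
  assumes "i \<notin> X"
  shows "part (insert i X) \<xi> = (\<lambda>e. tadd (fscale (cf (\<lambda>e x. \<psi> x * vc c \<xi> i e x) e) (Ei i)) (part X \<xi> e))"
proof
  fix e
  show "part (insert i X) \<xi> e = tadd (fscale (cf (\<lambda>e x. \<psi> x * vc c \<xi> i e x) e) (Ei i)) (part X \<xi> e)"
    unfolding part_def cf_def bumpE_def from_chart_fscale from_chart_add
  proof (rule from_chart_cong[OF chart[OF cA]])
    fix x and I J :: "'n list" assume "I \<in> idx 1"
    then obtain k where "I = [k]" by (auto simp: idx_1)
    then show "(if hd I \<in> insert i X then \<psi> x * coord c (\<xi> e) I [] x else 0) =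
      \<psi> x * coord c (\<xi> e) [i] [] x * (if I = [i] then \<phi> x else 0) + (if hd I \<in> X then \<psi> x * coord c (\<xi> e) I [] x else 0)"
      using assms \<psi>\<phi>[of x] by (auto simp: mult.assoc mult.left_commute mult.commute)
  qed
qed

lemma part_UNIV:
  assumes "\<xi> e \<in> Ck_tensor k A 1 0"
  shows "fscale (cf (\<lambda>e. \<psi>) e) (\<xi> e) = part UNIV \<xi> e"
  unfolding part_def cf_def from_chart_cut[OF assms cA chart[OF cA]]
  by (rule from_chart_cong[OF chart[OF cA]]) auto

text \<open>The zero field is a zero multiple of a frame field, so that it needs no axiom of its own.\<close>

lemma part_empty: "part {} \<xi> = (\<lambda>e. fscale (cf (\<lambda>e x. 0) e) (Ei i))"
  unfolding part_def cf_def bumpE_def from_chart_fscale by simp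

lemma part_V1: "\<xi> \<in> V1 \<Longrightarrow> part X \<xi> \<in> V1"
proof (induction X rule: infinite_finite_induct)
  case empty
  show ?case unfolding part_empty[of _ undefined] using cf_const_F[of "\<lambda>x. 0"] Ei_V scale1 by blast
next
  case (insert i X)
  then show ?case unfolding part_insert[OF insert(2)] by (intro add1 scale1 cf_cut Ei_V) auto
qed simp

lemma part_V2: "\<xi> \<in> V2 \<Longrightarrow> part X \<xi> \<in> V2"
proof (induction X rule: infinite_finite_induct)
  case empty
  show ?case unfolding part_empty[of _ undefined] using cf_const_F[of "\<lambda>x. 0"] Ei_V scale2 by blast
next
  case (insert i X)
  then show ?case unfolding part_insert[OF insert(2)] by (intro add2 scale2 cf_cut Ei_V) auto
qed simp

lemma D_part1:
  assumes \<xi>: "\<xi> \<in> V1" and \<eta>: "\<eta> \<in> V2" and W: "\<And>i. D (\<lambda>e. Ei i) \<eta> (W i)" and w: "D (part X \<xi>) \<eta> w"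
  shows "N (cran c) (\<lambda>e y. vc c w l e y - (\<Sum>i\<in>X. \<psi> y * vc c \<xi> i e y * vc c (W i) l e y))"
  using w
proof (induction X arbitrary: w rule: infinite_finite_induct)
  case empty
  have "N (cran c) (\<lambda>e y. vc c w l e y - fc c (cf (\<lambda>e x. 0)) e y * vc c (W undefined) l e y)"
    using D_scale1[OF Ei_V(1) _ \<eta> W _ cA, of "cf (\<lambda>e x. 0)" undefined w] empty cf_const_F[of "\<lambda>x. 0"]
    unfolding part_empty[of _ undefined] by blast
  then show ?case by (rule N_cong[OF cS, rotated]) (simp add: cf_coord)
next
  case (insert i X)
  let ?u = "cf (\<lambda>e x. \<psi> x * vc c \<xi> i e x)"
  have uE: "(\<lambda>e. fscale (?u e) (Ei i)) \<in> V1" by (intro scale1 cf_cut Ei_V \<xi>)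
  obtain w1 where w1: "D (\<lambda>e. fscale (?u e) (Ei i)) \<eta> w1" using D_ex[OF uE \<eta>] by blast
  obtain w2 where w2: "D (part X \<xi>) \<eta> w2" using D_ex[OF part_V1[OF \<xi>] \<eta>] by blast
  have 1: "N (cran c) (\<lambda>e y. vc c w1 l e y - fc c ?u e y * vc c (W i) l e y)"
    by (rule D_scale1[OF Ei_V(1) cf_cut(1)[OF \<xi>] \<eta> W w1 cA])
  have 2: "N (cran c) (\<lambda>e y. vc c w l e y - (vc c w1 l e y + vc c w2 l e y))"
    by (rule D_add1[OF uE part_V1[OF \<xi>] \<eta> w1 w2 _ cA]) (use insert.prems in \<open>simp add: part_insert[OF insert(2)]\<close>)
  show ?case
    by (rule N_cong[OF cS _ N_add[OF cS 2 N_add[OF cS 1 insert.IH[OF w2]]]])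
      (use insert in \<open>simp add: cf_coord\<close>)
qed simp

text \<open>On \<open>B\<close> nothing changes if the first argument is multiplied by \<open>\<psi>\<close>, and the product is a combination of frame fields.\<close>

lemma D_local1:
  assumes \<xi>: "\<xi> \<in> V1" and \<eta>: "\<eta> \<in> V2" and W: "\<And>i. D (\<lambda>e. Ei i) \<eta> (W i)" and w: "D \<xi> \<eta> w"
  shows "N B (\<lambda>e y. vc c w l e y - (\<Sum>i\<in>UNIV. vc c \<xi> i e y * vc c (W i) l e y))"
proof -
  have F: "cf (\<lambda>e. \<psi>) \<in> F1" using cf_const_F[of \<psi>] by blast
  have V: "(\<lambda>e. fscale (cf (\<lambda>e. \<psi>) e) (\<xi> e)) \<in> V1" by (rule scale1[OF F \<xi>])
  obtain w' where w': "D (\<lambda>e. fscale (cf (\<lambda>e. \<psi>) e) (\<xi> e)) \<eta> w'" using D_ex[OF V \<eta>] by blast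
  have "D (part UNIV \<xi>) \<eta> w'"
    by (rule D_cong[OF w' V part_V1[OF \<xi>] \<eta> \<eta>]) (use V1_tensor[OF \<xi>] part_UNIV in auto)
  from D_part1[OF \<xi> \<eta> W this]
  have 1: "N (cran c) (\<lambda>e y. vc c w' l e y - (\<Sum>i\<in>UNIV. \<psi> y * vc c \<xi> i e y * vc c (W i) l e y))" .
  have 2: "N (cran c) (\<lambda>e y. vc c w' l e y - fc c (cf (\<lambda>e. \<psi>)) e y * vc c w l e y)"
    by (rule D_scale1[OF \<xi> F \<eta> w w' cA])
  show ?thesis
    by (rule N_cong[OF B(1) _ N_mono[OF N_diff[OF cS 1 2] B(2)]]) (use B in \<open>auto simp: cf_coord\<close>)
qed

lemma Ei_act:
  assumes "y \<in> cran c"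
  shows "(\<Sum>m\<in>UNIV. coord c (Ei i) [m] [] y * F m) = \<phi> y * F i"
  using assms by (simp add: Ei_coord if_distrib[where f="\<lambda>x. x * _"] cong: if_cong)

lemma pd_cf: "y \<in> cran c \<Longrightarrow> pd [i] (fc c (cf f) e) y = pd [i] (f e) y"
  by (rule pd_cong_open[OF cS]) (auto simp: cf_coord)

lemma D_part2:
  assumes \<eta>: "\<eta> \<in> V2" and W: "\<And>j. D (\<lambda>e. Ei i) (\<lambda>e. Ei j) (W j)" and w: "D (\<lambda>e. Ei i) (part X \<eta>) w"
  shows "N (cran c) (\<lambda>e y. vc c w l e y - (\<Sum>j\<in>X. \<psi> y * vc c \<eta> j e y * vc c (W j) l e y
      + \<phi> y * pd [i] (\<lambda>x. \<psi> x * vc c \<eta> j e x) y * (if l = j then \<phi> y else 0)))"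
  using w
proof (induction X arbitrary: w rule: infinite_finite_induct)
  case empty
  let ?z = "cf (\<lambda>e x. 0)"
  have "N (cran c) (\<lambda>e y. vc c w l e y - (fc c ?z e y * vc c (W undefined) l e y +
    (\<Sum>m\<in>UNIV. coord c (Ei i) [m] [] y * pd [m] (fc c ?z e) y) * coord c (Ei undefined) [l] [] y))"
    using D_leib[OF Ei_V(1) _ Ei_V(2) W _ cA, of ?z] empty cf_const_F[of "\<lambda>x. 0"]
    unfolding part_empty[of _ undefined] by blast
  then show ?case by (rule N_cong[OF cS, rotated]) (simp add: cf_coord Ei_act pd_cf)
next
  case (insert j X)
  let ?u = "cf (\<lambda>e x. \<psi> x * vc c \<eta> j e x)"
  have uE: "(\<lambda>e. fscale (?u e) (Ei j)) \<in> V2" by (intro scale2 cf_cut Ei_V \<eta>)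
  obtain w1 where w1: "D (\<lambda>e. Ei i) (\<lambda>e. fscale (?u e) (Ei j)) w1" using D_ex[OF Ei_V(1) uE] by blast
  obtain w2 where w2: "D (\<lambda>e. Ei i) (part X \<eta>) w2" using D_ex[OF Ei_V(1) part_V2[OF \<eta>]] by blast
  have 1: "N (cran c) (\<lambda>e y. vc c w1 l e y - (fc c ?u e y * vc c (W j) l e y +
    (\<Sum>m\<in>UNIV. coord c (Ei i) [m] [] y * pd [m] (fc c ?u e) y) * coord c (Ei j) [l] [] y))"
    by (rule D_leib[OF Ei_V(1) cf_cut(2)[OF \<eta>] Ei_V(2) W w1 cA])
  have 2: "N (cran c) (\<lambda>e y. vc c w l e y - (vc c w1 l e y + vc c w2 l e y))"
    by (rule D_add2[OF Ei_V(1) uE part_V2[OF \<eta>] w1 w2 _ cA]) (use insert.prems in \<open>simp add: part_insert[OF insert(2)]\<close>)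
  show ?case
    by (rule N_cong[OF cS _ N_add[OF cS 2 N_add[OF cS 1 insert.IH[OF w2]]]])
      (use insert in \<open>simp add: cf_coord pd_cf Ei_coord if_distrib[where f="\<lambda>x. x * _"] cong: if_cong\<close>)
qed simp

text \<open>The same for the second argument, where the Leibniz rule contributes the derivatives of the components. Those of \<open>\<psi>\<close> vanish on \<open>B\<close>.\<close>

lemma D_local2:
  assumes \<eta>: "\<eta> \<in> V2" and W: "\<And>j. D (\<lambda>e. Ei i) (\<lambda>e. Ei j) (W j)" and w: "D (\<lambda>e. Ei i) \<eta> w"
  shows "N B (\<lambda>e y. vc c w l e y - (pd [i] (vc c \<eta> l e) y + (\<Sum>j\<in>UNIV. vc c \<eta> j e y * vc c (W j) l e y)))"
proof -
  have F: "cf (\<lambda>e. \<psi>) \<in> F2" using cf_const_F[of \<psi>] by blast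
  have V: "(\<lambda>e. fscale (cf (\<lambda>e. \<psi>) e) (\<eta> e)) \<in> V2" by (rule scale2[OF F \<eta>])
  obtain w' where w': "D (\<lambda>e. Ei i) (\<lambda>e. fscale (cf (\<lambda>e. \<psi>) e) (\<eta> e)) w'" using D_ex[OF Ei_V(1) V] by blast
  have "D (\<lambda>e. Ei i) (part UNIV \<eta>) w'"
    by (rule D_cong[OF w' Ei_V(1) Ei_V(1) V part_V2[OF \<eta>]]) (use V2_tensor[OF \<eta>] part_UNIV in auto)
  from D_part2[OF \<eta> W this]
  have 1: "N (cran c) (\<lambda>e y. vc c w' l e y - (\<Sum>j\<in>UNIV. \<psi> y * vc c \<eta> j e y * vc c (W j) l e y
      + \<phi> y * pd [i] (\<lambda>x. \<psi> x * vc c \<eta> j e x) y * (if l = j then \<phi> y else 0)))" .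
  have 2: "N (cran c) (\<lambda>e y. vc c w' l e y - (fc c (cf (\<lambda>e. \<psi>)) e y * vc c w l e y +
     (\<Sum>m\<in>UNIV. coord c (Ei i) [m] [] y * pd [m] (fc c (cf (\<lambda>e. \<psi>)) e) y) * vc c \<eta> l e y))"
    by (rule D_leib[OF Ei_V(1) F \<eta> w w' cA])
  show ?thesis
  proof (rule N_cong[OF B(1) _ N_mono[OF N_diff[OF cS 1 2] B(2)]])
    fix e :: real and y assume "e \<in> {0<..1}" and y: "y \<in> B"
    have yc: "y \<in> cran c" using y B by blast
    have p1: "pd [i] (\<lambda>x. \<psi> x * vc c \<eta> j e x) y = pd [i] (vc c \<eta> j e) y" for j
      by (rule pd_cong_open[OF B(1) y]) (use B in simp)
    have p2: "pd [i] \<psi> y = pd [i] (\<lambda>x. 1) y"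
      by (rule pd_cong_open[OF B(1) y]) (use B in simp)
    show "vc c w' l e y - (\<Sum>j\<in>UNIV. \<psi> y * vc c \<eta> j e y * vc c (W j) l e y
        + \<phi> y * pd [i] (\<lambda>x. \<psi> x * vc c \<eta> j e x) y * (if l = j then \<phi> y else 0)) -
      (vc c w' l e y - (fc c (cf (\<lambda>e. \<psi>)) e y * vc c w l e y +
       (\<Sum>m\<in>UNIV. coord c (Ei i) [m] [] y * pd [m] (fc c (cf (\<lambda>e. \<psi>)) e) y) * vc c \<eta> l e y)) =
      vc c w l e y - (pd [i] (vc c \<eta> l e) y + (\<Sum>j\<in>UNIV. vc c \<eta> j e y * vc c (W j) l e y))"
      using B(3)[OF y] unfolding p1
      by (simp add: cf_coord[OF yc] Ei_act[OF yc] pd_cf[OF yc] p2 sum.distrib if_distrib[where f="\<lambda>x. _ * x"] cong: if_cong)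
  qed
qed

lemma Ei_B: "y \<in> B \<Longrightarrow> coord c (Ei i) [l] [] y = (if l = i then 1 else 0)"
  using B by (auto simp: Ei_coord)

lemma Ei_pd: "y \<in> B \<Longrightarrow> pd [m] (coord c (Ei i) [l] []) y = 0"
  using pd_cong_open[OF B(1), of y "coord c (Ei i) [l] []" "\<lambda>y. if l = i then 1 else 0" "[m]"] Ei_B by simp

text \<open>The Koszul identity. Put \<open>P i j k = g(D\<^sub>i \<partial>\<^sub>j, \<partial>\<^sub>k)\<close>. Compatibility with the metric gives \<open>\<partial>\<^sub>i g\<^sub>j\<^sub>k = P i j k + P i k j\<close>, and torsion freeness
\<open>P i j k = P j i k\<close>, as coordinate fields commute. The combination with signs \<open>+, +, -\<close> determines \<open>P i j k\<close>, and
the inverse matrix then gives the components. All equations hold up to null nets.\<close>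

lemma D_koszul:
  assumes W: "\<And>i j. D (\<lambda>e. Ei i) (\<lambda>e. Ei j) (W i j)"
  shows "N B (\<lambda>e y. vc c (W i j) m e y - chr c m i j e y)"
proof -
  let ?P = "\<lambda>i j k e y. \<Sum>l\<in>UNIV. gg c l k e y * vc c (W i j) l e y"
  have RW: "R B (vc c (W i j) l)" for i j l using D_R[OF W cA] R_mono B(2) by blast
  have gs: "N B (\<lambda>e y. gg c a b e y - gg c b a e y)" for a b by (rule N_mono[OF g_sym[OF cA] B(2)])
  have tor: "N B (\<lambda>e y. vc c (W i j) l e y - vc c (W j i) l e y)" for i j l
    by (rule N_cong[OF B(1) _ N_scale[OF B(1) N_mono[OF D_torsion[OF _ _ W[of i j] W[of j i] cA] B(2)], of "-1"]])
      (use Ei_V in \<open>auto simp: Ei_pd\<close>)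
  have T: "N B (\<lambda>e y. ?P i j k e y - ?P j i k e y)" for i j k
  proof -
    have "N B (\<lambda>e y. \<Sum>l\<in>UNIV. gg c l k e y * (vc c (W i j) l e y - vc c (W j i) l e y))"
      by (intro N_sum N_mult B(1) tor R_mono[OF g_R[OF cA] B(2)])
    then show ?thesis by (rule N_cong[OF B(1), rotated]) (simp add: sum_subtractf algebra_simps)
  qed
  have M: "N B (\<lambda>e y. pd [i] (gg c j k e) y - (?P i j k e y + ?P i k j e y))" for i j k
  proof -
    \<comment> \<open>the symmetry of g, needed to write the second term as P i k j, is also only an identity up to null nets\<close>
    have 1: "N B (\<lambda>e y. \<Sum>b\<in>UNIV. vc c (W i k) b e y * (gg c j b e y - gg c b j e y))"
      by (intro N_sum N_mult B(1) RW gs)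
    show ?thesis
    proof (rule N_cong[OF B(1) _ N_add[OF B(1) N_mono[OF D_metric[OF Ei_V(1) Ei_V(2) Ei_V(2) W W cA] B(2)] 1]])
      fix e :: real and y assume y: "y \<in> B"
      have yc: "y \<in> cran c" using y B by blast
      have p: "pd [i] (\<lambda>y. \<Sum>a\<in>UNIV. \<Sum>b\<in>UNIV. gg c a b e y * coord c (Ei j) [a] [] y * coord c (Ei k) [b] [] y) y = pd [i] (gg c j k e) y"
        by (rule pd_cong_open[OF B(1) y])
          (simp add: Ei_B if_distrib[where f="\<lambda>x. x * _"] if_distrib[where f="\<lambda>x. _ * x"] cong: if_cong)
      show "(\<Sum>m\<in>UNIV. coord c (Ei i) [m] [] y * pd [m] (\<lambda>y. \<Sum>a\<in>UNIV. \<Sum>b\<in>UNIV. gg c a b e y * coord c (Ei j) [a] [] y * coord c (Ei k) [b] [] y) y)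
         - ((\<Sum>a\<in>UNIV. \<Sum>b\<in>UNIV. gg c a b e y * vc c (W i j) a e y * coord c (Ei k) [b] [] y)
          + (\<Sum>a\<in>UNIV. \<Sum>b\<in>UNIV. gg c a b e y * coord c (Ei j) [a] [] y * vc c (W i k) b e y))
         + (\<Sum>b\<in>UNIV. vc c (W i k) b e y * (gg c j b e y - gg c b j e y)) =
        pd [i] (gg c j k e) y - (?P i j k e y + ?P i k j e y)"
        unfolding Ei_act[OF yc] p using B(3)[OF y]
        by (simp add: Ei_B[OF y] if_distrib[where f="\<lambda>x. x * _"] if_distrib[where f="\<lambda>x. _ * x"] sum.swap[of _ UNIV UNIV]
            sum_subtractf algebra_simps cong: if_cong)
    qed
  qed
  let ?C = "\<lambda>k e y. 1/2 * (pd [i] (gg c j k e) y + pd [j] (gg c i k e) y - pd [k] (gg c i j e) y)"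
  have C: "N B (\<lambda>e y. ?C k e y - ?P i j k e y)" for k
    by (rule N_cong[OF B(1) _ N_scale[OF B(1) N_add[OF B(1) N_diff[OF B(1) N_add[OF B(1) M[of i j k] M[of j i k]] M[of k i j]]
       N_add[OF B(1) N_add[OF B(1) T[where i=i and j=k and k=j] T[where i=j and j=i and k=k]] T[where i=j and j=k and k=i]]], of "1/2"]])
      (simp add: algebra_simps)
  have Q: "N B (\<lambda>e y. \<Sum>k\<in>UNIV. gi c k m e y * (?C k e y - ?P i j k e y))"
    by (intro N_sum N_mult B(1) C R_mono[OF gi_R[OF cA] B(2)])
  have I: "N B (\<lambda>e y. \<Sum>l\<in>UNIV. vc c (W i j) l e y * ((\<Sum>k\<in>UNIV. gg c l k e y * gi c k m e y) - (if l = m then 1 else 0)))"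
    by (intro N_sum N_mult B(1) RW N_mono[OF g_inv[OF cA] B(2)])
  show ?thesis
  proof (rule N_cong[OF B(1) _ N_scale[OF B(1) N_add[OF B(1) Q I], of "-1"]])
    fix e :: real and y
    have s: "(\<Sum>k\<in>UNIV. gi c k m e y * ?P i j k e y) = (\<Sum>l\<in>UNIV. vc c (W i j) l e y * (\<Sum>k\<in>UNIV. gg c l k e y * gi c k m e y))"
      unfolding sum_distrib_left by (subst sum.swap) (simp add: mult_ac)
    have d: "(\<Sum>l\<in>UNIV. vc c (W i j) l e y * (if l = m then 1 else 0)) = vc c (W i j) m e y"
      by (simp add: if_distrib[where f="\<lambda>x. _ * x"] cong: if_cong)
    show "- 1 * ((\<Sum>k\<in>UNIV. gi c k m e y * (?C k e y - ?P i j k e y)) +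
       (\<Sum>l\<in>UNIV. vc c (W i j) l e y * ((\<Sum>k\<in>UNIV. gg c l k e y * gi c k m e y) - (if l = m then 1 else 0)))) =
      vc c (W i j) m e y - chr c m i j e y"
      unfolding right_diff_distrib[of "gi c _ m e y"] right_diff_distrib[of "vc c (W i j) _ e y"] sum_subtractf s d chr_def
      by simp
  qed
qed

lemma D_formula_B:
  assumes \<xi>: "\<xi> \<in> V1" and \<eta>: "\<eta> \<in> V2" and w: "D \<xi> \<eta> w"
  shows "N B (\<lambda>e y. vc c w l e y - (\<Sum>i\<in>UNIV. vc c \<xi> i e y *
     (pd [i] (vc c \<eta> l e) y + (\<Sum>j\<in>UNIV. vc c \<eta> j e y * chr c l i j e y))))"
proof -
  obtain W1 where W1: "\<And>i. D (\<lambda>e. Ei i) \<eta> (W1 i)" using D_ex[OF Ei_V(1) \<eta>] by metis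
  obtain W where W: "\<And>i j. D (\<lambda>e. Ei i) (\<lambda>e. Ei j) (W i j)" using D_ex[OF Ei_V(1) Ei_V(2)] by metis
  have RX: "R B (vc c \<xi> i)" "R B (vc c \<eta> i)" for i
    using R_mono[OF V1_R[OF \<xi> cA] B(2)] R_mono[OF V2_R[OF \<eta> cA] B(2)] by blast+
  have 1: "N B (\<lambda>e y. \<Sum>i\<in>UNIV. vc c \<xi> i e y * (vc c (W1 i) l e y - (pd [i] (vc c \<eta> l e) y + (\<Sum>j\<in>UNIV. vc c \<eta> j e y * vc c (W i j) l e y))))"
    by (intro N_sum N_mult B(1) RX D_local2[OF \<eta> W W1])
  have 2: "N B (\<lambda>e y. \<Sum>i\<in>UNIV. vc c \<xi> i e y * (\<Sum>j\<in>UNIV. vc c \<eta> j e y * (vc c (W i j) l e y - chr c l i j e y)))"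
    by (intro N_sum N_mult B(1) RX D_koszul W)
  show ?thesis
    by (rule N_cong[OF B(1) _ N_add[OF B(1) D_local1[OF \<xi> \<eta> W1 w, of l] N_add[OF B(1) 1 2]]])
      (simp add: right_diff_distrib distrib_left sum_subtractf sum.distrib)
qed

end

context conn
begin

text \<open>The formula on small balls implies it on the chart, since being null is a local property.\<close>

theorem D_formula:
  assumes \<xi>: "\<xi> \<in> V1" and \<eta>: "\<eta> \<in> V2" and w: "D \<xi> \<eta> w" and c: "c \<in> A"
  shows "N (cran c) (\<lambda>e y. vc c w l e y - (\<Sum>i\<in>UNIV. vc c \<xi> i e y *
     (pd [i] (vc c \<eta> l e) y + (\<Sum>j\<in>UNIV. vc c \<eta> j e y * chr c l i j e y))))"
proof (rule N_local)
  fix x0 assume x0: "x0 \<in> cran c"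
  obtain \<phi> r where r: "r > 0" "cball x0 r \<subseteq> cran c" and \<phi>: "Ck_on \<infinity> UNIV \<phi>"
    "\<And>x. x \<in> cball x0 (r/2) \<Longrightarrow> \<phi> x = 1" "\<And>x. x \<notin> cball x0 r \<Longrightarrow> \<phi> x = (0::real)"
    using chart_cutoff[OF c x0] by metis
  obtain \<psi> where \<psi>: "Ck_on \<infinity> UNIV \<psi>" "\<And>x. dist x x0 \<le> r/4 \<Longrightarrow> \<psi> x = 1" "\<And>x. r/2 \<le> dist x x0 \<Longrightarrow> \<psi> x = (0::real)"
    using bump_exists[of "r/4" "r/2" x0] r(1) by auto
  interpret C: conn_cut A N R V1 V2 F1 F2 D g gi c "cball x0 r" "ball x0 (r/4)" \<phi> \<psi>
  proof unfold_locales
    show "\<psi> x * \<phi> x = \<psi> x" for x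
      using \<phi>(2)[of x] \<psi>(3)[of x] by (cases "dist x x0 \<le> r/2") (auto simp: dist_commute)
    show "\<psi> x = 0" if "x \<notin> cball x0 r" for x using \<psi>(3)[of x] that r(1) by (auto simp: dist_commute)
    show "\<phi> x = 1 \<and> \<psi> x = 1" if "x \<in> ball x0 (r/4)" for x
      using \<phi>(2)[of x] \<psi>(2)[of x] that r(1) by (auto simp: dist_commute)
    show "ball x0 (r/4) \<subseteq> cran c" using r by (force simp: subset_iff)
  qed (use c r \<phi> \<psi> in auto)
  show "\<exists>U. x0 \<in> U \<and> N U (\<lambda>e y. vc c w l e y - (\<Sum>i\<in>UNIV. vc c \<xi> i e y *
     (pd [i] (vc c \<eta> l e) y + (\<Sum>j\<in>UNIV. vc c \<eta> j e y * chr c l i j e y))))"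
    using C.D_formula_B[OF \<xi> \<eta> w] r(1) by (intro exI[of _ "ball x0 (r/4)"]) auto
qed

end

section \<open>Determinant and adjugate\<close>

text \<open>An entry of the adjugate matrix, as the determinant in Cramer's rule. It is a polynomial in the entries of \<open>M\<close>, hence it is defined for the members of a
generalized metric where the determinant may vanish.\<close>

definition adjm :: "real^'n::finite^'n \<Rightarrow> 'n \<Rightarrow> 'n \<Rightarrow> real" where
  "adjm M k m = det (\<chi> i j. if j = k then axis m 1 $ i else M $ i $ j)"

lemma adjm_inverse:
  fixes M :: "real^'n::finite^'n"
  assumes "det M \<noteq> 0"
  shows "(\<Sum>k\<in>UNIV. M $ l $ k * (adjm M k m * (1 / det M))) = (if l = m then 1 else 0)"
proof -
  have "M *v (\<chi> k. adjm M k m / det M) = axis m 1"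
    using cramer[OF assms, of "\<chi> k. adjm M k m / det M" "axis m 1"] by (simp add: adjm_def)
  then have "(M *v (\<chi> k. adjm M k m / det M)) $ l = axis m 1 $ l" by simp
  then show ?thesis by (auto simp: matrix_vector_mult_def axis_def)
qed

lemma Ck_det:
  assumes "open S" "\<And>i j. Ck_on k S (\<lambda>x. M x $ i $ j)"
  shows "Ck_on k S (\<lambda>x. det (M x :: real^'n::finite^'n))"
  unfolding det_def by (intro Ck_sum Ck_mult Ck_prod Ck_const assms)

lemma Ck_adjm:
  assumes "open S" "\<And>i j. Ck_on k S (\<lambda>x. M x $ i $ j)"
  shows "Ck_on k S (\<lambda>x. adjm (M x :: real^'n::finite^'n) a b)"
  unfolding adjm_def
proof (rule Ck_det[OF assms(1)])
  show "Ck_on k S (\<lambda>x. (\<chi> i j. if j = a then axis b 1 $ i else M x $ i $ j) $ i $ j)" for i j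
    by (cases "j = a") (auto simp: Ck_const assms(2))
qed

lemma Mod_det:
  assumes "open S" "\<And>i j. Mod S (\<lambda>e x. M e x $ i $ j)"
  shows "Mod S (\<lambda>e x. det (M e x :: real^'n::finite^'n))"
  unfolding det_def by (intro Mod_sum Mod_mult Mod_prod Mod_const Ck_const assms)

lemma Mod_adjm:
  assumes "open S" "\<And>i j. Mod S (\<lambda>e x. M e x $ i $ j)"
  shows "Mod S (\<lambda>e x. adjm (M e x :: real^'n::finite^'n) a b)"
  unfolding adjm_def
proof (rule Mod_det[OF assms(1)])
  show "Mod S (\<lambda>e x. (\<chi> i j. if j = a then axis b 1 $ i else M e x $ i $ j) $ i $ j)" for i j
    by (cases "j = a") (auto simp: Mod_const Ck_const assms)
qed

lemma Conv_det:
  assumes "open S" "\<And>i j. Conv k S (\<lambda>e x. M e x $ i $ j) (\<lambda>x. M0 x $ i $ j)"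
  shows "Conv k S (\<lambda>e x. det (M e x :: real^'n::finite^'n)) (\<lambda>x. det (M0 x))"
  unfolding det_def by (intro Conv_sum Conv_mult Conv_prod Conv_const Ck_const assms)

lemma Conv_adjm:
  assumes "open S" "\<And>i j. Conv k S (\<lambda>e x. M e x $ i $ j) (\<lambda>x. M0 x $ i $ j)"
  shows "Conv k S (\<lambda>e x. adjm (M e x :: real^'n::finite^'n) a b) (\<lambda>x. adjm (M0 x) a b)"
  unfolding adjm_def
proof (rule Conv_det[OF assms(1)])
  show "Conv k S (\<lambda>e x. (\<chi> i j. if j = a then axis b 1 $ i else M e x $ i $ j) $ i $ j)
     (\<lambda>x. (\<chi> i j. if j = a then axis b 1 $ i else M0 x $ i $ j) $ i $ j)" for i j
    by (cases "j = a") (auto simp: Conv_const Ck_const assms)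
qed

section \<open>The coordinate frame on an open set\<close>

context atlas
begin

lemma sub_chart:
  assumes "c \<in> A" "open W"
  shows "(cdom c \<inter> W, cmap c) \<in> restr A W" "(cdom c \<inter> W, cmap c) \<in> A"
  using restr_mem[OF assms] by (auto simp: restr_def)

lemma same_map_comp:
  assumes "t \<in> Ck_tensor k A r s" "c \<in> A" "d \<in> A" "cmap d = cmap c" "p \<in> cdom c" "p \<in> cdom d" "I \<in> idx r" "J \<in> idx s"
  shows "t d p I J = t c p I J"
  using tensor_law[OF assms(1-3,5-8)] jac_same_map[OF assms(2,3,4,5,6)] jac_same_map[OF assms(3,2) assms(4)[symmetric] assms(6,5)]
  by (simp add: trf_id assms)

lemma frame_coord:
  assumes \<xi>: "\<xi> \<in> Ck_tensor k A 1 0" and c: "c \<in> A" and W: "open W" "W \<subseteq> cdom c"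
    and f: "tens (restr A W) 1 0 \<xi> = frame A W c i" and y: "y \<in> cmap c ` (cdom c \<inter> W)"
  shows "coord c \<xi> [m] [] y = (if m = i then 1 else 0)"
proof -
  obtain q where q: "q \<in> cdom c" "q \<in> W" "y = cmap c q" using y by blast
  let ?d = "(cdom c \<inter> W, cmap c)"
  note d = sub_chart[OF c W(1)]
  have I: "[m] \<in> idx 1" "[] \<in> idx 0" by (auto simp: idx_1)
  have "\<xi> ?d q [m] [] = tens (restr A W) 1 0 \<xi> ?d q [m] []" using d q by (simp add: tens_def idx_1)
  also have "\<dots> = jac c ?d q $ m $ i" unfolding f using d q by (simp add: frame_def tens_def idx_1)
  also have "\<dots> = (if m = i then 1 else 0)" using jac_same_map[OF c d(2), of q] q by (simp add: mat_def)
  finally show ?thesis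
    using same_map_comp[OF \<xi> c d(2) _ q(1) _ I] q ch(3)[OF c q(1)] by (simp add: coord_def)
qed

lemma tens_frame_comb:
  assumes t: "t \<in> Ck_tensor k A 1 0" and c: "c \<in> A" and W: "open W" "W \<subseteq> cdom c"
    and u: "\<And>l c' p. c' \<in> restr A W \<Longrightarrow> p \<in> cdom c' \<Longrightarrow> u l c' p [] [] = t c p [l] []"
  shows "tens (restr A W) 1 0 t = frame_comb A W c u"
proof (intro ext)
  fix c' p I J
  show "tens (restr A W) 1 0 t c' p I J = frame_comb A W c u c' p I J"
  proof (cases "c' \<in> restr A W \<and> p \<in> cdom c' \<and> I \<in> idx 1 \<and> J \<in> idx 0")
    case True
    then obtain m where m: "I = [m]" "J = []" by (auto simp: idx_1)
    have cp: "c' \<in> A" "p \<in> cdom c" using True W by (auto simp: restr_def)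
    have "t c' p [m] [] = (\<Sum>l\<in>UNIV. jac c c' p $ m $ l * t c p [l] [])"
      using tensor_law[OF t c cp(1) cp(2), of "[m]" "[]"] True by (simp add: idx_1 trf_vec)
    then show ?thesis using True m u[of c' p] by (simp add: tens_def frame_comb_def frame_def idx_1 mult.commute)
  next
    case False then show ?thesis by (auto simp: tens_def frame_comb_def)
  qed
qed

text \<open>Where the cut-off function is \<open>1\<close>, the cut-off field is the coordinate field in the sense of the definition of Christoffel symbols.\<close>

lemma bumpE_frame:
  assumes c: "c \<in> A" and W: "open W" "W \<subseteq> cdom c" and one: "\<And>p. p \<in> W \<Longrightarrow> \<phi> (cmap c p) = 1"
  shows "tens (restr A W) 1 0 (bumpE c \<phi> i) = frame A W c i"
proof (intro ext)
  fix c' p I J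
  show "tens (restr A W) 1 0 (bumpE c \<phi> i) c' p I J = frame A W c i c' p I J"
  proof (cases "c' \<in> restr A W \<and> p \<in> cdom c' \<and> I \<in> idx 1 \<and> J \<in> idx 0")
    case True
    then obtain m where m: "I = [m]" "J = []" by (auto simp: idx_1)
    have "p \<in> W" "c' \<in> A" using True by (auto simp: restr_def)
    then show ?thesis using True m W one[of p]
      by (auto simp: tens_def bumpE_def from_chart_def frame_def trf_vec idx_1 if_distrib[where f="\<lambda>x. _ * x"] cong: if_cong)
  next
    case False then show ?thesis by (auto simp: tens_def frame_def)
  qed
qed

text \<open>Christoffel symbols are defined by test fields that agree with the coordinate frame on an open set. Every point has such fields, which gives uniqueness.\<close>

lemma bump_frame_at:
  assumes c: "c \<in> A" and p: "p \<in> cdom c"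
  obtains W E where "open W" "p \<in> W" "W \<subseteq> cdom c" "\<And>i. E i \<in> smooth_tensor A 1 0"
    "\<And>i. tens (restr A W) 1 0 (E i) = frame A W c i"
proof -
  have x: "cmap c p \<in> cran c" by (rule ch(5)[OF c p])
  obtain \<phi> r where r: "r > 0" "cball (cmap c p) r \<subseteq> cran c" and \<phi>: "Ck_on \<infinity> UNIV \<phi>"
    "\<And>x. x \<in> cball (cmap c p) (r/2) \<Longrightarrow> \<phi> x = 1" "\<And>x. x \<notin> cball (cmap c p) r \<Longrightarrow> \<phi> x = (0::real)"
    using chart_cutoff[OF c x] by metis
  define W where "W = cdom c \<inter> cmap c -` ball (cmap c p) (r/2)"
  have W: "open W" unfolding W_def by (rule continuous_open_preimage[OF ch(7)[OF c] ch(1)[OF c] open_ball])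
  show ?thesis
  proof (rule that[of W "bumpE c \<phi>"])
    show "bumpE c \<phi> i \<in> smooth_tensor A 1 0" for i
      by (rule bumpE_smooth[OF c \<phi>(1) compact_cball r(2) \<phi>(3)])
    show "tens (restr A W) 1 0 (bumpE c \<phi> i) = frame A W c i" for i
      by (rule bumpE_frame[OF c W]) (use \<phi>(2) in \<open>auto simp: W_def\<close>)
  qed (use W p r(1) in \<open>auto simp: W_def\<close>)
qed

section \<open>Classical Levi-Civita connections\<close>

definition ginv :: "('a, 'n) tensor \<Rightarrow> ('a, 'n) chart \<Rightarrow> 'n \<Rightarrow> 'n \<Rightarrow> real^'n \<Rightarrow> real" where
  "ginv g c k m x = adjm (gmat g c (cinv c x)) k m * (1 / det (gmat g c (cinv c x)))"

text \<open>The classical Christoffel symbols \<open>\<Gamma>\<^sup>m\<^sub>i\<^sub>j\<close> in terms of the metric.\<close>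

definition cchr :: "('a, 'n) tensor \<Rightarrow> ('a, 'n) chart \<Rightarrow> 'n \<Rightarrow> 'n \<Rightarrow> 'n \<Rightarrow> real^'n \<Rightarrow> real" where
  "cchr g c m i j x = (\<Sum>k\<in>UNIV. ginv g c k m x *
     (1/2 * (pd [i] (coord c g [] [j, k]) x + pd [j] (coord c g [] [i, k]) x - pd [k] (coord c g [] [i, j]) x)))"

lemma pr_metric_det:
  assumes "pr_metric k A g" "c \<in> A" "p \<in> cdom c"
  shows "det (gmat g c p) \<noteq> 0"
proof
  assume "det (gmat g c p) = 0"
  then obtain v where "v \<noteq> 0" "gmat g c p *v v = 0"
    using matrix_left_invertible_ker[of "gmat g c p"] invertible_left_inverse invertible_det_nz by metis
  then show False using assms unfolding pr_metric_def by (metis inner_zero_right)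
qed

lemma ginv_Ck:
  assumes "pr_metric k A g" "c \<in> A"
  shows "Ck_on k (cran c) (ginv g c a b)"
proof -
  have g: "g \<in> Ck_tensor k A 0 2" using assms unfolding pr_metric_def by blast
  show ?thesis unfolding ginv_def[abs_def]
    by (intro Ck_mult Ck_adjm Ck_inverse Ck_det gmat_smooth[OF g assms(2)] ch(2)[OF assms(2)])
      (use pr_metric_det[OF assms] ch(6)[OF assms(2)] in auto)
qed

lemma enat_pred: "1 \<le> k \<Longrightarrow> k - 1 + 1 = (k::enat)"
  by (cases k) (auto simp: one_enat_def)

lemma enat_pred_le: "k - 1 \<le> (k::enat)"
  by (cases k) (auto simp: one_enat_def)

lemma Ck_pd1: "1 \<le> k \<Longrightarrow> Ck_on k S f \<Longrightarrow> Ck_on (k - 1) S (pd [i] f)"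
  using Ck_pd[of "k - 1" "[i]" S f] enat_pred[of k] by (simp add: one_enat_def)

lemma cchr_Ck:
  assumes "1 \<le> k" "pr_metric k A g" "c \<in> A"
  shows "Ck_on (k - 1) (cran c) (cchr g c m i j)"
proof -
  have g: "g \<in> Ck_tensor k A 0 2" using assms unfolding pr_metric_def by blast
  have p: "Ck_on (k - 1) (cran c) (pd [i] (coord c g [] [a, b]))" for i a b
    by (rule Ck_pd1[OF assms(1) tensor_Ck[OF g assms(3)]]) (auto simp: idx_2)
  show ?thesis unfolding cchr_def[abs_def]
    by (intro Ck_sum Ck_mult Ck_const Ck_add Ck_diff p ch(2)[OF assms(3)] Ck_mono[OF ginv_Ck[OF assms(2,3)] enat_pred_le order_refl])
qed

lemma tens_at: "c \<in> A \<Longrightarrow> x \<in> cran c \<Longrightarrow> I \<in> idx r \<Longrightarrow> J \<in> idx s \<Longrightarrow> coord c (tens A r s F) I J x = F c (cinv c x) I J"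
  using ch(6)[of c x] by (simp add: coord_def tens_def)

lemma act_coord: "c \<in> A \<Longrightarrow> x \<in> cran c \<Longrightarrow> coord c (act A \<xi> u) [] [] x = (\<Sum>i\<in>UNIV. coord c \<xi> [i] [] x * pd [i] (coord c u [] []) x)"
  using ch(4)[of c x] unfolding act_def by (subst tens_at) (auto simp: coord_def)

lemma bracket_coord: "c \<in> A \<Longrightarrow> x \<in> cran c \<Longrightarrow> coord c (bracket A \<xi> \<eta>) [l] [] x =
   (\<Sum>i\<in>UNIV. coord c \<xi> [i] [] x * pd [i] (coord c \<eta> [l] []) x - coord c \<eta> [i] [] x * pd [i] (coord c \<xi> [l] []) x)"
  using ch(4)[of c x] unfolding bracket_def by (subst tens_at) (auto simp: coord_def idx_1)

text \<open>The classical instance: null means zero, and nets are treated one parameter at a time.\<close>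

lemma levi_civita_conn:
  assumes k: "1 \<le> k" and g: "pr_metric k A g" and D: "levi_civita k A g D"
  shows "conn A (\<lambda>S f. \<forall>e\<in>{0<..1}. \<forall>x\<in>S. f e x = 0) (\<lambda>S f. True)
    {\<xi>. \<forall>e\<in>{0<..1}. \<xi> e \<in> Ck_tensor (k - 1) A 1 0} {\<xi>. \<forall>e\<in>{0<..1}. \<xi> e \<in> Ck_tensor k A 1 0}
    {\<xi>. \<forall>e\<in>{0<..1}. \<xi> e \<in> Ck_tensor (k - 1) A 0 0} {\<xi>. \<forall>e\<in>{0<..1}. \<xi> e \<in> Ck_tensor k A 0 0}
    (\<lambda>\<xi> \<eta> w. \<forall>e\<in>{0<..1}. w e = D (\<xi> e) (\<eta> e)) (\<lambda>e. g) (\<lambda>c k m e. ginv g c k m)"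
    (is "conn A ?N ?R ?V1 ?V2 ?F1 ?F2 ?D ?g ?gi")
proof -
  have con: "connection k A D" using D unfolding levi_civita_def by blast
  have add2: "D \<xi> (tadd \<eta> \<eta>') = tadd (D \<xi> \<eta>) (D \<xi> \<eta>')"
    if "\<xi> \<in> Ck_tensor (k - 1) A 1 0" "\<eta> \<in> Ck_tensor k A 1 0" "\<eta>' \<in> Ck_tensor k A 1 0" for \<xi> \<eta> \<eta>'
    using con that unfolding connection_def by blast
  have add1: "D (tadd \<xi> \<xi>') \<eta> = tadd (D \<xi> \<eta>) (D \<xi>' \<eta>)"
    if "\<xi> \<in> Ck_tensor (k - 1) A 1 0" "\<xi>' \<in> Ck_tensor (k - 1) A 1 0" "\<eta> \<in> Ck_tensor k A 1 0" for \<xi> \<xi>' \<eta>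
    using con that unfolding connection_def by blast
  have sc1: "D (fscale u \<xi>) \<eta> = fscale u (D \<xi> \<eta>)"
    if "\<xi> \<in> Ck_tensor (k - 1) A 1 0" "\<eta> \<in> Ck_tensor k A 1 0" "u \<in> Ck_tensor (k - 1) A 0 0" for \<xi> \<eta> u
    using con that unfolding connection_def by blast
  have leib: "D \<xi> (fscale u \<eta>) = tadd (fscale u (D \<xi> \<eta>)) (fscale (act A \<xi> u) \<eta>)"
    if "\<xi> \<in> Ck_tensor (k - 1) A 1 0" "\<eta> \<in> Ck_tensor k A 1 0" "u \<in> Ck_tensor k A 0 0" for \<xi> \<eta> u
    using con that unfolding connection_def by blast
  have tor: "bracket A \<xi> \<eta> = tsub (D \<xi> \<eta>) (D \<eta> \<xi>)" if "\<xi> \<in> Ck_tensor k A 1 0" "\<eta> \<in> Ck_tensor k A 1 0" for \<xi> \<eta>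
    using D that unfolding levi_civita_def by blast
  have met: "act A \<xi> (contr2 A g \<eta> \<zeta>) = tadd (contr2 A g (D \<xi> \<eta>) \<zeta>) (contr2 A g \<eta> (D \<xi> \<zeta>))"
    if "\<xi> \<in> Ck_tensor (k - 1) A 1 0" "\<eta> \<in> Ck_tensor k A 1 0" "\<zeta> \<in> Ck_tensor k A 1 0" for \<xi> \<eta> \<zeta>
    using D that unfolding levi_civita_def by blast
  have lk: "u \<in> Ck_tensor k A r s \<Longrightarrow> u \<in> Ck_tensor (k - 1) A r s" for u r s
    using tensor_mono enat_pred_le by blast
  have sm: "u \<in> smooth_tensor A r s \<Longrightarrow> u \<in> Ck_tensor k A r s" for u r s
    by (erule tensor_mono) auto
  have cut: "from_chart A c 0 0 (\<lambda>x I J. \<psi> x * coord c \<xi> [i] [] x) \<in> Ck_tensor k' A 0 0"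
    if "\<xi> \<in> Ck_tensor k' A 1 0" "c \<in> A" "compact K" "K \<subseteq> cran c" "Ck_on \<infinity> UNIV \<psi>" "\<And>x. x \<notin> K \<Longrightarrow> \<psi> x = 0"
    for \<xi> k' c K \<psi> i
    by (rule from_chart_supp[OF that(2) _ that(3,4)], intro Ck_mult ch(2)[OF that(2)] tensor_Ck[OF that(1,2)])
      (use that(6) in \<open>auto simp: idx_1 intro: Ck_mono[OF that(5)]\<close>)
  show ?thesis
  proof (intro conn.intro atlas_axioms conn_axioms.intro)
    show "\<exists>w. \<forall>e\<in>{0<..1}. w e = D (\<xi> e) (\<eta> e)" for \<xi> \<eta> by (rule exI[of _ "\<lambda>e. D (\<xi> e) (\<eta> e)"]) simp
    show "?N S f'" if "open S" "\<And>e y. e \<in> {0<..1} \<Longrightarrow> y \<in> S \<Longrightarrow> f e y = f' e y" "?N S f" for S f f'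
    proof (intro ballI)
      fix e :: real and y assume "e \<in> {0<..1}" "y \<in> S"
      then show "f' e y = 0" using that(2)[of e y] that(3) by auto
    qed
    show "?N S f \<Longrightarrow> T \<subseteq> S \<Longrightarrow> ?N T f" for S T f by blast
    show "(\<And>x. x \<in> S \<Longrightarrow> \<exists>U. x \<in> U \<and> ?N U f) \<Longrightarrow> ?N S f" for S f by blast
    show "(\<lambda>e. t) \<in> ?V1 \<inter> ?V2" if "t \<in> smooth_tensor A 1 0" for t using sm[OF that] lk by auto
    show "(\<lambda>e. t) \<in> ?F1 \<inter> ?F2" if "t \<in> smooth_tensor A 0 0" for t using sm[OF that] lk by auto
    show "(\<lambda>e. tadd (\<xi> e) (\<xi>' e)) \<in> ?V1" if "\<xi> \<in> ?V1" "\<xi>' \<in> ?V1" for \<xi> \<xi>' using that tadd_tensor by blast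
    show "(\<lambda>e. tadd (\<xi> e) (\<xi>' e)) \<in> ?V2" if "\<xi> \<in> ?V2" "\<xi>' \<in> ?V2" for \<xi> \<xi>' using that tadd_tensor by blast
    show "(\<lambda>e. fscale (u e) (\<xi> e)) \<in> ?V1" if "u \<in> ?F1" "\<xi> \<in> ?V1" for u \<xi> using that fscale_tensor by blast
    show "(\<lambda>e. fscale (u e) (\<xi> e)) \<in> ?V2" if "u \<in> ?F2" "\<xi> \<in> ?V2" for u \<xi> using that fscale_tensor by blast
    show "(\<lambda>e. from_chart A c 0 0 (\<lambda>x I J. \<psi> x * vc c \<xi> i e x)) \<in> ?F1"
      if "\<xi> \<in> ?V1" "c \<in> A" "compact K" "K \<subseteq> cran c" "Ck_on \<infinity> UNIV \<psi>" "\<And>x. x \<notin> K \<Longrightarrow> \<psi> x = 0" for \<xi> c K \<psi> i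
      using cut[OF _ that(2-6)] that(1) by blast
    show "(\<lambda>e. from_chart A c 0 0 (\<lambda>x I J. \<psi> x * vc c \<xi> i e x)) \<in> ?F2"
      if "\<xi> \<in> ?V2" "c \<in> A" "compact K" "K \<subseteq> cran c" "Ck_on \<infinity> UNIV \<psi>" "\<And>x. x \<notin> K \<Longrightarrow> \<psi> x = 0" for \<xi> c K \<psi> i
      using cut[OF _ that(2-6)] that(1) by blast
    show "\<exists>k. \<xi> e \<in> Ck_tensor k A 1 0" if "\<xi> \<in> ?V1" "e \<in> {0<..1}" for \<xi> e using that by blast
    show "\<exists>k. \<xi> e \<in> Ck_tensor k A 1 0" if "\<xi> \<in> ?V2" "e \<in> {0<..1}" for \<xi> e using that by blast
    fix c assume c: "c \<in> A"
    show "?N (cran c) (\<lambda>e y. coord c g [] [a, b] y - coord c g [] [b, a] y)" for a b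
    proof (intro ballI)
      fix e :: real and y assume y: "y \<in> cran c"
      have t: "transpose (gmat g c (cinv c y)) = gmat g c (cinv c y)"
        using g c ch(6)[OF c y] unfolding pr_metric_def by blast
      have "gmat g c (cinv c y) $ a $ b = gmat g c (cinv c y) $ b $ a"
        by (subst t[symmetric]) (simp add: transpose_def)
      then show "coord c g [] [a, b] y - coord c g [] [b, a] y = 0" by (simp add: coord_def gmat_def)
    qed
    show "?N (cran c) (\<lambda>e y. (\<Sum>k\<in>UNIV. coord c g [] [l, k] y * ginv g c k m y) - (if l = m then 1 else 0))" for l m
    proof (intro ballI)
      fix e :: real and y assume y: "y \<in> cran c"
      from adjm_inverse[OF pr_metric_det[OF g c ch(6)[OF c y]], of l m]
      show "(\<Sum>k\<in>UNIV. coord c g [] [l, k] y * ginv g c k m y) - (if l = m then 1 else 0) = 0"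
        by (simp add: ginv_def coord_def gmat_def)
    qed
    show "?N (cran c) (\<lambda>e y. vc c w'' l e y - (vc c w l e y + vc c w' l e y))"
      if "\<xi> \<in> ?V1" "\<xi>' \<in> ?V1" "\<eta> \<in> ?V2" "?D \<xi> \<eta> w" "?D \<xi>' \<eta> w'" "?D (\<lambda>e. tadd (\<xi> e) (\<xi>' e)) \<eta> w''" for \<xi> \<xi>' \<eta> w w' w'' l
      using that add1 by (simp add: coord_def tadd_def)
    show "?N (cran c) (\<lambda>e y. vc c w'' l e y - (vc c w l e y + vc c w' l e y))"
      if "\<xi> \<in> ?V1" "\<eta> \<in> ?V2" "\<eta>' \<in> ?V2" "?D \<xi> \<eta> w" "?D \<xi> \<eta>' w'" "?D \<xi> (\<lambda>e. tadd (\<eta> e) (\<eta>' e)) w''" for \<xi> \<eta> \<eta>' w w' w'' l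
      using that add2 by (simp add: coord_def tadd_def)
    show "?N (cran c) (\<lambda>e y. vc c w' l e y - fc c u e y * vc c w l e y)"
      if "\<xi> \<in> ?V1" "u \<in> ?F1" "\<eta> \<in> ?V2" "?D \<xi> \<eta> w" "?D (\<lambda>e. fscale (u e) (\<xi> e)) \<eta> w'" for \<xi> u \<eta> w w' l
      using that sc1 by (simp add: coord_def fscale_def)
    show "?N (cran c) (\<lambda>e y. vc c w' l e y - (fc c u e y * vc c w l e y + (\<Sum>i\<in>UNIV. vc c \<xi> i e y * pd [i] (fc c u e) y) * vc c \<eta> l e y))"
      if a: "\<xi> \<in> ?V1" "u \<in> ?F2" "\<eta> \<in> ?V2" "?D \<xi> \<eta> w" "?D \<xi> (\<lambda>e. fscale (u e) (\<eta> e)) w'" for \<xi> u \<eta> w w' l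
    proof (intro ballI)
      fix e :: real and y assume e: "e \<in> {0<..1}" and y: "y \<in> cran c"
      have "w' e = tadd (fscale (u e) (w e)) (fscale (act A (\<xi> e) (u e)) (\<eta> e))" using a e leib by simp
      then have "vc c w' l e y = fc c u e y * vc c w l e y + coord c (act A (\<xi> e) (u e)) [] [] y * vc c \<eta> l e y"
        by (simp add: coord_def tadd_def fscale_def)
      then show "vc c w' l e y - (fc c u e y * vc c w l e y + (\<Sum>i\<in>UNIV. vc c \<xi> i e y * pd [i] (fc c u e) y) * vc c \<eta> l e y) = 0"
        unfolding act_coord[OF c y] by simp
    qed
    show "?N (cran c) (\<lambda>e y. (\<Sum>i\<in>UNIV. vc c \<xi> i e y * pd [i] (vc c \<eta> l e) y - vc c \<eta> i e y * pd [i] (vc c \<xi> l e) y)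
         - (vc c w l e y - vc c w' l e y))"
      if a: "\<xi> \<in> ?V1 \<inter> ?V2" "\<eta> \<in> ?V1 \<inter> ?V2" "?D \<xi> \<eta> w" "?D \<eta> \<xi> w'" for \<xi> \<eta> w w' l
    proof (intro ballI)
      fix e :: real and y assume e: "e \<in> {0<..1}" and y: "y \<in> cran c"
      have "bracket A (\<xi> e) (\<eta> e) = tsub (w e) (w' e)" using a e tor by simp
      then have "coord c (bracket A (\<xi> e) (\<eta> e)) [l] [] y = vc c w l e y - vc c w' l e y" by (simp add: coord_def tsub_def)
      then show "(\<Sum>i\<in>UNIV. vc c \<xi> i e y * pd [i] (vc c \<eta> l e) y - vc c \<eta> i e y * pd [i] (vc c \<xi> l e) y)
         - (vc c w l e y - vc c w' l e y) = 0" unfolding bracket_coord[OF c y] by simp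
    qed
    show "?N (cran c) (\<lambda>e y. (\<Sum>i\<in>UNIV. vc c \<xi> i e y * pd [i] (\<lambda>y. \<Sum>a\<in>UNIV. \<Sum>b\<in>UNIV. coord c g [] [a, b] y * vc c \<eta> a e y * vc c \<zeta> b e y) y)
         - ((\<Sum>a\<in>UNIV. \<Sum>b\<in>UNIV. coord c g [] [a, b] y * vc c w a e y * vc c \<zeta> b e y)
          + (\<Sum>a\<in>UNIV. \<Sum>b\<in>UNIV. coord c g [] [a, b] y * vc c \<eta> a e y * vc c w' b e y)))"
      if a: "\<xi> \<in> ?V1" "\<eta> \<in> ?V2" "\<zeta> \<in> ?V2" "?D \<xi> \<eta> w" "?D \<xi> \<zeta> w'" for \<xi> \<eta> \<zeta> w w'
    proof (intro ballI)
      fix e :: real and y assume e: "e \<in> {0<..1}" and y: "y \<in> cran c"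
      have "act A (\<xi> e) (contr2 A g (\<eta> e) (\<zeta> e)) = tadd (contr2 A g (w e) (\<zeta> e)) (contr2 A g (\<eta> e) (w' e))"
        using a e met by simp
      then have "coord c (act A (\<xi> e) (contr2 A g (\<eta> e) (\<zeta> e))) [] [] y =
        coord c (contr2 A g (w e) (\<zeta> e)) [] [] y + coord c (contr2 A g (\<eta> e) (w' e)) [] [] y"
        by (simp add: coord_def tadd_def)
      moreover have "pd [i] (coord c (contr2 A g (\<eta> e) (\<zeta> e)) [] []) y =
        pd [i] (\<lambda>y. \<Sum>a\<in>UNIV. \<Sum>b\<in>UNIV. coord c g [] [a, b] y * vc c \<eta> a e y * vc c \<zeta> b e y) y" for i
        by (rule pd_cong_open[OF ch(2)[OF c] y contr2_coord[OF c]])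
      ultimately show "(\<Sum>i\<in>UNIV. vc c \<xi> i e y * pd [i] (\<lambda>y. \<Sum>a\<in>UNIV. \<Sum>b\<in>UNIV. coord c g [] [a, b] y * vc c \<eta> a e y * vc c \<zeta> b e y) y)
         - ((\<Sum>a\<in>UNIV. \<Sum>b\<in>UNIV. coord c g [] [a, b] y * vc c w a e y * vc c \<zeta> b e y)
          + (\<Sum>a\<in>UNIV. \<Sum>b\<in>UNIV. coord c g [] [a, b] y * vc c \<eta> a e y * vc c w' b e y)) = 0"
        unfolding act_coord[OF c y] contr2_coord[OF c y] by simp
    qed
  qed (simp_all (no_asm_simp))
qed

lemma levi_civita_formula:
  assumes k: "1 \<le> k" and g: "pr_metric k A g" and D: "levi_civita k A g D"
    and z: "\<zeta> \<in> Ck_tensor (k - 1) A 1 0" and n: "\<nu> \<in> Ck_tensor k A 1 0" and c: "c \<in> A" and x: "x \<in> cran c"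
  shows "coord c (D \<zeta> \<nu>) [l] [] x = (\<Sum>i\<in>UNIV. coord c \<zeta> [i] [] x *
     (pd [i] (coord c \<nu> [l] []) x + (\<Sum>j\<in>UNIV. coord c \<nu> [j] [] x * cchr g c l i j x)))"
proof -
  note C = conn.D_formula[OF levi_civita_conn[OF k g D], of "\<lambda>e. \<zeta>" "\<lambda>e. \<nu>" "\<lambda>e. D \<zeta> \<nu>" c l]
  note chr = conn.chr_def[OF levi_civita_conn[OF k g D]]
  from C have "coord c (D \<zeta> \<nu>) [l] [] x - (\<Sum>i\<in>UNIV. coord c \<zeta> [i] [] x *
     (pd [i] (coord c \<nu> [l] []) x + (\<Sum>j\<in>UNIV. coord c \<nu> [j] [] x *
       conn.chr (\<lambda>e. g) (\<lambda>c k m e. ginv g c k m) c l i j 1 x))) = 0"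
    using z n c x by simp
  then show ?thesis unfolding chr cchr_def by simp
qed

text \<open>The functions \<open>cchr\<close> have the defining property by the coordinate formula, as the components of the coordinate fields are constant. They are the only
ones, since around each point the coordinate fields extend to the manifold.\<close>

lemma christoffel_eq:
  assumes k: "1 \<le> k" and g: "pr_metric k A g" and D: "levi_civita k A g D" and c: "c \<in> A"
  shows "christoffel k A D c = (\<lambda>l i j. from_chart (restr A (cdom c)) c 0 0 (\<lambda>x I J. cchr g c l i j x))"
    (is "_ = ?G")
  unfolding christoffel_def
proof (rule the_equality)
  let ?B = "restr A (cdom c)"
  interpret B: atlas ?B by (rule restr_atlas[OF ch(1)[OF c]])
  note cB = mem_restr[OF c]
  have con: "connection k A D" using D unfolding levi_civita_def by blast
  have Dt: "D \<xi> \<eta> \<in> Ck_tensor (k - 1) A 1 0" if "\<xi> \<in> Ck_tensor (k - 1) A 1 0" "\<eta> \<in> Ck_tensor k A 1 0" for \<xi> \<eta>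
    using con that unfolding connection_def by blast
  have GT: "?G l i j \<in> Ck_tensor (k - 1) ?B 0 0" for l i j
    by (rule B.from_chart_cover[OF cB cchr_Ck[OF k g c] carrier_restr])
  have Gat: "?G l i j c' p [] [] = cchr g c l i j (cmap c p)" if "c' \<in> ?B" "p \<in> cdom c'" for l i j c' p
    using that by (auto simp: from_chart_def tens_def trf_fun restr_def)
  have frm: "tens (restr A W) 1 0 (D \<xi> \<eta>) = frame_comb A W c (\<lambda>l. ?G l i j)"
    if \<xi>: "\<xi> \<in> Ck_tensor (k - 1) A 1 0" and \<eta>: "\<eta> \<in> Ck_tensor k A 1 0" and W: "open W" "W \<subseteq> cdom c"
      and f: "tens (restr A W) 1 0 \<xi> = frame A W c i" "tens (restr A W) 1 0 \<eta> = frame A W c j" for i j W \<xi> \<eta>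
  proof (rule tens_frame_comb[OF Dt[OF \<xi> \<eta>] c W])
    fix l c' p assume c': "c' \<in> restr A W" "p \<in> cdom c'"
    then have pW: "p \<in> W" "p \<in> cdom c" and cB': "c' \<in> ?B" using W by (auto simp: restr_def)
    let ?x = "cmap c p" and ?S = "cmap c ` (cdom c \<inter> W)"
    have S: "open ?S" "?x \<in> ?S" using image_ov[OF c W(1)] pW by auto
    have x: "?x \<in> cran c" using ch(5)[OF c pW(2)] .
    note fx = frame_coord[OF \<xi> c W f(1)] and fy = frame_coord[OF \<eta> c W f(2)]
    have p0: "pd [m] (coord c \<eta> [l] []) ?x = 0" for m
      using pd_cong_open[OF S, of "coord c \<eta> [l] []" "\<lambda>y. if l = j then 1 else 0" "[m]"] fy[of _ l] by simp
    have "D \<xi> \<eta> c p [l] [] = coord c (D \<xi> \<eta>) [l] [] ?x" using ch(3)[OF c pW(2)] by (simp add: coord_def)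
    also have "\<dots> = cchr g c l i j ?x"
      unfolding levi_civita_formula[OF k g D \<xi> \<eta> c x] fx[OF S(2)] fy[OF S(2)] p0
      by (simp add: if_distrib[where f="\<lambda>x. x * _"] cong: if_cong)
    finally show "?G l i j c' p [] [] = D \<xi> \<eta> c p [l] []" using Gat[OF cB' c'(2)] by simp
  qed
  show "(\<forall>l i j. ?G l i j \<in> Ck_tensor (k - 1) (restr A (cdom c)) 0 0) \<and>
     (\<forall>i j W. \<forall>\<xi>\<in>Ck_tensor (k - 1) A 1 0. \<forall>\<eta>\<in>Ck_tensor k A 1 0.
        open W \<and> W \<subseteq> cdom c \<and>
        tens (restr A W) 1 0 \<xi> = frame A W c i \<and> tens (restr A W) 1 0 \<eta> = frame A W c j \<longrightarrow>
        tens (restr A W) 1 0 (D \<xi> \<eta>) = frame_comb A W c (\<lambda>l. ?G l i j))"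
    using GT frm by blast
  fix \<Gamma> assume G: "(\<forall>l i j. \<Gamma> l i j \<in> Ck_tensor (k - 1) (restr A (cdom c)) 0 0) \<and>
     (\<forall>i j W. \<forall>\<xi>\<in>Ck_tensor (k - 1) A 1 0. \<forall>\<eta>\<in>Ck_tensor k A 1 0.
        open W \<and> W \<subseteq> cdom c \<and>
        tens (restr A W) 1 0 \<xi> = frame A W c i \<and> tens (restr A W) 1 0 \<eta> = frame A W c j \<longrightarrow>
        tens (restr A W) 1 0 (D \<xi> \<eta>) = frame_comb A W c (\<lambda>l. \<Gamma> l i j))"
  show "\<Gamma> = ?G"
  proof (intro ext[where g="?G"] ext[where g="?G _"] ext[where g="?G _ _"])
    fix l i j
    have GT': "\<Gamma> m i j \<in> Ck_tensor (k - 1) ?B 0 0" for m using G by blast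
    show "\<Gamma> l i j = ?G l i j"
    proof (rule tensor_ext[OF GT' GT])
      fix p assume "p \<in> carrier_of ?B"
      then have p: "p \<in> cdom c" by (rule subsetD[OF carrier_restr])
      obtain W E where W: "open W" "p \<in> W" "W \<subseteq> cdom c" and E: "\<And>i. E i \<in> smooth_tensor A 1 0"
        "\<And>i. tens (restr A W) 1 0 (E i) = frame A W c i"
        using bump_frame_at[OF c p] by blast
      have E': "E i \<in> Ck_tensor (k - 1) A 1 0" "E i \<in> Ck_tensor k A 1 0" for i
        using tensor_mono[OF E(1)] by auto
      have eq: "frame_comb A W c (\<lambda>l. \<Gamma> l i j) = frame_comb A W c (\<lambda>l. ?G l i j)"
      proof -
        have "tens (restr A W) 1 0 (D (E i) (E j)) = frame_comb A W c (\<lambda>l. \<Gamma> l i j)"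
          by (rule conjunct2[OF G, rule_format, OF E'(1) E'(2)]) (use W E(2) in simp)
        then show ?thesis using frm[OF E' W(1,3) E(2) E(2)] by simp
      qed
      let ?d = "(cdom c \<inter> W, cmap c)"
      have d: "?d \<in> restr A W" "?d \<in> A" "?d \<in> ?B" using sub_chart[OF c W(1)] W(3) by (auto simp: restr_def)
      have pd: "p \<in> cdom ?d" using p W by simp
      have fr: "frame_comb A W c u ?d p [l] [] = u l ?d p [] []" for u
        using d pd jac_same_map[OF c d(2) _ p pd]
        by (simp add: frame_comb_def frame_def tens_def idx_1 mat_def if_distrib[where f="\<lambda>x. _ * x"] cong: if_cong)
      have "\<Gamma> l i j ?d p [] [] = ?G l i j ?d p [] []" using eq fr[of "\<lambda>l. \<Gamma> l i j"] fr[of "\<lambda>l. ?G l i j"] by simp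
      then have "\<Gamma> l i j c p [] [] = ?G l i j c p [] []"
        using B.fun_inv[OF GT'[of l] d(3) cB pd p] B.fun_inv[OF GT[of l i j] d(3) cB pd p] by simp
      then show "\<exists>c\<in>?B. p \<in> cdom c \<and> (\<forall>I\<in>idx 0. \<forall>J\<in>idx 0. \<Gamma> l i j c p I J = ?G l i j c p I J)"
        using cB p by auto
    qed
  qed
qed

lemma christoffel_coord:
  assumes "1 \<le> k" "pr_metric k A g" "levi_civita k A g D" "c \<in> A" "x \<in> cran c"
  shows "coord c (christoffel k A D c l i j) [] [] x = cchr g c l i j x"
proof -
  interpret B: atlas "restr A (cdom c)" by (rule restr_atlas[OF ch(1)[OF assms(4)]])
  show ?thesis unfolding christoffel_eq[OF assms(1-4)]
    by (rule B.from_chart_coord[OF mem_restr[OF assms(4)] assms(5)]) auto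
qed

end

section \<open>Generalized metrics in charts\<close>

lemma Neq_prod:
  assumes S: "open S" and "\<And>j. j \<in> J \<Longrightarrow> Mod S (f j)" "\<And>j. j \<in> J \<Longrightarrow> Mod S (g j)" "\<And>j. j \<in> J \<Longrightarrow> Neq S (f j) (g j)"
  shows "Neq S (\<lambda>e y. \<Prod>j\<in>J. f j e y) (\<lambda>e y. \<Prod>j\<in>J. g j e y)"
  using assms(2-4)
proof (induction J rule: infinite_finite_induct)
  case (insert j J)
  have "Neq S (\<lambda>e y. f j e y * (\<Prod>j\<in>J. f j e y)) (\<lambda>e y. g j e y * (\<Prod>j\<in>J. g j e y))"
    by (rule Neq_mult2[OF S]) (use insert in \<open>auto intro!: Mod_prod S\<close>)
  then show ?case using insert by simp
qed (auto simp: Neq_refl)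

lemma Neq_det:
  assumes S: "open S" and "\<And>i j. Mod S (\<lambda>e x. M e x $ i $ j)" "\<And>i j. Mod S (\<lambda>e x. M' e x $ i $ j)"
    "\<And>i j. Neq S (\<lambda>e x. M e x $ i $ j) (\<lambda>e x. M' e x $ i $ j)"
  shows "Neq S (\<lambda>e x. det (M e x :: real^'n::finite^'n)) (\<lambda>e x. det (M' e x))"
  unfolding det_def
  by (intro Neq_sum Neq_mult Neq_prod S assms Mod_const Ck_const)

lemma Neg_eneg: "Neg S f \<Longrightarrow> x \<in> S \<Longrightarrow> eneg x f"
  unfolding Neg_iff by (drule spec[of _ "[]"]) simp

context atlas
begin

lemma gmat_coord: "gmat g c (cinv c x) $ i $ j = coord c g [] [i, j] x"
  by (simp add: gmat_def coord_def)

lemma Mod_gmat: "\<gamma> \<in> moderate A 0 2 \<Longrightarrow> c \<in> A \<Longrightarrow> Mod (cran c) (\<lambda>e x. gmat (\<gamma> e) c (cinv c x) $ i $ j)"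
  using moderate_Mod[of \<gamma> 0 2 c "[]" "[i, j]"] by (simp add: gmat_coord idx_2)

lemma Neq_gmat: "G \<in> Gen A 0 2 \<Longrightarrow> \<gamma> \<in> G \<Longrightarrow> \<gamma>' \<in> G \<Longrightarrow> c \<in> A \<Longrightarrow>
   Neq (cran c) (\<lambda>e x. gmat (\<gamma> e) c (cinv c x) $ i $ j) (\<lambda>e x. gmat (\<gamma>' e) c (cinv c x) $ i $ j)"
  using Gen_Neq[of G 0 2 \<gamma> \<gamma>' c "[]" "[i, j]"] by (simp add: gmat_coord idx_2)

text \<open>Invertibility of the determinant is an equation of classes over the chart domain. Its right side is not empty, so the left side
contains a product of representatives, and these can be replaced by the given representative up to negligible nets.\<close>

lemma gen_metric_det_inv:
  assumes G: "gen_metric A G" and \<gamma>: "\<gamma> \<in> G" and c: "c \<in> A"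
  shows "\<exists>h. Mod (cran c) h \<and> Neq (cran c) (\<lambda>e x. h e x * det (gmat (\<gamma> e) c (cinv c x))) (\<lambda>e x. 1)"
proof -
  let ?B = "restr A (cdom c)"
  interpret B: atlas ?B by (rule restr_atlas[OF ch(1)[OF c]])
  note cB = mem_restr[OF c] and S = ch(2)[OF c]
  have GG: "G \<in> Gen A 0 2" using G unfolding gen_metric_def by blast
  let ?d = "lift1 ?B 0 0 (\<lambda>g. tens ?B 0 0 (\<lambda>c' p I J. det (gmat g c p))) G"
  obtain H where H: "H \<in> Gen ?B 0 0" and e: "lift2 ?B 0 0 fscale ?d H = const_emb ?B 0 0 (one_fun ?B)"
    using G c unfolding gen_metric_def Let_def by blast
  have "one_fun ?B = from_chart ?B c 0 0 (\<lambda>x I J. 1)"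
    by (intro ext) (auto simp: one_fun_def from_chart_def tens_def trf_fun restr_def)
  then have "one_fun ?B \<in> smooth_tensor ?B 0 0"
    by (simp only:) (rule B.from_chart_cover[OF cB Ck_const carrier_restr])
  from B.const_moderate[OF this] have "(\<lambda>e. one_fun ?B) \<in> lift2 ?B 0 0 fscale ?d H"
    unfolding e const_emb_def by (rule B.gcls_self)
  from B.lift2_elem[OF this] obtain \<delta> h where d: "\<delta> \<in> ?d" and h: "h \<in> H"
    and r: "(\<lambda>e. fscale (\<delta> e) (h e), \<lambda>e. one_fun ?B) \<in> net_rel ?B 0 0" by blast
  obtain g' where g': "g' \<in> G" and r': "(\<lambda>e. tens ?B 0 0 (\<lambda>c' p I J. det (gmat (g' e) c p)), \<delta>) \<in> net_rel ?B 0 0"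
    using d unfolding lift1_def gcls_def by blast
  have I: "[] \<in> idx 0" by simp
  have hM: "Mod (cran c) (fc c h)" by (rule B.moderate_fc[OF B.Gen_moderate[OF H h] cB])
  have dM: "Mod (cran c) (fc c \<delta>)" using r' B.moderate_fc[OF _ cB] unfolding net_rel_def by blast
  have M: "Mod (cran c) (\<lambda>e x. gmat (\<gamma> e) c (cinv c x) $ i $ j)" if "\<gamma> \<in> G" for i j \<gamma>
    by (rule Mod_gmat[OF Gen_moderate[OF GG that] c])
  have "Neq (cran c) (fc c (\<lambda>e. fscale (\<delta> e) (h e))) (\<lambda>e. coord c (one_fun ?B) [] [])"
    using B.net_rel_Neq[OF r cB I I] .
  then have 1: "Neq (cran c) (\<lambda>e x. fc c \<delta> e x * fc c h e x) (\<lambda>e x. 1)"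
    unfolding Neq_def
    by (rule Neg_cong[OF S, rotated]) (use B.tens_at[OF cB] in \<open>simp add: one_fun_def coord_def fscale_def\<close>)
  have "Neq (cran c) (fc c (\<lambda>e. tens ?B 0 0 (\<lambda>c' p I J. det (gmat (g' e) c p)))) (fc c \<delta>)"
    using B.net_rel_Neq[OF r' cB I I] .
  then have 2: "Neq (cran c) (\<lambda>e x. det (gmat (g' e) c (cinv c x))) (fc c \<delta>)"
    unfolding Neq_def
    by (rule Neg_cong[OF S, rotated]) (use B.tens_at[OF cB] in \<open>simp add: coord_def\<close>)
  have 3: "Neq (cran c) (\<lambda>e x. det (gmat (\<gamma> e) c (cinv c x))) (\<lambda>e x. det (gmat (g' e) c (cinv c x)))"
    by (rule Neq_det[OF S M[OF \<gamma>] M[OF g'] Neq_gmat[OF GG \<gamma> g' c]])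
  have "Neq (cran c) (\<lambda>e x. fc c h e x * det (gmat (\<gamma> e) c (cinv c x))) (\<lambda>e x. fc c h e x * fc c \<delta> e x)"
    by (rule Neq_mult[OF S hM Neq_trans[OF S 3 2]])
  then have "Neq (cran c) (\<lambda>e x. fc c h e x * det (gmat (\<gamma> e) c (cinv c x))) (\<lambda>e x. 1)"
    using Neq_trans[OF S _ 1] by (simp add: mult.commute)
  then show ?thesis using hM by blast
qed

definition dinv :: "(real \<Rightarrow> ('a, 'n) tensor) \<Rightarrow> ('a, 'n) chart \<Rightarrow> real \<Rightarrow> real^'n \<Rightarrow> real" where
  "dinv \<gamma> c = (SOME h. Mod (cran c) h \<and> Neq (cran c) (\<lambda>e x. h e x * det (gmat (\<gamma> e) c (cinv c x))) (\<lambda>e x. 1))"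

lemma dinv:
  assumes "gen_metric A G" "\<gamma> \<in> G" "c \<in> A"
  shows "Mod (cran c) (dinv \<gamma> c)" "Neq (cran c) (\<lambda>e x. dinv \<gamma> c e x * det (gmat (\<gamma> e) c (cinv c x))) (\<lambda>e x. 1)"
  using someI_ex[OF gen_metric_det_inv[OF assms]] unfolding dinv_def by blast+

definition gginv :: "(real \<Rightarrow> ('a, 'n) tensor) \<Rightarrow> ('a, 'n) chart \<Rightarrow> 'n \<Rightarrow> 'n \<Rightarrow> real \<Rightarrow> real^'n \<Rightarrow> real" where
  "gginv \<gamma> c k m = (\<lambda>e x. adjm (gmat (\<gamma> e) c (cinv c x)) k m * dinv \<gamma> c e x)"

lemma gginv_Mod:
  assumes "gen_metric A G" "\<gamma> \<in> G" "c \<in> A"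
  shows "Mod (cran c) (gginv \<gamma> c k m)"
proof -
  have "G \<in> Gen A 0 2" using assms unfolding gen_metric_def by blast
  from Gen_moderate[OF this assms(2)] show ?thesis unfolding gginv_def
    by (intro Mod_mult Mod_adjm Mod_gmat dinv(1)[OF assms] ch(2)[OF assms(3)] assms)
qed

text \<open>Cramer's rule needs a nonzero determinant, which the members of the net need not have. But \<open>dinv * det\<close> is close to \<open>1\<close> for small
parameters, locally uniformly, so the determinant is eventually not zero, and the error in the inverse is the one of \<open>dinv * det\<close>.\<close>

lemma gginv_inv:
  assumes "gen_metric A G" "\<gamma> \<in> G" "c \<in> A"
  shows "Neg (cran c) (\<lambda>e y. (\<Sum>k\<in>UNIV. coord c (\<gamma> e) [] [l, k] y * gginv \<gamma> c k m e y) - (if l = m then 1 else 0))"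
proof (rule NegI[OF ch(2)[OF assms(3)]])
  note S = ch(2)[OF assms(3)]
  have GG: "G \<in> Gen A 0 2" using assms unfolding gen_metric_def by blast
  have M: "Mod (cran c) (\<lambda>e. coord c (\<gamma> e) [] [l, k])" for k
    by (rule moderate_Mod[OF Gen_moderate[OF GG assms(2)] assms(3)]) (auto simp: idx_2)
  show "Mod (cran c) (\<lambda>e y. (\<Sum>k\<in>UNIV. coord c (\<gamma> e) [] [l, k] y * gginv \<gamma> c k m e y) - (if l = m then 1 else 0))"
    by (intro Mod_diff Mod_sum Mod_mult S M gginv_Mod[OF assms] Mod_const Ck_const)
  fix x assume x: "x \<in> cran c"
  show "eneg x (\<lambda>e y. (\<Sum>k\<in>UNIV. coord c (\<gamma> e) [] [l, k] y * gginv \<gamma> c k m e y) - (if l = m then 1 else 0))"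
    unfolding eneg_def
  proof
    fix n :: nat
    let ?d = "\<lambda>e y. det (gmat (\<gamma> e) c (cinv c y))"
    have "eneg x (\<lambda>e y. dinv \<gamma> c e y * ?d e y - 1)"
      by (rule Neg_eneg[OF dinv(2)[OF assms, unfolded Neq_def] x])
    then have "ev x (\<lambda>e y. \<bar>dinv \<gamma> c e y * ?d e y - 1\<bar> \<le> e ^ n)" "ev x (\<lambda>e y. \<bar>dinv \<gamma> c e y * ?d e y - 1\<bar> \<le> e ^ 1)"
      unfolding eneg_def by blast+
    from ev_conj[OF this(1) ev_conj[OF this(2) ev_one]]
    show "ev x (\<lambda>e y. \<bar>(\<Sum>k\<in>UNIV. coord c (\<gamma> e) [] [l, k] y * gginv \<gamma> c k m e y) - (if l = m then 1 else 0)\<bar> \<le> e ^ n)"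
    proof (rule ev_mono)
      fix e y assume a: "\<bar>dinv \<gamma> c e y * ?d e y - 1\<bar> \<le> e ^ n \<and> \<bar>dinv \<gamma> c e y * ?d e y - 1\<bar> \<le> e ^ 1 \<and> 0 < e \<and> e < 1"
      have d: "?d e y \<noteq> 0"
      proof
        assume z: "?d e y = 0"
        have "\<bar>dinv \<gamma> c e y * ?d e y - 1\<bar> \<le> e" "e < 1" using a by auto
        then show False unfolding z by simp
      qed
      have "(\<Sum>k\<in>UNIV. coord c (\<gamma> e) [] [l, k] y * gginv \<gamma> c k m e y) =
        (\<Sum>k\<in>UNIV. gmat (\<gamma> e) c (cinv c y) $ l $ k * (adjm (gmat (\<gamma> e) c (cinv c y)) k m * (1 / ?d e y))) * (dinv \<gamma> c e y * ?d e y)"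
        unfolding sum_distrib_right gginv_def gmat_coord using d by (intro sum.cong refl) simp
      also have "\<dots> = (if l = m then 1 else 0) * (dinv \<gamma> c e y * ?d e y)" unfolding adjm_inverse[OF d] ..
      finally show "\<bar>(\<Sum>k\<in>UNIV. coord c (\<gamma> e) [] [l, k] y * gginv \<gamma> c k m e y) - (if l = m then 1 else 0)\<bar> \<le> e ^ n"
        using a by auto
    qed
  qed
qed

text \<open>Symmetry is given for a representative that depends on the relatively compact set, and only for small parameters. Another representative
differs from it by a negligible net.\<close>

lemma gen_metric_sym:
  assumes G: "gen_metric A G" and \<gamma>: "\<gamma> \<in> G" and c: "c \<in> A"
  shows "Neg (cran c) (\<lambda>e y. coord c (\<gamma> e) [] [a, b] y - coord c (\<gamma> e) [] [b, a] y)"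
proof (rule NegI[OF ch(2)[OF c]])
  note S = ch(2)[OF c]
  have GG: "G \<in> Gen A 0 2" using assms unfolding gen_metric_def by blast
  have M: "Mod (cran c) (\<lambda>e. coord c (\<gamma>' e) [] [a, b])" if "\<gamma>' \<in> G" for a b \<gamma>'
    by (rule moderate_Mod[OF Gen_moderate[OF GG that] c]) (auto simp: idx_2)
  show "Mod (cran c) (\<lambda>e y. coord c (\<gamma> e) [] [a, b] y - coord c (\<gamma> e) [] [b, a] y)"
    by (intro Mod_diff S M \<gamma>)
  fix x assume x: "x \<in> cran c"
  obtain r where r: "r > 0" "cball x r \<subseteq> cran c" using open_contains_cball S x by blast
  define V where "V = cdom c \<inter> cmap c -` ball x r"
  have V: "open V" unfolding V_def by (rule continuous_open_preimage[OF ch(7)[OF c] ch(1)[OF c] open_ball])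
  let ?K = "cinv c ` cball x r"
  have K: "compact ?K" by (rule compact_continuous_image[OF continuous_on_subset[OF ch(8)[OF c] r(2)] compact_cball])
  have "V \<subseteq> ?K"
  proof
    fix p assume "p \<in> V"
    then have "p \<in> cdom c" "cmap c p \<in> cball x r" by (auto simp: V_def)
    then show "p \<in> ?K" using ch(3)[OF c] by (metis imageI)
  qed
  then have "closure V \<subseteq> ?K" by (rule closure_minimal[OF _ compact_imp_closed[OF K]])
  then have "compact (closure V)" using compact_Int_closed[OF K closed_closure[of V]] by (simp add: Int_absorb1)
  then obtain g' e0 where g': "g' \<in> G" "e0 > (0::real)" and
    pr: "\<And>e. e \<in> {0<..1} \<Longrightarrow> e < e0 \<Longrightarrow> pr_metric \<infinity> (restr A V) (tens (restr A V) 0 2 (g' e))"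
    using G V unfolding gen_metric_def by meson
  let ?d = "(cdom c \<inter> V, cmap c)"
  note d = sub_chart[OF c V]
  have sym: "coord c (g' e) [] [a, b] y = coord c (g' e) [] [b, a] y"
    if e: "e \<in> {0<..1}" "e < e0" and y: "y \<in> ball x r" for e y
  proof -
    have yc: "y \<in> cran c" using y r(2) by auto
    let ?p = "cinv c y"
    have p: "?p \<in> cdom c" "?p \<in> V" using ch(4,6)[OF c yc] y by (auto simp: V_def)
    have t: "transpose (gmat (tens (restr A V) 0 2 (g' e)) ?d ?p) = gmat (tens (restr A V) 0 2 (g' e)) ?d ?p"
      using pr[OF e] d(1) p unfolding pr_metric_def by fastforce
    have gt: "g' e \<in> smooth_tensor A 0 2" by (rule moderate_smooth[OF Gen_moderate[OF GG g'(1)] e(1)])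
    have q: "gmat (tens (restr A V) 0 2 (g' e)) ?d ?p $ i $ j = coord c (g' e) [] [i, j] y" for i j
      using same_map_comp[OF gt c d(2) _ p(1), of "[]" "[i, j]"] p d(1) by (simp add: gmat_def tens_def coord_def idx_2)
    have "gmat (tens (restr A V) 0 2 (g' e)) ?d ?p $ a $ b = gmat (tens (restr A V) 0 2 (g' e)) ?d ?p $ b $ a"
      by (subst t[symmetric]) (simp add: transpose_def)
    then show ?thesis unfolding q .
  qed
  have N: "Neq (cran c) (\<lambda>e. coord c (\<gamma> e) [] [i, j]) (\<lambda>e. coord c (g' e) [] [i, j])" for i j
    by (rule Gen_Neq[OF GG \<gamma> g'(1) c]) (auto simp: idx_2)
  have "Neg (cran c) (\<lambda>e y. (coord c (\<gamma> e) [] [a, b] y - coord c (g' e) [] [a, b] y) - (coord c (\<gamma> e) [] [b, a] y - coord c (g' e) [] [b, a] y))"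
    by (rule Neg_diff[OF S N[unfolded Neq_def] N[unfolded Neq_def]])
  then have en: "eneg x (\<lambda>e y. (coord c (\<gamma> e) [] [a, b] y - coord c (g' e) [] [a, b] y) - (coord c (\<gamma> e) [] [b, a] y - coord c (g' e) [] [b, a] y))"
    by (rule Neg_eneg[OF _ x])
  show "eneg x (\<lambda>e y. coord c (\<gamma> e) [] [a, b] y - coord c (\<gamma> e) [] [b, a] y)"
    unfolding eneg_def
  proof
    fix n :: nat
    have xb: "x \<in> ball x r" using r by simp
    have 1: "ev x (\<lambda>e y. \<bar>(coord c (\<gamma> e) [] [a, b] y - coord c (g' e) [] [a, b] y) - (coord c (\<gamma> e) [] [b, a] y - coord c (g' e) [] [b, a] y)\<bar> \<le> e ^ n)"
      using en unfolding eneg_def by blast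
    from ev_conj[OF 1 ev_conj[OF ev_open[OF open_ball xb] ev_conj[OF ev_small[OF g'(2)] ev_one]]]
    show "ev x (\<lambda>e y. \<bar>coord c (\<gamma> e) [] [a, b] y - coord c (\<gamma> e) [] [b, a] y\<bar> \<le> e ^ n)"
    proof (rule ev_mono)
      fix e y assume a: "\<bar>(coord c (\<gamma> e) [] [a, b] y - coord c (g' e) [] [a, b] y) - (coord c (\<gamma> e) [] [b, a] y - coord c (g' e) [] [b, a] y)\<bar> \<le> e ^ n \<and>
        y \<in> ball x r \<and> (0 < e \<and> e < e0) \<and> 0 < e \<and> e < 1"
      then have "coord c (g' e) [] [a, b] y = coord c (g' e) [] [b, a] y" by (intro sym) auto
      then show "\<bar>coord c (\<gamma> e) [] [a, b] y - coord c (\<gamma> e) [] [b, a] y\<bar> \<le> e ^ n" using a by simp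
    qed
  qed
qed

section \<open>Generalized Levi-Civita connections\<close>

lemma lift2_mem:
  assumes "t \<in> T" "u \<in> U" "(\<lambda>e. F (t e) (u e)) \<in> moderate A r 0"
  shows "(\<lambda>e. F (t e) (u e)) \<in> lift2 A r 0 F T U"
  unfolding lift2_def by (rule UN_I[OF assms(1)], rule UN_I[OF assms(2)], rule gcls_self[OF assms(3)])

lemma lift2_add:
  assumes "\<xi> \<in> moderate A 1 0" "\<xi>' \<in> moderate A 1 0"
  shows "lift2 A 1 0 tadd (gcls A 1 0 \<xi>) (gcls A 1 0 \<xi>') = gcls A 1 0 (\<lambda>e. tadd (\<xi> e) (\<xi>' e))"
proof (rule lift2_eq[where F=tadd, OF gcls_self[OF assms(1)] gcls_self[OF assms(2)] tadd_moderate[OF assms]])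
  fix t u assume "t \<in> gcls A 1 0 \<xi>" "u \<in> gcls A 1 0 \<xi>'"
  then have t: "(\<xi>, t) \<in> net_rel A 1 0" and u: "(\<xi>', u) \<in> net_rel A 1 0" unfolding gcls_def by auto
  then have m: "t \<in> moderate A 1 0" "u \<in> moderate A 1 0" unfolding net_rel_def by auto
  have "Neq (cran c) (\<lambda>e. coord c (tadd (\<xi> e) (\<xi>' e)) I []) (\<lambda>e. coord c (tadd (t e) (u e)) I [])"
    if "c \<in> A" "I \<in> idx 1" for c I
    using Neq_add[OF ch(2)[OF that(1)] net_rel_Neq[OF t that, of "[]"] net_rel_Neq[OF u that, of "[]"]]
    by (simp add: coord_def[abs_def] tadd_def)
  then show "(\<lambda>e. tadd (\<xi> e) (\<xi>' e), \<lambda>e. tadd (t e) (u e)) \<in> net_rel A 1 0"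
    unfolding net_rel_iff using tadd_moderate assms m by blast
qed

lemma lift2_fscale:
  assumes "v \<in> moderate A 0 0" "\<xi>' \<in> moderate A 1 0"
  shows "lift2 A 1 0 fscale (gcls A 0 0 v) (gcls A 1 0 \<xi>') = gcls A 1 0 (\<lambda>e. fscale (v e) (\<xi>' e))"
proof (rule lift2_eq[where F=fscale, OF gcls_self[OF assms(1)] gcls_self[OF assms(2)] fscale_moderate[OF assms]])
  fix t u assume "t \<in> gcls A 0 0 v" "u \<in> gcls A 1 0 \<xi>'"
  then have t: "(v, t) \<in> net_rel A 0 0" and u: "(\<xi>', u) \<in> net_rel A 1 0" unfolding gcls_def by auto
  then have m: "t \<in> moderate A 0 0" "u \<in> moderate A 1 0" unfolding net_rel_def by auto
  have "Neq (cran c) (\<lambda>e. coord c (fscale (v e) (\<xi>' e)) I []) (\<lambda>e. coord c (fscale (t e) (u e)) I [])"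
    if "c \<in> A" "I \<in> idx 1" for c I
    using Neq_mult2[OF ch(2)[OF that(1)] moderate_fc[OF assms(1) that(1)] moderate_Mod[OF m(2) that, of "[]"]
       net_rel_Neq[OF t that(1), of "[]" "[]"] net_rel_Neq[OF u that, of "[]"]]
    by (simp add: coord_def[abs_def] fscale_def)
  then show "(\<lambda>e. fscale (v e) (\<xi>' e), \<lambda>e. fscale (t e) (u e)) \<in> net_rel A 1 0"
    unfolding net_rel_iff using fscale_moderate assms m by blast
qed

lemma net_rel_vc: "(t, u) \<in> net_rel A 1 0 \<Longrightarrow> c \<in> A \<Longrightarrow> Neq (cran c) (vc c t l) (vc c u l)"
  by (rule net_rel_Neq) (auto simp: idx_1)

lemma net_rel_fc: "(t, u) \<in> net_rel A 0 0 \<Longrightarrow> c \<in> A \<Longrightarrow> Neq (cran c) (fc c t) (fc c u)"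
  by (rule net_rel_Neq) auto

lemma Gen_vc: "T \<in> Gen A 1 0 \<Longrightarrow> t \<in> T \<Longrightarrow> u \<in> T \<Longrightarrow> c \<in> A \<Longrightarrow> Neq (cran c) (vc c t l) (vc c u l)"
  by (rule Gen_Neq) (auto simp: idx_1)

lemma Gen_fc: "T \<in> Gen A 0 0 \<Longrightarrow> t \<in> T \<Longrightarrow> u \<in> T \<Longrightarrow> c \<in> A \<Longrightarrow> Neq (cran c) (fc c t) (fc c u)"
  by (rule Gen_Neq) auto

lemma contr2_Neq:
  assumes G: "G \<in> Gen A 0 2" and Y: "Y \<in> Gen A 1 0" and Z: "Z \<in> Gen A 1 0" and c: "c \<in> A"
    and x: "x \<in> gcontr2 A G Y Z" and m: "\<gamma> \<in> G" "\<eta> \<in> Y" "\<zeta> \<in> Z"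
  shows "Neq (cran c) (fc c x) (\<lambda>e y. \<Sum>a\<in>UNIV. \<Sum>b\<in>UNIV. coord c (\<gamma> e) [] [a, b] y * vc c \<eta> a e y * vc c \<zeta> b e y)"
proof -
  note S = ch(2)[OF c]
  obtain g' \<eta>' \<zeta>' where m': "g' \<in> G" "\<eta>' \<in> Y" "\<zeta>' \<in> Z"
    and r: "(\<lambda>e. contr2 A (g' e) (\<eta>' e) (\<zeta>' e), x) \<in> net_rel A 0 0"
    using x unfolding gcontr2_def gcls_def by blast
  have gM: "Mod (cran c) (\<lambda>e. coord c (\<gamma>' e) [] [a, b])" if "\<gamma>' \<in> G" for a b \<gamma>'
    by (rule moderate_Mod[OF Gen_moderate[OF G that] c]) (auto simp: idx_2)
  have gN: "Neq (cran c) (\<lambda>e. coord c (g' e) [] [a, b]) (\<lambda>e. coord c (\<gamma> e) [] [a, b])" for a b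
    by (rule Gen_Neq[OF G m'(1) m(1) c]) (auto simp: idx_2)
  note yM = moderate_vc[OF Gen_moderate[OF Y] c] and zM = moderate_vc[OF Gen_moderate[OF Z] c]
  have "Neq (cran c) (fc c x) (fc c (\<lambda>e. contr2 A (g' e) (\<eta>' e) (\<zeta>' e)))"
    by (rule Neq_sym[OF S net_rel_fc[OF r c]])
  moreover have "Neq (cran c) (fc c (\<lambda>e. contr2 A (g' e) (\<eta>' e) (\<zeta>' e)))
     (\<lambda>e y. \<Sum>a\<in>UNIV. \<Sum>b\<in>UNIV. coord c (g' e) [] [a, b] y * vc c \<eta>' a e y * vc c \<zeta>' b e y)"
    by (rule Neq_on[OF S]) (rule contr2_coord[OF c])
  moreover have "Neq (cran c) (\<lambda>e y. \<Sum>a\<in>UNIV. \<Sum>b\<in>UNIV. coord c (g' e) [] [a, b] y * vc c \<eta>' a e y * vc c \<zeta>' b e y)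
     (\<lambda>e y. \<Sum>a\<in>UNIV. \<Sum>b\<in>UNIV. coord c (\<gamma> e) [] [a, b] y * vc c \<eta> a e y * vc c \<zeta> b e y)"
    by (intro Neq_sum Neq_mult2 S gN Mod_mult gM yM zM m m' Gen_vc[OF Y m'(2) m(2) c] Gen_vc[OF Z m'(3) m(3) c])
  ultimately show ?thesis using Neq_trans[OF S] by blast
qed

lemma contr2_mem:
  assumes "G \<in> Gen A 0 2" "Y \<in> Gen A 1 0" "Z \<in> Gen A 1 0" "\<gamma> \<in> G" "\<eta> \<in> Y" "\<zeta> \<in> Z"
  shows "(\<lambda>e. contr2 A (\<gamma> e) (\<eta> e) (\<zeta> e)) \<in> gcontr2 A G Y Z"
  unfolding gcontr2_def
  using gcls_self[OF contr2_moderate[OF Gen_moderate[OF assms(1,4)] Gen_moderate[OF assms(2,5)] Gen_moderate[OF assms(3,6)]]] assms(4-6)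
  by blast

lemma gcontr2_moderate: "x \<in> gcontr2 A G Y Z \<Longrightarrow> x \<in> moderate A 0 0"
  unfolding gcontr2_def gcls_def net_rel_def by blast

lemma lift2_moderate: "x \<in> lift2 A r s F T U \<Longrightarrow> x \<in> moderate A r s"
  unfolding lift2_def gcls_def net_rel_def by blast

text \<open>The derivative of a whole set \<open>U\<close> of nets that all represent \<open>f\<close>. In the axioms of a connection the second
argument is itself the result of an operation on classes.\<close>

lemma act_Neq:
  assumes x: "x \<in> lift2 A 0 0 (act A) T U" and T: "T \<in> Gen A 1 0" "\<xi> \<in> T" and c: "c \<in> A"
    and U: "\<And>u. u \<in> U \<Longrightarrow> Mod (cran c) (fc c u) \<and> Neq (cran c) (fc c u) f" and f: "Mod (cran c) f"
  shows "Neq (cran c) (fc c x) (\<lambda>e y. \<Sum>i\<in>UNIV. vc c \<xi> i e y * pd [i] (f e) y)"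
proof -
  note S = ch(2)[OF c]
  obtain \<xi>' u where t: "\<xi>' \<in> T" "u \<in> U" and r: "(\<lambda>e. act A (\<xi>' e) (u e), x) \<in> net_rel A 0 0"
    using lift2_elem[OF x] by blast
  have "Neq (cran c) (fc c x) (fc c (\<lambda>e. act A (\<xi>' e) (u e)))" by (rule Neq_sym[OF S net_rel_fc[OF r c]])
  moreover have "Neq (cran c) (fc c (\<lambda>e. act A (\<xi>' e) (u e))) (\<lambda>e y. \<Sum>i\<in>UNIV. vc c \<xi>' i e y * pd [i] (fc c u e) y)"
    by (rule Neq_on[OF S]) (rule act_coord[OF c])
  moreover have "Neq (cran c) (\<lambda>e y. \<Sum>i\<in>UNIV. vc c \<xi>' i e y * pd [i] (fc c u e) y) (\<lambda>e y. \<Sum>i\<in>UNIV. vc c \<xi> i e y * pd [i] (f e) y)"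
    using U[OF t(2)] by (intro Neq_sum Neq_mult2 S moderate_vc[OF Gen_moderate[OF T(1) t(1)] c] Mod_pd f Gen_vc[OF T(1) t(1) T(2) c] Neq_pd) auto
  ultimately show ?thesis using Neq_trans[OF S] by blast
qed

text \<open>The generalized instance: null means negligible. Each axiom of a generalized connection is an equation between sets of nets. It is used by picking a member of the side that
is known to be inhabited, and comparing representatives with the rules for negligible nets.\<close>

lemma gen_levi_civita_conn:
  assumes G: "gen_metric A G" and \<gamma>: "\<gamma> \<in> G" and D: "gen_levi_civita A G Dh"
  shows "conn A Neg Mod (moderate A 1 0) (moderate A 1 0) (moderate A 0 0) (moderate A 0 0)
    (\<lambda>\<xi> \<eta> w. \<xi> \<in> moderate A 1 0 \<and> \<eta> \<in> moderate A 1 0 \<and> w \<in> Dh (gcls A 1 0 \<xi>) (gcls A 1 0 \<eta>)) \<gamma> (gginv \<gamma>)"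
    (is "conn A _ _ ?V _ ?F _ ?D _ _")
proof -
  have GG: "G \<in> Gen A 0 2" using G unfolding gen_metric_def by blast
  have con: "gen_connection A Dh" using D unfolding gen_levi_civita_def by blast
  note dd = conjunct2[OF D[unfolded gen_levi_civita_def]] and cc = con[unfolded gen_connection_def]
  have DG: "Dh X Y \<in> Gen A 1 0" if "X \<in> Gen A 1 0" "Y \<in> Gen A 1 0" for X Y
    by (rule conjunct1[OF cc, rule_format, OF that])
  have D2: "Dh X (lift2 A 1 0 tadd Y Y') = lift2 A 1 0 tadd (Dh X Y) (Dh X Y')"
    if "X \<in> Gen A 1 0" "Y \<in> Gen A 1 0" "Y' \<in> Gen A 1 0" for X Y Y'
    by (rule conjunct1[OF conjunct2[OF cc], rule_format, OF that])
  have D1: "Dh (lift2 A 1 0 tadd X X') Y = lift2 A 1 0 tadd (Dh X Y) (Dh X' Y)"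
    if "X \<in> Gen A 1 0" "X' \<in> Gen A 1 0" "Y \<in> Gen A 1 0" for X X' Y
    by (rule conjunct1[OF conjunct2[OF conjunct2[OF conjunct2[OF cc]]], rule_format, OF that])
  have Ds: "Dh (lift2 A 1 0 fscale U X) Y = lift2 A 1 0 fscale U (Dh X Y)"
    if "X \<in> Gen A 1 0" "Y \<in> Gen A 1 0" "U \<in> Gen A 0 0" for X U Y
    by (rule conjunct1[OF conjunct2[OF conjunct2[OF conjunct2[OF conjunct2[OF cc]]]], rule_format, OF that])
  have Dl: "Dh X (lift2 A 1 0 fscale U Y) = lift2 A 1 0 tadd (lift2 A 1 0 fscale U (Dh X Y)) (lift2 A 1 0 fscale (lift2 A 0 0 (act A) X U) Y)"
    if "X \<in> Gen A 1 0" "Y \<in> Gen A 1 0" "U \<in> Gen A 0 0" for X U Y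
    by (rule conjunct2[OF conjunct2[OF conjunct2[OF conjunct2[OF conjunct2[OF cc]]]], rule_format, OF that])
  have Dt: "lift2 A 1 0 (bracket A) X Y = lift2 A 1 0 tsub (Dh X Y) (Dh Y X)"
    if "X \<in> Gen A 1 0" "Y \<in> Gen A 1 0" for X Y
    by (rule conjunct1[OF dd, rule_format, OF that])
  have Dm: "lift2 A 0 0 (act A) X (gcontr2 A G Y Z) = lift2 A 0 0 tadd (gcontr2 A G (Dh X Y) Z) (gcontr2 A G Y (Dh X Z))"
    if "X \<in> Gen A 1 0" "Y \<in> Gen A 1 0" "Z \<in> Gen A 1 0" for X Y Z
    by (rule conjunct2[OF dd, rule_format, OF that])
  note gG = gcls_Gen and gs = gcls_self
  have DhG: "Dh (gcls A 1 0 \<xi>) (gcls A 1 0 \<eta>) \<in> Gen A 1 0" if "\<xi> \<in> ?V" "\<eta> \<in> ?V" for \<xi> \<eta>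
    using DG gG that by blast
  show ?thesis
  proof (intro conn.intro atlas_axioms conn_axioms.intro)
    show "Neg S f'" if "open S" "\<And>e y. e \<in> {0<..1} \<Longrightarrow> y \<in> S \<Longrightarrow> f e y = f' e y" "Neg S f" for S f f'
      by (rule Neg_cong[OF that])
    show "Neg S f" if "\<And>x. x \<in> S \<Longrightarrow> \<exists>U. x \<in> U \<and> Neg U f" for S f by (rule Neg_local[OF that])
    show "\<exists>w. ?D \<xi> \<eta> w" if "\<xi> \<in> ?V" "\<eta> \<in> ?V" for \<xi> \<eta> using Gen_ex[OF DhG[OF that]] that by blast
    show "?D \<xi>' \<eta>' w" if a: "?D \<xi> \<eta> w" "\<xi> \<in> ?V" "\<xi>' \<in> ?V" "\<eta> \<in> ?V" "\<eta>' \<in> ?V"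
      "\<And>e. e \<in> {0<..1} \<Longrightarrow> \<xi> e = \<xi>' e" "\<And>e. e \<in> {0<..1} \<Longrightarrow> \<eta> e = \<eta>' e" for \<xi> \<xi>' \<eta> \<eta>' w
      using gcls_cong[OF a(2,6,3)] gcls_cong[OF a(4,7,5)] a by simp
    show "(\<lambda>e. t) \<in> ?V \<inter> ?V" if "t \<in> smooth_tensor A 1 0" for t using const_moderate[OF that] by blast
    show "(\<lambda>e. t) \<in> ?F \<inter> ?F" if "t \<in> smooth_tensor A 0 0" for t using const_moderate[OF that] by blast
    show "\<exists>k. \<xi> e \<in> Ck_tensor k A 1 0" if "\<xi> \<in> ?V" "e \<in> {0<..1}" for \<xi> e using moderate_smooth[OF that] by blast
    then show "\<exists>k. \<xi> e \<in> Ck_tensor k A 1 0" if "\<xi> \<in> ?V" "e \<in> {0<..1}" for \<xi> e using that by blast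
    show cut: "(\<lambda>e. from_chart A c 0 0 (\<lambda>x I J. \<psi> x * vc c \<xi> i e x)) \<in> ?F"
      if \<xi>: "\<xi> \<in> ?V" and c: "c \<in> A" and K: "compact K" "K \<subseteq> cran c" and \<psi>: "Ck_on \<infinity> UNIV \<psi>" "\<And>x. x \<notin> K \<Longrightarrow> \<psi> x = 0" for \<xi> c K \<psi> i
    proof (rule from_chart_moderate[OF c, where Z="- cinv c ` K"])
      show "Mod (cran c) (\<lambda>e x. \<psi> x * vc c \<xi> i e x)"
        by (intro Mod_mult ch(2)[OF c] Mod_const moderate_vc[OF \<xi> c] Ck_mono[OF \<psi>(1)]) auto
      show "open (- cinv c ` K)" by (rule compl_image_open[OF c K])
      show "carrier_of A \<subseteq> cdom c \<union> - cinv c ` K" using ch(6)[OF c] K(2) by auto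
      show "\<psi> (cmap c p) * vc c \<xi> i e (cmap c p) = 0" if "p \<in> cdom c" "p \<in> - cinv c ` K" for e p
      proof -
        have "cmap c p \<notin> K" using that ch(3)[OF c that(1)] by (metis ComplD imageI)
        then show ?thesis by (simp add: \<psi>(2))
      qed
    qed
    then show "(\<lambda>e. from_chart A c 0 0 (\<lambda>x I J. \<psi> x * vc c \<xi> i e x)) \<in> ?F"
      if "\<xi> \<in> ?V" "c \<in> A" "compact K" "K \<subseteq> cran c" "Ck_on \<infinity> UNIV \<psi>" "\<And>x. x \<notin> K \<Longrightarrow> \<psi> x = 0" for \<xi> c K \<psi> i
      using that by blast
    fix c assume c: "c \<in> A"
    note S = ch(2)[OF c]
    show "Mod (cran c) (vc c w l)" if "?D \<xi> \<eta> w" for \<xi> \<eta> w l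
      using that moderate_vc[OF Gen_moderate[OF DhG] c] by blast
    show "Mod (cran c) (\<lambda>e. coord c (\<gamma> e) [] [a, b])" for a b
      by (rule moderate_Mod[OF Gen_moderate[OF GG \<gamma>] c]) (auto simp: idx_2)
    \<comment> \<open>members of a sum, and of a product with functions, in terms of arbitrary representatives of the arguments\<close>
    have lad: "Neg (cran c) (\<lambda>e y. vc c w'' l e y - (vc c w l e y + vc c w' l e y))"
      if T: "T \<in> Gen A 1 0" "U \<in> Gen A 1 0" and x: "w'' \<in> lift2 A 1 0 tadd T U" and w: "w \<in> T" "w' \<in> U" for T U w w' w'' l
    proof -
      obtain t u where t: "t \<in> T" "u \<in> U" and r: "(\<lambda>e. tadd (t e) (u e), w'') \<in> net_rel A 1 0" using lift2_elem[OF x] by blast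
      have 1: "Neq (cran c) (vc c w'' l) (\<lambda>e y. vc c t l e y + vc c u l e y)"
        using Neq_sym[OF S net_rel_vc[OF r c, of l]] by (simp add: coord_def[abs_def] tadd_def)
      have 2: "Neq (cran c) (\<lambda>e y. vc c t l e y + vc c u l e y) (\<lambda>e y. vc c w l e y + vc c w' l e y)"
        by (rule Neq_add[OF S Gen_vc[OF T(1) t(1) w(1) c] Gen_vc[OF T(2) t(2) w(2) c]])
      show ?thesis using Neq_trans[OF S 1 2] unfolding Neq_def .
    qed
    have lsc: "Neq (cran c) (vc c x l) (\<lambda>e y. fc c u e y * vc c w l e y)"
      if x: "x \<in> lift2 A 1 0 fscale U T" and T: "T \<in> Gen A 1 0" "w \<in> T"
        and u: "Mod (cran c) (fc c u)" "\<And>u'. u' \<in> U \<Longrightarrow> Neq (cran c) (fc c u') (fc c u) \<and> Mod (cran c) (fc c u')" for x U T u w l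
    proof -
      obtain u' t where t: "u' \<in> U" "t \<in> T" and r: "(\<lambda>e. fscale (u' e) (t e), x) \<in> net_rel A 1 0" using lift2_elem[OF x] by blast
      have 1: "Neq (cran c) (vc c x l) (\<lambda>e y. fc c u' e y * vc c t l e y)"
        using Neq_sym[OF S net_rel_vc[OF r c, of l]] by (simp add: coord_def[abs_def] fscale_def)
      have 2: "Neq (cran c) (\<lambda>e y. fc c u' e y * vc c t l e y) (\<lambda>e y. fc c u e y * vc c w l e y)"
        using u(2)[OF t(1)] by (intro Neq_mult2 S moderate_vc[OF Gen_moderate[OF T] c] Gen_vc[OF T(1) t(2) T(2) c]) auto
      show ?thesis by (rule Neq_trans[OF S 1 2])
    qed
    show "Neg (cran c) (\<lambda>e y. vc c w'' l e y - (vc c w l e y + vc c w' l e y))"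
      if a: "\<xi> \<in> ?V" "\<xi>' \<in> ?V" "\<eta> \<in> ?V" "?D \<xi> \<eta> w" "?D \<xi>' \<eta> w'" "?D (\<lambda>e. tadd (\<xi> e) (\<xi>' e)) \<eta> w''" for \<xi> \<xi>' \<eta> w w' w'' l
      by (rule lad[OF DhG[OF a(1,3)] DhG[OF a(2,3)]])
        (use a D1[OF gG gG gG, OF a(1,2,3)] lift2_add[OF a(1,2)] in auto)
    show "Neg (cran c) (\<lambda>e y. vc c w'' l e y - (vc c w l e y + vc c w' l e y))"
      if a: "\<xi> \<in> ?V" "\<eta> \<in> ?V" "\<eta>' \<in> ?V" "?D \<xi> \<eta> w" "?D \<xi> \<eta>' w'" "?D \<xi> (\<lambda>e. tadd (\<eta> e) (\<eta>' e)) w''" for \<xi> \<eta> \<eta>' w w' w'' l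
      by (rule lad[OF DhG[OF a(1,2)] DhG[OF a(1,3)]])
        (use a D2[OF gG gG gG, OF a(1,2,3)] lift2_add[OF a(2,3)] in auto)
    have ufc: "Neq (cran c) (fc c u') (fc c u) \<and> Mod (cran c) (fc c u')" if "u \<in> ?F" "u' \<in> gcls A 0 0 u" for u u'
      using Gen_fc[OF gG[OF that(1)] that(2) gs[OF that(1)] c] moderate_fc[OF Gen_moderate[OF gG[OF that(1)] that(2)] c] by blast
    show "Neg (cran c) (\<lambda>e y. vc c w' l e y - fc c u e y * vc c w l e y)"
      if a: "\<xi> \<in> ?V" "u \<in> ?F" "\<eta> \<in> ?V" "?D \<xi> \<eta> w" "?D (\<lambda>e. fscale (u e) (\<xi> e)) \<eta> w'" for \<xi> u \<eta> w w' l
    proof -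
      have "w' \<in> lift2 A 1 0 fscale (gcls A 0 0 u) (Dh (gcls A 1 0 \<xi>) (gcls A 1 0 \<eta>))"
        using a Ds[OF gG gG gG, OF a(1,3,2)] lift2_fscale[OF a(2,1)] by auto
      from lsc[OF this DhG[OF a(1,3)] _ moderate_fc[OF a(2) c] ufc[OF a(2)], of w l] a(4)
      show ?thesis unfolding Neq_def by blast
    qed
    show "Neg (cran c) (\<lambda>e y. vc c w' l e y - (fc c u e y * vc c w l e y + (\<Sum>i\<in>UNIV. vc c \<xi> i e y * pd [i] (fc c u e) y) * vc c \<eta> l e y))"
      if a: "\<xi> \<in> ?V" "u \<in> ?F" "\<eta> \<in> ?V" "?D \<xi> \<eta> w" "?D \<xi> (\<lambda>e. fscale (u e) (\<eta> e)) w'" for \<xi> u \<eta> w w' l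
    proof -
      let ?L = "lift2 A 0 0 (act A) (gcls A 1 0 \<xi>) (gcls A 0 0 u)"
      have "w' \<in> lift2 A 1 0 tadd (lift2 A 1 0 fscale (gcls A 0 0 u) (Dh (gcls A 1 0 \<xi>) (gcls A 1 0 \<eta>))) (lift2 A 1 0 fscale ?L (gcls A 1 0 \<eta>))"
        using a Dl[OF gG gG gG, OF a(1,3,2)] lift2_fscale[OF a(2,3)] by auto
      from lift2_elem[OF this] obtain x1 x2 where x1: "x1 \<in> lift2 A 1 0 fscale (gcls A 0 0 u) (Dh (gcls A 1 0 \<xi>) (gcls A 1 0 \<eta>))"
        and x2: "x2 \<in> lift2 A 1 0 fscale ?L (gcls A 1 0 \<eta>)" and r: "(\<lambda>e. tadd (x1 e) (x2 e), w') \<in> net_rel A 1 0" by blast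
      have 0: "Neq (cran c) (vc c w' l) (\<lambda>e y. vc c x1 l e y + vc c x2 l e y)"
        using Neq_sym[OF S net_rel_vc[OF r c, of l]] by (simp add: coord_def[abs_def] tadd_def)
      have 1: "Neq (cran c) (vc c x1 l) (\<lambda>e y. fc c u e y * vc c w l e y)"
        using lsc[OF x1 DhG[OF a(1,3)] _ moderate_fc[OF a(2) c] ufc[OF a(2)], of w l] a(4) by blast
      obtain b \<eta>' where b: "b \<in> ?L" "\<eta>' \<in> gcls A 1 0 \<eta>" and r2: "(\<lambda>e. fscale (b e) (\<eta>' e), x2) \<in> net_rel A 1 0" using lift2_elem[OF x2] by blast
      have 2: "Neq (cran c) (vc c x2 l) (\<lambda>e y. fc c b e y * vc c \<eta>' l e y)"
        using Neq_sym[OF S net_rel_vc[OF r2 c, of l]] by (simp add: coord_def[abs_def] fscale_def)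
      have 3: "Neq (cran c) (fc c b) (\<lambda>e y. \<Sum>i\<in>UNIV. vc c \<xi> i e y * pd [i] (fc c u e) y)"
        by (rule act_Neq[OF b(1) gG[OF a(1)] gs[OF a(1)] c _ moderate_fc[OF a(2) c]]) (use ufc[OF a(2)] in blast)
      have 4: "Neq (cran c) (\<lambda>e y. fc c b e y * vc c \<eta>' l e y) (\<lambda>e y. (\<Sum>i\<in>UNIV. vc c \<xi> i e y * pd [i] (fc c u e) y) * vc c \<eta> l e y)"
        by (rule Neq_mult2[OF S moderate_fc[OF lift2_moderate[OF b(1)] c] moderate_vc[OF a(3) c] 3 Gen_vc[OF gG[OF a(3)] b(2) gs[OF a(3)] c]])
      show ?thesis
        using Neq_trans[OF S 0 Neq_add[OF S 1 Neq_trans[OF S 2 4]]] unfolding Neq_def .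
    qed
    show "Neg (cran c) (\<lambda>e y. (\<Sum>i\<in>UNIV. vc c \<xi> i e y * pd [i] (vc c \<eta> l e) y - vc c \<eta> i e y * pd [i] (vc c \<xi> l e) y)
         - (vc c w l e y - vc c w' l e y))"
      if a: "\<xi> \<in> ?V \<inter> ?V" "\<eta> \<in> ?V \<inter> ?V" "?D \<xi> \<eta> w" "?D \<eta> \<xi> w'" for \<xi> \<eta> w w' l
    proof -
      have m: "\<xi> \<in> ?V" "\<eta> \<in> ?V" using a by auto
      have w: "w \<in> ?V" "w' \<in> ?V" using a Gen_moderate[OF DhG] by blast+
      \<comment> \<open>the difference is moderate, hence the right side of the torsion identity has a member, and so has the left one\<close>
      have "(\<lambda>e. tsub (w e) (w' e)) \<in> lift2 A 1 0 (bracket A) (gcls A 1 0 \<xi>) (gcls A 1 0 \<eta>)"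
        unfolding Dt[OF gG[OF m(1)] gG[OF m(2)]]
        by (rule lift2_mem[where F=tsub, OF _ _ tsub_moderate[OF w]]) (use a in auto)
      from lift2_elem[OF this] obtain \<xi>' \<eta>' where t: "\<xi>' \<in> gcls A 1 0 \<xi>" "\<eta>' \<in> gcls A 1 0 \<eta>"
        and r: "(\<lambda>e. bracket A (\<xi>' e) (\<eta>' e), \<lambda>e. tsub (w e) (w' e)) \<in> net_rel A 1 0" by blast
      have m': "\<xi>' \<in> ?V" "\<eta>' \<in> ?V" using t Gen_moderate gG m by blast+
      have x: "Neq (cran c) (vc c \<xi> i) (vc c \<xi>' i)" "Neq (cran c) (vc c \<eta> i) (vc c \<eta>' i)" for i
        using Gen_vc[OF gG[OF m(1)] gs[OF m(1)] t(1) c] Gen_vc[OF gG[OF m(2)] gs[OF m(2)] t(2) c] by blast+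
      have 1: "Neq (cran c) (\<lambda>e y. \<Sum>i\<in>UNIV. vc c \<xi> i e y * pd [i] (vc c \<eta> l e) y) (\<lambda>e y. \<Sum>i\<in>UNIV. vc c \<xi>' i e y * pd [i] (vc c \<eta>' l e) y)"
        and 2: "Neq (cran c) (\<lambda>e y. \<Sum>i\<in>UNIV. vc c \<eta> i e y * pd [i] (vc c \<xi> l e) y) (\<lambda>e y. \<Sum>i\<in>UNIV. vc c \<eta>' i e y * pd [i] (vc c \<xi>' l e) y)"
        by (intro Neq_sum Neq_mult2 S Neq_pd Mod_pd x moderate_vc[OF m(1) c] moderate_vc[OF m(2) c] moderate_vc[OF m'(1) c] moderate_vc[OF m'(2) c])+
      have "Neq (cran c) (vc c (\<lambda>e. bracket A (\<xi>' e) (\<eta>' e)) l) (\<lambda>e y. vc c w l e y - vc c w' l e y)"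
        using net_rel_vc[OF r c, of l] by (simp add: coord_def[abs_def] tsub_def)
      then have 3: "Neg (cran c) (\<lambda>e y. vc c (\<lambda>e. bracket A (\<xi>' e) (\<eta>' e)) l e y - (vc c w l e y - vc c w' l e y))" unfolding Neq_def .
      show ?thesis
        by (rule Neg_cong[OF S _ Neg_add[OF S 3 Neg_diff[OF S 1[unfolded Neq_def] 2[unfolded Neq_def]]]])
          (simp add: bracket_coord[OF c] sum_subtractf)
    qed
    show "Neg (cran c) (\<lambda>e y. (\<Sum>i\<in>UNIV. vc c \<xi> i e y * pd [i] (\<lambda>y. \<Sum>a\<in>UNIV. \<Sum>b\<in>UNIV. coord c (\<gamma> e) [] [a, b] y * vc c \<eta> a e y * vc c \<zeta> b e y) y)
         - ((\<Sum>a\<in>UNIV. \<Sum>b\<in>UNIV. coord c (\<gamma> e) [] [a, b] y * vc c w a e y * vc c \<zeta> b e y)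
          + (\<Sum>a\<in>UNIV. \<Sum>b\<in>UNIV. coord c (\<gamma> e) [] [a, b] y * vc c \<eta> a e y * vc c w' b e y)))"
      if a: "\<xi> \<in> ?V" "\<eta> \<in> ?V" "\<zeta> \<in> ?V" "?D \<xi> \<eta> w" "?D \<xi> \<zeta> w'" for \<xi> \<eta> \<zeta> w w'
    proof -
      let ?X = "gcls A 1 0 \<xi>" and ?Y = "gcls A 1 0 \<eta>" and ?Z = "gcls A 1 0 \<zeta>"
      have w: "w \<in> Dh ?X ?Y" "w' \<in> Dh ?X ?Z" using a by auto
      have m1: "(\<lambda>e. contr2 A (\<gamma> e) (w e) (\<zeta> e)) \<in> gcontr2 A G (Dh ?X ?Y) ?Z"
        by (rule contr2_mem[OF GG DhG[OF a(1,2)] gG[OF a(3)] \<gamma> w(1) gs[OF a(3)]])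
      have m2: "(\<lambda>e. contr2 A (\<gamma> e) (\<eta> e) (w' e)) \<in> gcontr2 A G ?Y (Dh ?X ?Z)"
        by (rule contr2_mem[OF GG gG[OF a(2)] DhG[OF a(1,3)] \<gamma> gs[OF a(2)] w(2)])
      let ?s = "\<lambda>e. tadd (contr2 A (\<gamma> e) (w e) (\<zeta> e)) (contr2 A (\<gamma> e) (\<eta> e) (w' e))"
      have "?s \<in> lift2 A 0 0 (act A) ?X (gcontr2 A G ?Y ?Z)"
        unfolding Dm[OF gG[OF a(1)] gG[OF a(2)] gG[OF a(3)]]
        by (rule lift2_mem[where F=tadd, OF m1 m2 tadd_moderate[OF gcontr2_moderate[OF m1] gcontr2_moderate[OF m2]]])
      then have "Neq (cran c) (fc c ?s) (\<lambda>e y. \<Sum>i\<in>UNIV. vc c \<xi> i e y *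
         pd [i] (\<lambda>y. \<Sum>a\<in>UNIV. \<Sum>b\<in>UNIV. coord c (\<gamma> e) [] [a, b] y * vc c \<eta> a e y * vc c \<zeta> b e y) y)"
      proof (rule act_Neq[OF _ gG[OF a(1)] gs[OF a(1)] c])
        show "Mod (cran c) (\<lambda>e y. \<Sum>a\<in>UNIV. \<Sum>b\<in>UNIV. coord c (\<gamma> e) [] [a, b] y * vc c \<eta> a e y * vc c \<zeta> b e y)"
          by (intro Mod_sum Mod_mult S moderate_Mod[OF Gen_moderate[OF GG \<gamma>] c] moderate_vc[OF a(2) c] moderate_vc[OF a(3) c]) (auto simp: idx_2)
        show "Mod (cran c) (fc c u) \<and> Neq (cran c) (fc c u) (\<lambda>e y. \<Sum>a\<in>UNIV. \<Sum>b\<in>UNIV. coord c (\<gamma> e) [] [a, b] y * vc c \<eta> a e y * vc c \<zeta> b e y)"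
          if "u \<in> gcontr2 A G ?Y ?Z" for u
          using moderate_fc[OF gcontr2_moderate[OF that] c] contr2_Neq[OF GG gG[OF a(2)] gG[OF a(3)] c that \<gamma> gs[OF a(2)] gs[OF a(3)]] by blast
      qed
      from Neq_sym[OF S this] show ?thesis unfolding Neq_def
        by (rule Neg_cong[OF S, rotated]) (simp add: contr2_coord[OF c, symmetric], simp add: coord_def tadd_def)
    qed
    show "Neg (cran c) (\<lambda>e y. coord c (\<gamma> e) [] [a, b] y - coord c (\<gamma> e) [] [b, a] y)" for a b
      by (rule gen_metric_sym[OF G \<gamma> c])
    show "Neg (cran c) (\<lambda>e y. (\<Sum>k\<in>UNIV. coord c (\<gamma> e) [] [l, k] y * gginv \<gamma> c k m e y) - (if l = m then 1 else 0))" for l m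
      by (rule gginv_inv[OF G \<gamma> c])
    show "Mod (cran c) (gginv \<gamma> c l m)" for l m by (rule gginv_Mod[OF G \<gamma> c])
  qed (blast intro: Neg_zero Neg_add Neg_mult Neg_mono Mod_const Mod_mono moderate_vc tadd_moderate fscale_moderate)+
qed

end

context atlas
begin

text \<open>The Christoffel symbols of a representative of the metric, with \<open>gginv\<close> as inverse matrix.\<close>

definition gchr :: "(real \<Rightarrow> ('a, 'n) tensor) \<Rightarrow> ('a, 'n) chart \<Rightarrow> 'n \<Rightarrow> 'n \<Rightarrow> 'n \<Rightarrow> real \<Rightarrow> real^'n \<Rightarrow> real" where
  "gchr \<gamma> c m i j = (\<lambda>e y. \<Sum>k\<in>UNIV. gginv \<gamma> c k m e y *
     (1/2 * (pd [i] (coord c (\<gamma> e) [] [j, k]) y + pd [j] (coord c (\<gamma> e) [] [i, k]) y - pd [k] (coord c (\<gamma> e) [] [i, j]) y)))"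

lemma gen_metric_Gen: "gen_metric A G \<Longrightarrow> G \<in> Gen A 0 2"
  unfolding gen_metric_def by blast

lemma gen_levi_civita_Gen:
  assumes "gen_levi_civita A G Dh" "X \<in> Gen A 1 0" "Y \<in> Gen A 1 0" shows "Dh X Y \<in> Gen A 1 0"
proof -
  have "gen_connection A Dh" using assms(1) unfolding gen_levi_civita_def by blast
  from conjunct1[OF this[unfolded gen_connection_def], rule_format, OF assms(2,3)] show ?thesis .
qed

lemma metric_comp_Mod:
  assumes "gen_metric A G" "\<gamma> \<in> G" "c \<in> A" shows "Mod (cran c) (\<lambda>e. coord c (\<gamma> e) [] [a, b])"
  by (rule moderate_Mod[OF Gen_moderate[OF gen_metric_Gen[OF assms(1)] assms(2)] assms(3)]) (auto simp: idx_2)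

lemma gchr_Mod:
  assumes "gen_metric A G" "\<gamma> \<in> G" "c \<in> A" shows "Mod (cran c) (gchr \<gamma> c m i j)"
  unfolding gchr_def
  by (intro Mod_sum Mod_mult Mod_const Mod_add Mod_diff Mod_pd ch(2)[OF assms(3)] gginv_Mod[OF assms] metric_comp_Mod[OF assms] Ck_const)

lemma gen_formula:
  assumes G: "gen_metric A G" and \<gamma>: "\<gamma> \<in> G" and D: "gen_levi_civita A G Dh"
    and X: "X \<in> Gen A 1 0" "\<xi> \<in> X" and Y: "Y \<in> Gen A 1 0" "\<eta> \<in> Y" and w: "w \<in> Dh X Y" and c: "c \<in> A"
  shows "Neq (cran c) (vc c w l) (\<lambda>e y. \<Sum>i\<in>UNIV. vc c \<xi> i e y *
     (pd [i] (vc c \<eta> l e) y + (\<Sum>j\<in>UNIV. vc c \<eta> j e y * gchr \<gamma> c l i j e y)))"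
proof -
  have m: "\<xi> \<in> moderate A 1 0" "\<eta> \<in> moderate A 1 0" using Gen_moderate X Y by blast+
  have e: "gcls A 1 0 \<xi> = X" "gcls A 1 0 \<eta> = Y" using Gen_gcls[OF X] Gen_gcls[OF Y] by simp_all
  note conn.D_formula[OF gen_levi_civita_conn[OF G \<gamma> D] m, of w c l]
  then show ?thesis unfolding Neq_def gchr_def conn.chr_def[OF gen_levi_civita_conn[OF G \<gamma> D]] using m e w c by simp
qed

section \<open>Restriction to open sets\<close>

lemma moderate_cong:
  assumes "t \<in> moderate A r 0" "\<And>e. e \<in> {0<..1} \<Longrightarrow> t e = u e" shows "u \<in> moderate A r 0"
proof (rule moderateI_all)
  show "u e \<in> smooth_tensor A r 0" if "e \<in> {0<..1}" for e using moderate_smooth[OF assms(1) that] assms(2)[OF that] by simp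
  show "Mod (cran c) (\<lambda>e. coord c (u e) I [])" if "c \<in> A" "I \<in> idx r" for c I
    by (rule Mod_cong[OF ch(2)[OF that(1)] _ moderate_Mod[OF assms(1) that, of "[]"]]) (use assms(2) in auto)
qed

lemma restr_coord:
  assumes "c \<in> restr A W" "x \<in> cran c" "I \<in> idx r" "J \<in> idx s"
  shows "coord c (tens (restr A W) r s t) I J x = coord c t I J x"
  using assms ch(6)[of c x] by (simp add: coord_def tens_def restr_def)

lemma restr_moderate:
  assumes W: "open W" and t: "t \<in> moderate A r 0"
  shows "(\<lambda>e. tens (restr A W) r 0 (t e)) \<in> moderate (restr A W) r 0"
proof -
  interpret C: atlas "restr A W" by (rule restr_atlas[OF W])
  show ?thesis
  proof (rule C.moderateI_all)
    show "tens (restr A W) r 0 (t e) \<in> smooth_tensor (restr A W) r 0" if "e \<in> {0<..1}" for e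
      by (rule restr_tensor[OF W moderate_smooth[OF t that]])
    show "Mod (cran c) (\<lambda>e. coord c (tens (restr A W) r 0 (t e)) I [])" if c: "c \<in> restr A W" and I: "I \<in> idx r" for c I
    proof -
      have "c \<in> A" using c by (simp add: restr_def)
      from moderate_Mod[OF t this I, of "[]"] show ?thesis
        by (rule Mod_cong[OF C.ch(2)[OF c], rotated 1]) (use restr_coord[OF c _ I, of _ "[]" 0] in auto)
    qed
  qed
qed

text \<open>Restriction to an open set respects equivalence, so one representative computes it.\<close>

lemma grestr_rep:
  assumes W: "open W" and T: "T \<in> Gen A r 0" "t \<in> T"
  shows "grestr A W r 0 T = gcls (restr A W) r 0 (\<lambda>e. tens (restr A W) r 0 (t e))"
proof -
  interpret C: atlas "restr A W" by (rule restr_atlas[OF W])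
  note tm = restr_moderate[OF W Gen_moderate[OF T(1)]]
  have "gcls (restr A W) r 0 (\<lambda>e. tens (restr A W) r 0 (t e)) = gcls (restr A W) r 0 (\<lambda>e. tens (restr A W) r 0 (u e))"
    if u: "u \<in> T" for u
    unfolding C.gcls_eq_iff[OF tm[OF T(2)]] C.net_rel_iff
  proof (intro conjI tm T(2) u ballI)
    fix c and I :: "'n list" assume c: "c \<in> restr A W" and I: "I \<in> idx r"
    have cA: "c \<in> A" using c by (simp add: restr_def)
    have "Neq (cran c) (\<lambda>e. coord c (t e) I []) (\<lambda>e. coord c (u e) I [])"
      by (rule Gen_Neq[OF T u cA I]) simp
    then show "Neq (cran c) (\<lambda>e. coord c (tens (restr A W) r 0 (t e)) I []) (\<lambda>e. coord c (tens (restr A W) r 0 (u e)) I [])"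
      unfolding Neq_def
      by (rule Neg_cong[OF C.ch(2)[OF c], rotated 1]) (use restr_coord[OF c _ I, of _ "[]" 0] in auto)
  qed
  then show ?thesis unfolding grestr_def lift1_def using T(2) by blast
qed

lemma jac_sub:
  assumes c: "c \<in> A" and W: "open W" and c': "c' \<in> A" and p: "p \<in> cdom c" "p \<in> W" "p \<in> cdom c'"
  shows "jac (cdom c \<inter> W, cmap c) c' p = jac c c' p"
proof -
  note d = sub_chart[OF c W]
  have "jac (cdom c \<inter> W, cmap c) c' p = jac c c' p ** jac (cdom c \<inter> W, cmap c) c p"
    by (rule jac_chain[OF d(2) c c']) (use p in auto)
  also have "jac (cdom c \<inter> W, cmap c) c p = mat 1"
    by (rule jac_same_map[OF d(2) c]) (use p in auto)
  finally show ?thesis by simp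
qed

lemma frame_comb_from_chart:
  assumes c: "c \<in> A" and W: "open W" "W \<subseteq> cdom c"
    and u: "\<And>l c' p. c' \<in> restr A W \<Longrightarrow> p \<in> cdom c' \<Longrightarrow> u l c' p [] [] = v l (cmap c p)"
  shows "frame_comb A W c u = from_chart (restr A W) (cdom c \<inter> W, cmap c) 1 0 (\<lambda>x I J. v (hd I) x)"
proof (intro ext)
  fix c' p I J
  show "frame_comb A W c u c' p I J = from_chart (restr A W) (cdom c \<inter> W, cmap c) 1 0 (\<lambda>x I J. v (hd I) x) c' p I J"
  proof (cases "c' \<in> restr A W \<and> p \<in> cdom c' \<and> I \<in> idx 1 \<and> J \<in> idx 0")
    case True
    then obtain m where m: "I = [m]" "J = []" by (auto simp: idx_1)
    have p: "c' \<in> A" "p \<in> W" "p \<in> cdom c" using True W by (auto simp: restr_def)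
    have j: "jac (cdom c \<inter> W, cmap c) c' p = jac c c' p" by (rule jac_sub[OF c W(1) p(1) p(3,2)]) (use True in auto)
    show ?thesis using True m p u[of c' p]
      by (simp add: frame_comb_def frame_def from_chart_def tens_def idx_1 trf_vec j mult.commute)
  next
    case False then show ?thesis by (auto simp: frame_comb_def from_chart_def tens_def)
  qed
qed

lemma frame_from_chart:
  assumes c: "c \<in> A" and W: "open W" "W \<subseteq> cdom c"
  shows "frame A W c i = from_chart (restr A W) (cdom c \<inter> W, cmap c) 1 0 (\<lambda>x I J. if hd I = i then 1 else 0)"
proof (intro ext)
  fix c' p I J
  show "frame A W c i c' p I J = from_chart (restr A W) (cdom c \<inter> W, cmap c) 1 0 (\<lambda>x I J. if hd I = i then 1 else 0) c' p I J"
  proof (cases "c' \<in> restr A W \<and> p \<in> cdom c' \<and> I \<in> idx 1 \<and> J \<in> idx 0")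
    case True
    then obtain m where m: "I = [m]" "J = []" by (auto simp: idx_1)
    have p: "c' \<in> A" "p \<in> W" "p \<in> cdom c" using True W by (auto simp: restr_def)
    have j: "jac (cdom c \<inter> W, cmap c) c' p = jac c c' p" by (rule jac_sub[OF c W(1) p(1) p(3,2)]) (use True in auto)
    show ?thesis using True m p
      by (simp add: frame_def from_chart_def tens_def idx_1 trf_vec j if_distrib[where f="\<lambda>x. _ * x"] cong: if_cong)
  next
    case False then show ?thesis by (auto simp: frame_def from_chart_def tens_def)
  qed
qed

lemma sub_cran:
  assumes c: "c \<in> A" and W: "open W" and x: "x \<in> cran (cdom c \<inter> W, cmap c)"
  shows "x \<in> cran c" "cinv (cdom c \<inter> W, cmap c) x = cinv c x" "cinv c x \<in> W"
proof -
  have x': "x \<in> cmap c ` (cdom c \<inter> W)" using x by (simp add: cran_def)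
  then show "x \<in> cran c" "cinv (cdom c \<inter> W, cmap c) x = cinv c x" "cinv c x \<in> W"
    using restr_cinv[OF chart[OF c] x'] ch(3)[OF c] by (auto simp: cran_def)
qed

lemma sub_coord:
  assumes t: "t \<in> Ck_tensor k A r s" and c: "c \<in> A" and W: "open W" and x: "x \<in> cran (cdom c \<inter> W, cmap c)"
    and I: "I \<in> idx r" "J \<in> idx s"
  shows "coord (cdom c \<inter> W, cmap c) t I J x = coord c t I J x"
  using same_map_comp[OF t c sub_chart(2)[OF c W] _ _ _ I, of "cinv c x"] sub_cran[OF c W x] ch(6)[OF c]
  by (simp add: coord_def)

section \<open>Generalized Christoffel symbols\<close>

text \<open>The Christoffel symbols as functions on the submanifold that is the domain of the chart.\<close>

definition gchr_net :: "(real \<Rightarrow> ('a, 'n) tensor) \<Rightarrow> ('a, 'n) chart \<Rightarrow> 'n \<Rightarrow> 'n \<Rightarrow> 'n \<Rightarrow> real \<Rightarrow> ('a, 'n) tensor" where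
  "gchr_net \<gamma> c l i j = (\<lambda>e. from_chart (restr A (cdom c)) c 0 0 (\<lambda>x I J. gchr \<gamma> c l i j e x))"

lemma gchr_net_moderate:
  assumes "gen_metric A G" "\<gamma> \<in> G" and c: "c \<in> A"
  shows "gchr_net \<gamma> c l i j \<in> moderate (restr A (cdom c)) 0 0"
proof -
  interpret B: atlas "restr A (cdom c)" by (rule restr_atlas[OF ch(1)[OF c]])
  show ?thesis unfolding gchr_net_def
    by (rule B.from_chart_moderate[OF mem_restr[OF c], where Z="{}"])
      (use gchr_Mod[OF assms] carrier_restr[of A "cdom c"] in auto)
qed

lemma gchr_net_coord:
  assumes c: "c \<in> A" and x: "x \<in> cran c"
  shows "fc c (gchr_net \<gamma> c l i j) e x = gchr \<gamma> c l i j e x"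
proof -
  interpret B: atlas "restr A (cdom c)" by (rule restr_atlas[OF ch(1)[OF c]])
  show ?thesis unfolding gchr_net_def by (rule B.from_chart_coord[OF mem_restr[OF c] x]) auto
qed

text \<open>In the chart \<open>c\<close>, shrunk to \<open>W\<close>, a combination of coordinate fields has its coefficients as components.\<close>

lemma frame_comb_net:
  assumes c: "c \<in> A" and W: "open W" "W \<subseteq> cdom c" and u: "\<And>l. u l \<in> moderate (restr A (cdom c)) 0 0"
  shows "(\<lambda>e. frame_comb A W c (\<lambda>l. u l e)) \<in> moderate (restr A W) 1 0"
    and "Neq (cran (cdom c \<inter> W, cmap c)) (vc (cdom c \<inter> W, cmap c) (\<lambda>e. frame_comb A W c (\<lambda>l. u l e)) m) (fc c (u m))"
proof -
  let ?B = "restr A (cdom c)" and ?C = "restr A W" and ?d = "(cdom c \<inter> W, cmap c)"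
  interpret B: atlas ?B by (rule restr_atlas[OF ch(1)[OF c]])
  interpret C: atlas ?C by (rule restr_atlas[OF W(1)])
  note d = sub_chart[OF c W(1)] and cB = mem_restr[OF c]
  have e: "frame_comb A W c (\<lambda>l. u l e) = from_chart ?C ?d 1 0 (\<lambda>x I J. fc c (u (hd I)) e x)" if e: "e \<in> {0<..1}" for e
  proof (rule frame_comb_from_chart[OF c W])
    fix l c' p assume c': "c' \<in> ?C" "p \<in> cdom c'"
    then have cB': "c' \<in> ?B" "p \<in> cdom c" using W by (auto simp: restr_def)
    show "u l e c' p [] [] = fc c (u l) e (cmap c p)"
      using B.fun_inv[OF B.moderate_smooth[OF u e] cB cB'(1) cB'(2) c'(2)] ch(3)[OF c cB'(2)] by (simp add: coord_def)
  qed
  have sub: "cran ?d \<subseteq> cran c" using sub_cran[OF c W(1)] by blast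
  have M: "(\<lambda>e. from_chart ?C ?d 1 0 (\<lambda>x I J. fc c (u (hd I)) e x)) \<in> moderate ?C 1 0"
    by (rule C.from_chart_moderate[OF d(1), where Z="{}"])
      (use Mod_mono[OF B.moderate_fc[OF u cB] sub] carrier_restr[of A W] W in auto)
  show "(\<lambda>e. frame_comb A W c (\<lambda>l. u l e)) \<in> moderate ?C 1 0"
    by (rule C.moderate_cong[OF M e[symmetric]])
  show "Neq (cran ?d) (vc ?d (\<lambda>e. frame_comb A W c (\<lambda>l. u l e)) m) (fc c (u m))"
    by (rule Neq_on[OF C.ch(2)[OF d(1)]]) (use e C.from_chart_coord[OF d(1), of _ "[m]" 1 "[]" 0] in \<open>simp add: idx_1\<close>)
qed

text \<open>The coordinate formula for fields whose components are \<open>1\<close> or \<open>0\<close> on \<open>W\<close>, up to negligible nets.\<close>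

lemma gchr_property:
  assumes G: "gen_metric A G" and \<gamma>: "\<gamma> \<in> G" and D: "gen_levi_civita A G Dh" and c: "c \<in> A"
    and X: "X \<in> Gen A 1 0" and Y: "Y \<in> Gen A 1 0" and W: "open W" "W \<subseteq> cdom c"
    and fX: "grestr A W 1 0 X = const_emb (restr A W) 1 0 (frame A W c i)"
    and fY: "grestr A W 1 0 Y = const_emb (restr A W) 1 0 (frame A W c j)"
    and u: "\<And>l. u l \<in> gcls (restr A (cdom c)) 0 0 (gchr_net \<gamma> c l i j)"
  shows "grestr A W 1 0 (Dh X Y) = gcls (restr A W) 1 0 (\<lambda>e. frame_comb A W c (\<lambda>l. u l e))"
proof -
  let ?B = "restr A (cdom c)" and ?C = "restr A W" and ?d = "(cdom c \<inter> W, cmap c)"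
  interpret B: atlas ?B by (rule restr_atlas[OF ch(1)[OF c]])
  interpret C: atlas ?C by (rule restr_atlas[OF W(1)])
  note d = sub_chart[OF c W(1)] and cB = mem_restr[OF c] and S = C.ch(2)[OF sub_chart(1)[OF c W(1)]]
  have sub: "cran ?d \<subseteq> cran c" using sub_cran[OF c W(1)] by blast
  obtain \<xi> \<eta> w where x: "\<xi> \<in> X" and y: "\<eta> \<in> Y" and w: "w \<in> Dh X Y"
    using Gen_ex[OF X] Gen_ex[OF Y] Gen_ex[OF gen_levi_civita_Gen[OF D X Y]] by blast
  note DG = gen_levi_civita_Gen[OF D X Y]
  have ur: "(gchr_net \<gamma> c l i j, u l) \<in> net_rel ?B 0 0" for l using u[of l] unfolding gcls_def by blast
  then have um: "u l \<in> moderate ?B 0 0" for l unfolding net_rel_def by blast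
  have uN: "Neq (cran ?d) (fc c (u l)) (gchr \<gamma> c l i j)" for l
  proof -
    have "Neq (cran c) (fc c (u l)) (fc c (gchr_net \<gamma> c l i j))" by (rule Neq_sym[OF ch(2)[OF c] B.net_rel_fc[OF ur cB]])
    moreover have "Neq (cran c) (fc c (gchr_net \<gamma> c l i j)) (gchr \<gamma> c l i j)"
      by (rule Neq_on[OF ch(2)[OF c]]) (rule gchr_net_coord[OF c])
    ultimately show ?thesis using Neq_trans[OF ch(2)[OF c]] Neq_mono[OF _ sub] by blast
  qed
  \<comment> \<open>a field with the restriction of a coordinate field as class has components 1 and 0 there, up to negligible nets\<close>
  have FN: "Neq (cran ?d) (vc c \<xi> m) (\<lambda>e y. if m = i then 1 else 0)"
    if X: "X \<in> Gen A 1 0" and x: "\<xi> \<in> X" and fX: "grestr A W 1 0 X = const_emb (restr A W) 1 0 (frame A W c i)" for X \<xi> m i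
  proof -
    have tm: "(\<lambda>e. tens ?C 1 0 (\<xi> e)) \<in> moderate ?C 1 0" by (rule restr_moderate[OF W(1) Gen_moderate[OF X x]])
    have "gcls ?C 1 0 (\<lambda>e. tens ?C 1 0 (\<xi> e)) = gcls ?C 1 0 (\<lambda>e. frame A W c i)"
      using fX unfolding grestr_rep[OF W(1) X x] const_emb_def .
    then have "(\<lambda>e. tens ?C 1 0 (\<xi> e), \<lambda>e. frame A W c i) \<in> net_rel ?C 1 0" using C.gcls_eq_iff[OF tm] by blast
    from C.net_rel_vc[OF this d(1), of m]
    have N: "Neq (cran ?d) (vc ?d (\<lambda>e. tens ?C 1 0 (\<xi> e)) m) (\<lambda>e. coord ?d (frame A W c i) [m] [])" .
    show ?thesis unfolding Neq_def
    proof (rule Neg_cong[OF S _ N[unfolded Neq_def]])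
      fix e :: real and y assume e: "e \<in> {0<..1}" and y: "y \<in> cran ?d"
      have "vc ?d (\<lambda>e. tens ?C 1 0 (\<xi> e)) m e y = coord ?d (\<xi> e) [m] [] y"
        by (rule restr_coord[OF d(1) y]) (auto simp: idx_1)
      also have "\<dots> = vc c \<xi> m e y"
        by (rule sub_coord[OF moderate_smooth[OF Gen_moderate[OF X x] e] c W(1) y]) (auto simp: idx_1)
      finally show "vc ?d (\<lambda>e. tens ?C 1 0 (\<xi> e)) m e y - coord ?d (frame A W c i) [m] [] y = vc c \<xi> m e y - (if m = i then 1 else 0)"
        unfolding frame_from_chart[OF c W] using C.from_chart_coord[OF d(1) y, of "[m]" 1 "[]" 0] by (simp add: idx_1)
    qed
  qed
  note xN = FN[OF X x fX] and yN = FN[OF Y y fY]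
  have cM: "Mod (cran ?d) (\<lambda>e y. if P then 1 else 0)" for P by (rule Mod_const[OF S Ck_const])
  have gM: "Mod (cran ?d) (gchr \<gamma> c l i j)" for l i j by (rule Mod_mono[OF gchr_Mod[OF G \<gamma> c] sub])
  have vM: "Mod (cran ?d) (vc c \<xi> m)" "Mod (cran ?d) (vc c \<eta> m)" for m
    using Mod_mono[OF moderate_vc[OF Gen_moderate[OF X x] c] sub] Mod_mono[OF moderate_vc[OF Gen_moderate[OF Y y] c] sub] by blast+
  have wN: "Neq (cran ?d) (vc c w l) (gchr \<gamma> c l i j)" for l
  proof -
    have "Neq (cran ?d) (vc c w l) (\<lambda>e y. \<Sum>i\<in>UNIV. vc c \<xi> i e y * (pd [i] (vc c \<eta> l e) y + (\<Sum>j\<in>UNIV. vc c \<eta> j e y * gchr \<gamma> c l i j e y)))"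
      by (rule Neq_mono[OF gen_formula[OF G \<gamma> D X x Y y w c] sub])
    moreover have "Neq (cran ?d) (\<lambda>e y. \<Sum>i\<in>UNIV. vc c \<xi> i e y * (pd [i] (vc c \<eta> l e) y + (\<Sum>j\<in>UNIV. vc c \<eta> j e y * gchr \<gamma> c l i j e y)))
      (\<lambda>e y. \<Sum>m\<in>UNIV. (if m = i then 1 else 0) * (pd [m] (\<lambda>y. if l = j then 1 else 0) y + (\<Sum>n\<in>UNIV. (if n = j then 1 else 0) * gchr \<gamma> c l m n e y)))"
      by (intro Neq_sum Neq_mult2 Neq_add S xN yN Neq_pd Neq_refl cM gM vM Mod_add Mod_sum Mod_mult Mod_pd)
    ultimately have "Neq (cran ?d) (vc c w l) (\<lambda>e y. \<Sum>m\<in>UNIV. (if m = i then 1 else 0) * (pd [m] (\<lambda>y. if l = j then 1 else 0) y + (\<Sum>n\<in>UNIV. (if n = j then 1 else 0) * gchr \<gamma> c l m n e y)))"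
      by (rule Neq_trans[OF S])
    then show ?thesis by (simp add: if_distrib[where f="\<lambda>x. x * _"] cong: if_cong)
  qed
  note FC = frame_comb_net[OF c W, of u, OF um]
  have tm: "(\<lambda>e. tens ?C 1 0 (w e)) \<in> moderate ?C 1 0" by (rule restr_moderate[OF W(1) Gen_moderate[OF DG w]])
  have "(\<lambda>e. tens ?C 1 0 (w e), \<lambda>e. frame_comb A W c (\<lambda>l. u l e)) \<in> net_rel ?C 1 0"
  proof (rule C.net_relI[OF tm FC(1)])
    fix p assume "p \<in> carrier_of ?C"
    then have p: "p \<in> cdom ?d" using carrier_restr[of A W] W by auto
    have "Neq (cran ?d) (vc ?d (\<lambda>e. tens ?C 1 0 (w e)) l) (vc ?d (\<lambda>e. frame_comb A W c (\<lambda>l. u l e)) l)" for l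
    proof -
      have 1: "Neq (cran ?d) (vc ?d (\<lambda>e. tens ?C 1 0 (w e)) l) (vc c w l)"
      proof (rule Neq_on[OF S])
        fix e :: real and y assume e: "e \<in> {0<..1}" and y: "y \<in> cran ?d"
        have "vc ?d (\<lambda>e. tens ?C 1 0 (w e)) l e y = coord ?d (w e) [l] [] y"
          by (rule restr_coord[OF d(1) y]) (auto simp: idx_1)
        also have "\<dots> = vc c w l e y"
          by (rule sub_coord[OF moderate_smooth[OF Gen_moderate[OF DG w] e] c W(1) y]) (auto simp: idx_1)
        finally show "vc ?d (\<lambda>e. tens ?C 1 0 (w e)) l e y = vc c w l e y" .
      qed
      show ?thesis
        by (rule Neq_trans[OF S 1 Neq_trans[OF S wN[of l] Neq_sym[OF S Neq_trans[OF S FC(2)[where m=l] uN[of l]]]]])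
    qed
    then show "\<exists>c'\<in>?C. p \<in> cdom c' \<and> (\<forall>I\<in>idx 1. Neq (cran c') (\<lambda>e. coord c' (tens ?C 1 0 (w e)) I []) (\<lambda>e. coord c' (frame_comb A W c (\<lambda>l. u l e)) I []))"
      using d(1) p by (intro bexI[of _ ?d]) (auto simp: idx_1)
  qed
  then show ?thesis unfolding grestr_rep[OF W(1) DG w] using C.gcls_eq_iff[OF tm] by blast
qed

text \<open>Uniqueness is tested near each point with constant nets of fields that extend the coordinate fields.\<close>

lemma gen_christoffel_eq:
  assumes G: "gen_metric A G" and \<gamma>: "\<gamma> \<in> G" and D: "gen_levi_civita A G Dh" and c: "c \<in> A"
  shows "gen_christoffel A Dh c = (\<lambda>l i j. gcls (restr A (cdom c)) 0 0 (gchr_net \<gamma> c l i j))" (is "_ = ?G")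
  unfolding gen_christoffel_def
proof (rule the_equality)
  let ?B = "restr A (cdom c)"
  interpret B: atlas ?B by (rule restr_atlas[OF ch(1)[OF c]])
  note cB = mem_restr[OF c] and gm = gchr_net_moderate[OF G \<gamma> c]
  show "(\<forall>l i j. ?G l i j \<in> Gen ?B 0 0) \<and>
     (\<forall>i j W. \<forall>\<xi>\<in>Gen A 1 0. \<forall>\<eta>\<in>Gen A 1 0.
        open W \<and> W \<subseteq> cdom c \<and>
        grestr A W 1 0 \<xi> = const_emb (restr A W) 1 0 (frame A W c i) \<and>
        grestr A W 1 0 \<eta> = const_emb (restr A W) 1 0 (frame A W c j) \<longrightarrow>
        (\<forall>u. (\<forall>l. u l \<in> ?G l i j) \<longrightarrow>
           grestr A W 1 0 (Dh \<xi> \<eta>) = gcls (restr A W) 1 0 (\<lambda>e. frame_comb A W c (\<lambda>l. u l e))))"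
    using B.gcls_Gen[OF gm] gchr_property[OF G \<gamma> D c] by blast
  fix \<Gamma> assume G': "(\<forall>l i j. \<Gamma> l i j \<in> Gen ?B 0 0) \<and>
     (\<forall>i j W. \<forall>\<xi>\<in>Gen A 1 0. \<forall>\<eta>\<in>Gen A 1 0.
        open W \<and> W \<subseteq> cdom c \<and>
        grestr A W 1 0 \<xi> = const_emb (restr A W) 1 0 (frame A W c i) \<and>
        grestr A W 1 0 \<eta> = const_emb (restr A W) 1 0 (frame A W c j) \<longrightarrow>
        (\<forall>u. (\<forall>l. u l \<in> \<Gamma> l i j) \<longrightarrow>
           grestr A W 1 0 (Dh \<xi> \<eta>) = gcls (restr A W) 1 0 (\<lambda>e. frame_comb A W c (\<lambda>l. u l e))))"
  show "\<Gamma> = ?G"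
  proof (intro ext[where g="?G"] ext[where g="?G _"] ext[where g="?G _ _"])
    fix l i j
    have GG: "\<Gamma> m i j \<in> Gen ?B 0 0" for m by (rule conjunct1[OF G', rule_format])
    have "\<forall>m. \<exists>t. t \<in> \<Gamma> m i j" using B.Gen_ex[OF GG] by blast
    from choice[OF this] obtain v where "\<forall>m. v m \<in> \<Gamma> m i j" ..
    then have v: "\<And>m. v m \<in> \<Gamma> m i j" by blast
    have vm: "v m \<in> moderate ?B 0 0" for m by (rule B.Gen_moderate[OF GG v])
    have "(v l, gchr_net \<gamma> c l i j) \<in> net_rel ?B 0 0"
    proof (rule B.net_relI[OF vm gm])
      fix p assume "p \<in> carrier_of ?B"
      then have p: "p \<in> cdom c" by (rule subsetD[OF carrier_restr])
      obtain W E where W: "open W" "p \<in> W" "W \<subseteq> cdom c" and E: "\<And>i. E i \<in> smooth_tensor A 1 0"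
        "\<And>i. tens (restr A W) 1 0 (E i) = frame A W c i"
        using bump_frame_at[OF c p] by blast
      let ?C = "restr A W" and ?d = "(cdom c \<inter> W, cmap c)"
      interpret C: atlas ?C by (rule restr_atlas[OF W(1)])
      note d = sub_chart[OF c W(1)] and S = C.ch(2)[OF sub_chart(1)[OF c W(1)]]
      let ?X = "\<lambda>i. gcls A 1 0 (\<lambda>e. E i)"
      have X: "?X i \<in> Gen A 1 0" for i by (rule gcls_Gen[OF const_moderate[OF E(1)]])
      have fX: "grestr A W 1 0 (?X i) = const_emb ?C 1 0 (frame A W c i)" for i
        unfolding grestr_rep[OF W(1) X gcls_self[OF const_moderate[OF E(1)]]] const_emb_def E(2) ..
      have e1: "grestr A W 1 0 (Dh (?X i) (?X j)) = gcls ?C 1 0 (\<lambda>e. frame_comb A W c (\<lambda>l. v l e))"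
        by (rule conjunct2[OF G', rule_format, OF X X]) (use W fX v in auto)
      have e2: "grestr A W 1 0 (Dh (?X i) (?X j)) = gcls ?C 1 0 (\<lambda>e. frame_comb A W c (\<lambda>l. gchr_net \<gamma> c l i j e))"
        by (rule gchr_property[OF G \<gamma> D c X X W(1,3) fX fX B.gcls_self[OF gm]])
      note F1 = frame_comb_net[OF c W(1,3), of v, OF vm] and F2 = frame_comb_net[OF c W(1,3), of "\<lambda>l. gchr_net \<gamma> c l i j", OF gm]
      have "(\<lambda>e. frame_comb A W c (\<lambda>l. v l e), \<lambda>e. frame_comb A W c (\<lambda>l. gchr_net \<gamma> c l i j e)) \<in> net_rel ?C 1 0"
        using C.gcls_eq_iff[OF F1(1)] e1 e2 by simp
      from C.net_rel_vc[OF this d(1), of l]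
      have N: "Neq (cran ?d) (fc c (v l)) (fc c (gchr_net \<gamma> c l i j))"
        by (rule Neq_trans[OF S Neq_sym[OF S F1(2)[where m=l]] Neq_trans[OF S _ F2(2)[where m=l]]])
      have dB: "?d \<in> ?B" using d(2) by (auto simp: restr_def)
      have sc: "coord ?d t [] [] y = coord c t [] [] y" if t: "t \<in> smooth_tensor ?B 0 0" and y: "y \<in> cran ?d" for t y
        using sub_cran[OF c W(1) y] B.fun_inv[OF t cB dB, of "cinv c y"] ch(6)[OF c] by (simp add: coord_def)
      have "Neq (cran ?d) (fc ?d (v l)) (fc ?d (gchr_net \<gamma> c l i j))"
        unfolding Neq_def
        by (rule Neg_cong[OF S _ N[unfolded Neq_def]]) (simp add: sc[OF B.moderate_smooth[OF vm]] sc[OF B.moderate_smooth[OF gm]])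
      then show "\<exists>c'\<in>?B. p \<in> cdom c' \<and> (\<forall>I\<in>idx 0. Neq (cran c') (\<lambda>e. coord c' (v l e) I []) (\<lambda>e. coord c' (gchr_net \<gamma> c l i j e) I []))"
        using dB p W by (intro bexI[of _ ?d]) auto
    qed
    then show "\<Gamma> l i j = ?G l i j"
      using B.Gen_gcls[OF GG v, of l] B.gcls_eq_iff[OF vm] by simp
  qed
qed

end

section \<open>Constant nets\<close>

lemma Neq_diff: "open S \<Longrightarrow> Neq S f f' \<Longrightarrow> Neq S g g' \<Longrightarrow> Neq S (\<lambda>e y. f e y - g e y) (\<lambda>e y. f' e y - g' e y)"
  unfolding Neq_def using Neg_diff[of S "\<lambda>e y. f e y - f' e y" "\<lambda>e y. g e y - g' e y"] by (simp add: algebra_simps)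

lemma Neq_adjm:
  assumes S: "open S" and "\<And>i j. Mod S (\<lambda>e x. M e x $ i $ j)" "\<And>i j. Mod S (\<lambda>e x. M' e x $ i $ j)"
    "\<And>i j. Neq S (\<lambda>e x. M e x $ i $ j) (\<lambda>e x. M' e x $ i $ j)"
  shows "Neq S (\<lambda>e x. adjm (M e x :: real^'n::finite^'n) a b) (\<lambda>e x. adjm (M' e x) a b)"
  unfolding adjm_def
proof (rule Neq_det[OF S])
  have c: "Mod S (\<lambda>e x. axis b (1::real) $ i)" for i by (rule Mod_const[OF S Ck_const])
  have n: "Neq S (\<lambda>e x. axis b (1::real) $ i) (\<lambda>e x. axis b (1::real) $ i)" for i by (rule Neq_refl)
  fix i j
  show "Mod S (\<lambda>e x. (\<chi> i j. if j = a then axis b 1 $ i else M e x $ i $ j) $ i $ j)"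
    using assms(2) c by (cases "j = a") simp_all
  show "Mod S (\<lambda>e x. (\<chi> i j. if j = a then axis b 1 $ i else M' e x $ i $ j) $ i $ j)"
    using assms(3) c by (cases "j = a") simp_all
  show "Neq S (\<lambda>e x. (\<chi> i j. if j = a then axis b 1 $ i else M e x $ i $ j) $ i $ j)
     (\<lambda>e x. (\<chi> i j. if j = a then axis b 1 $ i else M' e x $ i $ j) $ i $ j)"
    using assms(4) n by (cases "j = a") simp_all
qed

text \<open>Generalized inverses are unique: \<open>h = (1 / d0) (h d0)\<close>, and \<open>d0\<close> may be replaced by \<open>d\<close> up to negligible nets.\<close>

lemma Neq_const_inverse:
  assumes S: "open S" and d: "Mod S d" and h: "Mod S h" and n: "Neq S (\<lambda>e y. h e y * d e y) (\<lambda>e y. 1)"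
    and d0: "Neq S d (\<lambda>e. d0)" "Ck_on \<infinity> S d0" "\<And>x. x \<in> S \<Longrightarrow> d0 x \<noteq> 0"
  shows "Neq S h (\<lambda>e y. 1 / d0 y)"
proof -
  have i: "Mod S (\<lambda>e y. 1 / d0 y)" by (rule Mod_const[OF S Ck_inverse[OF S d0(2,3)]])
  have "Neq S h (\<lambda>e y. 1 / d0 y * (h e y * d0 y))" by (rule Neq_on[OF S]) (use d0(3) in simp)
  moreover have "Neq S (\<lambda>e y. 1 / d0 y * (h e y * d0 y)) (\<lambda>e y. 1 / d0 y * (h e y * d e y))"
    by (intro Neq_mult S i h Neq_sym[OF S d0(1)])
  moreover have "Neq S (\<lambda>e y. 1 / d0 y * (h e y * d e y)) (\<lambda>e y. 1 / d0 y * 1)" by (rule Neq_mult[OF S i n])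
  ultimately have "Neq S h (\<lambda>e y. 1 / d0 y * 1)" using Neq_trans[OF S] by blast
  then show ?thesis by simp
qed

context atlas
begin

text \<open>The empty set is relatively compact.\<close>

lemma gen_metric_ex: assumes "gen_metric A G" shows "\<exists>\<gamma>. \<gamma> \<in> G"
proof -
  have "open ({} :: 'a set)" "compact (closure ({} :: 'a set))" by simp_all
  then show ?thesis using assms unfolding gen_metric_def by blast
qed

lemma gchr_Neq_cchr:
  assumes G: "gen_metric A G" and \<gamma>: "\<gamma> \<in> G" and g: "pr_metric \<infinity> A g" and e: "G = const_emb A 0 2 g" and c: "c \<in> A"
  shows "Neq (cran c) (gchr \<gamma> c l i j) (\<lambda>e. cchr g c l i j)"
proof -
  note S = ch(2)[OF c]
  have gt: "g \<in> smooth_tensor A 0 2" using g unfolding pr_metric_def by blast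
  have r: "(\<lambda>e. g, \<gamma>) \<in> net_rel A 0 2" using \<gamma> unfolding e const_emb_def gcls_def by blast
  have N: "Neq (cran c) (\<lambda>e. coord c (\<gamma> e) [] [a, b]) (\<lambda>e. coord c g [] [a, b])" for a b
    by (rule Neq_sym[OF S net_rel_Neq[OF r c]]) (auto simp: idx_2)
  have Mg: "Mod (cran c) (\<lambda>e. coord c g [] [a, b])" for a b
    by (rule Mod_const[OF S tensor_Ck[OF gt c]]) (auto simp: idx_2)
  have M: "Mod (cran c) (\<lambda>e x. gmat (\<gamma> e) c (cinv c x) $ i $ j)" "Mod (cran c) (\<lambda>e x. gmat g c (cinv c x) $ i $ j)"
    "Neq (cran c) (\<lambda>e x. gmat (\<gamma> e) c (cinv c x) $ i $ j) (\<lambda>e x. gmat g c (cinv c x) $ i $ j)" for i j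
    using metric_comp_Mod[OF G \<gamma> c] Mg N by (simp_all add: gmat_coord)
  have D: "Neq (cran c) (dinv \<gamma> c) (\<lambda>e x. 1 / det (gmat g c (cinv c x)))"
    by (rule Neq_const_inverse[OF S Mod_det[OF S M(1)] dinv[OF G \<gamma> c] Neq_det[OF S M]])
      (use pr_metric_det[OF g c] ch(6)[OF c] in \<open>auto intro!: Ck_det[OF S] gmat_smooth[OF gt c]\<close>)
  have I: "Neq (cran c) (gginv \<gamma> c k m) (\<lambda>e. ginv g c k m)" for k m
    unfolding gginv_def ginv_def
    by (intro Neq_mult2[OF S] D Neq_adjm[OF S M] Mod_adjm[OF S M(1)] Mod_const[OF S Ck_inverse[OF S Ck_det[OF S gmat_smooth[OF gt c]]]])
      (use pr_metric_det[OF g c] ch(6)[OF c] in auto)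
  show ?thesis unfolding gchr_def cchr_def Neq_def
    by (fold Neq_def, intro Neq_sum Neq_mult2 S I gginv_Mod[OF G \<gamma> c] Neq_refl Neq_diff Neq_add Neq_pd N Mg metric_comp_Mod[OF G \<gamma> c]
       Mod_mult Mod_const[OF S Ck_const] Mod_diff Mod_add Mod_pd)
qed

theorem gen_christoffel_const:
  assumes G: "gen_metric A G" and D: "gen_levi_civita A G Dh" and g: "pr_metric \<infinity> A g" and d: "levi_civita \<infinity> A g D"
    and e: "G = const_emb A 0 2 g" and c: "c \<in> A"
  shows "gen_christoffel A Dh c l i j = const_emb (restr A (cdom c)) 0 0 (christoffel \<infinity> A D c l i j)"
proof -
  let ?B = "restr A (cdom c)"
  interpret B: atlas ?B by (rule restr_atlas[OF ch(1)[OF c]])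
  obtain \<gamma> where \<gamma>: "\<gamma> \<in> G" using gen_metric_ex[OF G] by blast
  note S = ch(2)[OF c] and cB = mem_restr[OF c] and gm = gchr_net_moderate[OF G \<gamma> c]
  have "christoffel \<infinity> A D c l i j \<in> smooth_tensor ?B 0 0"
    unfolding christoffel_eq[OF _ g d c, simplified]
    by (rule B.from_chart_cover[OF cB]) (use cchr_Ck[OF _ g c] carrier_restr[of A "cdom c"] in auto)
  then have cm: "(\<lambda>e. christoffel \<infinity> A D c l i j) \<in> moderate ?B 0 0" by (rule B.const_moderate)
  have "Neq (cran c) (fc c (gchr_net \<gamma> c l i j)) (gchr \<gamma> c l i j)"
    by (rule Neq_on[OF S]) (rule gchr_net_coord[OF c])
  moreover have "Neq (cran c) (\<lambda>e. cchr g c l i j) (\<lambda>e. coord c (christoffel \<infinity> A D c l i j) [] [])"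
    by (rule Neq_on[OF S]) (use christoffel_coord[OF _ g d c] in simp)
  ultimately have N: "Neq (cran c) (fc c (gchr_net \<gamma> c l i j)) (\<lambda>e. coord c (christoffel \<infinity> A D c l i j) [] [])"
    using gchr_Neq_cchr[OF G \<gamma> g e c, of l i j] Neq_trans[OF S] by blast
  have "(gchr_net \<gamma> c l i j, \<lambda>e. christoffel \<infinity> A D c l i j) \<in> net_rel ?B 0 0"
  proof (rule B.net_relI[OF gm cm])
    fix p assume "p \<in> carrier_of ?B"
    then have "p \<in> cdom c" by (rule subsetD[OF carrier_restr])
    then show "\<exists>c'\<in>?B. p \<in> cdom c' \<and> (\<forall>I\<in>idx 0. Neq (cran c') (\<lambda>e. coord c' (gchr_net \<gamma> c l i j e) I [])
        (\<lambda>e. coord c' (christoffel \<infinity> A D c l i j) I []))"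
      using cB N by (intro bexI[of _ c]) auto
  qed
  then show ?thesis unfolding gen_christoffel_eq[OF G \<gamma> D c] const_emb_def using B.gcls_eq_iff[OF gm] by blast
qed

text \<open>The smooth connection is applied to arbitrary representatives. The coordinate formula of the smooth connection shows that the result is moderate, and
comparison with the generalized formula that it lies in the same class for all choices.\<close>

theorem gen_levi_civita_const:
  assumes G: "gen_metric A G" and D: "gen_levi_civita A G Dh" and g: "pr_metric \<infinity> A g" and d: "levi_civita \<infinity> A g D"
    and e: "G = const_emb A 0 2 g" and X: "X \<in> Gen A 1 0" and Y: "Y \<in> Gen A 1 0"
  shows "Dh X Y = lift2 A 1 0 D X Y"
proof -
  note DG = gen_levi_civita_Gen[OF D X Y]
  obtain \<gamma> \<xi> \<eta> w where \<gamma>: "\<gamma> \<in> G" and x: "\<xi> \<in> X" and y: "\<eta> \<in> Y" and w: "w \<in> Dh X Y"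
    using gen_metric_ex[OF G] Gen_ex[OF X] Gen_ex[OF Y] Gen_ex[OF DG] by blast
  have R: "(\<lambda>e. D (\<xi> e) (\<eta> e), w) \<in> net_rel A 1 0" if x: "\<xi> \<in> X" and y: "\<eta> \<in> Y" for \<xi> \<eta>
  proof -
    note xm = Gen_moderate[OF X x] and ym = Gen_moderate[OF Y y]
    have sm: "D (\<xi> e) (\<eta> e) \<in> smooth_tensor A 1 0" if "e \<in> {0<..1}" for e
    proof -
      have "connection \<infinity> A D" using d unfolding levi_civita_def by blast
      from conjunct1[OF this[unfolded connection_def]] moderate_smooth[OF xm that] moderate_smooth[OF ym that]
      show ?thesis by simp
    qed
    let ?R = "\<lambda>c l e y. \<Sum>i\<in>UNIV. vc c \<xi> i e y * (pd [i] (vc c \<eta> l e) y + (\<Sum>j\<in>UNIV. vc c \<eta> j e y * cchr g c l i j y))"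
    have fe: "vc c (\<lambda>e. D (\<xi> e) (\<eta> e)) l e z = ?R c l e z" if "e \<in> {0<..1}" "c \<in> A" "z \<in> cran c" for c l e z
      by (rule levi_civita_formula[OF _ g d _ moderate_smooth[OF ym that(1)] that(2,3)]) (use moderate_smooth[OF xm that(1)] in simp_all)
    have M: "Mod (cran c) (?R c l)" if c: "c \<in> A" for c l
      using cchr_Ck[OF _ g c] by (intro Mod_sum Mod_mult Mod_add Mod_pd Mod_const ch(2)[OF c] moderate_vc[OF xm c] moderate_vc[OF ym c]) simp_all
    have m: "(\<lambda>e. D (\<xi> e) (\<eta> e)) \<in> moderate A 1 0"
    proof (rule moderateI_all[OF sm])
      fix c and I :: "'n list" assume c: "c \<in> A" and "I \<in> idx 1"
      then obtain l where I: "I = [l]" by (auto simp: idx_1)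
      show "Mod (cran c) (\<lambda>e. coord c (D (\<xi> e) (\<eta> e)) I [])" unfolding I
        by (rule Mod_cong[OF ch(2)[OF c] fe[symmetric] M[OF c]]) (use c in auto)
    qed
    show ?thesis
    proof (rule net_relI[OF m Gen_moderate[OF DG w]])
      fix p assume "p \<in> carrier_of A"
      then obtain c where c: "c \<in> A" "p \<in> cdom c" using chart_at by blast
      note S = ch(2)[OF c(1)]
      have "Neq (cran c) (vc c (\<lambda>e. D (\<xi> e) (\<eta> e)) l) (vc c w l)" for l
      proof -
        have 1: "Neq (cran c) (vc c (\<lambda>e. D (\<xi> e) (\<eta> e)) l) (?R c l)" by (rule Neq_on[OF S]) (use fe c in auto)
        have 2: "Neq (cran c) (\<lambda>e y. \<Sum>i\<in>UNIV. vc c \<xi> i e y * (pd [i] (vc c \<eta> l e) y + (\<Sum>j\<in>UNIV. vc c \<eta> j e y * gchr \<gamma> c l i j e y))) (?R c l)"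
          by (intro Neq_sum Neq_mult Neq_add Neq_refl S moderate_vc[OF xm c(1)] moderate_vc[OF ym c(1)] gchr_Neq_cchr[OF G \<gamma> g e c(1)])
        note 3 = gen_formula[OF G \<gamma> D X x Y y w c(1), of l]
        show ?thesis by (rule Neq_trans[OF S 1 Neq_sym[OF S Neq_trans[OF S 3 2]]])
      qed
      then show "\<exists>c\<in>A. p \<in> cdom c \<and> (\<forall>I\<in>idx 1. Neq (cran c) (\<lambda>e. coord c (D (\<xi> e) (\<eta> e)) I []) (\<lambda>e. coord c (w e) I []))"
        using c by (intro bexI[of _ c]) (auto simp: idx_1)
    qed
  qed
  have m: "(\<lambda>e. D (\<xi> e) (\<eta> e)) \<in> moderate A 1 0" using R[OF x y] unfolding net_rel_iff by blast
  have "lift2 A 1 0 D X Y = gcls A 1 0 (\<lambda>e. D (\<xi> e) (\<eta> e))"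
    by (rule lift2_eq[where F=D, OF x y m]) (rule net_rel_trans[OF R[OF x y] net_rel_sym[OF R]])
  also have "\<dots> = gcls A 1 0 w" using gcls_eq_iff[OF m] R[OF x y] by blast
  also have "\<dots> = Dh X Y" using Gen_gcls[OF DG w] by simp
  finally show ?thesis by simp
qed

end

section \<open>Metrics that converge in \<open>C\<^sup>k\<close>\<close>

lemma Conv_comp:
  fixes \<tau> :: "real^'n::finite \<Rightarrow> real^'n"
  assumes "open S" "open T" "Conv k T f f0" "\<And>x. x \<in> S \<Longrightarrow> \<tau> x \<in> T" "\<And>j. Ck_on \<infinity> S (\<lambda>x. \<tau> x $ j)"
  shows "Conv k S (\<lambda>e y. f e (\<tau> y)) (\<lambda>y. f0 (\<tau> y))"
proof -
  have *: "(\<lambda>e y. f e (\<tau> y))(0 := \<lambda>y. f0 (\<tau> y)) = (\<lambda>e y. (f(0 := f0)) e (\<tau> y))" by auto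
  show ?thesis unfolding Conv_def *
  proof (intro allI impI)
    fix n assume "enat n \<le> k"
    then have "conv.R.G n T (f(0 := f0))" using assms(3) unfolding Conv_def by blast
    then show "conv.R.G n S (\<lambda>e y. (f(0 := f0)) e (\<tau> y))"
      by (rule conv.G_comp[OF assms(1,2) _ assms(4) Ck_nat[OF assms(5)]])
  qed
qed

lemma Neq_Conv:
  assumes "open S" "Neq S f g" "Conv k S g g0" shows "Conv k S f g0"
proof -
  have "Conv k S (\<lambda>e y. (f e y - g e y) + g e y) (\<lambda>y. 0 + g0 y)"
    by (rule Conv_add[OF assms(1) Neg_Conv[OF assms(1)] assms(3)]) (use assms(2) in \<open>simp add: Neq_def\<close>)
  then show ?thesis by simp
qed

context atlas
begin

text \<open>Association is stated for one representative; negligible nets converge to zero in all derivatives, so it holds for each.\<close>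

lemma assoc_Conv:
  assumes a: "assoc_k k A r s T t" and T: "T \<in> Gen A r s" "u \<in> T" and t: "t \<in> Ck_tensor k A r s"
    and c: "c \<in> A" and I: "I \<in> idx r" "J \<in> idx s"
  shows "Conv k (cran c) (\<lambda>e. coord c (u e) I J) (coord c t I J)"
proof -
  obtain v where v: "v \<in> T" and l: "\<forall>c\<in>A. \<forall>I\<in>idx r. \<forall>J\<in>idx s. \<forall>\<alpha>. enat (length \<alpha>) \<le> k \<longrightarrow>
      (\<forall>K. compact K \<and> K \<subseteq> cran c \<longrightarrow> uniform_limit K (\<lambda>e. pd \<alpha> (coord c (v e) I J)) (pd \<alpha> (coord c t I J)) (at_right 0))"
    using a unfolding assoc_k_def by (rule bexE)
  have "Conv k (cran c) (\<lambda>e. coord c (v e) I J) (coord c t I J)"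
    by (rule ConvI[OF ch(2)[OF c] tensor_Ck[OF moderate_smooth[OF Gen_moderate[OF T(1) v]] c I] tensor_Ck[OF t c I] l[rule_format, OF c I]])
      auto
  then show ?thesis by (rule Neq_Conv[OF ch(2)[OF c] Gen_Neq[OF T v c I]])
qed

lemma Conv_assoc:
  assumes "u \<in> T" "\<And>c I J. c \<in> A \<Longrightarrow> I \<in> idx r \<Longrightarrow> J \<in> idx s \<Longrightarrow> Conv k (cran c) (\<lambda>e. coord c (u e) I J) (coord c t I J)"
  shows "assoc_k k A r s T t"
  unfolding assoc_k_def
proof (intro bexI[OF _ assms(1)] ballI allI impI)
  fix c K and I J \<alpha> :: "'n list" assume "c \<in> A" "I \<in> idx r" "J \<in> idx s" and a: "enat (length \<alpha>) \<le> k" and K: "compact K \<and> K \<subseteq> cran c"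
  from Conv_uniform[OF assms(2)[OF this(1-3)] conjunct1[OF K] conjunct2[OF K] a]
  show "uniform_limit K (\<lambda>e. pd \<alpha> (coord c (u e) I J)) (pd \<alpha> (coord c t I J)) (at_right 0)" .
qed

lemma gchr_Conv:
  assumes G: "gen_metric A G" and \<gamma>: "\<gamma> \<in> G" and k: "1 \<le> k" and g: "pr_metric k A g" and a: "assoc_k k A 0 2 G g" and c: "c \<in> A"
  shows "Conv (k - 1) (cran c) (gchr \<gamma> c l i j) (cchr g c l i j)"
proof -
  note S = ch(2)[OF c]
  have gt: "g \<in> Ck_tensor k A 0 2" using g unfolding pr_metric_def by blast
  have C: "Conv k (cran c) (\<lambda>e. coord c (\<gamma> e) [] [a, b]) (coord c g [] [a, b])" for a b
    by (rule assoc_Conv[OF a gen_metric_Gen[OF G] \<gamma> gt c]) (auto simp: idx_2)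
  have M: "Conv k (cran c) (\<lambda>e x. gmat (\<gamma> e) c (cinv c x) $ i $ j) (\<lambda>x. gmat g c (cinv c x) $ i $ j)"
    "Mod (cran c) (\<lambda>e x. gmat (\<gamma> e) c (cinv c x) $ i $ j)" for i j
    using metric_comp_Mod[OF G \<gamma> c] C by (simp_all add: gmat_coord)
  have D: "Conv k (cran c) (dinv \<gamma> c) (\<lambda>x. 1 / det (gmat g c (cinv c x)))"
    by (rule Conv_inverse[OF S Conv_det[OF S M(1)] Mod_det[OF S M(2)] dinv(1)[OF G \<gamma> c] dinv(2)[OF G \<gamma> c, unfolded Neq_def]])
      (use pr_metric_det[OF g c] ch(6)[OF c] in \<open>auto intro!: Ck_det[OF S] gmat_smooth[OF gt c]\<close>)
  have I: "Conv (k - 1) (cran c) (gginv \<gamma> c k' m) (ginv g c k' m)" for k' m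
    unfolding gginv_def ginv_def[abs_def]
    by (rule Conv_mono[OF Conv_mult[OF S Conv_adjm[OF S M(1)] D] enat_pred_le order_refl])
  have P: "Conv (k - 1) (cran c) (\<lambda>e. pd [i] (coord c (\<gamma> e) [] [a, b])) (pd [i] (coord c g [] [a, b]))" for a b i
    by (rule Conv_pd) (simp add: enat_pred[OF k] C)
  show ?thesis unfolding gchr_def cchr_def[abs_def]
    by (intro Conv_sum Conv_mult S I Conv_add Conv_diff P Conv_const Ck_const)
qed

lemma from_chart_fun:
  assumes "c' \<in> restr A (cdom c)" "y \<in> cran c'"
  shows "coord c' (from_chart (restr A (cdom c)) c 0 0 (\<lambda>x I J. F x)) [] [] y = F (cmap c (cinv c' y))"
proof -
  have "c' \<in> A" using assms(1) by (simp add: restr_def)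
  moreover have "cinv c' y \<in> cdom c" using ch(6)[OF \<open>c' \<in> A\<close> assms(2)] assms(1) by (auto simp: restr_def)
  ultimately show ?thesis using assms ch(6)[of c' y] by (simp add: coord_def from_chart_def tens_def trf_fun)
qed

text \<open>Association has to be checked in all charts of the submanifold. There the function is the one in \<open>c\<close> after a smooth change of
coordinates, which preserves convergence in \<open>C\<^bsup>k-1\<^esup>\<close>.\<close>

theorem gen_christoffel_assoc:
  assumes G: "gen_metric A G" and Dh: "gen_levi_civita A G Dh" and k: "1 \<le> k" and g: "pr_metric k A g" and D: "levi_civita k A g D"
    and a: "assoc_k k A 0 2 G g" and c: "c \<in> A"
  shows "assoc_k (k - 1) (restr A (cdom c)) 0 0 (gen_christoffel A Dh c l i j) (christoffel k A D c l i j)"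
proof -
  let ?B = "restr A (cdom c)"
  interpret B: atlas ?B by (rule restr_atlas[OF ch(1)[OF c]])
  obtain \<gamma> where \<gamma>: "\<gamma> \<in> G" using gen_metric_ex[OF G] by blast
  note C = gchr_Conv[OF G \<gamma> k g a c, of l i j]
  show ?thesis unfolding gen_christoffel_eq[OF G \<gamma> Dh c] christoffel_eq[OF k g D c]
  proof (rule B.Conv_assoc[OF B.gcls_self[OF gchr_net_moderate[OF G \<gamma> c]]])
    fix c' and I J :: "'n list" assume c': "c' \<in> ?B" and "I \<in> idx 0" "J \<in> idx 0"
    then have I: "I = []" "J = []" by auto
    have A': "c' \<in> A" "cdom c' \<subseteq> cdom c" using c' by (auto simp: restr_def)
    have ov: "ov c' c = cran c'" using A'(2) by (auto simp: ov_def cran_def)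
    have in_c: "cmap c (cinv c' x) \<in> cran c" if "x \<in> cran c'" for x
      using ch(6)[OF A'(1) that] A'(2) ch(5)[OF c] by blast
    have "Conv (k - 1) (cran c') (\<lambda>e y. gchr \<gamma> c l i j e (cmap c (cinv c' y))) (\<lambda>y. cchr g c l i j (cmap c (cinv c' y)))"
      by (rule Conv_comp[OF ch(2)[OF A'(1)] ch(2)[OF c] C in_c]) (use trans_smooth[OF A'(1) c] ov in auto)
    then show "Conv (k - 1) (cran c') (\<lambda>e. coord c' (gchr_net \<gamma> c l i j e) I J) (coord c' (from_chart ?B c 0 0 (\<lambda>x I J. cchr g c l i j x)) I J)"
      unfolding I
      by (rule Conv_cong[OF ch(2)[OF A'(1)], rotated 2]) (simp_all add: gchr_net_def from_chart_fun[OF c'])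
  qed
qed

text \<open>The field \<open>\<eta>\<close> converges in \<open>C\<^sup>k\<close>, so its first derivatives converge in \<open>C\<^bsup>k-1\<^esup>\<close>, and so does every factor in the coordinate formula.\<close>

theorem gen_levi_civita_assoc:
  assumes G: "gen_metric A G" and Dh: "gen_levi_civita A G Dh" and k: "1 \<le> k" and g: "pr_metric k A g" and D: "levi_civita k A g D"
    and a: "assoc_k k A 0 2 G g" and X: "X \<in> Gen A 1 0" and Y: "Y \<in> Gen A 1 0"
    and z: "\<zeta> \<in> Ck_tensor (k - 1) A 1 0" "assoc_k (k - 1) A 1 0 X \<zeta>" and n: "\<nu> \<in> Ck_tensor k A 1 0" "assoc_k k A 1 0 Y \<nu>"
  shows "assoc_k (k - 1) A 1 0 (Dh X Y) (D \<zeta> \<nu>)"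
proof -
  obtain \<gamma> \<xi> \<eta> w where \<gamma>: "\<gamma> \<in> G" and x: "\<xi> \<in> X" and y: "\<eta> \<in> Y" and w: "w \<in> Dh X Y"
    using gen_metric_ex[OF G] Gen_ex[OF X] Gen_ex[OF Y] Gen_ex[OF gen_levi_civita_Gen[OF Dh X Y]] by blast
  show ?thesis
  proof (rule Conv_assoc[OF w])
    fix c and I J :: "'n list" assume c: "c \<in> A" and "I \<in> idx 1" "J \<in> idx 0"
    then obtain l where I: "I = [l]" "J = []" by (auto simp: idx_1)
    note S = ch(2)[OF c]
    have C1: "Conv (k - 1) (cran c) (vc c \<xi> m) (coord c \<zeta> [m] [])" for m
      by (rule assoc_Conv[OF z(2) X x z(1) c]) (auto simp: idx_1)
    have C2: "Conv k (cran c) (vc c \<eta> m) (coord c \<nu> [m] [])" for m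
      by (rule assoc_Conv[OF n(2) Y y n(1) c]) (auto simp: idx_1)
    have C3: "Conv (k - 1) (cran c) (\<lambda>e. pd [i] (vc c \<eta> m e)) (pd [i] (coord c \<nu> [m] []))" for i m
      by (rule Conv_pd) (simp add: enat_pred[OF k] C2)
    have "Conv (k - 1) (cran c) (\<lambda>e y. \<Sum>i\<in>UNIV. vc c \<xi> i e y * (pd [i] (vc c \<eta> l e) y + (\<Sum>j\<in>UNIV. vc c \<eta> j e y * gchr \<gamma> c l i j e y)))
      (\<lambda>y. \<Sum>i\<in>UNIV. coord c \<zeta> [i] [] y * (pd [i] (coord c \<nu> [l] []) y + (\<Sum>j\<in>UNIV. coord c \<nu> [j] [] y * cchr g c l i j y)))"
      by (intro Conv_sum Conv_mult Conv_add S C1 C3 Conv_mono[OF C2 enat_pred_le order_refl] gchr_Conv[OF G \<gamma> k g a c])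
    from Neq_Conv[OF S gen_formula[OF G \<gamma> Dh X x Y y w c] this]
    show "Conv (k - 1) (cran c) (\<lambda>e. coord c (w e) I J) (coord c (D \<zeta> \<nu>) I J)"
      unfolding I by (rule Conv_cong[OF S, rotated 2]) (simp_all add: levi_civita_formula[OF k g D z(1) n(1) c])
  qed
qed

end

section \<open>Banach--Steinhaus for test functions\<close>

lemma pd_cmult: "Ck_on \<infinity> UNIV f \<Longrightarrow> pd \<alpha> (\<lambda>x. a * f x) = (\<lambda>x. a * pd \<alpha> f x)"
proof (induction \<alpha>)
  case (Cons i \<alpha>)
  have d: "pd \<alpha> f differentiable at x" for x using Cons.prems Ck_inf_iff[of UNIV f] by blast
  have "pd [i] (\<lambda>x. a * pd \<alpha> f x) x = a * pd [i] (pd \<alpha> f) x" for x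
    using pd_mult[of "\<lambda>x. a" x "pd \<alpha> f" i] d by simp
  then show ?case using Cons by (simp only: pd_Cons[of i \<alpha>])
qed simp

text \<open>The bound on the derivative along \<open>\<alpha>\<close> is required from the index \<open>length \<alpha>\<close> on only. This is all that the choice of the summands one after the other
can provide, and it makes every differentiated series converge uniformly.\<close>

lemma smooth_series:
  fixes g :: "nat \<Rightarrow> real^'n::finite \<Rightarrow> real"
  assumes s: "\<And>k. Ck_on \<infinity> UNIV (g k)"
    and b: "\<And>(\<alpha>::'n list) k x. length \<alpha> \<le> k \<Longrightarrow> \<bar>pd \<alpha> (g k) x\<bar> \<le> (1/2) ^ k"
  shows "Ck_on \<infinity> UNIV (\<lambda>x. \<Sum>k. g k x)"
proof -
  have diff: "pd \<alpha> (g k) differentiable at x" for \<alpha> k x using s[of k] Ck_inf_iff[of UNIV "g k"] by blast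
  have geo: "summable (\<lambda>k. (1/2::real) ^ k)" by (rule summable_geometric) simp
  have ul: "uniform_limit UNIV (\<lambda>n x. \<Sum>k<n. pd \<alpha> (g k) x) (\<lambda>x. \<Sum>k. pd \<alpha> (g k) x) sequentially" for \<alpha> :: "'n list"
    by (rule Weierstrass_m_test_ev[OF _ geo]) (use b[of \<alpha>] in \<open>auto simp: eventually_sequentially\<close>)
  have sm: "summable (\<lambda>k. pd \<alpha> (g k) x)" for \<alpha> :: "'n list" and x
    by (rule summable_comparison_test_ev[OF _ geo]) (use b[of \<alpha>] in \<open>auto simp: eventually_sequentially\<close>)
  have step: "((\<lambda>x. \<Sum>k. pd \<alpha> (g k) x) has_derivative (\<lambda>h. \<Sum>i\<in>UNIV. h $ i * (\<Sum>k. pd (i # \<alpha>) (g k) x))) (at x)" for \<alpha> :: "'n list" and x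
  proof -
    let ?g' = "\<lambda>x h. \<Sum>i\<in>UNIV. h $ i * (\<Sum>k. pd (i # \<alpha>) (g k) x)"
    have "\<exists>G. \<forall>x\<in>UNIV. (\<lambda>k. pd \<alpha> (g k) x) sums G x \<and> (G has_derivative ?g' x) (at x within UNIV)"
    proof (rule has_derivative_series[where f'="\<lambda>k x h. \<Sum>i\<in>UNIV. h $ i * pd [i] (pd \<alpha> (g k)) x" and x=0])
      show "(pd \<alpha> (g k) has_derivative (\<lambda>h. \<Sum>i\<in>UNIV. h $ i * pd [i] (pd \<alpha> (g k)) x)) (at x within UNIV)" for k x
        using has_derivative_pd[OF diff] by simp
      show "(\<lambda>k. pd \<alpha> (g k) 0) sums (\<Sum>k. pd \<alpha> (g k) 0)" by (rule summable_sums[OF sm])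
      fix q :: real assume q: "q > 0"
      define r where "r = q / (real CARD('n))"
      have r: "r > 0" using q by (simp add: r_def)
      have "\<forall>\<^sub>F n in sequentially. \<forall>i. \<forall>x\<in>UNIV. dist (\<Sum>k<n. pd (i # \<alpha>) (g k) x) (\<Sum>k. pd (i # \<alpha>) (g k) x) < r"
        using uniform_limitD[OF ul r] by (simp add: eventually_all_finite)
      then show "\<forall>\<^sub>F n in sequentially. \<forall>x\<in>UNIV. \<forall>h. norm ((\<Sum>k<n. \<Sum>i\<in>UNIV. h $ i * pd [i] (pd \<alpha> (g k)) x) - ?g' x h) \<le> q * norm h"
      proof (rule eventually_mono, intro ballI allI)
        fix n x and h :: "real^'n"
        assume a: "\<forall>i. \<forall>x\<in>UNIV. dist (\<Sum>k<n. pd (i # \<alpha>) (g k) x) (\<Sum>k. pd (i # \<alpha>) (g k) x) < r"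
        have "(\<Sum>k<n. \<Sum>i\<in>UNIV. h $ i * pd [i] (pd \<alpha> (g k)) x) - ?g' x h
            = (\<Sum>i\<in>UNIV. h $ i * ((\<Sum>k<n. pd (i # \<alpha>) (g k) x) - (\<Sum>k. pd (i # \<alpha>) (g k) x)))"
          by (subst sum.swap) (simp add: pd_Cons[of _ \<alpha>, symmetric] sum_distrib_left right_diff_distrib sum_subtractf)
        also have "norm \<dots> \<le> (\<Sum>i\<in>(UNIV::'n set). norm h * r)"
        proof (rule sum_norm_le)
          fix i
          have "\<bar>(\<Sum>k<n. pd (i # \<alpha>) (g k) x) - (\<Sum>k. pd (i # \<alpha>) (g k) x)\<bar> \<le> r"
            using a by (simp add: dist_real_def less_imp_le)
          then show "norm (h $ i * ((\<Sum>k<n. pd (i # \<alpha>) (g k) x) - (\<Sum>k. pd (i # \<alpha>) (g k) x))) \<le> norm h * r"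
            unfolding real_norm_def abs_mult by (intro mult_mono component_le_norm_cart) auto
        qed
        also have "\<dots> = q * norm h" by (simp add: r_def)
        finally show "norm ((\<Sum>k<n. \<Sum>i\<in>UNIV. h $ i * pd [i] (pd \<alpha> (g k)) x) - ?g' x h) \<le> q * norm h" .
      qed
    qed auto
    then obtain G where G: "\<And>x. (\<lambda>k. pd \<alpha> (g k) x) sums G x" "\<And>x. (G has_derivative ?g' x) (at x)" by auto
    have "G = (\<lambda>x. \<Sum>k. pd \<alpha> (g k) x)" using sums_unique[OF G(1)] by auto
    then show ?thesis using G(2) by simp
  qed
  have pdf: "pd \<alpha> (\<lambda>x. \<Sum>k. g k x) = (\<lambda>x. \<Sum>k. pd \<alpha> (g k) x)" for \<alpha> :: "'n list"
  proof (induction \<alpha>)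
    case (Cons i \<alpha>)
    have "pd [i] (\<lambda>x. \<Sum>k. pd \<alpha> (g k) x) x = (\<Sum>k. pd (i # \<alpha>) (g k) x)" for x
      unfolding pd_one[OF step[of \<alpha> x]] by (simp add: axis_def if_distrib[where f="\<lambda>x. x * _"] cong: if_cong)
    then show ?case unfolding pd_Cons[of i \<alpha>] Cons by auto
  qed simp
  show ?thesis unfolding Ck_inf_iff[OF open_UNIV] pdf using step differentiable_def by blast
qed

text \<open>Test functions with support in a fixed compact set, which form a complete space.\<close>

definition bumps :: "(real^'n::finite) set \<Rightarrow> (real^'n \<Rightarrow> real) set" where
  "bumps K = {f. Ck_on \<infinity> UNIV f \<and> (\<forall>x. x \<notin> K \<longrightarrow> f x = 0)}"

lemma bumps_add: "f \<in> bumps K \<Longrightarrow> g \<in> bumps K \<Longrightarrow> (\<lambda>x. f x + a * g x) \<in> bumps K"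
  unfolding bumps_def by (auto intro!: Ck_add Ck_mult Ck_const)

lemma bumps_diff: "f \<in> bumps K \<Longrightarrow> g \<in> bumps K \<Longrightarrow> (\<lambda>x. f x - g x) \<in> bumps K"
  using bumps_add[of f K g "-1"] by simp

text \<open>The functionals \<open>L n\<close> are continuous for the uniform norm, and bounded on every single function. If \<open>L n (\<psi> n)\<close> did not tend to zero,
one could add multiples of suitable \<open>\<psi> m\<close> one after the other so that, for the partial sum after step \<open>k\<close>, some functional \<open>L m\<close> has absolute value at least \<open>k + 2\<close>:
the factor is chosen to beat the bound of all \<open>L n\<close> on the previous partial sum. As \<open>\<psi> m\<close> is small for large \<open>m\<close>, the new summand can be made so small
that the sum converges with all derivatives and that functionals chosen earlier change by at most \<open>1\<close> in total. Then the functionals are unbounded on the sum.\<close>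

lemma gliding_hump:
  fixes L :: "nat \<Rightarrow> (real^'n::finite \<Rightarrow> real) \<Rightarrow> real" and \<psi> :: "nat \<Rightarrow> real^'n \<Rightarrow> real"
  assumes lin: "\<And>n f g a. f \<in> bumps K \<Longrightarrow> g \<in> bumps K \<Longrightarrow> L n (\<lambda>x. f x + a * g x) = L n f + a * L n g"
    and cont: "\<And>n. \<exists>C. \<forall>f\<in>bumps K. \<forall>b. (\<forall>x. \<bar>f x\<bar> \<le> b) \<longrightarrow> \<bar>L n f\<bar> \<le> C * b"
    and bdd: "\<And>f. f \<in> bumps K \<Longrightarrow> \<exists>B. \<forall>n. \<bar>L n f\<bar> \<le> B"
    and \<psi>: "\<And>n. \<psi> n \<in> bumps K" and small: "\<And>(\<alpha>::'n list) r. r > 0 \<Longrightarrow> \<forall>\<^sub>F n in sequentially. \<forall>x. \<bar>pd \<alpha> (\<psi> n) x\<bar> \<le> r"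
  shows "(\<lambda>n. L n (\<psi> n)) \<longlonglongrightarrow> 0"
proof (rule ccontr)
  assume "\<not> ?thesis"
  then obtain \<delta> where \<delta>: "\<delta> > 0" and fr: "\<exists>\<^sub>F n in sequentially. \<bar>L n (\<psi> n)\<bar> \<ge> \<delta>"
    unfolding tendsto_iff by (auto simp: frequently_def not_le)
  obtain C where C: "\<And>n f b. f \<in> bumps K \<Longrightarrow> (\<And>x. \<bar>f x\<bar> \<le> b) \<Longrightarrow> \<bar>L n f\<bar> \<le> C n * b" using cont by metis
  \<comment> \<open>state: the partial sum, and a constant that bounds the norms of all functionals chosen so far\<close>
  let ?P = "\<lambda>(k::nat) s. fst s \<in> bumps K \<and> (1::real) \<le> snd s"
  let ?Q = "\<lambda>k s t. snd s \<le> snd t \<and> (\<forall>\<alpha>::'n list. \<forall>x. length \<alpha> \<le> k \<longrightarrow> snd s * \<bar>pd \<alpha> (\<lambda>x. fst t x - fst s x) x\<bar> \<le> (1/2) ^ k)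
     \<and> (\<exists>m. C m \<le> snd t \<and> real k + 2 \<le> \<bar>L m (fst t)\<bar>)"
  have "\<exists>s. \<forall>k. ?P k (s k) \<and> ?Q k (s k) (s (Suc k))"
  proof (rule dependent_nat_choice)
    show "\<exists>s. ?P 0 s" by (rule exI[of _ "(\<lambda>x. 0, 1)"]) (simp add: bumps_def Ck_const)
    fix s :: "(real^'n \<Rightarrow> real) \<times> real" and k :: nat
    assume s: "?P k s"
    define f D where "f = fst s" and "D = snd s"
    have f: "f \<in> bumps K" and D: "1 \<le> D" using s by (auto simp: f_def D_def)
    obtain B where B: "\<And>n. \<bar>L n f\<bar> \<le> B" using bdd[OF f] by blast
    \<comment> \<open>large enough for a * |L m (psi m)| to exceed the value of any functional on f by k + 2\<close>
    define a where "a = (B + k + 2) / \<delta>"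
    have a: "a > 0" using B[of 0] \<delta> by (auto simp: a_def intro!: divide_pos_pos)
    let ?r = "(1/2) ^ k / (a * D)"
    have r: "?r > 0" using a D by simp
    have "\<forall>\<^sub>F n in sequentially. \<forall>\<alpha>\<in>{\<alpha>::'n list. length \<alpha> \<le> k}. \<forall>x. \<bar>pd \<alpha> (\<psi> n) x\<bar> \<le> ?r"
      by (intro eventually_ball_finite finite_lists_le ballI small[OF r])
    from frequently_eventually_conj[OF fr this]
    obtain m where m: "\<bar>L m (\<psi> m)\<bar> \<ge> \<delta>" "\<And>(\<alpha>::'n list) x. length \<alpha> \<le> k \<Longrightarrow> \<bar>pd \<alpha> (\<psi> m) x\<bar> \<le> ?r"
      using frequently_ex by force
    let ?f = "\<lambda>x. f x + a * \<psi> m x"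
    have "pd \<alpha> (\<lambda>x. ?f x - f x) = (\<lambda>x. a * pd \<alpha> (\<psi> m) x)" for \<alpha>
      using pd_cmult[of "\<psi> m" \<alpha> a] \<psi>[of m] by (simp add: bumps_def)
    moreover have "D * \<bar>a * pd \<alpha> (\<psi> m) x\<bar> \<le> (1/2) ^ k" if "length \<alpha> \<le> k" for \<alpha> x
      using mult_left_mono[OF m(2)[OF that, of x], of "a * D"] a D by (simp add: abs_mult mult_ac)
    moreover have "real k + 2 \<le> \<bar>L m ?f\<bar>"
    proof -
      have "a * \<bar>L m (\<psi> m)\<bar> \<ge> a * \<delta>" using m(1) a by (intro mult_left_mono) auto
      moreover have "a * \<delta> = B + k + 2" using \<delta> by (simp add: a_def)
      ultimately have "\<bar>a * L m (\<psi> m)\<bar> \<ge> B + k + 2" using a by (simp add: abs_mult)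
      then show ?thesis unfolding lin[OF f \<psi>] using B[of m] by linarith
    qed
    ultimately show "\<exists>t. ?P (Suc k) t \<and> ?Q k s t"
      using bumps_add[OF f \<psi>] D unfolding f_def[symmetric] D_def[symmetric]
      by (intro exI[of _ "(?f, max D (C m))"]) (auto intro!: exI[of _ m])
  qed
  then obtain s where s: "\<And>k. ?P k (s k)" and Q: "\<And>k. ?Q k (s k) (s (Suc k))" by blast
  define p D where "p = (\<lambda>k. fst (s k))" and "D = (\<lambda>k. snd (s k))"
  have p: "p k \<in> bumps K" and D1: "1 \<le> D k" and Dmono: "D k \<le> D (Suc k)" for k using s Q by (auto simp: p_def D_def)
  have db: "D k * \<bar>pd \<alpha> (\<lambda>x. p (Suc k) x - p k x) x\<bar> \<le> (1/2) ^ k" if "length \<alpha> \<le> k" for k x and \<alpha> :: "'n list"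
    using Q[of k] that by (auto simp: p_def D_def)
  have hit: "\<exists>m. C m \<le> D (Suc k) \<and> real k + 2 \<le> \<bar>L m (p (Suc k))\<bar>" for k using Q[of k] by (simp add: p_def D_def)
  have Dle: "D k \<le> D j" if "k \<le> j" for k j by (rule lift_Suc_mono_le[of D, OF Dmono that])
  define g where "g = (\<lambda>k x. p (Suc k) x - p k x)"
  have gK: "g k \<in> bumps K" for k unfolding g_def by (rule bumps_diff[OF p p])
  have gb: "\<bar>pd \<alpha> (g k) x\<bar> \<le> (1/2) ^ k" if "length \<alpha> \<le> k" for k x and \<alpha> :: "'n list"
    using db[OF that, of x] mult_right_mono[OF D1[of k], of "\<bar>pd \<alpha> (g k) x\<bar>"] by (simp add: g_def)
  have g0: "D k * \<bar>g j x\<bar> \<le> (1/2) ^ j" if "k \<le> j" for k j x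
    using db[of "[]" j x] mult_right_mono[OF Dle[OF that], of "\<bar>g j x\<bar>"] by (simp add: g_def)
  have gs: "summable (\<lambda>k. g k x)" for x
    by (rule summable_comparison_test'[OF summable_geometric[of "1/2::real"], of 0]) (use gb[of "[]"] in auto)
  define f where "f = (\<lambda>x. p 0 x + 1 * (\<Sum>k. g k x))"
  have fK: "f \<in> bumps K" unfolding f_def
  proof (rule bumps_add[OF p])
    show "(\<lambda>x. \<Sum>k. g k x) \<in> bumps K"
      using smooth_series[of g] gK gb by (simp add: bumps_def)
  qed
  have fp: "f x - p n x = (\<Sum>j. g (j + n) x)" for n x
  proof -
    have "(\<Sum>j<n. g j x) = p n x - p 0 x" unfolding g_def by (rule sum_lessThan_telescope)
    then show ?thesis using suminf_minus_initial_segment[OF gs, of n x] by (simp add: f_def)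
  qed
  obtain B where B: "\<And>n. \<bar>L n f\<bar> \<le> B" using bdd[OF fK] by blast
  obtain k :: nat where k: "B < k" using reals_Archimedean2 by blast
  obtain m where m: "C m \<le> D (Suc k)" "real k + 2 \<le> \<bar>L m (p (Suc k))\<bar>" using hit by blast
  \<comment> \<open>the summands after step k change the functional chosen there by at most 1\<close>
  have tail: "\<bar>f x - p (Suc k) x\<bar> \<le> 1 / D (Suc k)" for x
  proof -
    have "norm (\<Sum>j. g (j + Suc k) x) \<le> (\<Sum>j. (1/2) ^ (j + 1) / D (Suc k))"
    proof (rule norm_suminf_le)
      show "norm (g (j + Suc k) x) \<le> (1/2) ^ (j + 1) / D (Suc k)" for j
      proof -
        have "D (Suc k) * \<bar>g (j + Suc k) x\<bar> \<le> (1/2) ^ (j + Suc k)" by (rule g0) simp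
        also have "\<dots> \<le> (1/2) ^ (j + 1)" by (rule power_decreasing) auto
        finally show ?thesis using D1[of "Suc k"] by (simp add: field_simps)
      qed
      show "summable (\<lambda>j. (1/2) ^ (j + 1) / D (Suc k))"
        by (intro summable_divide) (simp add: summable_geometric)
    qed
    also have "\<dots> = 1 / D (Suc k)"
      using suminf_divide[of "\<lambda>j. (1/2::real) ^ (j + 1)" "D (Suc k)"] suminf_mult[OF summable_geometric[of "1/2::real"], of "1/2"] suminf_geometric[of "1/2::real"]
      by (simp add: summable_geometric)
    finally show ?thesis unfolding fp by simp
  qed
  have "\<bar>L m (\<lambda>x. f x - p (Suc k) x)\<bar> \<le> C m * (1 / D (Suc k))" by (rule C[OF bumps_diff[OF fK p] tail])
  also have "\<dots> \<le> 1" using m(1) D1[of "Suc k"] by simp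
  finally have "\<bar>L m f - L m (p (Suc k))\<bar> \<le> 1" using lin[OF fK p, of m "-1"] by simp
  then show False using m(2) B[of m] k by linarith
qed

section \<open>Integrals against test functions\<close>

lemma Ck_continuous: "Ck_on k S f \<Longrightarrow> continuous_on S f"
  unfolding Ck_on_def by (metis list.size(3) pd.simps(1) zero_enat_def zero_le)

lemma bumps_continuous: "f \<in> bumps K \<Longrightarrow> continuous_on T f"
  unfolding bumps_def using Ck_continuous continuous_on_subset by blast

lemma bumps_test_fun: "f \<in> bumps K \<Longrightarrow> compact K \<Longrightarrow> K \<subseteq> S \<Longrightarrow> f \<in> test_fun S"
proof -
  assume f: "f \<in> bumps K" and K: "compact K" "K \<subseteq> S"
  have "tsupp f \<subseteq> K" unfolding tsupp_def
    by (rule closure_minimal) (use f compact_imp_closed[OF K(1)] in \<open>auto simp: bumps_def\<close>)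
  moreover have "compact (tsupp f)"
    using compact_Int_closed[OF K(1), of "tsupp f"] \<open>tsupp f \<subseteq> K\<close> by (simp add: tsupp_def inf.absorb2)
  ultimately show ?thesis using f K by (auto simp: test_fun_def bumps_def)
qed

lemma test_fun_bumps: "f \<in> test_fun S \<Longrightarrow> f \<in> bumps (tsupp f) \<and> compact (tsupp f) \<and> tsupp f \<subseteq> S"
  using subsetD[OF closure_subset[of "{x. f x \<noteq> 0}"]] by (auto simp: test_fun_def bumps_def tsupp_def)

lemma bumps_pd: "f \<in> bumps K \<Longrightarrow> compact K \<Longrightarrow> pd \<alpha> f \<in> bumps K"
proof -
  assume f: "f \<in> bumps K" and K: "compact K"
  have "pd \<alpha> f x = 0" if "x \<notin> K" for x
    using pd_cong_open[of "- K" x f "\<lambda>x. 0" \<alpha>] that f K compact_imp_closed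
    by (auto simp: bumps_def open_Compl pd_const_list)
  then show ?thesis using f by (simp add: bumps_def Ck_pd_inf)
qed

text \<open>The factor \<open>a\<close> is smooth only on \<open>S\<close>; the product is smooth everywhere, as it vanishes near each point outside of \<open>K\<close>.\<close>

lemma bumps_mult:
  assumes S: "open S" and a: "Ck_on \<infinity> S a" and f: "f \<in> bumps K" and K: "compact K" "K \<subseteq> S"
  shows "(\<lambda>x. a x * f x) \<in> bumps K"
proof -
  have o: "open (- K)" using K compact_imp_closed by auto
  have fC: "Ck_on \<infinity> T f" for T using f Ck_mono[of \<infinity> UNIV f \<infinity> T] by (simp add: bumps_def)
  have "Ck_on \<infinity> S (\<lambda>x. a x * f x)" by (rule Ck_mult[OF S a fC])
  moreover have "Ck_on \<infinity> (- K) (\<lambda>x. a x * f x)"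
    by (rule Ck_cong[OF o _ Ck_const[of _ _ 0]]) (use f in \<open>auto simp: bumps_def\<close>)
  ultimately have "Ck_on \<infinity> UNIV (\<lambda>x. a x * f x)"
    using K S o by (intro Ck_local open_UNIV) blast
  then show ?thesis using f by (simp add: bumps_def)
qed

text \<open>Integrals over \<open>S\<close> against such a function are integrals over a compact set, where continuity gives integrability.\<close>

lemma int_bump_eq:
  assumes "f \<in> bumps K" "K \<subseteq> S"
  shows "indicator S x *\<^sub>R (u x * f x) = indicator K x *\<^sub>R (u x * f x :: real)"
  using assms by (auto simp: indicator_def bumps_def)

lemma int_bump:
  assumes u: "continuous_on S u" and K: "compact K" "K \<subseteq> S" and f: "f \<in> bumps K"
  shows "set_integrable lborel S (\<lambda>x. u x * f x)"
  unfolding set_integrable_def int_bump_eq[OF f K(2)]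
  by (intro borel_integrable_compact[OF K(1)] continuous_on_mult continuous_on_subset[OF u K(2)] bumps_continuous[OF f])

lemma int_bump_bound:
  assumes u: "continuous_on S u" and K: "compact K" "K \<subseteq> S"
  shows "\<exists>C. \<forall>f\<in>bumps K. \<forall>b. (\<forall>x. \<bar>f x\<bar> \<le> b) \<longrightarrow> \<bar>LINT x:S|lborel. u x * f x\<bar> \<le> C * b"
proof (intro exI ballI allI impI)
  fix f b assume f: "f \<in> bumps K" and b: "\<forall>x. \<bar>f x\<bar> \<le> b"
  have uc: "continuous_on K u" by (rule continuous_on_subset[OF u K(2)])
  have "\<bar>LINT x:S|lborel. u x * f x\<bar> \<le> (LINT x|lborel. norm (indicator K x *\<^sub>R (u x * f x)))"
    unfolding set_lebesgue_integral_def int_bump_eq[OF f K(2)] real_norm_def[symmetric] by (rule integral_norm_bound)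
  also have "\<dots> \<le> (LINT x|lborel. indicator K x *\<^sub>R (\<bar>u x\<bar> * b))"
  proof (rule integral_mono)
    show "integrable lborel (\<lambda>x. norm (indicator K x *\<^sub>R (u x * f x)))"
      by (intro integrable_norm borel_integrable_compact[OF K(1)] continuous_on_mult uc bumps_continuous[OF f])
    show "integrable lborel (\<lambda>x. indicator K x *\<^sub>R (\<bar>u x\<bar> * b))"
      by (intro borel_integrable_compact[OF K(1)] continuous_on_mult continuous_on_rabs uc continuous_on_const)
    show "norm (indicator K x *\<^sub>R (u x * f x)) \<le> indicator K x *\<^sub>R (\<bar>u x\<bar> * b)" for x
      using b by (auto simp: indicator_def abs_mult intro!: mult_left_mono)
  qed
  also have "\<dots> = (LINT x|lborel. indicator K x *\<^sub>R \<bar>u x\<bar>) * b"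
    by (simp only: real_scaleR_def mult.assoc[symmetric] integral_mult_left_zero)
  finally show "\<bar>LINT x:S|lborel. u x * f x\<bar> \<le> (LINT x|lborel. indicator K x *\<^sub>R \<bar>u x\<bar>) * b" .
qed

text \<open>The integral of a difference quotient vanishes by translation invariance of Lebesgue measure. The quotients are bounded by the
maximum of the derivative and have their support in a fixed ball, so dominated convergence applies.\<close>

lemma integral_pd_zero:
  fixes F :: "real^'n::finite \<Rightarrow> real"
  assumes F: "F \<in> bumps K" and K: "compact K"
  shows "(LINT x|lborel. pd [i] F x) = 0"
proof -
  let ?e = "axis i (1::real) :: real^'n"
  define h where "h = (\<lambda>n. 1 / real (Suc n))"
  define q where "q = (\<lambda>n x. (F (h n *\<^sub>R ?e + x) - F x) / h n)"
  have h: "0 < h n" "h n \<le> 1" for n by (auto simp: h_def)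
  have h0: "h \<longlonglongrightarrow> 0" unfolding h_def by (rule LIMSEQ_Suc[OF lim_1_over_n])
  have diff: "F differentiable at x" for x using F Ck_inf_iff[of UNIV F] by (auto simp: bumps_def dest!: spec[of _ "[]"])
  have D: "((\<lambda>t. F (t *\<^sub>R ?e + x)) has_real_derivative pd [i] F (t *\<^sub>R ?e + x)) (at t)" for t x
  proof -
    have "((\<lambda>t. F (t *\<^sub>R ?e + x)) has_derivative (\<lambda>s. \<Sum>j\<in>UNIV. (s *\<^sub>R ?e) $ j * pd [j] F (t *\<^sub>R ?e + x))) (at t)"
      by (rule has_derivative_compose[OF _ has_derivative_pd[OF diff]]) (auto intro!: derivative_eq_intros)
    moreover have "(\<lambda>s. \<Sum>j\<in>UNIV. (s *\<^sub>R ?e) $ j * pd [j] F (t *\<^sub>R ?e + x)) = (*) (pd [i] F (t *\<^sub>R ?e + x))"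
      by (rule ext) (simp add: axis_def if_distrib[where f="\<lambda>x. _ * x"] if_distrib[where f="\<lambda>x. x * _"] mult.commute cong: if_cong)
    ultimately show ?thesis unfolding has_field_derivative_def by simp
  qed
  note pK = bumps_pd[OF F K, of "[i]"]
  obtain M where M: "\<And>x. \<bar>pd [i] F x\<bar> \<le> M"
  proof -
    have "bounded (pd [i] F ` K)" by (intro compact_imp_bounded compact_continuous_image bumps_continuous[OF pK] K)
    then obtain M where "\<And>x. x \<in> K \<Longrightarrow> \<bar>pd [i] F x\<bar> \<le> M" unfolding bounded_iff by auto
    then have "\<bar>pd [i] F x\<bar> \<le> \<bar>M\<bar>" for x
    proof (cases "x \<in> K")
      case False then show ?thesis using pK by (simp add: bumps_def)
    qed force
    then show ?thesis by (rule that)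
  qed
  obtain R where "\<forall>x\<in>K. norm x \<le> R" using compact_imp_bounded[OF K] unfolding bounded_iff by (rule exE)
  then have R: "K \<subseteq> cball 0 R" by auto
  have q: "\<bar>q n x\<bar> \<le> M" for n x
  proof -
    obtain z where "F (h n *\<^sub>R ?e + x) - F (0 *\<^sub>R ?e + x) = (h n - 0) * pd [i] F (z *\<^sub>R ?e + x)"
      using MVT2[of 0 "h n" "\<lambda>t. F (t *\<^sub>R ?e + x)" "\<lambda>t. pd [i] F (t *\<^sub>R ?e + x)", OF h(1) D] by blast
    then show ?thesis using h(1)[of n] M[of "z *\<^sub>R ?e + x"] by (simp add: q_def)
  qed
  have q0: "q n x = 0" if "x \<notin> cball 0 (R + 1)" for n x
  proof -
    have "norm x > R + 1" using that by simp
    moreover have "norm (h n *\<^sub>R ?e + x) \<ge> norm x - h n" using norm_triangle_ineq4[of "h n *\<^sub>R ?e + x" "h n *\<^sub>R ?e"] h[of n] by simp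
    ultimately have "x \<notin> K" "h n *\<^sub>R ?e + x \<notin> K" using R h(2)[of n] by auto
    then show ?thesis using F by (simp add: q_def bumps_def)
  qed
  have Fi: "integrable lborel F"
    using int_bump[of UNIV "\<lambda>x. 1" K F] F K by (simp add: set_integrable_def)
  have Fm: "F \<in> borel_measurable borel" by (intro borel_measurable_continuous_onI bumps_continuous[OF F])
  have tm: "(+) (h n *\<^sub>R ?e) \<in> lborel \<rightarrow>\<^sub>M borel" for n by measurable
  have Fh: "integrable lborel (\<lambda>x. F (h n *\<^sub>R ?e + x))" for n
    using integrable_distr_eq[OF tm Fm] Fi unfolding lborel_distr_plus by simp
  have "(LINT x|lborel. F (h n *\<^sub>R ?e + x)) = (LINT x|lborel. F x)" for n
    using integral_distr[OF tm Fm] unfolding lborel_distr_plus by simp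
  then have z: "(LINT x|lborel. q n x) = 0" for n unfolding q_def using Fi Fh by simp
  have "(\<lambda>n. LINT x|lborel. q n x) \<longlonglongrightarrow> (LINT x|lborel. pd [i] F x)"
  proof (rule integral_dominated_convergence[where w="\<lambda>x. indicator (cball 0 (R + 1)) x *\<^sub>R M"])
    show "pd [i] F \<in> borel_measurable lborel" "q n \<in> borel_measurable lborel" for n
      using borel_measurable_continuous_onI[OF bumps_continuous[OF pK]] borel_measurable_integrable[OF Fi] borel_measurable_integrable[OF Fh]
      unfolding q_def by auto
    show "integrable lborel (\<lambda>x. indicator (cball 0 (R + 1)) x *\<^sub>R M)"
      by (rule borel_integrable_compact) auto
    show "AE x in lborel. (\<lambda>n. q n x) \<longlonglongrightarrow> pd [i] F x"
    proof (rule AE_I2)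
      fix x
      have "((\<lambda>s. (F (s *\<^sub>R ?e + x) - F x) / s) \<longlongrightarrow> pd [i] F x) (at 0)"
        using D[of x 0] unfolding DERIV_def by simp
      moreover have "filterlim h (at 0) sequentially" unfolding filterlim_at using h0 h(1) by (auto simp: less_imp_neq[symmetric] intro!: always_eventually)
      ultimately show "(\<lambda>n. q n x) \<longlonglongrightarrow> pd [i] F x" unfolding q_def by (rule filterlim_compose)
    qed
    show "AE x in lborel. norm (q n x) \<le> indicator (cball 0 (R + 1)) x *\<^sub>R M" for n
      by (rule AE_I2) (use q q0 in \<open>auto simp: indicator_def\<close>)
  qed
  then show ?thesis unfolding z using LIMSEQ_const_iff by metis
qed

text \<open>The function \<open>u f\<close> extends by zero to a smooth function with compact support, whose partial derivative has integral zero.\<close>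

lemma integration_by_parts:
  assumes S: "open S" and u: "Ck_on \<infinity> S u" and f: "f \<in> bumps K" and K: "compact K" "K \<subseteq> S"
  shows "(LINT x:S|lborel. pd [i] u x * f x) = - (LINT x:S|lborel. u x * pd [i] f x)"
proof -
  note F = bumps_mult[OF S u f K] and fp = bumps_pd[OF f K(1), of "[i]"]
  have c: "continuous_on S u" "continuous_on S (pd [i] u)" by (rule Ck_continuous[OF u]) (rule Ck_continuous[OF Ck_pd_inf[OF u]])
  have d: "u differentiable at x" "f differentiable at x" if "x \<in> S" for x
    using u f that Ck_inf_iff[OF S, of u] Ck_inf_iff[of UNIV f] by (auto simp: bumps_def dest!: spec[of _ "[]"])
  have "indicator S x *\<^sub>R (pd [i] u x * f x + u x * pd [i] f x) = pd [i] (\<lambda>x. u x * f x) x" for x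
  proof (cases "x \<in> S")
    case True then show ?thesis using pd_mult[OF d] by simp
  next
    case False then have "x \<notin> K" using K by blast
    then show ?thesis using False bumps_pd[OF F K(1), of "[i]"] by (simp add: bumps_def)
  qed
  then have "(LINT x:S|lborel. pd [i] u x * f x + u x * pd [i] f x) = 0"
    unfolding set_lebesgue_integral_def using integral_pd_zero[OF F K(1), of i] by simp
  moreover have "(LINT x:S|lborel. pd [i] u x * f x + u x * pd [i] f x) = (LINT x:S|lborel. pd [i] u x * f x) + (LINT x:S|lborel. u x * pd [i] f x)"
    by (rule set_integral_add(2)[OF int_bump[OF c(2) K f] int_bump[OF c(1) K fp]])
  ultimately show ?thesis by simp
qed

section \<open>Weak limits\<close>

text \<open>Convergence in the sense of distributions on \<open>S\<close>. Smoothness of the members is part of the notion, so that it is closed under derivatives.\<close>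

definition wlim :: "(real^'n::finite) set \<Rightarrow> (real \<Rightarrow> real^'n \<Rightarrow> real) \<Rightarrow> ((real^'n \<Rightarrow> real) \<Rightarrow> real) \<Rightarrow> bool" where
  "wlim S u \<nu> \<longleftrightarrow> (\<forall>e\<in>{0<..1}. Ck_on \<infinity> S (u e)) \<and>
     (\<forall>f\<in>test_fun S. ((\<lambda>e. LINT x:S|lborel. u e x * f x) \<longlongrightarrow> \<nu> f) (at_right 0))"

lemma eventually_unit: "\<forall>\<^sub>F e in at_right (0::real). e \<in> {0<..1}"
  unfolding eventually_at_right_field by (intro exI[of _ 1]) auto

lemma bumps_conv_small:
  fixes \<phi> :: "real \<Rightarrow> real^'n::finite \<Rightarrow> real"
  assumes S: "open S" and K: "compact K" "K \<subseteq> S" and \<phi>: "\<And>e. e \<in> {0<..1} \<Longrightarrow> \<phi> e \<in> bumps K" and \<phi>0: "\<phi>0 \<in> bumps K"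
    and C: "Conv \<infinity> S \<phi> \<phi>0" and r: "r > 0"
  shows "\<forall>\<^sub>F e in at_right 0. \<forall>x. \<bar>pd \<alpha> (\<lambda>x. \<phi> e x - \<phi>0 x) x\<bar> \<le> r"
proof -
  have "Ck_on \<infinity> S \<phi>0" using \<phi>0 Ck_mono[of \<infinity> UNIV \<phi>0 \<infinity> S] by (simp add: bumps_def)
  then have "Conv \<infinity> S (\<lambda>e x. \<phi> e x - \<phi>0 x) (\<lambda>x. \<phi>0 x - \<phi>0 x)" by (intro Conv_diff[OF S C] Conv_const[OF S])
  from Conv_uniform[OF this K, of \<alpha>]
  have "uniform_limit K (\<lambda>e. pd \<alpha> (\<lambda>x. \<phi> e x - \<phi>0 x)) (\<lambda>x. 0) (at_right 0)" by (simp add: pd_const_list)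
  from eventually_conj[OF uniform_limitD[OF this r] eventually_unit] show ?thesis
  proof (rule eventually_mono, intro allI)
    fix e x assume a: "(\<forall>x\<in>K. dist (pd \<alpha> (\<lambda>x. \<phi> e x - \<phi>0 x) x) 0 < r) \<and> e \<in> {0<..1}"
    show "\<bar>pd \<alpha> (\<lambda>x. \<phi> e x - \<phi>0 x) x\<bar> \<le> r"
    proof (cases "x \<in> K")
      case True then show ?thesis using conjunct1[OF a, rule_format, OF True] by (simp add: dist_real_def)
    next
      case False then show ?thesis
        using bumps_pd[OF bumps_diff[OF \<phi> \<phi>0] K(1), of e \<alpha>] a r by (simp add: bumps_def)
    qed
  qed
qed

text \<open>Both the functionals and the test functions vary. Along a sequence of parameters the gliding hump applies to \<open>\<psi> n = \<phi> (X n) - \<phi>0\<close>.\<close>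

lemma wlim_bumps:
  fixes \<phi> :: "real \<Rightarrow> real^'n::finite \<Rightarrow> real"
  assumes S: "open S" and u: "wlim S u \<nu>" and K: "compact K" "K \<subseteq> S" and \<phi>: "\<And>e. e \<in> {0<..1} \<Longrightarrow> \<phi> e \<in> bumps K"
    and \<phi>0: "\<phi>0 \<in> bumps K" and C: "Conv \<infinity> S \<phi> \<phi>0"
  shows "((\<lambda>e. LINT x:S|lborel. u e x * \<phi> e x) \<longlongrightarrow> \<nu> \<phi>0) (at_right 0)"
proof (rule tendsto_at_right_sequentially[of 0 1])
  fix X :: "nat \<Rightarrow> real" assume X: "\<And>n. 0 < X n" "\<And>n. X n < 1" "X \<longlonglongrightarrow> 0"
  have XI: "X n \<in> {0<..1}" for n using X(1,2)[of n] by simp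
  have F: "filterlim X (at_right 0) sequentially" by (rule tendsto_imp_filterlim_at_right[OF X(3)]) (use X(1) in simp)
  define L where "L = (\<lambda>n f. LINT x:S|lborel. u (X n) x * f x)"
  define \<psi> where "\<psi> = (\<lambda>n x. \<phi> (X n) x - \<phi>0 x)"
  have uc: "continuous_on S (u (X n))" for n using u XI Ck_continuous unfolding wlim_def by blast
  have lim: "(\<lambda>n. L n f) \<longlonglongrightarrow> \<nu> f" if f: "f \<in> bumps K" for f
  proof -
    have "((\<lambda>e. LINT x:S|lborel. u e x * f x) \<longlongrightarrow> \<nu> f) (at_right 0)"
      using u bumps_test_fun[OF f K] unfolding wlim_def by blast
    from filterlim_compose[OF this F] show ?thesis by (simp add: L_def)
  qed
  have lin: "L n (\<lambda>x. f x + a * g x) = L n f + a * L n g" if f: "f \<in> bumps K" and g: "g \<in> bumps K" for n f g a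
  proof -
    have "L n (\<lambda>x. f x + a * g x) = (LINT x:S|lborel. u (X n) x * f x + a * (u (X n) x * g x))"
      unfolding L_def by (simp add: algebra_simps)
    also have "\<dots> = L n f + (LINT x:S|lborel. a * (u (X n) x * g x))"
      unfolding L_def by (intro set_integral_add set_integrable_mult_right int_bump[OF uc K] f g)
    finally show ?thesis by (simp add: L_def)
  qed
  have \<psi>: "\<psi> n \<in> bumps K" for n unfolding \<psi>_def by (rule bumps_diff[OF \<phi>[OF XI] \<phi>0])
  have "(\<lambda>n. L n (\<psi> n)) \<longlonglongrightarrow> 0"
  proof (rule gliding_hump[of K, OF lin _ _ \<psi>])
    show "\<exists>C. \<forall>f\<in>bumps K. \<forall>b. (\<forall>x. \<bar>f x\<bar> \<le> b) \<longrightarrow> \<bar>L n f\<bar> \<le> C * b" for n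
      unfolding L_def by (rule int_bump_bound[OF uc K])
    show "\<exists>B. \<forall>n. \<bar>L n f\<bar> \<le> B" if "f \<in> bumps K" for f
      using convergent_imp_Bseq[OF convergentI[OF lim[OF that]]] by (auto simp: Bseq_def)
    show "\<forall>\<^sub>F n in sequentially. \<forall>x. \<bar>pd \<alpha> (\<psi> n) x\<bar> \<le> r" if "r > 0" for r and \<alpha> :: "'n list"
      using filterlim_iff[THEN iffD1, rule_format, OF F bumps_conv_small[OF S K \<phi> \<phi>0 C that, of \<alpha>]] by (simp add: \<psi>_def)
  qed
  from tendsto_add[OF this lim[OF \<phi>0]] have "(\<lambda>n. L n (\<psi> n) + L n \<phi>0) \<longlonglongrightarrow> \<nu> \<phi>0" by simp
  moreover have "L n (\<psi> n) + L n \<phi>0 = L n (\<phi> (X n))" for n using lin[OF \<psi> \<phi>0, of n n 1] by (simp add: \<psi>_def)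
  ultimately show "(\<lambda>n. LINT x:S|lborel. u (X n) x * \<phi> (X n) x) \<longlonglongrightarrow> \<nu> \<phi>0" by (simp add: L_def)
qed simp

lemma wlimI:
  assumes "\<And>e. e \<in> {0<..1} \<Longrightarrow> Ck_on \<infinity> S (u e)"
    and "\<And>f K. f \<in> bumps K \<Longrightarrow> compact K \<Longrightarrow> K \<subseteq> S \<Longrightarrow> f \<in> test_fun S \<Longrightarrow> ((\<lambda>e. LINT x:S|lborel. u e x * f x) \<longlongrightarrow> \<nu> f) (at_right 0)"
  shows "wlim S u \<nu>"
  unfolding wlim_def using assms test_fun_bumps by blast

lemma lim_cong:
  assumes "\<And>e. e \<in> {0<..1} \<Longrightarrow> a e = b e" "(b \<longlongrightarrow> l) (at_right (0::real))"
  shows "(a \<longlongrightarrow> l) (at_right 0)"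
  by (rule Lim_transform_eventually[OF assms(2) eventually_mono[OF eventually_unit]]) (use assms(1) in simp)

lemma wlim_smooth: "wlim S u \<nu> \<Longrightarrow> e \<in> {0<..1} \<Longrightarrow> Ck_on \<infinity> S (u e)"
  unfolding wlim_def by blast

lemma wlim_lim: "wlim S u \<nu> \<Longrightarrow> f \<in> test_fun S \<Longrightarrow> ((\<lambda>e. LINT x:S|lborel. u e x * f x) \<longlongrightarrow> \<nu> f) (at_right 0)"
  unfolding wlim_def by blast

text \<open>The factor is moved to the test function, which then depends on the parameter.\<close>

lemma wlim_mult:
  assumes S: "open S" and u: "wlim S u \<nu>" and a: "\<And>e. e \<in> {0<..1} \<Longrightarrow> Ck_on \<infinity> S (a e)" "Conv \<infinity> S a a0" "Ck_on \<infinity> S a0"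
  shows "wlim S (\<lambda>e x. a e x * u e x) (dist_mult a0 \<nu>)"
proof (rule wlimI)
  show "Ck_on \<infinity> S (\<lambda>x. a e x * u e x)" if "e \<in> {0<..1}" for e by (rule Ck_mult[OF S a(1)[OF that] wlim_smooth[OF u that]])
  fix f K assume f: "f \<in> bumps K" and K: "compact K" "K \<subseteq> S"
  have fC: "Ck_on \<infinity> S f" using f Ck_mono[of \<infinity> UNIV f \<infinity> S] by (simp add: bumps_def)
  have "((\<lambda>e. LINT x:S|lborel. u e x * (a e x * f x)) \<longlongrightarrow> \<nu> (\<lambda>x. a0 x * f x)) (at_right 0)"
  proof (rule wlim_bumps[OF S u K])
    show "(\<lambda>x. a e x * f x) \<in> bumps K" if "e \<in> {0<..1}" for e by (rule bumps_mult[OF S a(1)[OF that] f K])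
    show "(\<lambda>x. a0 x * f x) \<in> bumps K" by (rule bumps_mult[OF S a(3) f K])
    show "Conv \<infinity> S (\<lambda>e x. a e x * f x) (\<lambda>x. a0 x * f x)" by (rule Conv_mult[OF S a(2) Conv_const[OF S fC]])
  qed
  then show "((\<lambda>e. LINT x:S|lborel. a e x * u e x * f x) \<longlongrightarrow> dist_mult a0 \<nu> f) (at_right 0)"
    by (simp add: dist_mult_def mult_ac)
qed

lemma wlim_pd:
  assumes S: "open S" and u: "wlim S u \<nu>"
  shows "wlim S (\<lambda>e. pd [i] (u e)) (dist_pd i \<nu>)"
proof (rule wlimI)
  show "Ck_on \<infinity> S (pd [i] (u e))" if "e \<in> {0<..1}" for e by (rule Ck_pd_inf[OF wlim_smooth[OF u that]])
  fix f K assume f: "f \<in> bumps K" and K: "compact K" "K \<subseteq> S"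
  show "((\<lambda>e. LINT x:S|lborel. pd [i] (u e) x * f x) \<longlongrightarrow> dist_pd i \<nu> f) (at_right 0)"
    unfolding dist_pd_def
    by (rule lim_cong[OF integration_by_parts[OF S wlim_smooth[OF u] f K]], assumption)
      (intro tendsto_minus wlim_lim[OF u] bumps_test_fun[OF bumps_pd[OF f K(1)] K])
qed

lemma wlim_add:
  assumes S: "open S" and u: "wlim S u \<nu>" and v: "wlim S v \<mu>"
  shows "wlim S (\<lambda>e x. u e x + v e x) (\<lambda>f. \<nu> f + \<mu> f)"
proof (rule wlimI)
  show "Ck_on \<infinity> S (\<lambda>x. u e x + v e x)" if "e \<in> {0<..1}" for e by (intro Ck_add S wlim_smooth[OF u that] wlim_smooth[OF v that])
  fix f K assume f: "f \<in> bumps K" and K: "compact K" "K \<subseteq> S" and t: "f \<in> test_fun S"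
  show "((\<lambda>e. LINT x:S|lborel. (u e x + v e x) * f x) \<longlongrightarrow> \<nu> f + \<mu> f) (at_right 0)"
  proof (rule lim_cong[OF _ tendsto_add[OF wlim_lim[OF u t] wlim_lim[OF v t]]])
    fix e :: real assume e: "e \<in> {0<..1}"
    show "(LINT x:S|lborel. (u e x + v e x) * f x) = (LINT x:S|lborel. u e x * f x) + (LINT x:S|lborel. v e x * f x)"
      unfolding distrib_right
      by (intro set_integral_add int_bump[OF _ K f] Ck_continuous[OF wlim_smooth[OF u e]] Ck_continuous[OF wlim_smooth[OF v e]])
  qed
qed

lemma wlim_zero: "wlim S (\<lambda>e x. 0) (\<lambda>f. 0)"
  by (rule wlimI) (auto intro: Ck_const simp: set_lebesgue_integral_def)

lemma wlim_sum:
  assumes "open S" "finite J" "\<And>j. j \<in> J \<Longrightarrow> wlim S (u j) (\<nu> j)"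
  shows "wlim S (\<lambda>e x. \<Sum>j\<in>J. u j e x) (\<lambda>f. \<Sum>j\<in>J. \<nu> j f)"
  using assms(2,3) by (induction J) (auto intro: wlim_zero wlim_add[OF assms(1)])

text \<open>A negligible net tends to zero with all derivatives, so it is the product of such a net and the constant \<open>1\<close>.\<close>

lemma wlim_Neq:
  assumes S: "open S" and v: "wlim S v \<nu>" and n: "Neq S u v"
  shows "wlim S u \<nu>"
proof -
  have m: "Mod S (\<lambda>e x. u e x - v e x)" and N: "Neg S (\<lambda>e x. u e x - v e x)" using n Neg_Mod by (auto simp: Neq_def)
  have 1: "wlim S (\<lambda>e x. 1) (\<lambda>f. LINT x:S|lborel. f x)" by (rule wlimI) (auto intro: Ck_const)
  have "wlim S (\<lambda>e x. (u e x - v e x) * 1) (dist_mult (\<lambda>x. 0) (\<lambda>f. LINT x:S|lborel. f x))"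
    by (rule wlim_mult[OF S 1 Mod_smooth[OF S m] Neg_Conv[OF S N] Ck_const])
  from wlim_add[OF S this v] show ?thesis by (simp add: dist_mult_def set_lebesgue_integral_def)
qed

context atlas
begin

lemma assoc_dist_wlim:
  assumes a: "assoc_dist_vf A T w" and T: "T \<in> Gen A 1 0" "u \<in> T" and c: "c \<in> A"
  shows "wlim (cran c) (vc c u i) (w c i)"
proof -
  obtain v where v: "v \<in> T" and l: "\<forall>c\<in>A. \<forall>i. \<forall>f\<in>test_fun (cran c).
     ((\<lambda>e. LINT x:cran c|lborel. coord c (v e) [i] [] x * f x) \<longlongrightarrow> w c i f) (at_right 0)"
    using a unfolding assoc_dist_vf_def by (rule bexE)
  have "wlim (cran c) (vc c v i) (w c i)"
    by (rule wlimI[OF Mod_smooth[OF ch(2)[OF c] moderate_vc[OF Gen_moderate[OF T(1) v] c]]])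
      (use l[rule_format, OF c] in auto)
  then show ?thesis by (rule wlim_Neq[OF ch(2)[OF c] _ Gen_vc[OF T v c]])
qed

lemma wlim_assoc_dist:
  assumes "u \<in> T" "\<And>c i. c \<in> A \<Longrightarrow> wlim (cran c) (vc c u i) (w c i)"
  shows "assoc_dist_vf A T w"
  unfolding assoc_dist_vf_def
  by (intro bexI[OF _ assms(1)] ballI allI wlim_lim[OF assms(2)])

lemma assoc_inf_vc:
  assumes a: "assoc_k \<infinity> A 1 0 T t" and T: "T \<in> Gen A 1 0" "u \<in> T" and t: "t \<in> smooth_tensor A 1 0" and c: "c \<in> A"
  shows "e \<in> {0<..1} \<Longrightarrow> Ck_on \<infinity> (cran c) (vc c u i e)" "Conv \<infinity> (cran c) (vc c u i) (coord c t [i] [])" "Ck_on \<infinity> (cran c) (coord c t [i] [])"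
proof -
  show "e \<in> {0<..1} \<Longrightarrow> Ck_on \<infinity> (cran c) (vc c u i e)" by (rule Mod_smooth[OF ch(2)[OF c] moderate_vc[OF Gen_moderate[OF T] c]])
  show "Conv \<infinity> (cran c) (vc c u i) (coord c t [i] [])" by (rule assoc_Conv[OF a T t c]) (auto simp: idx_1)
  show "Ck_on \<infinity> (cran c) (coord c t [i] [])" by (rule tensor_Ck[OF t c]) (auto simp: idx_1)
qed

lemma gchr_inf:
  assumes G: "gen_metric A G" and \<gamma>: "\<gamma> \<in> G" and g: "pr_metric \<infinity> A g" and D: "levi_civita \<infinity> A g D" and a: "assoc_k \<infinity> A 0 2 G g" and c: "c \<in> A"
  defines "\<Gamma> \<equiv> \<lambda>l i j. coord c (christoffel \<infinity> A D c l i j) [] []"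
  shows "e \<in> {0<..1} \<Longrightarrow> Ck_on \<infinity> (cran c) (gchr \<gamma> c l i j e)" "Conv \<infinity> (cran c) (gchr \<gamma> c l i j) (\<Gamma> l i j)" "Ck_on \<infinity> (cran c) (\<Gamma> l i j)"
proof -
  note S = ch(2)[OF c]
  have e: "\<Gamma> l i j x = cchr g c l i j x" if "x \<in> cran c" for x
    unfolding \<Gamma>_def by (rule christoffel_coord[OF _ g D c that]) simp
  show "e \<in> {0<..1} \<Longrightarrow> Ck_on \<infinity> (cran c) (gchr \<gamma> c l i j e)" by (rule Mod_smooth[OF S gchr_Mod[OF G \<gamma> c]])
  show "Conv \<infinity> (cran c) (gchr \<gamma> c l i j) (\<Gamma> l i j)"
    by (rule Conv_cong[OF S _ _ gchr_Conv[OF G \<gamma> _ g a c, simplified]]) (simp_all add: e)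
  show "Ck_on \<infinity> (cran c) (\<Gamma> l i j)" by (rule Ck_cong[OF S _ cchr_Ck[OF _ g c, simplified]]) (simp_all add: e)
qed

text \<open>The definitions of the two distributional derivatives are the coordinate formula with each product written as a smooth factor times a distribution. So the rules for weak
limits apply to the formula term by term, after the smooth factors have been collected.\<close>

theorem gen_levi_civita_assoc_dist:
  assumes G: "gen_metric A G" and Dh: "gen_levi_civita A G Dh" and g: "pr_metric \<infinity> A g" and D: "levi_civita \<infinity> A g D"
    and a: "assoc_k \<infinity> A 0 2 G g" and X: "X \<in> Gen A 1 0" and Y: "Y \<in> Gen A 1 0"
  shows "\<zeta> \<in> smooth_tensor A 1 0 \<Longrightarrow> assoc_k \<infinity> A 1 0 X \<zeta> \<Longrightarrow> assoc_dist_vf A Y \<nu>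
      \<Longrightarrow> assoc_dist_vf A (Dh X Y) (nabla_smooth_dist A D \<zeta> \<nu>)"
    and "\<nu>' \<in> smooth_tensor A 1 0 \<Longrightarrow> assoc_dist_vf A X \<zeta>' \<Longrightarrow> assoc_k \<infinity> A 1 0 Y \<nu>'
      \<Longrightarrow> assoc_dist_vf A (Dh X Y) (nabla_dist_smooth A D \<zeta>' \<nu>')"
proof -
  obtain \<gamma> \<xi> \<eta> w where \<gamma>: "\<gamma> \<in> G" and x: "\<xi> \<in> X" and y: "\<eta> \<in> Y" and w: "w \<in> Dh X Y"
    using gen_metric_ex[OF G] Gen_ex[OF X] Gen_ex[OF Y] Gen_ex[OF gen_levi_civita_Gen[OF Dh X Y]] by blast
  {
    assume z: "\<zeta> \<in> smooth_tensor A 1 0" "assoc_k \<infinity> A 1 0 X \<zeta>" and n: "assoc_dist_vf A Y \<nu>"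
    show "assoc_dist_vf A (Dh X Y) (nabla_smooth_dist A D \<zeta> \<nu>)"
    proof (rule wlim_assoc_dist[OF w])
      fix c l assume c: "c \<in> A"
      note S = ch(2)[OF c] and Z = assoc_inf_vc[OF z(2) X x z(1) c] and \<Gamma> = gchr_inf[OF G \<gamma> g D a c]
      note N = assoc_dist_wlim[OF n Y y c]
      have "wlim (cran c) (\<lambda>e y. (\<Sum>i\<in>UNIV. vc c \<xi> i e y * pd [i] (vc c \<eta> l e) y) +
          (\<Sum>i\<in>UNIV. \<Sum>j\<in>UNIV. gchr \<gamma> c l i j e y * vc c \<xi> i e y * vc c \<eta> j e y)) (nabla_smooth_dist A D \<zeta> \<nu> c l)"
        unfolding nabla_smooth_dist_def
        by (intro wlim_add wlim_sum wlim_mult wlim_pd S N Ck_mult Conv_mult Z \<Gamma> finite_class.finite_UNIV)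
      from wlim_Neq[OF S this]
      show "wlim (cran c) (vc c w l) (nabla_smooth_dist A D \<zeta> \<nu> c l)"
        using gen_formula[OF G \<gamma> Dh X x Y y w c, of l]
        by (simp add: distrib_left sum.distrib sum_distrib_left mult_ac)
    qed
  }
  {
    assume z: "\<nu>' \<in> smooth_tensor A 1 0" and n: "assoc_dist_vf A X \<zeta>'" and z2: "assoc_k \<infinity> A 1 0 Y \<nu>'"
    show "assoc_dist_vf A (Dh X Y) (nabla_dist_smooth A D \<zeta>' \<nu>')"
    proof (rule wlim_assoc_dist[OF w])
      fix c l assume c: "c \<in> A"
      note S = ch(2)[OF c] and Z = assoc_inf_vc[OF z2 Y y z c] and \<Gamma> = gchr_inf[OF G \<gamma> g D a c]
      note N = assoc_dist_wlim[OF n X x c]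
      have P: "Conv \<infinity> (cran c) (\<lambda>e. pd [i] (vc c \<eta> l e)) (pd [i] (coord c \<nu>' [l] []))" for i
        by (rule Conv_pd) (simp add: Z)
      have "wlim (cran c) (\<lambda>e y. (\<Sum>i\<in>UNIV. pd [i] (vc c \<eta> l e) y * vc c \<xi> i e y) +
          (\<Sum>i\<in>UNIV. \<Sum>j\<in>UNIV. gchr \<gamma> c l i j e y * vc c \<eta> j e y * vc c \<xi> i e y)) (nabla_dist_smooth A D \<zeta>' \<nu>' c l)"
        unfolding nabla_dist_smooth_def
        by (intro wlim_add wlim_sum wlim_mult S N Ck_mult Conv_mult P Z \<Gamma> Ck_pd_inf finite_class.finite_UNIV)
      from wlim_Neq[OF S this]
      show "wlim (cran c) (vc c w l) (nabla_dist_smooth A D \<zeta>' \<nu>' c l)"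
        using gen_formula[OF G \<gamma> Dh X x Y y w c, of l]
        by (simp add: distrib_left sum.distrib sum_distrib_left mult_ac)
    qed
  }
qed

end

theorem proposition5p4:
  fixes A :: "('a::t2_space, 'n::finite) chart set"
    and G :: "('a, 'n) gtensor"
    and Dh :: "('a, 'n) gtensor \<Rightarrow> ('a, 'n) gtensor \<Rightarrow> ('a, 'n) gtensor"
  assumes "smooth_manifold A"
    and "gen_metric A G"
    and "gen_levi_civita A G Dh"
  shows
    "(\<forall>g D. pr_metric \<infinity> A g \<and> levi_civita \<infinity> A g D \<and> G = const_emb A 0 2 g \<longrightarrow>
        (\<forall>c\<in>A. \<forall>l i j. gen_christoffel A Dh c l i j
           = const_emb (restr A (cdom c)) 0 0 (christoffel \<infinity> A D c l i j)) \<and>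
        (\<forall>\<xi>\<in>Gen A 1 0. \<forall>\<eta>\<in>Gen A 1 0. Dh \<xi> \<eta> = lift2 A 1 0 D \<xi> \<eta>))
     \<and>
     (\<forall>g D. pr_metric \<infinity> A g \<and> levi_civita \<infinity> A g D \<and> assoc_k \<infinity> A 0 2 G g \<longrightarrow>
        (\<forall>\<xi>\<in>Gen A 1 0. \<forall>\<eta>\<in>Gen A 1 0.
           (\<forall>\<zeta>\<in>smooth_tensor A 1 0. \<forall>\<nu>. is_dist_vf A \<nu> \<and>
              assoc_k \<infinity> A 1 0 \<xi> \<zeta> \<and> assoc_dist_vf A \<eta> \<nu> \<longrightarrow>
              assoc_dist_vf A (Dh \<xi> \<eta>) (nabla_smooth_dist A D \<zeta> \<nu>)) \<and>
           (\<forall>\<zeta>. \<forall>\<nu>\<in>smooth_tensor A 1 0. is_dist_vf A \<zeta> \<and>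
              assoc_dist_vf A \<xi> \<zeta> \<and> assoc_k \<infinity> A 1 0 \<eta> \<nu> \<longrightarrow>
              assoc_dist_vf A (Dh \<xi> \<eta>) (nabla_dist_smooth A D \<zeta> \<nu>))))
     \<and>
     (\<forall>k g D. 1 \<le> k \<and> pr_metric k A g \<and> levi_civita k A g D \<and> assoc_k k A 0 2 G g \<longrightarrow>
        (\<forall>c\<in>A. \<forall>l i j. assoc_k (k - 1) (restr A (cdom c)) 0 0
           (gen_christoffel A Dh c l i j) (christoffel k A D c l i j)) \<and>
        (\<forall>\<xi>\<in>Gen A 1 0. \<forall>\<eta>\<in>Gen A 1 0.
           \<forall>\<zeta>\<in>Ck_tensor (k - 1) A 1 0. \<forall>\<nu>\<in>Ck_tensor k A 1 0.
              assoc_k (k - 1) A 1 0 \<xi> \<zeta> \<and> assoc_k k A 1 0 \<eta> \<nu> \<longrightarrow>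
              assoc_k (k - 1) A 1 0 (Dh \<xi> \<eta>) (D \<zeta> \<nu>)))"
proof -
  interpret atlas A by (rule smooth_manifold_atlas[OF assms(1)])
  note G = assms(2) and Dh = assms(3)
  show ?thesis
  proof (intro conjI allI impI ballI, goal_cases)
    case 1 then show ?case using gen_christoffel_const[OF G Dh] by blast
  next
    case 2 then show ?case using gen_levi_civita_const[OF G Dh] by blast
  next
    case 3 then show ?case using gen_levi_civita_assoc_dist(1)[OF G Dh] by blast
  next
    case 4 then show ?case using gen_levi_civita_assoc_dist(2)[OF G Dh] by blast
  next
    case 5 then show ?case using gen_christoffel_assoc[OF G Dh] by blast
  next
    case 6 then show ?case using gen_levi_civita_assoc[OF G Dh] by blast
  qed
qed

end
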